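(* Let $s\in(0,1)$, let $\Omega\subset\mathbb{R}^n$ be a bounded, $C^{1,1}$, star-shaped domain, and let $f:\mathbb{R}\to\mathbb{R}$ be a locally Lipschitz function. Consider the problem $$(-\Delta)^s u=f(u)\ \text{ in }\Omega,\qquad u=0\ \text{ in }\mathbb{R}^n\setminus\Omega.\qquad ( * )$$ 1. If $$\frac{n-2s}{2n}\,t f(t)\ \ge\ \int_0^t f(\tau)\,d\tau\qquad\text{for all } t\in\mathbb{R},$$ then problem $( * )$ admits no positive bounded solution (that is, no bounded solution $u$ with $u>0$ in $\Omega$). 2. If $$\frac{n-2s}{2n}\,t f(t)\ >\ \int_0^t f(\tau)\,d\tau\qquad\text{for all } t\in\mathbb{R}\setminus\{0\},$$ then problem $( * )$ admits no nontrivial bounded solution (that is, every bounded solution, of any sign, is identically zero).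
   Context: The fractional Laplacian is $$(-\Delta)^s u(x)=c_{n,s}\,\mathrm{PV}\int_{\mathbb{R}^n}\frac{u(x)-u(y)}{|x-y|^{n+2s}}\,dy,$$ where PV denotes the principal value and $c_{n,s}$ is the standard normalization constant $c_{n,s}=\dfrac{s\,2^{2s}\,\Gamma\left(\frac{n+2s}{2}\right)}{\pi^{n/2}\,\Gamma(1-s)}$, for which $(-\Delta)^s$ has Fourier symbol $|\xi|^{2s}$. A solution is understood in the weak (energy) sense: $u\in H^s(\mathbb{R}^n)$, $u=0$ a.e. in $\mathbb{R}^n\setminus\Omega$, and $$\int_{\mathbb{R}^n}(-\Delta)^{s/2}u\,(-\Delta)^{s/2}\varphi\,dx=\int_\Omega f(u)\varphi\,dx$$ for all $\varphi\in H^s(\mathbb{R}^n)$ with $\varphi=0$ a.e. in $\mathbb{R}^n\setminus\Omega$. For bounded $u$ this agrees with the notion of viscosity solution. The function $u$ is identified with its continuous representative. Star-shaped means star-shaped with respect to some point $x_0\in\Omega$: for every $x\in\Omega$ the segment from $x_0$ to $x$ is contained in $\Omega$. *)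

theory Defs
  imports "HOL-Analysis.Analysis"
begin

text \<open>
  The ambient space is an arbitrary Euclidean space \<open>'a\<close>, with \<open>n = DIM('a)\<close>. All measures are
  complete Lebesgue measure, so elements of \<open>L\<^sup>2\<close> or \<open>H\<^sup>s\<close> are represented by
  Lebesgue measurable functions, and being a bounded weak solution is invariant under changes on
  null sets.
\<close>

definition frac_const :: "nat \<Rightarrow> real \<Rightarrow> real" where
  "frac_const n s =
     s * 2 powr (2 * s) * Gamma ((real n + 2 * s) / 2) / (pi powr (real n / 2) * Gamma (1 - s))"

text \<open>
  The principal value is the limit of the integrals over the complements of balls centred at \<open>x\<close>.
  For \<open>u\<close> in \<open>H\<^sup>s\<close> it exists at almost every \<open>x\<close> for the operator of order \<open>s\<close>, i.e. for
  \<open>frac_laplacian (s / 2) u\<close>, which is the one used in \<open>weak_solution\<close>. Where the limit does not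
  exist the value is unspecified.
\<close>

definition frac_laplacian :: "real \<Rightarrow> ('a::euclidean_space \<Rightarrow> real) \<Rightarrow> 'a \<Rightarrow> real" where
  "frac_laplacian s u x =
     frac_const DIM('a) s *
     Lim (at_right 0) (\<lambda>\<epsilon>.
       LINT y:{y. \<epsilon> < norm (x - y)}|lebesgue.
         (u x - u y) / norm (x - y) powr (real DIM('a) + 2 * s))"

text \<open>\<open>H\<^sup>s\<close> for \<open>0 < s < 1\<close>: square integrable functions with finite Gagliardo seminorm.\<close>

definition Hs :: "real \<Rightarrow> ('a::euclidean_space \<Rightarrow> real) set" where
  "Hs s = {u. u \<in> borel_measurable lebesgue \<and>
              integrable lebesgue (\<lambda>x. (u x)\<^sup>2) \<and>
              (\<integral>\<^sup>+ x. (\<integral>\<^sup>+ y. ennreal ((u x - u y)\<^sup>2 / norm (x - y) powr (real DIM('a) + 2 * s))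
                 \<partial>lebesgue) \<partial>lebesgue) < \<infinity>}"

definition Hs0 :: "real \<Rightarrow> 'a::euclidean_space set \<Rightarrow> ('a \<Rightarrow> real) set" where
  "Hs0 s \<Omega> = {u \<in> Hs s. AE x in lebesgue. x \<notin> \<Omega> \<longrightarrow> u x = 0}"

definition weak_solution ::
  "real \<Rightarrow> 'a::euclidean_space set \<Rightarrow> (real \<Rightarrow> real) \<Rightarrow> ('a \<Rightarrow> real) \<Rightarrow> bool" where
  "weak_solution s \<Omega> f u \<longleftrightarrow>
     u \<in> Hs0 s \<Omega> \<and>
     (\<forall>\<phi> \<in> Hs0 s \<Omega>.
        (LINT x|lebesgue. frac_laplacian (s / 2) u x * frac_laplacian (s / 2) \<phi> x) =
        (LINT x:\<Omega>|lebesgue. f (u x) * \<phi> x))"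

definition ess_bounded :: "('a::euclidean_space \<Rightarrow> real) \<Rightarrow> bool" where
  "ess_bounded u \<longleftrightarrow> (\<exists>M. AE x in lebesgue. \<bar>u x\<bar> \<le> M)"

definition bounded_solution ::
  "real \<Rightarrow> 'a::euclidean_space set \<Rightarrow> (real \<Rightarrow> real) \<Rightarrow> ('a \<Rightarrow> real) \<Rightarrow> bool" where
  "bounded_solution s \<Omega> f u \<longleftrightarrow> weak_solution s \<Omega> f u \<and> ess_bounded u"

text \<open>Two functions continuous on the whole space that agree almost everywhere are equal, so a
  continuous representative is unique.\<close>

definition continuous_representative ::
  "('a::euclidean_space \<Rightarrow> real) \<Rightarrow> ('a \<Rightarrow> real) \<Rightarrow> bool" where
  "continuous_representative v u \<longleftrightarrow> continuous_on UNIV v \<and> (AE x in lebesgue. v x = u x)"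

definition C11_function :: "('a::euclidean_space \<Rightarrow> real) \<Rightarrow> bool" where
  "C11_function \<gamma> \<longleftrightarrow>
     (\<exists>G L. (\<forall>x. (\<gamma> has_derivative (\<lambda>h. G x \<bullet> h)) (at x)) \<and> L-lipschitz_on UNIV (G :: 'a \<Rightarrow> 'a))"

text \<open>
  Near each boundary point the domain lies above the graph of a \<open>C\<^sup>1\<^sup>,\<^sup>1\<close> function over the
  hyperplane orthogonal to a unit vector \<open>e\<close>. The function \<open>\<gamma>\<close> is only evaluated on that
  hyperplane, namely at the projection \<open>x - (x \<bullet> e) *\<^sub>R e\<close>; giving it on the whole space is no
  restriction, since a function on the hyperplane can be composed with this projection.
\<close>

definition C11_domain :: "'a::euclidean_space set \<Rightarrow> bool" where
  "C11_domain \<Omega> \<longleftrightarrow>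
     open \<Omega> \<and> connected \<Omega> \<and> \<Omega> \<noteq> {} \<and>
     (\<forall>z \<in> frontier \<Omega>. \<exists>r > 0. \<exists>e \<gamma>. norm e = 1 \<and> C11_function \<gamma> \<and>
        \<Omega> \<inter> ball z r = {x \<in> ball z r. \<gamma> (x - (x \<bullet> e) *\<^sub>R e) < x \<bullet> e})"

definition locally_lipschitz :: "(real \<Rightarrow> real) \<Rightarrow> bool" where
  "locally_lipschitz f \<longleftrightarrow> (\<forall>t. \<exists>r > 0. \<exists>L. L-lipschitz_on (ball t r) f)"

end

theory Submission
  imports Defs
begin

text \<open>
  Step 1. Testing with truncated operators, a representation of \<open>|z|\<^bsup>-n-s\<^esup>\<close> as a mixture of Gaussians
  and a maximal function estimate show that the weak formulation says \<open>c [u, \<phi>] = \<integral> f(u) \<phi>\<close>,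
  where \<open>[u, \<phi>]\<close> is the Gagliardo form.

  Step 2. Let \<open>u\<^sub>h(x) = e\<^bsup>bh\<^esup> u(e\<^sup>h x)\<close>, \<open>b = (n-2s)/2\<close>, be the energy preserving dilations about the star
  centre. For \<open>h > 0\<close> the difference \<open>w = u\<^sub>h - u\<close> is an admissible test function, and expanding
  \<open>[w, w] = 2 [u, u - u\<^sub>h]\<close> gives \<open>[w, w] \<le> -2hP + C(h\<^sup>2 + \<parallel>w\<parallel>\<^sup>2)\<close>, where
  \<open>P = \<integral> b u f(u) - n F(u) \<ge> 0\<close> and \<open>F' = f\<close>. A bootstrap over dyadic \<open>h\<close> yields \<open>\<parallel>w\<parallel> = O(h)\<close>.
  Hence \<open>P = 0\<close>, which is the Pohozaev inequality needed for the second claim, and moreover \<open>[w, w] = O(h\<^sup>2)\<close>.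

  Step 3. A positive solution grows at least linearly at the boundary (comparison with truncated
  paraboloids on interior balls). Testing \<open>w\<close> with a function concentrated on the shell between \<open>\<Omega>\<close> and
  \<open>e\<^bsup>-h\<^esup> \<Omega>\<close>, of thickness of order \<open>h\<close> near a farthest boundary point, contradicts \<open>[w, w] = O(h\<^sup>2)\<close>: the
  interaction of \<open>u\<^sub>h\<close> with the shell exceeds \<open>J h\<^bsup>3/2-s\<^esup>\<close> for every \<open>J\<close>, by adding up \<open>J\<close> dyadic scales.
\<close>

text \<open>No regularity of \<open>u\<close> at the boundary and no boundary trace is used:
  \<open>u\<close> enters the Pohozaev part only as a bounded function of finite energy, and
  differentiation in \<open>h\<close> is replaced by a one-sided expansion, since dilates are
  admissible test functions only for \<open>h \<ge> 0\<close>. The price is that only an inequality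
  is available. Moreover, star-shapedness alone allows rays tangent to the boundary; transversality
  is therefore extracted at a single point, a farthest one. There the linear lower bound gives on
  one scale exactly the power \<open>h powr (3/2 - s)\<close> of the upper bound, which is the
  geometric mean of the energies \<open>h\<^sup>2\<close> and \<open>h powr (1 - 2 * s)\<close>;
  this is why arbitrarily many scales have to be summed. No Fourier transform occurs. The factor
  between the weak form and the Gagliardo form is only known to be a positive constant, which
  suffices because the hypothesis on \<open>f\<close> is homogeneous. The maximal function is forced
  by \<open>frac_laplacian\<close> being a pointwise limit, while the energy argument yields only
  limits in the mean.\<close>

text \<open>An integral without a measure is taken with respect to Lebesgue measure.\<close>

abbreviation lborel_nn :: "('a::euclidean_space \<Rightarrow> ennreal) \<Rightarrow> ennreal" (binder "\<integral>\<^sup>+" 10) where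
 "lborel_nn f \<equiv> nn_integral lborel f"

abbreviation lborel_int :: "('a::euclidean_space \<Rightarrow> real) \<Rightarrow> real" (binder "\<integral>" 10) where
 "lborel_int f \<equiv> integral\<^sup>L lborel f"

abbreviation lborel2 :: "('a::euclidean_space \<times> 'b::euclidean_space) measure" where
 "lborel2 \<equiv> lborel \<Otimes>\<^sub>M lborel"

subsection \<open>Riesz kernels\<close>

lemma nn_integral_lborel_affine:
 fixes f :: "'a::euclidean_space \<Rightarrow> ennreal"
 assumes [measurable]: "f \<in> borel_measurable borel" and c: "c \<noteq> 0"
 shows "(\<integral>\<^sup>+x. f (t + c *\<^sub>R x)) = ennreal (1 / \<bar>c\<bar> ^ DIM('a)) * (\<integral>\<^sup>+x. f x)"
proof -
 have "(\<integral>\<^sup>+x. f x) = ennreal (\<bar>c\<bar> ^ DIM('a)) * (\<integral>\<^sup>+x. f (t + c *\<^sub>R x))"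
  by (subst lborel_affine[OF c, of t])
    (simp add: nn_integral_density nn_integral_distr nn_integral_cmult)
 then have "ennreal (1 / \<bar>c\<bar> ^ DIM('a)) * (\<integral>\<^sup>+x. f x) =
   (ennreal (1 / \<bar>c\<bar> ^ DIM('a)) * ennreal (\<bar>c\<bar> ^ DIM('a))) * (\<integral>\<^sup>+x. f (t + c *\<^sub>R x))"
  by (simp add: mult.assoc)
 also have "ennreal (1 / \<bar>c\<bar> ^ DIM('a)) * ennreal (\<bar>c\<bar> ^ DIM('a)) = 1"
  using c by (simp flip: ennreal_mult)
 finally show ?thesis by simp
qed

lemma nn_integral_lborel_shift:
 fixes f :: "'a::euclidean_space \<Rightarrow> ennreal"
 assumes "f \<in> borel_measurable borel"
 shows "(\<integral>\<^sup>+x. f (t + x)) = (\<integral>\<^sup>+x. f x)"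
 using nn_integral_lborel_affine[OF assms, of 1 t] by simp

lemma nn_integral_lborel_reflect:
 fixes f :: "'a::euclidean_space \<Rightarrow> ennreal"
 assumes "f \<in> borel_measurable borel"
 shows "(\<integral>\<^sup>+x. f (t - x)) = (\<integral>\<^sup>+x. f x)"
 using nn_integral_lborel_affine[OF assms, of "-1" t] by simp

lemma nn_integral_lborel_scale:
 fixes f :: "'a::euclidean_space \<Rightarrow> ennreal"
 assumes "f \<in> borel_measurable borel" "c > 0"
 shows "(\<integral>\<^sup>+x. f (c *\<^sub>R x)) = ennreal (1 / c ^ DIM('a)) * (\<integral>\<^sup>+x. f x)"
 using nn_integral_lborel_affine[OF assms(1), of c 0] assms by simp

lemma integrable_lborel_affine:
 fixes f :: "'a::euclidean_space \<Rightarrow> real"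
 assumes f: "integrable lborel f" and c: "c \<noteq> 0"
 shows "integrable lborel (\<lambda>x. f (t + c *\<^sub>R x))"
proof -
 have [measurable]: "f \<in> borel_measurable borel" using f by auto
 have "(\<integral>\<^sup>+x. ennreal (norm (f (t + c *\<^sub>R x)))) < \<infinity>"
  using f nn_integral_lborel_affine[OF _ c, where f="\<lambda>x. ennreal (norm (f x))" and t=t]
  by (simp add: integrable_iff_bounded ennreal_mult_less_top)
 then show ?thesis by (intro integrableI_bounded) auto
qed

lemma integral_lborel_affine:
 fixes f :: "'a::euclidean_space \<Rightarrow> real"
 assumes c: "c \<noteq> 0" and [measurable]: "f \<in> borel_measurable borel"
 shows "(\<integral>x. f (t + c *\<^sub>R x)) = (1 / \<bar>c\<bar> ^ DIM('a)) * (\<integral>x. f x)"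
proof -
 have "(\<integral>x. f x) = \<bar>c\<bar> ^ DIM('a) * (\<integral>x. f (t + c *\<^sub>R x))"
  by (subst lborel_affine[OF c, of t]) (simp add: integral_density integral_distr)
 then show ?thesis using c by simp
qed

lemma integral_lborel_shift:
 fixes f :: "'a::euclidean_space \<Rightarrow> real"
 assumes "f \<in> borel_measurable borel"
 shows "(\<integral>x. f (t + x)) = (\<integral>x. f x)"
 using integral_lborel_affine[OF _ assms, of 1 t] by simp

lemma integral_lborel_reflect:
 fixes f :: "'a::euclidean_space \<Rightarrow> real"
 assumes "f \<in> borel_measurable borel"
 shows "(\<integral>x. f (t - x)) = (\<integral>x. f x)"
 using integral_lborel_affine[OF _ assms, of "-1" t] by simp

lemma integrable_lborel_shift:
 fixes f :: "'a::euclidean_space \<Rightarrow> real"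
 assumes "integrable lborel f"
 shows "integrable lborel (\<lambda>x. f (t + x))"
 using integrable_lborel_affine[OF assms, of 1 t] by simp

lemma integrable_lborel_reflect:
 fixes f :: "'a::euclidean_space \<Rightarrow> real"
 assumes "integrable lborel f"
 shows "integrable lborel (\<lambda>x. f (t - x))"
 using integrable_lborel_affine[OF assms, of "-1" t] by simp

text \<open>The kernel \<open>|z|\<^bsup>-n-a\<^esup>\<close>; it vanishes at the origin because \<open>1 / 0 = 0\<close>.\<close>

definition kr :: "real \<Rightarrow> 'a::euclidean_space \<Rightarrow> real" where
 "kr a z = 1 / norm z powr (real DIM('a) + a)"

lemma kr_measurable [measurable]: "kr a \<in> borel_measurable borel"
 unfolding kr_def by measurable

lemma kr_nonneg [simp]: "0 \<le> kr a z"
 by (simp add: kr_def)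

lemma kr_minus [simp]: "kr a (- z) = kr a z"
 by (simp add: kr_def)

lemma kr_minus_commute: "kr a (x - y) = kr a (y - x)"
 by (simp add: kr_def norm_minus_commute)

lemma kr_0 [simp]: "kr a 0 = 0"
 by (simp add: kr_def)

lemma kr_scale: "c > 0 \<Longrightarrow> kr a (c *\<^sub>R z) = c powr - (real DIM('a) + a) * kr a (z::'a::euclidean_space)"
 by (simp add: kr_def powr_mult powr_minus_divide[of _ "real DIM('a) + a"] del: minus_add_distrib)

lemma kr_mult_norm: "z \<noteq> 0 \<Longrightarrow> norm z powr b * kr a z = kr (a - b) z"
 by (simp add: kr_def powr_diff powr_add divide_simps)

lemma kr_shell:
 assumes "r > 0"
 shows "(\<integral>\<^sup>+z\<in>{z. r \<le> norm z \<and> norm z < 2 * r}. kr a (z::'a::euclidean_space) \<partial>lborel) =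
   ennreal (r powr - a) * (\<integral>\<^sup>+z\<in>{z. 1 \<le> norm z \<and> norm z < 2}. kr a (z::'a::euclidean_space) \<partial>lborel)"
proof -
 let ?f = "\<lambda>z::'a. ennreal (kr a z) * indicator {z. r \<le> norm z \<and> norm z < 2 * r} z"
 have "(\<integral>\<^sup>+z. ?f (r *\<^sub>R z)) = ennreal (1 / r ^ DIM('a)) * (\<integral>\<^sup>+z. ?f z)"
  by (rule nn_integral_lborel_scale) (use assms in measurable)
 moreover have "?f (r *\<^sub>R z) = ennreal (r powr - (real DIM('a) + a)) * (ennreal (kr a z) * indicator {z. 1 \<le> norm z \<and> norm z < 2} z)" for z
  using assms by (auto simp: kr_scale indicator_def ennreal_mult)
 ultimately have "ennreal (r ^ DIM('a)) * (ennreal (r powr - (real DIM('a) + a)) * (\<integral>\<^sup>+z\<in>{z. 1 \<le> norm z \<and> norm z < 2}. kr a (z::'a) \<partial>lborel))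
   = (ennreal (r ^ DIM('a)) * ennreal (1 / r ^ DIM('a))) * (\<integral>\<^sup>+z. ?f z)"
  by (simp add: nn_integral_cmult mult.assoc)
 also have "ennreal (r ^ DIM('a)) * ennreal (1 / r ^ DIM('a)) = 1"
  using assms by (simp flip: ennreal_mult)
 finally have "ennreal (r ^ DIM('a) * r powr - (real DIM('a) + a)) * (\<integral>\<^sup>+z\<in>{z. 1 \<le> norm z \<and> norm z < 2}. kr a (z::'a) \<partial>lborel)
   = (\<integral>\<^sup>+z. ?f z)"
  using assms by (simp add: mult.assoc[symmetric] ennreal_mult[symmetric])
 moreover have "r ^ DIM('a) * r powr - (real DIM('a) + a) = r powr - a"
  using assms by (simp add: powr_realpow[symmetric] powr_add[symmetric] del: powr_realpow)
 ultimately show ?thesis by simp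
qed

lemma kr_shell_finite: "(\<integral>\<^sup>+z\<in>{z. 1 \<le> norm z \<and> norm z < 2}. kr a (z::'a::euclidean_space) \<partial>lborel) < \<infinity>"
proof -
 define B where "B = (2::real) powr \<bar>real DIM('a) + a\<bar>"
 have "kr a z \<le> B" if "1 \<le> norm z" "norm z < 2" for z :: 'a
 proof -
  have "1 / norm z powr (real DIM('a) + a) = norm z powr - (real DIM('a) + a)"
   by (simp add: powr_minus_divide[of _ "real DIM('a) + a"] del: minus_add_distrib)
  also have "... \<le> norm z powr \<bar>real DIM('a) + a\<bar>" using that by (intro powr_mono) auto
  also have "... \<le> 2 powr \<bar>real DIM('a) + a\<bar>" using that by (intro powr_mono2) auto
  finally show ?thesis by (simp add: kr_def B_def)
 qed
 then have "(\<integral>\<^sup>+z\<in>{z. 1 \<le> norm z \<and> norm z < 2}. kr a (z::'a) \<partial>lborel) \<le> (\<integral>\<^sup>+z. ennreal B * indicator (ball 0 2) (z::'a))"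
  by (intro nn_integral_mono) (auto simp: indicator_def intro!: ennreal_leI)
 also have "... = ennreal B * emeasure lborel (ball (0::'a) 2)" by (rule nn_integral_cmult_indicator) auto
 also have "... < \<infinity>" using emeasure_lborel_ball_finite[of "0::'a" 2] by (simp add: ennreal_mult_less_top)
 finally show ?thesis .
qed

text \<open>The integral over the unit dyadic shell times the sum of the geometric series with ratio
  \<open>2 powr - \<bar>a\<bar>\<close>. The absolute value lets the same constant serve tails
  (\<open>a > 0\<close>) and cores (\<open>a < 0\<close>).\<close>

definition kr_const :: "'a::euclidean_space itself \<Rightarrow> real \<Rightarrow> real" where
 "kr_const _ a = enn2real (\<integral>\<^sup>+z\<in>{z. 1 \<le> norm z \<and> norm z < 2}. kr a (z::'a) \<partial>lborel) / (1 - 2 powr - \<bar>a\<bar>)"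

text \<open>Shells of radius \<open>r * 2 powr (e * j)\<close> run outwards for \<open>e = 1\<close>
  and inwards for \<open>e = -1\<close>; the condition \<open>e * a = \<bar>a\<bar>\<close> selects
  the direction in which the shell integrals decay geometrically.\<close>

lemma kr_dyadic_sum:
 assumes A: "A \<in> sets lborel" and cov: "\<And>z::'a. z \<in> A \<Longrightarrow> \<exists>j. r * 2 powr (e * real j) \<le> norm z \<and> norm z < 2 * (r * 2 powr (e * real j))"
  and r: "r > 0" and e: "e * a = \<bar>a\<bar>" "a \<noteq> 0"
 shows "(\<integral>\<^sup>+z\<in>A. kr a (z::'a::euclidean_space) \<partial>lborel) \<le> ennreal (kr_const TYPE('a) a * r powr - a)"
proof -
 define S where "S = enn2real (\<integral>\<^sup>+z\<in>{z. 1 \<le> norm z \<and> norm z < 2}. kr a (z::'a) \<partial>lborel)"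
 have S: "(\<integral>\<^sup>+z\<in>{z. 1 \<le> norm z \<and> norm z < 2}. kr a (z::'a) \<partial>lborel) = ennreal S" "S \<ge> 0"
  using kr_shell_finite[where 'a='a, of a] by (auto simp: S_def)
 define q where "q = (2::real) powr - \<bar>a\<bar>"
 have q: "0 < q" "q < 1" using e by (auto simp: q_def powr_less_one)
 have "(\<integral>\<^sup>+z\<in>A. kr a (z::'a) \<partial>lborel) \<le> (\<integral>\<^sup>+(z::'a). (\<Sum>j. ennreal (kr a z) * indicator {z. r * 2 powr (e * real j) \<le> norm z \<and> norm z < 2 * (r * 2 powr (e * real j))} z))"
 proof (rule nn_integral_mono, goal_cases)
  case (1 z)
  show ?case
  proof (cases "z \<in> A")
   case True
   then obtain j where "r * 2 powr (e * real j) \<le> norm z \<and> norm z < 2 * (r * 2 powr (e * real j))" using cov by blast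
   then have "ennreal (kr a z) = (\<Sum>j\<in>{j}. ennreal (kr a z) * indicator {z. r * 2 powr (e * real j) \<le> norm z \<and> norm z < 2 * (r * 2 powr (e * real j))} z)"
    by simp
   also have "... \<le> (\<Sum>j. ennreal (kr a z) * indicator {z. r * 2 powr (e * real j) \<le> norm z \<and> norm z < 2 * (r * 2 powr (e * real j))} z)"
    by (rule sum_le_suminf) auto
   finally show ?thesis using True by simp
  qed simp
 qed
 also have "... = (\<Sum>j. (\<integral>\<^sup>+z\<in>{z. r * 2 powr (e * real j) \<le> norm z \<and> norm z < 2 * (r * 2 powr (e * real j))}. kr a (z::'a) \<partial>lborel))"
  by (rule nn_integral_suminf) measurable
 also have "... = (\<Sum>j. ennreal (S * r powr - a * q ^ j))"
 proof (intro suminf_cong)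
  fix j
  have "(r * 2 powr (e * real j)) powr - a = r powr - a * q ^ j"
   using r by (simp add: powr_mult powr_powr q_def powr_realpow[symmetric] e(1)[symmetric] mult_ac del: powr_realpow)
  then show "(\<integral>\<^sup>+z\<in>{z. r * 2 powr (e * real j) \<le> norm z \<and> norm z < 2 * (r * 2 powr (e * real j))}. kr a (z::'a) \<partial>lborel) = ennreal (S * r powr - a * q ^ j)"
   using r S q by (subst kr_shell) (auto simp: ennreal_mult mult_ac)
 qed
 also have "... = ennreal (\<Sum>j. S * r powr - a * q ^ j)"
  using q S by (intro suminf_ennreal2) (auto intro!: summable_mult)
 also have "(\<Sum>j. S * r powr - a * q ^ j) = S * r powr - a * (1 / (1 - q))"
  using q by (subst suminf_mult) (auto simp: suminf_geometric)
 finally show ?thesis by (simp add: kr_const_def S_def q_def)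
qed

lemma kr_const_nonneg [simp]: "0 \<le> kr_const TYPE('a::euclidean_space) a"
proof -
 have "(2::real) powr - \<bar>a\<bar> \<le> 2 powr 0" by (intro powr_mono) auto
 then show ?thesis by (simp add: kr_const_def)
qed

lemma kr_tail:
 assumes r: "r > 0" and a: "a > 0"
 shows "(\<integral>\<^sup>+z\<in>{z. r \<le> norm z}. kr a (z::'a::euclidean_space) \<partial>lborel) \<le> ennreal (kr_const TYPE('a) a * r powr - a)"
proof (rule kr_dyadic_sum[where e=1])
 fix z :: 'a assume "z \<in> {z. r \<le> norm z}"
 then have z: "1 \<le> norm z / r" using r by simp
 define j where "j = nat \<lfloor>log 2 (norm z / r)\<rfloor>"
 have "real j = of_int \<lfloor>log 2 (norm z / r)\<rfloor>" using z by (simp add: j_def)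
 then have "real j \<le> log 2 (norm z / r)" "log 2 (norm z / r) < real j + 1" by linarith+
 then have "2 powr real j \<le> 2 powr (log 2 (norm z / r))" "2 powr (log 2 (norm z / r)) < 2 powr (real j + 1)" by simp_all
 moreover have "2 powr (log 2 (norm z / r)) = norm z / r" using z by (intro powr_log_cancel) auto
 ultimately have "2 powr real j \<le> norm z / r" "norm z / r < 2 * 2 powr real j" by (simp_all add: powr_add)
 then show "\<exists>j. r * 2 powr (1 * real j) \<le> norm z \<and> norm z < 2 * (r * 2 powr (1 * real j))"
  using r by (intro exI[of _ j]) (simp add: field_simps)
qed (use assms in auto)

lemma kr_core:
 assumes r: "r > 0" and b: "b > 0"
 shows "(\<integral>\<^sup>+z\<in>{z. norm z < r}. kr (- b) (z::'a::euclidean_space) \<partial>lborel) \<le> ennreal (kr_const TYPE('a) (- b) * r powr b)"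
proof -
 \<comment> \<open>No dyadic shell contains the origin; it can be removed because \<open>kr\<close>
   vanishes there. The shells then start at radius \<open>r/2\<close>.\<close>
 have "(\<integral>\<^sup>+z\<in>{z. norm z < r}. kr (- b) (z::'a) \<partial>lborel) = (\<integral>\<^sup>+z\<in>{z. norm z < r \<and> z \<noteq> 0}. kr (- b) (z::'a) \<partial>lborel)"
  by (intro nn_integral_cong) (auto simp: indicator_def)
 also have "... \<le> ennreal (kr_const TYPE('a) (- b) * (r/2) powr - (- b))"
 proof (rule kr_dyadic_sum[where e="-1"])
  fix z :: 'a assume "z \<in> {z. norm z < r \<and> z \<noteq> 0}"
  then have z: "0 < norm z / (r/2)" "norm z / (r/2) < 2" using r by (auto simp: field_simps)
  then have l2: "log 2 (norm z / (r/2)) < 1" by (subst log_less_iff) auto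
  define j where "j = nat (- \<lfloor>log 2 (norm z / (r/2))\<rfloor>)"
  have "\<lfloor>log 2 (norm z / (r/2))\<rfloor> \<le> 0" using l2 by linarith
  then have "- real j = of_int \<lfloor>log 2 (norm z / (r/2))\<rfloor>" by (simp add: j_def)
  then have "- real j \<le> log 2 (norm z / (r/2))" "log 2 (norm z / (r/2)) < - real j + 1" by linarith+
  then have "2 powr - real j \<le> 2 powr (log 2 (norm z / (r/2)))" "2 powr (log 2 (norm z / (r/2))) < 2 powr (- real j + 1)" by simp_all
  moreover have "2 powr (log 2 (norm z / (r/2))) = norm z / (r/2)" using z by (intro powr_log_cancel) auto
  ultimately have "2 powr - real j \<le> norm z / (r/2)" "norm z / (r/2) < 2 * 2 powr - real j" by (simp_all only: powr_add) simp_all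
  then show "\<exists>j. r/2 * 2 powr (-1 * real j) \<le> norm z \<and> norm z < 2 * (r/2 * 2 powr (-1 * real j))"
   using r by (intro exI[of _ j]) (simp add: field_simps)
 qed (use assms in auto)
 also have "... \<le> ennreal (kr_const TYPE('a) (- b) * r powr b)"
  using r b kr_const_nonneg[where 'a='a, of "-b"] by (intro ennreal_leI mult_left_mono) (auto intro: powr_mono2)
 finally show ?thesis .
qed

subsection \<open>Square integrable functions and truncated operators\<close>

text \<open>Borel rather than Lebesgue measurability, so that Fubini applies on
  \<open>lborel2\<close>; elements of \<open>Hs\<close> enter later through Borel representatives in
  \<open>Hs_borel\<close>.\<close>

definition sqint :: "('a::euclidean_space \<Rightarrow> real) \<Rightarrow> bool" where
 "sqint w \<longleftrightarrow> w \<in> borel_measurable borel \<and> integrable lborel (\<lambda>x. (w x)\<^sup>2)"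

lemma sqint_measurable [measurable_dest]: "sqint w \<Longrightarrow> w \<in> borel_measurable borel"
 by (simp add: sqint_def)

lemma sqint_integrable: "sqint w \<Longrightarrow> integrable lborel (\<lambda>x. (w x)\<^sup>2)"
 by (simp add: sqint_def)

lemma sqintI: "w \<in> borel_measurable borel \<Longrightarrow> integrable lborel (\<lambda>x. (w x)\<^sup>2) \<Longrightarrow> sqint w"
 by (simp add: sqint_def)

lemma sqint_bound:
 assumes w: "sqint w" and f[measurable]: "f \<in> borel_measurable borel" and le: "\<And>x. \<bar>f x\<bar> \<le> \<bar>w x\<bar>"
 shows "sqint f"
proof (rule sqintI)
 show "integrable lborel (\<lambda>x. (f x)\<^sup>2)"
  by (rule Bochner_Integration.integrable_bound[OF sqint_integrable[OF w]]) (use le in \<open>auto simp: abs_le_square_iff\<close>)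
qed fact

lemma sqint_lin:
 assumes w: "sqint w" and v: "sqint v"
 shows "sqint (\<lambda>x. a * w x + b * v x)"
proof (rule sqintI)
 note [measurable] = sqint_measurable[OF w] sqint_measurable[OF v]
 show "(\<lambda>x. a * w x + b * v x) \<in> borel_measurable borel" by measurable
 have "integrable lborel (\<lambda>x. 2 * a\<^sup>2 * (w x)\<^sup>2 + 2 * b\<^sup>2 * (v x)\<^sup>2)"
  using sqint_integrable[OF w] sqint_integrable[OF v] by auto
 then show "integrable lborel (\<lambda>x. (a * w x + b * v x)\<^sup>2)"
 proof (rule Bochner_Integration.integrable_bound)
  show "AE x in lborel. norm ((a * w x + b * v x)\<^sup>2) \<le> norm (2 * a\<^sup>2 * (w x)\<^sup>2 + 2 * b\<^sup>2 * (v x)\<^sup>2)"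
  proof (rule AE_I2, goal_cases)
   case (1 x)
   have "0 \<le> (a * w x - b * v x)\<^sup>2" by simp
   then have "(a * w x + b * v x)\<^sup>2 \<le> 2 * a\<^sup>2 * (w x)\<^sup>2 + 2 * b\<^sup>2 * (v x)\<^sup>2"
    by (simp add: power2_eq_square algebra_simps)
   moreover have "0 \<le> (a * w x + b * v x)\<^sup>2" by simp
   ultimately show ?case
    unfolding real_norm_def by (simp only: abs_of_nonneg order_trans)
  qed
 qed measurable
qed

lemma sqint_diff: "sqint w \<Longrightarrow> sqint v \<Longrightarrow> sqint (\<lambda>x. w x - v x)"
 using sqint_lin[of w v 1 "-1"] by simp

lemma sqint_cmult: "sqint w \<Longrightarrow> sqint (\<lambda>x. a * w x)"
 using sqint_lin[of w w a 0] by simp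

lemma sqint_affine: "sqint w \<Longrightarrow> c \<noteq> 0 \<Longrightarrow> sqint (\<lambda>x. w (t + c *\<^sub>R x))"
 using integrable_lborel_affine[of "\<lambda>x. (w x)\<^sup>2" c t]
 by (auto simp: sqint_def intro: measurable_compose[of _ borel])

lemma sqint_shift: "sqint w \<Longrightarrow> sqint (\<lambda>x. w (x + t))"
 using sqint_affine[of w 1 t] by (simp add: add.commute)

lemma integrable_lborel_pair_mult:
 fixes f :: "'a::euclidean_space \<Rightarrow> real" and g :: "'b::euclidean_space \<Rightarrow> real"
 assumes f: "integrable lborel f" and g: "integrable lborel g"
 shows "integrable lborel2 (\<lambda>p. f (fst p) * g (snd p))"
proof -
 have [measurable]: "f \<in> borel_measurable borel" "g \<in> borel_measurable borel" using f g by auto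
 show ?thesis
  by (rule lborel_pair.Fubini_integrable) (use f g in \<open>simp_all add: abs_mult\<close>)
qed

lemma sqint_prod_integrable:
 assumes w: "sqint w" and v: "sqint v"
 shows "integrable lborel (\<lambda>x. w x * v x)"
proof (rule Bochner_Integration.integrable_bound)
 note [measurable] = sqint_measurable[OF w] sqint_measurable[OF v]
 show "integrable lborel (\<lambda>x. (w x)\<^sup>2 + (v x)\<^sup>2)"
  using sqint_integrable[OF w] sqint_integrable[OF v] by auto
 show "AE x in lborel. norm (w x * v x) \<le> norm ((w x)\<^sup>2 + (v x)\<^sup>2)"
 proof (rule AE_I2, goal_cases)
  case (1 x)
  have "0 \<le> (\<bar>w x\<bar> - \<bar>v x\<bar>)\<^sup>2" by simp
  then have "2 * (\<bar>w x\<bar> * \<bar>v x\<bar>) \<le> (w x)\<^sup>2 + (v x)\<^sup>2" by (simp add: power2_diff)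
  moreover have "0 \<le> \<bar>w x\<bar> * \<bar>v x\<bar>" by simp
  ultimately have "\<bar>w x\<bar> * \<bar>v x\<bar> \<le> (w x)\<^sup>2 + (v x)\<^sup>2" by linarith
  then show ?case by (simp add: abs_mult)
 qed
qed (use w v in measurable)

section \<open>Translation moduli and mixed second differences\<close>

definition Nw :: "('a::euclidean_space \<Rightarrow> real) \<Rightarrow> 'a \<Rightarrow> real" where
 "Nw w z = (\<integral>x. (w (x + z) - w x)\<^sup>2)"

lemma Nw_integrable: "sqint w \<Longrightarrow> integrable lborel (\<lambda>x. (w (x + y) - w (x + z))\<^sup>2)"
 by (intro sqint_integrable sqint_diff sqint_shift)

lemma Nw_integral:
 assumes w: "sqint w"
 shows "(\<integral>x. (w (x + y) - w (x + z))\<^sup>2) = Nw w (y - z)"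
proof -
 note [measurable] = sqint_measurable[OF w]
 have "(\<integral>x. (w ((z + x) + (y - z)) - w (z + x))\<^sup>2) = Nw w (y - z)"
  unfolding Nw_def by (rule integral_lborel_shift[where f="\<lambda>x. (w (x + (y - z)) - w x)\<^sup>2"]) measurable
 then show ?thesis by (simp add: algebra_simps)
qed

lemma Nw_nonneg [simp]: "0 \<le> Nw w z"
 by (simp add: Nw_def)

lemma Nw_measurable [measurable]:
 assumes w[measurable]: "w \<in> borel_measurable borel"
 shows "Nw w \<in> borel_measurable borel"
 unfolding Nw_def by measurable

lemma Nw_minus: "sqint w \<Longrightarrow> Nw w (- z) = Nw w z"
 using Nw_integral[of w 0 z] Nw_integral[of w z 0] by (simp add: power2_commute)

lemma Nw_le: 
 assumes w: "sqint w"
 shows "Nw w z \<le> 4 * (\<integral>x. (w x)\<^sup>2)"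
proof -
 note [measurable] = sqint_measurable[OF w]
 have i: "integrable lborel (\<lambda>x. 2 * (w (x + z))\<^sup>2 + 2 * (w x)\<^sup>2)"
  using sqint_integrable[OF w] sqint_integrable[OF sqint_shift[OF w, of z]] by auto
 have "Nw w z \<le> (\<integral>x. 2 * (w (x + z))\<^sup>2 + 2 * (w x)\<^sup>2)"
  unfolding Nw_def
 proof (rule integral_mono[OF _ i])
  fix x have "0 \<le> (w (x + z) + w x)\<^sup>2" by simp
  then show "(w (x + z) - w x)\<^sup>2 \<le> 2 * (w (x + z))\<^sup>2 + 2 * (w x)\<^sup>2"
   by (simp add: power2_eq_square algebra_simps)
 qed (use Nw_integrable[OF w, of z 0] in simp)
 also have "... = 2 * (\<integral>x. (w (z + x))\<^sup>2) + 2 * (\<integral>x. (w x)\<^sup>2)"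
  using sqint_integrable[OF w] sqint_integrable[OF sqint_shift[OF w, of z]] by (simp add: add.commute)
 also have "(\<integral>x. (w (z + x))\<^sup>2) = (\<integral>x. (w x)\<^sup>2)"
  by (rule integral_lborel_shift[where f="\<lambda>x. (w x)\<^sup>2"]) measurable
 finally show ?thesis by simp
qed

text \<open>By \<open>Bw_eq\<close> this is the squared norm of a mixed second difference, hence
  nonnegative. Writing it through \<open>Nw\<close> gives joint measurability at once and lets
  \<open>Mw_add\<close> integrate it against a pair of Gaussians term by term.\<close>

definition Bw :: "('a::euclidean_space \<Rightarrow> real) \<Rightarrow> 'a \<Rightarrow> 'a \<Rightarrow> real" where
 "Bw w y z = 2 * Nw w y + 2 * Nw w z - Nw w (y + z) - Nw w (y - z)"

lemma Bw_eq:
 assumes w: "sqint w"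
 shows "Bw w y z = (\<integral>x. (w (x + y + z) - w (x + y) - w (x + z) + w x)\<^sup>2)"
proof -
 note I = Nw_integrable[OF w]
 have "(w (x + y + z) - w (x + y) - w (x + z) + w x)\<^sup>2 =
   (w (x + (y + z)) - w (x + y))\<^sup>2 + (w (x + (y + z)) - w (x + z))\<^sup>2 + (w (x + 0) - w (x + y))\<^sup>2
   + (w (x + 0) - w (x + z))\<^sup>2 - (w (x + (y + z)) - w (x + 0))\<^sup>2 - (w (x + y) - w (x + z))\<^sup>2" for x
  by (simp add: power2_eq_square algebra_simps)
 then show ?thesis
  by (simp only: Bochner_Integration.integral_diff Bochner_Integration.integral_add I Bochner_Integration.integrable_add
    Bochner_Integration.integrable_diff Nw_integral[OF w])
    (simp add: Bw_def Nw_minus[OF w])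
qed

lemma Bw_nonneg: "sqint w \<Longrightarrow> 0 \<le> Bw w y z"
 by (simp add: Bw_eq)

text \<open>Together with \<open>Bw_commute\<close> this allows an estimate to use whichever of the
  two increments is shorter.\<close>

lemma Bw_le:
 assumes w: "sqint w"
 shows "Bw w y z \<le> 4 * Nw w y"
proof -
 note [measurable] = sqint_measurable[OF w]
 note I = Nw_integrable[OF w]
 have "Bw w y z \<le> (\<integral>x. 2 * (w (x + (y + z)) - w (x + z))\<^sup>2 + 2 * (w (x + y) - w (x + 0))\<^sup>2)"
  unfolding Bw_eq[OF w]
 proof (rule integral_mono)
  show "integrable lborel (\<lambda>x. (w (x + y + z) - w (x + y) - w (x + z) + w x)\<^sup>2)"
   using sqint_integrable[OF sqint_diff[OF sqint_diff[OF sqint_shift[OF w, of "y + z"] sqint_shift[OF w, of y]] sqint_diff[OF sqint_shift[OF w, of z] w]]]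
   by (simp add: algebra_simps)
  show "integrable lborel (\<lambda>x. 2 * (w (x + (y + z)) - w (x + z))\<^sup>2 + 2 * (w (x + y) - w (x + 0))\<^sup>2)"
   by (intro Bochner_Integration.integrable_add integrable_mult_right I)
  fix x
  have "0 \<le> ((w (x + (y + z)) - w (x + z)) + (w (x + y) - w (x + 0)))\<^sup>2" by simp
  then show "(w (x + y + z) - w (x + y) - w (x + z) + w x)\<^sup>2 \<le> 2 * (w (x + (y + z)) - w (x + z))\<^sup>2 + 2 * (w (x + y) - w (x + 0))\<^sup>2"
   by (simp add: power2_eq_square algebra_simps)
 qed
 also have "... = 4 * Nw w y"
  by (simp only: Bochner_Integration.integral_add I integrable_mult_right integral_mult_right_zero Nw_integral[OF w]) simp
 finally show ?thesis .
qed

lemma Bw_commute: "sqint w \<Longrightarrow> Bw w y z = Bw w z y"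
 using Nw_minus[of w "y - z"] by (simp add: Bw_def add.commute)

definition TK :: "('a::euclidean_space \<Rightarrow> real) \<Rightarrow> ('a \<Rightarrow> real) \<Rightarrow> 'a \<Rightarrow> real" where
 "TK K w x = (\<integral>z. (w x - w (x + z)) * K z)"

lemma TK_integrand:
 assumes w: "sqint w" and K: "sqint K" "integrable lborel K"
 shows "integrable lborel (\<lambda>z. (w x - w (x + z)) * K z)"
proof -
 have "integrable lborel (\<lambda>z. w (x + z) * K z)"
  using sqint_prod_integrable[OF sqint_affine[OF w, of 1 x] K(1)] by simp
 moreover have "integrable lborel (\<lambda>z. w x * K z)" using K by simp
 ultimately show ?thesis by (simp add: left_diff_distrib)
qed

text \<open>Polarisation \<open>a * c = (a\<^sup>2 + c\<^sup>2 - (a - c)\<^sup>2) / 2\<close>, with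
  \<open>a = w (x + y) - w x\<close> and \<open>c = w (x + z) - w x\<close>, turns the integral in
  \<open>x\<close> into values of \<open>Nw\<close>. Absolute convergence comes from the boundedness
  of \<open>Nw\<close> and the integrability of both kernels.\<close>

lemma TK_inner:
 fixes w :: "'a::euclidean_space \<Rightarrow> real"
 assumes w: "sqint w" and K: "sqint K" "integrable lborel K" and H: "sqint H" "integrable lborel H"
 shows "integrable lborel (\<lambda>x. TK K w x * TK H w x)" (is ?A)
  and "(\<integral>x. TK K w x * TK H w x) =
   (\<integral>y. (\<integral>z. (1/2) * (Nw w y + Nw w z - Nw w (y - z)) * (K y * H z)))" (is ?B)
  and "integrable lborel2 (\<lambda>(y, z). (1/2) * (Nw w y + Nw w z - Nw w (y - z)) * (K y * H z))" (is ?C)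
proof -
 let ?m = "\<lambda>p. \<bar>K (fst p)\<bar> * \<bar>H (snd p)\<bar>"
 note [measurable] = sqint_measurable[OF w] sqint_measurable[OF K(1)] sqint_measurable[OF H(1)]
 define f where "f x p = ((w x - w (x + fst p)) * K (fst p)) * ((w x - w (x + snd p)) * H (snd p))" for x and p :: "'a \<times> 'a"
 have [measurable]: "case_prod f \<in> borel_measurable lborel2"
  unfolding f_def split_beta' lborel_prod[symmetric] by measurable
 define S where "S = 4 * (\<integral>x. (w x)\<^sup>2)"
 have NS: "Nw w z \<le> S" for z using Nw_le[OF w] by (simp add: S_def)
 have iK: "integrable (lborel :: ('a \<times> 'a) measure) (\<lambda>p. S * ?m p)"
  unfolding lborel_prod[symmetric]
  by (intro integrable_mult_right integrable_lborel_pair_mult[where f="\<lambda>x. \<bar>K x\<bar>" and g="\<lambda>x. \<bar>H x\<bar>"] integrable_abs K H)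
 have fx: "integrable lborel (\<lambda>x. f x p)" for p
  unfolding f_def
  using integrable_mult_right[of "K (fst p) * H (snd p)", OF sqint_prod_integrable[OF sqint_diff[OF w sqint_shift[OF w, of "fst p"]] sqint_diff[OF w sqint_shift[OF w, of "snd p"]]]]
  by (simp add: mult_ac)
 have Ifx: "(\<integral>x. f x p) = (1/2) * (Nw w (fst p) + Nw w (snd p) - Nw w (fst p - snd p)) * (K (fst p) * H (snd p))" for p
 proof -
  have "f x p = (1/2) * (K (fst p) * H (snd p)) * ((w (x + fst p) - w (x + 0))\<^sup>2 + (w (x + snd p) - w (x + 0))\<^sup>2 - (w (x + fst p) - w (x + snd p))\<^sup>2)" for x
   by (simp add: f_def power2_eq_square algebra_simps)
  then show ?thesis
   using Nw_integrable[OF w] 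
   by (simp only: integral_mult_right_zero Bochner_Integration.integral_diff Bochner_Integration.integral_add Nw_integrable[OF w] Bochner_Integration.integrable_add
    Bochner_Integration.integrable_diff Nw_integral[OF w]) simp
 qed
 have nfx: "(\<integral>x. norm (f x p)) \<le> S * ?m p" for p
 proof -
  have "(\<integral>x. norm (f x p)) \<le> (\<integral>x. ?m p * (1/2) * ((w (x + fst p) - w (x + 0))\<^sup>2 + (w (x + snd p) - w (x + 0))\<^sup>2))"
  proof (rule integral_mono)
   show "integrable lborel (\<lambda>x. norm (f x p))" using fx by simp
   show "integrable lborel (\<lambda>x. ?m p * (1/2) * ((w (x + fst p) - w (x + 0))\<^sup>2 + (w (x + snd p) - w (x + 0))\<^sup>2))"
    by (intro integrable_mult_right Bochner_Integration.integrable_add Nw_integrable w)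
   fix x
   have "0 \<le> (\<bar>w x - w (x + fst p)\<bar> - \<bar>w x - w (x + snd p)\<bar>)\<^sup>2" by simp
   then have "\<bar>w x - w (x + fst p)\<bar> * \<bar>w x - w (x + snd p)\<bar> \<le> (1/2) * ((w (x + fst p) - w (x + 0))\<^sup>2 + (w (x + snd p) - w (x + 0))\<^sup>2)"
    by (simp add: power2_diff power2_commute[of "w x"] mult_ac)
   from mult_left_mono[OF this, of "\<bar>K (fst p)\<bar> * \<bar>H (snd p)\<bar>"]
   show "norm (f x p) \<le> ?m p * (1/2) * ((w (x + fst p) - w (x + 0))\<^sup>2 + (w (x + snd p) - w (x + 0))\<^sup>2)"
    by (simp add: f_def abs_mult mult_ac)
  qed
  also have "... = ?m p * (1/2) * (Nw w (fst p) + Nw w (snd p))"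
   by (simp only: integral_mult_right_zero Bochner_Integration.integral_add Nw_integrable[OF w] Nw_integral[OF w]) simp
  also have "... \<le> ?m p * (1/2) * (S + S)"
   by (intro mult_left_mono add_mono NS) auto
  finally show ?thesis by (simp add: mult_ac)
 qed
 interpret Q: pair_sigma_finite "lborel :: 'a measure" "lborel :: ('a \<times> 'a) measure" ..
 have int: "integrable lborel2 (case_prod f)"
 proof -
  have "integrable lborel2 (\<lambda>(p, x). f x p)"
  proof (rule lborel_pair.Fubini_integrable)
   show "(\<lambda>(p, x). f x p) \<in> borel_measurable ((lborel :: ('a \<times> 'a) measure) \<Otimes>\<^sub>M (lborel :: 'a measure))"
    unfolding f_def split_beta' lborel_prod[symmetric] by measurable
   show "integrable (lborel :: ('a \<times> 'a) measure) (\<lambda>p. \<integral>x. norm (case (p, x) of (p, x) \<Rightarrow> f x p))"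
   proof (rule Bochner_Integration.integrable_bound[OF iK])
    show "(\<lambda>p. \<integral>x. norm (case (p, x) of (p, x) \<Rightarrow> f x p)) \<in> borel_measurable lborel"
     unfolding f_def split lborel_prod[symmetric] by measurable
    show "AE p in lborel. norm (\<integral>x. norm (case (p, x) of (p, x) \<Rightarrow> f x p)) \<le> norm (S * ?m p)"
    proof (rule AE_I2, goal_cases)
     case (1 p)
     have "0 \<le> (\<integral>x. norm (f x p))" by simp
     then show ?case
      using nfx[of p] unfolding split real_norm_def by linarith
    qed
   qed
   show "AE p in lborel. integrable lborel (\<lambda>x. case (p, x) of (p, x) \<Rightarrow> f x p)" using fx by simp
  qed
  then show ?thesis
   by (subst lborel_pair.integrable_product_swap_iff[symmetric]) (simp add: split_beta')
 qed
 have ip: "(\<integral>p. f x p) = TK K w x * TK H w x" for x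
 proof -
  have "integrable lborel2 (\<lambda>p. f x p)"
   unfolding f_def
   by (intro integrable_lborel_pair_mult[where f="\<lambda>y. (w x - w (x + y)) * K y" and g="\<lambda>z. (w x - w (x + z)) * H z"] TK_integrand w K H)
  then have "(\<integral>p. f x p) = (\<integral>y. (\<integral>z. f x (y, z)))"
   using lborel_pair.integral_fst'[of "f x"] by (simp add: lborel_prod)
  also have "... = TK K w x * TK H w x"
   by (simp add: f_def TK_def)
  finally show ?thesis .
 qed
 show ?A using lborel_pair.integrable_fst'[OF int] by (simp add: ip)
 have "(\<integral>x. TK K w x * TK H w x) = (\<integral>x. (\<integral>p. f x p))" by (simp add: ip)
 also have "... = (\<integral>p. (\<integral>x. f x p))"
  using lborel_pair.Fubini_integral[OF int] by simp
 finally have 1: "(\<integral>x. TK K w x * TK H w x) = (\<integral>p. (1/2) * (Nw w (fst p) + Nw w (snd p) - Nw w (fst p - snd p)) * (K (fst p) * H (snd p)))"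
  by (simp only: Ifx)
 have "integrable lborel (\<lambda>p. (\<integral>x. f x p))"
  using lborel_pair.integrable_snd[OF int] by simp
 then have 2: "integrable lborel2 (\<lambda>p. (1/2) * (Nw w (fst p) + Nw w (snd p) - Nw w (fst p - snd p)) * (K (fst p) * H (snd p)))"
  by (simp only: Ifx lborel_prod)
 then show ?C by (simp only: split_beta')
 show ?B using 1 lborel_pair.integral_fst'[OF 2] by (simp add: lborel_prod)
qed

lemma kr_cut:
 assumes A[measurable]: "A \<in> sets borel" and sub: "A \<subseteq> {z. r \<le> norm z}" and r: "r > 0" and a: "a > 0"
 shows "integrable lborel (\<lambda>z::'a::euclidean_space. kr a z * indicator A z)"
  and "sqint (\<lambda>z::'a. kr a z * indicator A z)"
proof -
 have "(\<integral>\<^sup>+z. ennreal (norm (kr a (z::'a) * indicator A z))) \<le> (\<integral>\<^sup>+z\<in>{z. r \<le> norm z}. kr a (z::'a) \<partial>lborel)"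
  using sub by (intro nn_integral_mono) (auto simp: indicator_def)
 also have "... < \<infinity>" using kr_tail[OF r a, where 'a='a] by (simp add: order_le_less_trans)
 finally show i: "integrable lborel (\<lambda>z::'a. kr a z * indicator A z)"
  by (intro integrableI_bounded) auto
 show "sqint (\<lambda>z::'a. kr a z * indicator A z)"
 proof (rule sqintI)
  show "integrable lborel (\<lambda>z::'a. (kr a z * indicator A z)\<^sup>2)"
  proof (rule Bochner_Integration.integrable_bound[OF integrable_mult_right[OF i, of "1 / r powr (real DIM('a) + a)"]])
   have "kr a z \<le> 1 / r powr (real DIM('a) + a)" if "r \<le> norm z" for z :: 'a
    unfolding kr_def using r a that by (intro divide_left_mono powr_mono2 mult_pos_pos) auto
   then have "(kr a z * indicator A z) * (kr a z * indicator A z) \<le> 1 / r powr (real DIM('a) + a) * (kr a z * indicator A z)" for z :: 'a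
    using sub by (intro mult_right_mono) (auto simp: indicator_def)
   then have "(kr a z * indicator A z)\<^sup>2 \<le> 1 / r powr (real DIM('a) + a) * (kr a z * indicator A z)" for z :: 'a
    by (simp only: power2_eq_square)
   then show "AE z::'a in lborel. norm ((kr a z * indicator A z)\<^sup>2) \<le> norm (1 / r powr (real DIM('a) + a) * (kr a z * indicator A z))"
    by (intro AE_I2) (metis abs_ge_self abs_of_nonneg order_trans real_norm_def zero_le_power2)
  qed measurable
 qed measurable
qed

definition gag :: "real \<Rightarrow> ('a::euclidean_space \<Rightarrow> real) \<Rightarrow> ennreal" where
 "gag s w = (\<integral>\<^sup>+z. ennreal (Nw w z * kr (2 * s) z))"

lemma gag_eq:
 fixes w :: "'a::euclidean_space \<Rightarrow> real"
 assumes w: "sqint w"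
 shows "(\<integral>\<^sup>+x. (\<integral>\<^sup>+y. ennreal ((w x - w y)\<^sup>2 * kr (2 * s) (x - y)))) = gag s w"
proof -
 note [measurable] = sqint_measurable[OF w]
 have "(\<integral>\<^sup>+y. ennreal ((w x - w y)\<^sup>2 * kr (2 * s) (x - y))) = (\<integral>\<^sup>+z. ennreal ((w (x + z) - w x)\<^sup>2 * kr (2 * s) z))" for x
  using nn_integral_lborel_shift[where f="\<lambda>y. ennreal ((w x - w y)\<^sup>2 * kr (2 * s) (x - y))" and t=x]
  by (simp add: power2_commute)
 then have "(\<integral>\<^sup>+x. (\<integral>\<^sup>+y. ennreal ((w x - w y)\<^sup>2 * kr (2 * s) (x - y))))
   = (\<integral>\<^sup>+x. (\<integral>\<^sup>+z. ennreal ((w (x + z) - w x)\<^sup>2 * kr (2 * s) z)))"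
  by simp
 also have "... = (\<integral>\<^sup>+z. (\<integral>\<^sup>+x. ennreal ((w (x + z) - w x)\<^sup>2 * kr (2 * s) z)))"
  by (rule lborel_pair.Fubini') measurable
 also have "... = gag s w"
  unfolding gag_def
 proof (intro nn_integral_cong, goal_cases)
  case (1 z)
  have "(\<integral>\<^sup>+x. ennreal ((w (x + z) - w x)\<^sup>2)) = ennreal (Nw w z)"
   unfolding Nw_def using Nw_integrable[OF w, of z 0] by (intro nn_integral_eq_integral) auto
  then show ?case
   by (simp add: ennreal_mult nn_integral_multc)
 qed
 finally show ?thesis .
qed

text \<open>The integrand from \<open>TK_inner\<close> has no sign. For an even kernel it may be
  averaged over \<open>z\<close> and \<open>- z\<close>, which produces
  \<open>Bw / 4 \<ge> 0\<close>; the later limits of truncations rest on this positivity.\<close>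

lemma TK_norm:
 fixes w :: "'a::euclidean_space \<Rightarrow> real"
 assumes w: "sqint w" and K: "sqint K" "integrable lborel K" and pos: "\<And>z. 0 \<le> K z" and even: "\<And>z. K (- z) = K z"
 shows "sqint (TK K w)"
  and "ennreal (\<integral>x. (TK K w x)\<^sup>2) = (\<integral>\<^sup>+p. ennreal ((1/4) * Bw w (fst p) (snd p) * (K (fst p) * K (snd p))) \<partial>lborel2)"
proof -
 note [measurable] = sqint_measurable[OF w] sqint_measurable[OF K(1)]
 note T = TK_inner[OF w K K]
 show "sqint (TK K w)"
 proof (rule sqintI)
  show "TK K w \<in> borel_measurable borel" unfolding TK_def by measurable
  show "integrable lborel (\<lambda>x. (TK K w x)\<^sup>2)" using T(1) by (simp add: power2_eq_square)
 qed
 define I where "I y z = (1/2) * (Nw w y + Nw w z - Nw w (y - z)) * (K y * K z)" for y z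
 have Ieq: "case_prod I = (\<lambda>(y, z). (1/2) * (Nw w y + Nw w z - Nw w (y - z)) * (K y * K z))"
  by (simp add: fun_eq_iff I_def)
 have iI: "integrable lborel2 (case_prod I)" using T(3) unfolding Ieq .
 have [measurable]: "case_prod I \<in> borel_measurable (borel \<Otimes>\<^sub>M borel)"
  unfolding I_def split_beta' by measurable
 define J where "J y z = I y (- z)" for y z
 have iJ: "integrable lborel2 (case_prod J)"
 proof (rule lborel_pair.Fubini_integrable)
  show "case_prod J \<in> borel_measurable lborel2"
   unfolding J_def I_def split_beta' by measurable
  have "(\<integral>z. norm (I y (- z))) = (\<integral>z. norm (I y z))" for y
  proof -
   have "(\<lambda>z. norm (I y z)) \<in> borel_measurable borel" unfolding I_def by measurable
   from integral_lborel_reflect[OF this, of 0] show ?thesis by simp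
  qed
  then show "integrable lborel (\<lambda>x. \<integral>y. norm (case (x, y) of (x, y) \<Rightarrow> J x y))"
   using lborel_pair.integrable_fst'[OF integrable_norm[OF iI]] by (simp add: J_def)
  show "AE x in lborel. integrable lborel (\<lambda>y. case (x, y) of (x, y) \<Rightarrow> J x y)"
   using lborel_pair.AE_integrable_fst'[OF iI]
  proof eventually_elim
   case (elim x)
   then show ?case using integrable_lborel_reflect[of "I x" 0] by (simp add: J_def)
  qed
 qed
 have IJ: "(\<integral>z. I y z) = (\<integral>z. J y z)" for y
 proof -
  have "I y \<in> borel_measurable borel" unfolding I_def by measurable
  from integral_lborel_reflect[OF this, of 0] show ?thesis by (simp add: J_def)
 qed
 have BIJ: "(1/4) * Bw w y z * (K y * K z) = (1/2) * (I y z + J y z)" for y z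
  by (simp add: I_def J_def Bw_def Nw_minus[OF w] even algebra_simps)
 have iB: "integrable lborel2 (\<lambda>p. (1/4) * Bw w (fst p) (snd p) * (K (fst p) * K (snd p)))"
  unfolding BIJ using integrable_mult_right[OF Bochner_Integration.integrable_add[OF iI iJ], of "1/2"] by (simp add: split_beta')
 have "(\<integral>x. (TK K w x)\<^sup>2) = (\<integral>p. case_prod I p \<partial>lborel2)"
  using T(2) lborel_pair.integral_fst'[OF iI] by (simp add: power2_eq_square I_def)
 moreover have "(\<integral>p. case_prod I p \<partial>lborel2) = (\<integral>p. case_prod J p \<partial>lborel2)"
  using lborel_pair.integral_fst'[OF iI] lborel_pair.integral_fst'[OF iJ] IJ by simp
 ultimately have "(\<integral>x. (TK K w x)\<^sup>2) = (1/2) * ((\<integral>p. case_prod I p \<partial>lborel2) + (\<integral>p. case_prod J p \<partial>lborel2))"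
  by simp
 also have "... = (\<integral>p. (1/2) * (case_prod I p + case_prod J p) \<partial>lborel2)"
  using iI iJ by simp
 also have "... = (\<integral>p. (1/4) * Bw w (fst p) (snd p) * (K (fst p) * K (snd p)) \<partial>lborel2)"
  unfolding BIJ by (simp add: split_beta')
 finally have E: "(\<integral>x. (TK K w x)\<^sup>2) = (\<integral>p. (1/4) * Bw w (fst p) (snd p) * (K (fst p) * K (snd p)) \<partial>lborel2)" .
 show "ennreal (\<integral>x. (TK K w x)\<^sup>2) = (\<integral>\<^sup>+p. ennreal ((1/4) * Bw w (fst p) (snd p) * (K (fst p) * K (snd p))) \<partial>lborel2)"
  unfolding E using pos
  by (intro nn_integral_eq_integral[OF iB, symmetric] AE_I2 mult_nonneg_nonneg Bw_nonneg w) auto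
qed

text \<open>The integrand of \<open>TK_norm\<close> for the full kernel \<open>kr s\<close>.
  Truncating the operator merely restricts the domain of integration of this fixed nonnegative
  function.\<close>

definition Qf :: "real \<Rightarrow> ('a::euclidean_space \<Rightarrow> real) \<Rightarrow> ('a \<times> 'a) \<Rightarrow> ennreal" where
 "Qf s w p = ennreal ((1/4) * Bw w (fst p) (snd p) * (kr s (fst p) * kr s (snd p)))"

lemma Bw_measurable [measurable]:
 fixes w :: "'a::euclidean_space \<Rightarrow> real"
 assumes [measurable]: "w \<in> borel_measurable borel"
 shows "(\<lambda>p. Bw w (fst p) (snd p)) \<in> borel_measurable (borel \<Otimes>\<^sub>M borel)"
 unfolding Bw_def by measurable

lemma Qf_measurable [measurable]:
 assumes [measurable]: "w \<in> borel_measurable borel"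
 shows "Qf s w \<in> borel_measurable (borel \<Otimes>\<^sub>M borel)"
 unfolding Qf_def by measurable

text \<open>Split according to which of \<open>y\<close>, \<open>z\<close> is shorter. If it is
  \<open>y\<close>, then \<open>Bw \<le> 4 * Nw w y\<close>, and the tail of \<open>kr s\<close>
  beyond \<open>norm y\<close> contributes \<open>norm y powr - s\<close>, which raises
  \<open>kr s y\<close> to \<open>kr (2 * s) y\<close>. The two halves are symmetric, hence the
  factor \<open>2\<close>.\<close>

lemma Qf_le:
 fixes w :: "'a::euclidean_space \<Rightarrow> real"
 assumes w: "sqint w" and s: "s > 0"
 shows "(\<integral>\<^sup>+p. Qf s w p \<partial>lborel2) \<le> ennreal (2 * kr_const TYPE('a) s) * gag s w"
proof -
 note [measurable] = sqint_measurable[OF w]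
 define h where "h y z = ennreal (Nw w y * kr s y) * (ennreal (kr s z) * indicator {z. norm y \<le> norm z} z)" for y z :: 'a
 have [measurable]: "case_prod h \<in> borel_measurable lborel2" 
  unfolding h_def split_beta' by measurable
 have Qh: "Qf s w (y, z) \<le> h y z + h z y" for y z
 proof -
  have a: "Bw w y z \<le> 4 * Nw w y" "Bw w y z \<le> 4 * Nw w z" using Bw_le[OF w] Bw_commute[OF w] by metis+
  have "norm y \<le> norm z \<or> norm z \<le> norm y" by linarith
  then show ?thesis
  proof
   assume yz: "norm y \<le> norm z"
   have "Qf s w (y, z) \<le> ennreal (Nw w y * (kr s y * kr s z))"
    unfolding Qf_def fst_conv snd_conv using a by (intro ennreal_leI mult_right_mono) auto
   also have "... = h y z" using yz by (simp add: h_def ennreal_mult mult_ac)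
   finally show ?thesis by (simp add: add_increasing2)
  next
   assume yz: "norm z \<le> norm y"
   have "Qf s w (y, z) \<le> ennreal (Nw w z * (kr s y * kr s z))"
    unfolding Qf_def fst_conv snd_conv using a by (intro ennreal_leI mult_right_mono) auto
   also have "... = h z y" using yz by (simp add: h_def ennreal_mult mult_ac)
   finally show ?thesis by (simp add: add_increasing)
  qed
 qed
 have h1: "(\<integral>\<^sup>+y. (\<integral>\<^sup>+z. h y z)) \<le> ennreal (kr_const TYPE('a) s) * gag s w"
 proof -
  have "(\<integral>\<^sup>+z. h y z) \<le> ennreal (kr_const TYPE('a) s) * ennreal (Nw w y * kr (2 * s) y)" for y
  proof (cases "y = 0")
   case False
   have "(\<integral>\<^sup>+z. h y z) = ennreal (Nw w y * kr s y) * (\<integral>\<^sup>+z\<in>{z. norm y \<le> norm z}. kr s (z::'a) \<partial>lborel)"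
    unfolding h_def by (rule nn_integral_cmult) measurable
   also have "... \<le> ennreal (Nw w y * kr s y) * ennreal (kr_const TYPE('a) s * norm y powr - s)"
    using False s by (intro mult_left_mono kr_tail) auto
   also have "... = ennreal (kr_const TYPE('a) s * (Nw w y * (norm y powr - s * kr s y)))"
    using kr_const_nonneg[where 'a='a, of s] by (subst ennreal_mult[symmetric]) (auto simp: mult_ac)
   also have "norm y powr - s * kr s y = kr (2 * s) y" using False kr_mult_norm[of y "-s" s] by simp
   finally show ?thesis using kr_const_nonneg[where 'a='a, of s] by (simp add: ennreal_mult)
  qed (simp add: h_def)
  then have "(\<integral>\<^sup>+y. (\<integral>\<^sup>+z. h y z)) \<le> (\<integral>\<^sup>+y. ennreal (kr_const TYPE('a) s) * ennreal (Nw w y * kr (2 * s) y))"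
   by (intro nn_integral_mono)
  also have "... = ennreal (kr_const TYPE('a) s) * gag s w"
   unfolding gag_def by (rule nn_integral_cmult) measurable
  finally show ?thesis .
 qed
 have "(\<integral>\<^sup>+p. Qf s w p \<partial>lborel2) = (\<integral>\<^sup>+y. (\<integral>\<^sup>+z. Qf s w (y, z)))"
  by (rule lborel.nn_integral_fst[symmetric]) measurable
 also have "... \<le> (\<integral>\<^sup>+y. (\<integral>\<^sup>+z. h y z + h z y))"
  by (intro nn_integral_mono Qh)
 also have "... = (\<integral>\<^sup>+y. (\<integral>\<^sup>+z. h y z)) + (\<integral>\<^sup>+y. (\<integral>\<^sup>+z. h z y))"
  by (subst nn_integral_add[symmetric]) (auto intro!: nn_integral_cong nn_integral_add)
 also have "(\<integral>\<^sup>+y. (\<integral>\<^sup>+z. h z y)) = (\<integral>\<^sup>+z. (\<integral>\<^sup>+y. h z y))"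
  by (rule lborel_pair.Fubini') measurable
 also have "(\<integral>\<^sup>+y. (\<integral>\<^sup>+z. h y z)) + (\<integral>\<^sup>+y. (\<integral>\<^sup>+z. h y z)) \<le> ennreal (kr_const TYPE('a) s) * gag s w + ennreal (kr_const TYPE('a) s) * gag s w"
  by (intro add_mono h1)
 also have "... = ennreal (2 * kr_const TYPE('a) s) * gag s w"
  using kr_const_nonneg[where 'a='a, of s] by (simp add: distrib_right[symmetric] ennreal_plus[symmetric] del: ennreal_plus)
 finally show ?thesis .
qed

text \<open>Completeness, with the limit realised as the pointwise limit of a rapidly convergent
  subsequence so that it is a Borel function; Fatou then transfers the estimates to the
  limit.\<close>

lemma Riesz_Fischer:
 fixes f :: "nat \<Rightarrow> 'a::euclidean_space \<Rightarrow> real"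
 assumes f: "\<And>k. sqint (f k)" 
  and e: "\<And>k i j. k \<le> i \<Longrightarrow> k \<le> j \<Longrightarrow> (\<integral>x. (f i x - f j x)\<^sup>2) \<le> e k" and e0: "e \<longlonglongrightarrow> (0::real)"
 shows "\<exists>g. sqint g \<and> (\<lambda>k. \<integral>x. (f k x - g x)\<^sup>2) \<longlonglongrightarrow> 0"
proof -
 note [measurable] = sqint_measurable[OF f]
 \<comment> \<open>The rate \<open>(1/8)^k\<close> leaves room for weights \<open>2^k\<close>: the
   weighted squares still sum to at most a geometric series of ratio \<open>1/4\<close>, and the
   weights make the increments summable at almost every point.\<close>
 have "\<exists>m. e m \<le> (1/8)^k" for k
 proof -
  have "eventually (\<lambda>m. e m < (1/8)^k) sequentially"
   using e0 by (rule order_tendstoD) simp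
  then show ?thesis by (metis eventually_sequentially le_refl less_imp_le)
 qed
 then obtain r where r: "\<And>k. e (r k) \<le> (1/8)^k" by metis
 \<comment> \<open>\<open>r\<close> need not be monotone; its running maximum is.\<close>
 define R where "R k = Max (r ` {..k})" for k
 have Rr: "r k \<le> R k" for k by (auto simp: R_def)
 have Rm: "R k \<le> R j" if "k \<le> j" for k j using that by (auto simp: R_def intro!: Max_mono)
 have est: "(\<integral>x. (f i x - f j x)\<^sup>2) \<le> (1/8)^k" if "R k \<le> i" "R k \<le> j" for i j k
  using e[of "r k" i j] r[of k] Rr[of k] that by linarith
 have nn: "(\<integral>\<^sup>+x. ennreal ((f i x - f j x)\<^sup>2)) = ennreal (\<integral>x. (f i x - f j x)\<^sup>2)" for i j
  by (rule nn_integral_eq_integral) (auto intro!: sqint_integrable sqint_diff f)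
 have "(\<integral>\<^sup>+x. (\<Sum>k. ennreal (2^k * (f (R (Suc k)) x - f (R k) x)\<^sup>2))) = (\<Sum>k. (\<integral>\<^sup>+x. ennreal (2^k * (f (R (Suc k)) x - f (R k) x)\<^sup>2)))"
  by (rule nn_integral_suminf) measurable
 also have "... \<le> (\<Sum>k. ennreal ((1/4)^k))"
 proof (intro suminf_le)
  fix k
  have "(\<integral>\<^sup>+x. ennreal (2^k * (f (R (Suc k)) x - f (R k) x)\<^sup>2)) = ennreal (2^k) * (\<integral>\<^sup>+x. ennreal ((f (R (Suc k)) x - f (R k) x)\<^sup>2))"
   by (simp add: ennreal_mult nn_integral_cmult)
  also have "... = ennreal (2^k * (\<integral>x. (f (R (Suc k)) x - f (R k) x)\<^sup>2))"
   by (simp add: nn ennreal_mult)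
  also have "... \<le> ennreal (2^k * (1/8)^k)"
   using est[of k "R (Suc k)" "R k"] Rm[of k "Suc k"] by (intro ennreal_leI mult_left_mono) auto
  finally show "(\<integral>\<^sup>+x. ennreal (2^k * (f (R (Suc k)) x - f (R k) x)\<^sup>2)) \<le> ennreal ((1/4)^k)"
   by (simp add: power_mult_distrib[symmetric])
 qed auto
 also have "... = ennreal (\<Sum>k. (1/4)^k)" by (intro suminf_ennreal2) auto
 finally have "(\<integral>\<^sup>+x. (\<Sum>k. ennreal (2^k * (f (R (Suc k)) x - f (R k) x)\<^sup>2))) \<noteq> \<infinity>"
  by (metis ennreal_neq_top infinity_ennreal_def neq_top_trans)
 then have ae: "AE x in lborel. (\<Sum>k. ennreal (2^k * (f (R (Suc k)) x - f (R k) x)\<^sup>2)) \<noteq> \<infinity>"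
  by (intro nn_integral_PInf_AE) auto
 define g where "g x = lim (\<lambda>k. f (R k) x)" for x
 have [measurable]: "g \<in> borel_measurable borel" unfolding g_def by measurable
 have conv: "AE x in lborel. (\<lambda>k. f (R k) x) \<longlonglongrightarrow> g x"
  using ae
 proof eventually_elim
  case (elim x)
  have "summable (\<lambda>k. 2^k * (f (R (Suc k)) x - f (R k) x)\<^sup>2)"
   using elim by (intro summable_suminf_not_top) auto
  then have "summable (\<lambda>k. (1/2)^k + 2^k * (f (R (Suc k)) x - f (R k) x)\<^sup>2)"
   by (intro summable_add) auto
  then have "summable (\<lambda>k. f (R (Suc k)) x - f (R k) x)"
  proof (rule summable_comparison_test'[where N=0])
   fix k
   let ?d = "\<bar>f (R (Suc k)) x - f (R k) x\<bar>"
   \<comment> \<open>Young's inequality bounds the increment itself, not only its square, by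
     summable terms.\<close>
   have "2 * ?d \<le> (1/2)^k + 2^k * ?d\<^sup>2"
   proof -
    have "0 \<le> 2^k * ((1/2)^k - ?d)\<^sup>2" by simp
    also have "... = (2^k * (1/2)^k) * (1/2)^k - 2 * (2^k * (1/2)^k) * ?d + 2^k * ?d\<^sup>2"
     by (simp add: power2_eq_square algebra_simps)
    also have "2^k * (1/2)^k = (1::real)" by (simp add: power_mult_distrib[symmetric])
    finally show ?thesis by simp
   qed
   then show "norm (f (R (Suc k)) x - f (R k) x) \<le> (1/2)^k + 2^k * (f (R (Suc k)) x - f (R k) x)\<^sup>2"
    using order_trans[OF _ \<open>2 * ?d \<le> (1/2)^k + 2^k * ?d\<^sup>2\<close>, of "norm (f (R (Suc k)) x - f (R k) x)"] by simp
  qed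
  then have "convergent (\<lambda>k. \<Sum>i<k. f (R (Suc i)) x - f (R i) x)" by (simp add: summable_iff_convergent)
  then have "convergent (\<lambda>k. f (R k) x - f (R 0) x)" unfolding sum_lessThan_telescope[of "\<lambda>k. f (R k) x"] .
  then have "convergent (\<lambda>k. f (R k) x)" by (simp add: convergent_diff_const_right_iff)
  then show ?case by (simp add: g_def convergent_LIMSEQ_iff)
 qed
 have fin: "(\<integral>\<^sup>+x. ennreal ((f i x - g x)\<^sup>2)) \<le> ennreal ((1/8)^m)" if i: "R m \<le> i" for i m
 proof -
  have "(\<integral>\<^sup>+x. ennreal ((f i x - g x)\<^sup>2)) = (\<integral>\<^sup>+x. liminf (\<lambda>k. ennreal ((f i x - f (R k) x)\<^sup>2)))"
   using conv
  proof (intro nn_integral_cong_AE, eventually_elim)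
   case (elim x)
   have "(\<lambda>k. ennreal ((f i x - f (R k) x)\<^sup>2)) \<longlonglongrightarrow> ennreal ((f i x - g x)\<^sup>2)"
    by (intro tendsto_ennrealI tendsto_intros elim)
   then show ?case by (rule lim_imp_Liminf[OF trivial_limit_sequentially, symmetric])
  qed
  also have "... \<le> liminf (\<lambda>k. (\<integral>\<^sup>+x. ennreal ((f i x - f (R k) x)\<^sup>2)))"
   by (rule nn_integral_liminf) measurable
  also have "... \<le> ennreal ((1/8)^m)"
  proof (rule Liminf_le)
   show "eventually (\<lambda>k. (\<integral>\<^sup>+x. ennreal ((f i x - f (R k) x)\<^sup>2)) \<le> ennreal ((1/8)^m)) sequentially"
    unfolding eventually_sequentially nn using i Rm
    by (intro exI[of _ m]) (auto intro!: ennreal_leI est)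
  qed simp
  finally show ?thesis .
 qed
 have sq: "sqint (\<lambda>x. f i x - g x)" if "R m \<le> i" for i m
 proof (rule sqintI)
  show "integrable lborel (\<lambda>x. (f i x - g x)\<^sup>2)"
   using fin[OF that] by (intro integrableI_bounded) (auto simp: order_le_less_trans[OF _ ennreal_less_top])
 qed measurable
 have "sqint g" using sqint_diff[OF f[of "R 0"] sq[of 0 "R 0"]] by simp
 moreover have "(\<lambda>k. \<integral>x. (f k x - g x)\<^sup>2) \<longlonglongrightarrow> 0"
 proof (rule LIMSEQ_I)
  fix d :: real assume "0 < d"
  then obtain m where m: "(1/8)^m < d" using real_arch_pow_inv[of d "1/8"] by auto
  have "norm ((\<integral>x. (f i x - g x)\<^sup>2) - 0) < d" if i: "R m \<le> i" for i
  proof -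
   have "ennreal (\<integral>x. (f i x - g x)\<^sup>2) \<le> ennreal ((1/8)^m)"
    using fin[OF i] nn_integral_eq_integral[OF sqint_integrable[OF sq[OF i]]] by simp
   then have "(\<integral>x. (f i x - g x)\<^sup>2) \<le> (1/8)^m" by (subst (asm) ennreal_le_iff) auto
   then show ?thesis using m by simp
  qed
  then show "\<exists>no. \<forall>n\<ge>no. norm ((\<integral>x. (f n x - g x)\<^sup>2) - 0) < d" by blast
 qed
 ultimately show ?thesis by blast
qed

text \<open>The truncated operator whose limit is the principal value.\<close>

definition Te :: "real \<Rightarrow> real \<Rightarrow> ('a::euclidean_space \<Rightarrow> real) \<Rightarrow> 'a \<Rightarrow> real" where
 "Te s \<epsilon> = TK (\<lambda>z. kr s z * indicator {z. \<epsilon> < norm z} z)"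

lemma Te_kernel:
 assumes "\<epsilon> > 0" "s > 0"
 shows "sqint (\<lambda>z::'a::euclidean_space. kr s z * indicator {z. \<epsilon> < norm z} z)"
  and "integrable lborel (\<lambda>z::'a. kr s z * indicator {z. \<epsilon> < norm z} z)"
 by (rule kr_cut[OF _ _ assms]; force)+

lemma Te_sqint: "sqint w \<Longrightarrow> \<epsilon> > 0 \<Longrightarrow> s > 0 \<Longrightarrow> sqint (Te s \<epsilon> w)"
 unfolding Te_def by (rule TK_norm(1)[OF _ Te_kernel]) (auto simp: indicator_def)

lemma Te_lin:
 assumes "sqint w" "sqint v" "\<epsilon> > 0" "s > 0"
 shows "Te s \<epsilon> (\<lambda>x. a * w x + b * v x) x = a * Te s \<epsilon> w x + b * Te s \<epsilon> v x"
proof -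
 note I = TK_integrand[OF _ Te_kernel[OF assms(3,4)]]
 have "Te s \<epsilon> (\<lambda>x. a * w x + b * v x) x = (\<integral>z. a * ((w x - w (x + z)) * (kr s z * indicator {z. \<epsilon> < norm z} z)) + b * ((v x - v (x + z)) * (kr s z * indicator {z. \<epsilon> < norm z} z)))"
  unfolding Te_def TK_def by (intro Bochner_Integration.integral_cong) (simp_all add: algebra_simps)
 also have "... = a * Te s \<epsilon> w x + b * Te s \<epsilon> v x"
  unfolding Te_def TK_def using I[OF assms(1)] I[OF assms(2)] by simp
 finally show ?thesis .
qed

lemma Te_norm:
 fixes w :: "'a::euclidean_space \<Rightarrow> real"
 assumes w: "sqint w" and s: "s > 0" and e: "\<epsilon> > 0"
 shows "ennreal (\<integral>x. (Te s \<epsilon> w x)\<^sup>2) = (\<integral>\<^sup>+p. Qf s w p * indicator {p. \<epsilon> < norm (fst p) \<and> \<epsilon> < norm (snd p)} p \<partial>lborel2)"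
 unfolding Te_def by (subst TK_norm[OF w Te_kernel[OF e s]]) (auto simp: indicator_def Qf_def intro!: nn_integral_cong)

text \<open>A difference of two truncations is again of the form \<open>TK\<close>, with the kernel
  cut to an annulus, so \<open>TK_norm\<close> applies to it; for points of the annulus both norms
  are at most \<open>\<delta>\<close>.\<close>

lemma Te_diff:
 fixes w :: "'a::euclidean_space \<Rightarrow> real"
 assumes w: "sqint w" and s: "s > 0" and e: "0 < \<epsilon>" "\<epsilon> \<le> \<delta>"
 shows "ennreal (\<integral>x. (Te s \<epsilon> w x - Te s \<delta> w x)\<^sup>2) \<le> (\<integral>\<^sup>+p. Qf s w p * indicator {p. norm (fst p) \<le> \<delta> \<and> norm (snd p) \<le> \<delta>} p \<partial>lborel2)"
proof -
 let ?A = "{z::'a. \<epsilon> < norm z \<and> norm z \<le> \<delta>}"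
 have A: "sqint (\<lambda>z. kr s z * indicator ?A z)" "integrable lborel (\<lambda>z. kr s z * indicator ?A z)"
  by (rule kr_cut[OF _ _ e(1) s]; force)+
 have "Te s \<epsilon> w x - Te s \<delta> w x = TK (\<lambda>z. kr s z * indicator ?A z) w x" for x
 proof -
  have "Te s \<epsilon> w x - Te s \<delta> w x = (\<integral>z. (w x - w (x + z)) * (kr s z * indicator {z. \<epsilon> < norm z} z) - (w x - w (x + z)) * (kr s z * indicator {z. \<delta> < norm z} z))"
   unfolding Te_def TK_def
   by (rule Bochner_Integration.integral_diff[symmetric]; rule TK_integrand[OF w Te_kernel]) (use e s in auto)
  also have "... = TK (\<lambda>z. kr s z * indicator ?A z) w x"
   unfolding TK_def using e by (intro Bochner_Integration.integral_cong) (auto simp: indicator_def)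
  finally show ?thesis .
 qed
 then have "ennreal (\<integral>x. (Te s \<epsilon> w x - Te s \<delta> w x)\<^sup>2) = (\<integral>\<^sup>+p. Qf s w p * indicator (?A \<times> ?A) p \<partial>lborel2)"
  by (simp only:) (subst TK_norm[OF w A], auto simp: indicator_def Qf_def intro!: nn_integral_cong)
 also have "... \<le> (\<integral>\<^sup>+p. Qf s w p * indicator {p. norm (fst p) \<le> \<delta> \<and> norm (snd p) \<le> \<delta>} p \<partial>lborel2)"
  by (intro nn_integral_mono) (auto simp: indicator_def)
 finally show ?thesis .
qed

lemma Qf_0: "fst p = 0 \<or> snd p = 0 \<Longrightarrow> Qf s w p = 0"
 by (auto simp: Qf_def)

text \<open>\<open>Qf s w\<close> has finite integral by \<open>Qf_le\<close> and serves as the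
  dominating function twice: its mass near the origin controls the Cauchy property through
  \<open>Te_diff\<close>, and its mass outside small balls gives the norm of the limit through
  \<open>Te_norm\<close>.\<close>

proposition Te_limit:
 fixes w :: "'a::euclidean_space \<Rightarrow> real"
 assumes w: "sqint w" and s: "s > 0" and fin: "gag s w < \<infinity>"
 shows "\<exists>g. sqint g \<and> (\<lambda>k. \<integral>x. (Te s (1 / real (Suc k)) w x - g x)\<^sup>2) \<longlonglongrightarrow> 0
   \<and> ennreal (\<integral>x. (g x)\<^sup>2) = (\<integral>\<^sup>+p. Qf s w p \<partial>lborel2)"
proof -
 note [measurable] = sqint_measurable[OF w]
 let ?M = "lborel2 :: ('a \<times> 'a) measure"
 define q where "q = (\<integral>\<^sup>+p. Qf s w p \<partial>?M)"
 have "q \<le> ennreal (2 * kr_const TYPE('a) s) * gag s w" unfolding q_def by (rule Qf_le[OF w s])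
 also have "... < \<infinity>" using fin by (simp add: ennreal_mult_less_top)
 finally have q: "q < \<infinity>" .
 \<comment> \<open>A pair with nonzero first component eventually leaves the region of integration,
   and \<open>Qf\<close> vanishes on the remaining pairs; hence \<open>D\<close> tends to zero by
   domination.\<close>
 define D where "D k = (\<integral>\<^sup>+p. Qf s w p * indicator {p. norm (fst p) \<le> 1 / real (Suc k) \<and> norm (snd p) \<le> 1 / real (Suc k)} p \<partial>?M)" for k
 have D0: "D \<longlonglongrightarrow> (\<integral>\<^sup>+p. 0 \<partial>?M)"
  unfolding D_def
 proof (rule nn_integral_dominated_convergence[where w="Qf s w"])
  show "AE p in ?M. (\<lambda>k. Qf s w p * indicator {p. norm (fst p) \<le> 1 / real (Suc k) \<and> norm (snd p) \<le> 1 / real (Suc k)} p) \<longlonglongrightarrow> 0"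
  proof (rule AE_I2, goal_cases)
   case (1 p)
   show ?case
   proof (cases "fst p = 0")
    case False
    have "(\<lambda>k. 1 / real (Suc k)) \<longlonglongrightarrow> 0" by (rule LIMSEQ_Suc[OF lim_1_over_n])
    then have "eventually (\<lambda>k. 1 / real (Suc k) < norm (fst p)) sequentially"
     using False by (intro order_tendstoD) auto
    then have "eventually (\<lambda>k. Qf s w p * indicator {p. norm (fst p) \<le> 1 / real (Suc k) \<and> norm (snd p) \<le> 1 / real (Suc k)} p = 0) sequentially"
     by eventually_elim (auto simp: indicator_def)
    then show ?thesis by (rule tendsto_eventually)
   qed (simp add: Qf_0)
  qed
  show "(\<integral>\<^sup>+p. Qf s w p \<partial>?M) < \<infinity>" using q by (simp add: q_def)
 qed (auto simp: indicator_def)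
 have Dfin: "D k < \<infinity>" for k
 proof -
  have "D k \<le> q" unfolding D_def q_def by (intro nn_integral_mono) (auto simp: indicator_def)
  then show ?thesis using q by simp
 qed
 have D0': "(\<lambda>k. enn2real (D k)) \<longlonglongrightarrow> 0"
  using tendsto_enn2real[of D 0] D0 by simp
 define f where "f k = Te s (1 / real (Suc k)) w" for k
 have fs: "sqint (f k)" for k unfolding f_def using w s by (intro Te_sqint) auto
 have mono: "(\<integral>x. (f i x - f j x)\<^sup>2) \<le> enn2real (D k)" if "k \<le> j" "j \<le> i" for i j k
 proof -
  have "1 / real (Suc j) \<le> 1 / real (Suc k)" using that by (intro divide_left_mono) auto
  have "ennreal (\<integral>x. (f i x - f j x)\<^sup>2) \<le> D j"
   unfolding f_def D_def using that by (intro Te_diff w s) (auto intro!: divide_left_mono)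
  also have "... \<le> D k" unfolding D_def using \<open>1 / real (Suc j) \<le> 1 / real (Suc k)\<close>
   by (intro nn_integral_mono) (auto simp: indicator_def intro: order_trans)
  finally have "ennreal (\<integral>x. (f i x - f j x)\<^sup>2) \<le> ennreal (enn2real (D k))" using Dfin[of k] by simp
  then show ?thesis by (subst (asm) ennreal_le_iff) auto
 qed
 have est: "(\<integral>x. (f i x - f j x)\<^sup>2) \<le> enn2real (D k)" if "k \<le> i" "k \<le> j" for i j k
 proof (cases "j \<le> i")
  case True then show ?thesis using mono that by blast
 next
  case False 
  then have "(\<integral>x. (f j x - f i x)\<^sup>2) \<le> enn2real (D k)" using mono that by simp
  then show ?thesis by (simp add: power2_commute)
 qed
 obtain g where g: "sqint g" "(\<lambda>k. \<integral>x. (f k x - g x)\<^sup>2) \<longlonglongrightarrow> 0"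
  using Riesz_Fischer[where f=f and e="\<lambda>k. enn2real (D k)", OF fs est D0'] by blast
 have "(\<lambda>k. (\<integral>\<^sup>+p. Qf s w p * indicator {p. 1 / real (Suc k) < norm (fst p) \<and> 1 / real (Suc k) < norm (snd p)} p \<partial>?M)) \<longlonglongrightarrow> q"
  unfolding q_def
 proof (rule nn_integral_dominated_convergence[where w="Qf s w"])
  show "AE p in ?M. (\<lambda>k. Qf s w p * indicator {p. 1 / real (Suc k) < norm (fst p) \<and> 1 / real (Suc k) < norm (snd p)} p) \<longlonglongrightarrow> Qf s w p"
  proof (rule AE_I2, goal_cases)
   case (1 p)
   show ?case
   proof (cases "fst p = 0 \<or> snd p = 0")
    case False
    have l: "(\<lambda>k. 1 / real (Suc k)) \<longlonglongrightarrow> 0" by (rule LIMSEQ_Suc[OF lim_1_over_n])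
    have "eventually (\<lambda>k. 1 / real (Suc k) < norm (fst p)) sequentially" "eventually (\<lambda>k. 1 / real (Suc k) < norm (snd p)) sequentially"
     using False by (intro order_tendstoD[OF l]; auto)+
    then have "eventually (\<lambda>k. Qf s w p * indicator {p. 1 / real (Suc k) < norm (fst p) \<and> 1 / real (Suc k) < norm (snd p)} p = Qf s w p) sequentially"
     by eventually_elim (auto simp: indicator_def)
    then show ?thesis by (rule tendsto_eventually)
   qed (auto simp: Qf_0)
  qed
  show "(\<integral>\<^sup>+p. Qf s w p \<partial>?M) < \<infinity>" using q by (simp add: q_def)
 qed (auto simp: indicator_def)
 then have fq: "(\<lambda>k. ennreal (\<integral>x. (f k x)\<^sup>2)) \<longlonglongrightarrow> q"
  unfolding f_def using Te_norm[OF w s] by simp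
 have qlim: "(\<lambda>k. \<integral>x. (f k x)\<^sup>2) \<longlonglongrightarrow> enn2real q"
 proof -
  have "(\<lambda>k. enn2real (ennreal (\<integral>x. (f k x)\<^sup>2))) \<longlonglongrightarrow> enn2real q"
   using fq q by (intro tendsto_enn2real) simp_all
  then show ?thesis by simp
 qed
 have glim: "(\<lambda>k. \<integral>x. (f k x)\<^sup>2) \<longlonglongrightarrow> (\<integral>x. (g x)\<^sup>2)"
 proof -
  define G where "G = (\<integral>x. (g x)\<^sup>2)"
  define F where "F k = (\<integral>x. (f k x)\<^sup>2)" for k
  define d where "d k = (\<integral>x. (f k x - g x)\<^sup>2)" for k
  have d: "d \<longlonglongrightarrow> 0" using g by (simp add: d_def[abs_def])
  have d0: "0 \<le> d k" "0 \<le> G" for k by (simp_all add: d_def G_def)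
  \<comment> \<open>Weighted Young inequality. Choosing \<open>\<theta>\<close> first and then
    \<open>k\<close> large gives convergence of the squared norms.\<close>
  have key: "\<bar>F k - G\<bar> \<le> \<theta> * G + (1 + 1 / \<theta>) * d k" if th: "\<theta> > 0" for \<theta> k
  proof -
   have i: "integrable lborel (\<lambda>x. (f k x)\<^sup>2)" "integrable lborel (\<lambda>x. (g x)\<^sup>2)" "integrable lborel (\<lambda>x. (f k x - g x)\<^sup>2)"
    using fs g by (auto intro!: sqint_integrable sqint_diff)
   have "F k - G = (\<integral>x. (f k x)\<^sup>2 - (g x)\<^sup>2)" using i by (simp add: F_def G_def)
   also have "\<bar>...\<bar> \<le> (\<integral>x. \<bar>(f k x)\<^sup>2 - (g x)\<^sup>2\<bar>)" by (rule integral_abs_bound)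
   also have "... \<le> (\<integral>x. \<theta> * (g x)\<^sup>2 + (1 + 1 / \<theta>) * (f k x - g x)\<^sup>2)"
   proof (rule integral_mono)
    fix x
    have "0 \<le> (1/\<theta>) * (\<theta> * \<bar>g x\<bar> - \<bar>f k x - g x\<bar>)\<^sup>2" using th by simp
    also have "... = \<theta> * (g x)\<^sup>2 + (1/\<theta>) * (f k x - g x)\<^sup>2 - 2 * (\<bar>g x\<bar> * \<bar>f k x - g x\<bar>)"
     using th by (simp add: power2_diff power_mult_distrib field_simps) (simp add: power2_eq_square)
    finally have 1: "2 * (\<bar>g x\<bar> * \<bar>f k x - g x\<bar>) \<le> \<theta> * (g x)\<^sup>2 + (1/\<theta>) * (f k x - g x)\<^sup>2" by simp
    have "(f k x)\<^sup>2 - (g x)\<^sup>2 = (f k x - g x)\<^sup>2 + 2 * (g x * (f k x - g x))" by (simp add: power2_eq_square algebra_simps)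
    then have "\<bar>(f k x)\<^sup>2 - (g x)\<^sup>2\<bar> \<le> \<bar>(f k x - g x)\<^sup>2\<bar> + \<bar>2 * (g x * (f k x - g x))\<bar>" by (simp only: abs_triangle_ineq)
    also have "... = (f k x - g x)\<^sup>2 + 2 * (\<bar>g x\<bar> * \<bar>f k x - g x\<bar>)" by (simp add: abs_mult)
    finally show "\<bar>(f k x)\<^sup>2 - (g x)\<^sup>2\<bar> \<le> \<theta> * (g x)\<^sup>2 + (1 + 1 / \<theta>) * (f k x - g x)\<^sup>2"
     using 1 by (simp add: algebra_simps)
   qed (use i in auto)
   also have "... = \<theta> * G + (1 + 1 / \<theta>) * d k" using i by (simp add: G_def d_def)
   finally show ?thesis .
  qed
  have "F \<longlonglongrightarrow> G"
  proof (rule LIMSEQ_I)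
   fix r :: real assume r: "0 < r"
   define \<theta> where "\<theta> = r / (2 * (G + 1))"
   have th: "\<theta> > 0" "\<theta> * G \<le> r / 2" using r d0 by (auto simp: \<theta>_def field_simps)
   have "(\<lambda>k. (1 + 1 / \<theta>) * d k) \<longlonglongrightarrow> (1 + 1 / \<theta>) * 0" by (intro tendsto_intros d)
   then have "eventually (\<lambda>k. (1 + 1 / \<theta>) * d k < r / 2) sequentially" using r by (intro order_tendstoD) auto
   then obtain N where N: "\<And>k. k \<ge> N \<Longrightarrow> (1 + 1 / \<theta>) * d k < r / 2"
    unfolding eventually_sequentially by blast
   show "\<exists>no. \<forall>k\<ge>no. norm (F k - G) < r"
   proof (intro exI allI impI)
    fix k assume "N \<le> k"
    from N[OF this] key[OF th(1), of k] th(2) show "norm (F k - G) < r"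
     unfolding real_norm_def by linarith
   qed
  qed
  then show ?thesis by (simp add: F_def[abs_def] G_def)
 qed
 have "(\<integral>x. (g x)\<^sup>2) = enn2real q" by (rule LIMSEQ_unique[OF glim qlim])
 then have "ennreal (\<integral>x. (g x)\<^sup>2) = q" using q by simp
 then show ?thesis using g by (auto simp: f_def q_def)
qed

subsection \<open>Gaussian mixtures and the value of the quadratic form\<close>

text \<open>Mixing density of the Gaussian representation; with exponent \<open>a/2\<close> it
  reproduces \<open>kr a\<close> in \<open>gauss_mixture\<close>.\<close>

definition kap :: "real \<Rightarrow> real \<Rightarrow> real" where
 "kap b t = (if 0 < t then t powr (- 1 - b) else 0)"

text \<open>The heat kernel at time \<open>t / 4\<close> up to the factor
  \<open>pi powr (n / 2)\<close>. The normalisation is left out, so the total mass is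
  \<open>gau_const\<close> for every \<open>t > 0\<close>.\<close>

definition gau :: "real \<Rightarrow> 'a::euclidean_space \<Rightarrow> real" where
 "gau t z = t powr - (real DIM('a) / 2) * exp (- ((norm z)\<^sup>2 / t))"

lemma kap_measurable [measurable]: "kap b \<in> borel_measurable borel"
 unfolding kap_def by measurable

lemma gau_measurable [measurable]: "(\<lambda>p. gau (fst p) (snd p)) \<in> borel_measurable (borel \<Otimes>\<^sub>M borel)"
 unfolding gau_def by measurable

lemma gau_measurable1 [measurable]: "gau t \<in> borel_measurable borel"
 unfolding gau_def by measurable

lemma gau_measurable' [measurable (raw)]:
 assumes [measurable]: "f \<in> borel_measurable M" "g \<in> borel_measurable M"
 shows "(\<lambda>x. gau (f x) (g x)) \<in> borel_measurable M"
 unfolding gau_def by measurable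

lemma kap_nonneg [simp]: "0 \<le> kap b t" by (simp add: kap_def)
lemma gau_nonneg [simp]: "0 \<le> gau t z" by (simp add: gau_def)
lemma gau_minus [simp]: "gau t (- z) = gau t z" by (simp add: gau_def)

lemma exp_minus_le_powr:
 fixes t :: real assumes t: "0 < t" and m: "0 < m"
 shows "exp (- t) \<le> (m / t) powr m"
proof -
 have "1 + t / m \<le> exp (t / m)" by (rule exp_ge_add_one_self)
 then have "t / m \<le> exp (t / m)" by linarith
 then have "(t / m) powr m \<le> exp (t / m) powr m" using t m by (intro powr_mono2) auto
 also have "... = exp t" using m by (simp add: powr_def)
 finally have "(t / m) powr m \<le> exp t" .
 then have "inverse (exp t) \<le> inverse ((t / m) powr m)" using t m by (intro le_imp_inverse_le) auto
 then show ?thesis using t m by (simp add: exp_minus powr_divide)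
qed

lemma nn_integral_positive_finite:
 assumes f: "f \<in> borel_measurable M" and fin: "(\<integral>\<^sup>+x. ennreal (f x) \<partial>M) < \<infinity>"
  and A: "A \<in> sets M" "emeasure M A \<noteq> 0" "\<And>x. x \<in> A \<Longrightarrow> 0 < f x"
 obtains J where "0 < J" "(\<integral>\<^sup>+x. ennreal (f x) \<partial>M) = ennreal J"
proof -
 have "(\<integral>\<^sup>+x. ennreal (f x) \<partial>M) \<noteq> 0"
 proof
  assume "(\<integral>\<^sup>+x. ennreal (f x) \<partial>M) = 0"
  then have "AE x in M. ennreal (f x) = 0" using f by (subst (asm) nn_integral_0_iff_AE) auto
  then have "AE x in M. x \<notin> A" by eventually_elim (use A(3) in \<open>force simp: ennreal_eq_0_iff\<close>)
  then have "A \<in> null_sets M" using A(1) by (simp add: AE_iff_null_sets)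
  then show False using A(2) by auto
 qed
 with fin show ?thesis using that[of "enn2real (\<integral>\<^sup>+x. ennreal (f x) \<partial>M)"] by (auto simp: enn2real_positive_iff less_top zero_less_iff_neq_zero)
qed

text \<open>Inverting \<open>t\<close> shows that the value is \<open>Gamma b\<close>, but only
  positivity and finiteness matter. Near zero the exponential beats the power by
  \<open>exp_minus_le_powr\<close>, and for \<open>t \<ge> 1\<close> the integrand is at most
  \<open>kr b\<close>.\<close>

lemma kap_exp_integral:
 assumes b: "b > 0"
 obtains J where "0 < J" "(\<integral>\<^sup>+t. ennreal (kap b t * exp (- (1 / t)))) = ennreal J"
proof -
 let ?I = "\<integral>\<^sup>+t. ennreal (kap b t * exp (- (1 / t)))"
 let ?C = "(1 + b) powr (1 + b)"
 have "?I \<le> (\<integral>\<^sup>+(t::real). ennreal ?C * indicator {0..1} t + ennreal (kr b t) * indicator {t. 1 \<le> norm t} t)"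
 proof (rule nn_integral_mono)
  fix t :: real
  consider "t \<le> 0" | "0 < t" "t < 1" | "1 \<le> t" by linarith
  then show "ennreal (kap b t * exp (- (1 / t))) \<le> ennreal ?C * indicator {0..1} t + ennreal (kr b t) * indicator {t. 1 \<le> norm t} t"
  proof cases
   case 1 then show ?thesis by (simp add: kap_def)
  next
   case 2
   have "exp (- (1 / t)) \<le> ((1 + b) / (1 / t)) powr (1 + b)" using 2 b by (intro exp_minus_le_powr) auto
   also have "... = ?C * t powr (1 + b)" using 2 b by (simp add: powr_mult)
   finally have "kap b t * exp (- (1 / t)) \<le> kap b t * (?C * t powr (1 + b))" by (intro mult_left_mono) auto
   also have "... = ?C * (t powr (- 1 - b) * t powr (1 + b))" using 2 by (simp add: kap_def)
   also have "t powr (- 1 - b) * t powr (1 + b) = 1" using 2 by (simp add: powr_add[symmetric])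
   finally show ?thesis using 2 by (simp add: ennreal_leI)
  next
   case 3
   have kk: "kap b t = kr b t" using 3 powr_minus_divide[of t "1 + b"] by (simp add: kap_def kr_def)
   have "kap b t * exp (- (1 / t)) \<le> kap b t * 1" using 3 by (intro mult_left_mono) auto
   then have "kap b t * exp (- (1 / t)) \<le> kr b t" by (simp add: kk)
   then show ?thesis using 3 by (auto simp: ennreal_leI indicator_def intro: add_increasing)
  qed
 qed
 also have "... = (\<integral>\<^sup>+t. ennreal ?C * indicator {0..1::real} t) + (\<integral>\<^sup>+t\<in>{t. 1 \<le> norm t}. kr b (t::real) \<partial>lborel)"
  by (rule nn_integral_add) measurable
 also have "... < \<infinity>"
  using order_le_less_trans[OF kr_tail[of 1 b, where 'a=real] ennreal_less_top] b
  by (simp add: nn_integral_cmult_indicator ennreal_mult_less_top)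
 finally have fin: "?I < \<infinity>" .
 show ?thesis
  by (rule nn_integral_positive_finite[OF _ fin, of "{1..2}"]) (auto simp: kap_def intro!: that mult_pos_pos)
qed

lemma gauss_mixture:
 assumes a: "a > 0"
 obtains c where "0 < c" "\<And>z::'a::euclidean_space. z \<noteq> 0 \<Longrightarrow> (\<integral>\<^sup>+t. ennreal (kap (a/2) t * gau t z)) = ennreal (c * kr a z)"
proof -
 \<comment> \<open>The exponent after the power of \<open>t\<close> in the Gaussian is merged with
   \<open>kap (a/2)\<close>; rescaling \<open>t\<close> by \<open>(norm z)\<^sup>2\<close> then
   extracts the power of \<open>norm z\<close>.\<close>
 define b where "b = (real DIM('a) + a) / 2"
 have b: "b > 0" using a by (simp add: b_def add_pos_pos)
 obtain J where J: "0 < J" "(\<integral>\<^sup>+t. ennreal (kap b t * exp (- (1 / t)))) = ennreal J"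
  by (rule kap_exp_integral[OF b])
 have "(\<integral>\<^sup>+t. ennreal (kap (a/2) t * gau t z)) = ennreal (J * kr a z)" if z: "z \<noteq> 0" for z :: 'a
 proof -
  let ?r = "(norm z)\<^sup>2"
  have r: "?r > 0" using z by simp
  have "kap (a/2) t * gau t z = kap b t * exp (- (?r / t))" for t
   by (auto simp: kap_def gau_def b_def powr_add[symmetric] add_divide_distrib algebra_simps)
  then have "(\<integral>\<^sup>+t. ennreal (kap (a/2) t * gau t z)) = (\<integral>\<^sup>+t. ennreal (kap b t * exp (- (?r / t))))" by simp
  also have "... = \<bar>?r\<bar> * (\<integral>\<^sup>+t. ennreal (kap b (0 + ?r * t) * exp (- (?r / (0 + ?r * t)))))"
   by (rule nn_integral_real_affine) (use r in auto)
  also have "(\<integral>\<^sup>+t. ennreal (kap b (0 + ?r * t) * exp (- (?r / (0 + ?r * t)))))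
    = (\<integral>\<^sup>+t. ennreal (?r powr (- 1 - b)) * ennreal (kap b t * exp (- (1 / t))))"
  proof (intro nn_integral_cong, goal_cases)
   case (1 t)
   have "kap b (?r * t) = ?r powr (- 1 - b) * kap b t"
    using r z by (auto simp: kap_def powr_mult zero_less_mult_iff)
   moreover have "?r / (?r * t) = 1 / t" using r by simp
   ultimately show ?case
    by (simp add: ennreal_mult[symmetric] mult.assoc)
  qed
  also have "... = ennreal (?r powr (- 1 - b)) * ennreal J" by (subst nn_integral_cmult) (auto simp: J)
  also have "\<bar>?r\<bar> * (ennreal (?r powr (- 1 - b)) * ennreal J) = ennreal (J * (?r * ?r powr (- 1 - b)))"
   using r J by (simp add: ennreal_mult[symmetric] mult_ac)
  also have "?r * ?r powr (- 1 - b) = ?r powr (1 + (- 1 - b))" using r by (subst powr_add) simp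
  also have "... = kr a z"
  proof -
   have "?r = norm z powr 2" using z by simp
   moreover have "2 * (1 + (- 1 - b)) = - (real DIM('a) + a)" by (simp add: b_def field_simps)
   ultimately have "?r powr (1 + (- 1 - b)) = norm z powr - (real DIM('a) + a)" by (simp only: powr_powr)
   then show ?thesis by (simp only: kr_def powr_minus_divide)
  qed
  finally show ?thesis .
 qed
 with J that show ?thesis by blast
qed

definition gau_const :: "'a::euclidean_space itself \<Rightarrow> real" where
 "gau_const _ = enn2real (\<integral>\<^sup>+x. ennreal (exp (- (norm (x::'a))\<^sup>2)))"

lemma gau_const:
 "(\<integral>\<^sup>+x. ennreal (exp (- (norm (x::'a::euclidean_space))\<^sup>2))) = ennreal (gau_const TYPE('a))" "0 < gau_const TYPE('a)"
proof -
 let ?I = "\<integral>\<^sup>+x. ennreal (exp (- (norm (x::'a))\<^sup>2))"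
 define m where "m = (real DIM('a) + 1) / 2"
 have m: "m > 0" by (simp add: m_def add_pos_pos)
 have "?I \<le> (\<integral>\<^sup>+x. indicator (ball 0 1) x + ennreal (m powr m) * (ennreal (kr 1 (x::'a)) * indicator {x. 1 \<le> norm x} x))"
 proof (rule nn_integral_mono)
  fix x :: 'a
  show "ennreal (exp (- (norm x)\<^sup>2)) \<le> indicator (ball 0 1) x + ennreal (m powr m) * (ennreal (kr 1 x) * indicator {x. 1 \<le> norm x} x)"
  proof (cases "norm x < 1")
   case True then show ?thesis by (simp add: indicator_def)
  next
   case False
   have "exp (- (norm x)\<^sup>2) \<le> (m / (norm x)\<^sup>2) powr m" using False m by (intro exp_minus_le_powr) auto
   also have "... = m powr m / ((norm x)\<^sup>2) powr m" using m by (simp add: powr_divide)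
   also have "((norm x)\<^sup>2) powr m = norm x powr (real DIM('a) + 1)"
   proof -
    have "(norm x)\<^sup>2 = norm x powr 2" using False by (subst powr_numeral) auto
    moreover have "2 * m = real DIM('a) + 1" by (simp add: m_def)
    ultimately show ?thesis by (simp only: powr_powr)
   qed
   finally have "exp (- (norm x)\<^sup>2) \<le> m powr m * kr 1 x" by (simp add: kr_def)
   then show ?thesis using False by (simp add: ennreal_mult[symmetric] ennreal_leI indicator_def)
  qed
 qed
 also have "... = emeasure lborel (ball (0::'a) 1) + ennreal (m powr m) * (\<integral>\<^sup>+x\<in>{x. 1 \<le> norm x}. kr 1 (x::'a) \<partial>lborel)"
  by (subst nn_integral_add) (auto simp: nn_integral_cmult intro!: borel_measurable_indicator)
 also have "... < \<infinity>"
  using emeasure_lborel_ball_finite[of "0::'a" 1] order_le_less_trans[OF kr_tail[of 1 1, where 'a='a] ennreal_less_top]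
  by (simp add: ennreal_mult_less_top)
 finally have fin: "?I < \<infinity>" .
 obtain J where "0 < J" "?I = ennreal J"
  by (rule nn_integral_positive_finite[OF _ fin, of UNIV]) (auto simp: emeasure_lborel_UNIV)
 then show "?I = ennreal (gau_const TYPE('a))" "0 < gau_const TYPE('a)" by (auto simp: gau_const_def)
qed

lemma gau_conv:
 fixes v :: "'a::euclidean_space"
 assumes t: "0 < t" and r: "0 < r"
 shows "(\<integral>\<^sup>+y. ennreal (gau t y * gau r (v - y))) = ennreal (gau_const TYPE('a) * gau (t + r) v)"
proof -
 \<comment> \<open>Completing the square: with \<open>y = t0 + c *\<^sub>R x\<close> the exponent
   \<open>|y|^2 / t + |v - y|^2 / r\<close> becomes \<open>|v|^2 / (t + r) + |x|^2\<close>.\<close>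
 define c where "c = sqrt (t * r / (t + r))"
 have c: "c > 0" "c\<^sup>2 = t * r / (t + r)" using t r by (auto simp: c_def)
 define t0 where "t0 = (t / (t + r)) *\<^sub>R v"
 let ?f = "\<lambda>y. ennreal (gau t y * gau r (v - y))"
 have ff: "?f (t0 + c *\<^sub>R x) = ennreal (t powr - (real DIM('a) / 2) * r powr - (real DIM('a) / 2) * exp (- ((norm v)\<^sup>2 / (t + r)))) * ennreal (exp (- (norm x)\<^sup>2))" for x :: 'a
 proof -
  have tr: "t + r \<noteq> 0" "t \<noteq> 0" "r \<noteq> 0" using t r by auto
  have e1: "v - (t0 + c *\<^sub>R x) = (r / (t + r)) *\<^sub>R v - c *\<^sub>R x"
  proof -
   have "v = (t / (t + r) + r / (t + r)) *\<^sub>R v" using tr by (simp add: add_divide_distrib[symmetric])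
   then have "v = (t / (t + r)) *\<^sub>R v + (r / (t + r)) *\<^sub>R v" by (simp only: scaleR_left_distrib)
   then have "v - t0 = (r / (t + r)) *\<^sub>R v" unfolding t0_def by (metis add_diff_cancel_left')
   then show ?thesis by (simp add: diff_diff_add[symmetric])
  qed
  have n2: "(norm (v - (t0 + c *\<^sub>R x)))\<^sup>2 = (r / (t + r))\<^sup>2 * (v \<bullet> v) - 2 * (r / (t + r)) * c * (v \<bullet> x) + c\<^sup>2 * (x \<bullet> x)"
   unfolding e1 power2_norm_eq_inner by (simp add: inner_diff inner_commute power2_eq_square algebra_simps)
  have n1: "(norm (t0 + c *\<^sub>R x))\<^sup>2 = (t / (t + r))\<^sup>2 * (v \<bullet> v) + 2 * (t / (t + r)) * c * (v \<bullet> x) + c\<^sup>2 * (x \<bullet> x)"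
   unfolding power2_norm_eq_inner t0_def by (simp add: inner_add inner_commute power2_eq_square algebra_simps)
  have "(norm (t0 + c *\<^sub>R x))\<^sup>2 / t + (norm (v - (t0 + c *\<^sub>R x)))\<^sup>2 / r
    = (t / (t + r)\<^sup>2 + r / (t + r)\<^sup>2) * (v \<bullet> v) + (c\<^sup>2 / t + c\<^sup>2 / r) * (x \<bullet> x)"
  proof -
   have "((t / D)\<^sup>2 * V + 2 * (t / D) * c * X + c\<^sup>2 * Y) / t = t / D\<^sup>2 * V + 2 / D * c * X + c\<^sup>2 / t * Y" for D V X Y :: real
    using tr by (simp add: add_divide_distrib power_divide power2_eq_square)
   moreover have "((r / D)\<^sup>2 * V - 2 * (r / D) * c * X + c\<^sup>2 * Y) / r = r / D\<^sup>2 * V - 2 / D * c * X + c\<^sup>2 / r * Y" for D V X Y :: real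
    using tr by (simp add: add_divide_distrib diff_divide_distrib power_divide power2_eq_square)
   ultimately show ?thesis unfolding n1 n2 by (simp add: distrib_right)
  qed
  also have "t / (t + r)\<^sup>2 + r / (t + r)\<^sup>2 = 1 / (t + r)"
   using tr by (simp add: add_divide_distrib[symmetric] power2_eq_square)
  also have "c\<^sup>2 / t + c\<^sup>2 / r = 1"
  proof -
   have "c\<^sup>2 / t = r / (t + r)" "c\<^sup>2 / r = t / (t + r)" unfolding c(2) using tr by simp_all
   then have "c\<^sup>2 / t + c\<^sup>2 / r = (r + t) / (t + r)" by (simp add: add_divide_distrib)
   then show ?thesis using tr by (simp add: add.commute)
  qed
  finally have e: "(norm (t0 + c *\<^sub>R x))\<^sup>2 / t + (norm (v - (t0 + c *\<^sub>R x)))\<^sup>2 / r = (norm v)\<^sup>2 / (t + r) + (norm x)\<^sup>2"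
   by (simp add: power2_norm_eq_inner)
  have "gau t (t0 + c *\<^sub>R x) * gau r (v - (t0 + c *\<^sub>R x)) = t powr - (real DIM('a) / 2) * r powr - (real DIM('a) / 2) * exp (- ((norm (t0 + c *\<^sub>R x))\<^sup>2 / t + (norm (v - (t0 + c *\<^sub>R x)))\<^sup>2 / r))"
   by (simp add: gau_def exp_add[symmetric])
  also have "... = t powr - (real DIM('a) / 2) * r powr - (real DIM('a) / 2) * exp (- ((norm v)\<^sup>2 / (t + r))) * exp (- (norm x)\<^sup>2)"
   unfolding e by (simp add: exp_add[symmetric])
  finally show ?thesis by (simp add: ennreal_mult)
 qed
 have "(\<integral>\<^sup>+x. ?f (t0 + c *\<^sub>R x)) = ennreal (1 / \<bar>c\<bar> ^ DIM('a)) * (\<integral>\<^sup>+y. ?f y)"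
  by (rule nn_integral_lborel_affine) (use c in auto)
 then have "ennreal (c ^ DIM('a)) * (\<integral>\<^sup>+x. ?f (t0 + c *\<^sub>R x)) = (ennreal (c ^ DIM('a)) * ennreal (1 / c ^ DIM('a))) * (\<integral>\<^sup>+y. ?f y)"
  using c by (simp add: mult.assoc)
 also have "ennreal (c ^ DIM('a)) * ennreal (1 / c ^ DIM('a)) = 1" using c by (simp flip: ennreal_mult)
 finally have "(\<integral>\<^sup>+y. ?f y) = ennreal (c ^ DIM('a)) * (\<integral>\<^sup>+x. ?f (t0 + c *\<^sub>R x))" by simp
 also have "... = ennreal (c ^ DIM('a)) * (ennreal (t powr - (real DIM('a) / 2) * r powr - (real DIM('a) / 2) * exp (- ((norm v)\<^sup>2 / (t + r)))) * ennreal (gau_const TYPE('a)))"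
  unfolding ff by (subst nn_integral_cmult) (auto simp: gau_const)
 also have "... = ennreal (gau_const TYPE('a) * ((c ^ DIM('a) * t powr - (real DIM('a) / 2) * r powr - (real DIM('a) / 2)) * exp (- ((norm v)\<^sup>2 / (t + r)))))"
  using c gau_const(2)[where 'a='a] by (simp add: ennreal_mult[symmetric] mult_ac)
 also have "c ^ DIM('a) * t powr - (real DIM('a) / 2) * r powr - (real DIM('a) / 2) = (t + r) powr - (real DIM('a) / 2)"
 proof -
  have "c ^ DIM('a) = (c\<^sup>2) powr (real DIM('a) / 2)"
  proof -
   have "c\<^sup>2 = c powr 2" using c(1) by simp
   then have "(c\<^sup>2) powr (real DIM('a) / 2) = c powr real DIM('a)" by (simp only: powr_powr) simp
   then show ?thesis using c(1) by (simp add: powr_realpow)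
  qed
  also have "... = t powr (real DIM('a) / 2) * r powr (real DIM('a) / 2) / (t + r) powr (real DIM('a) / 2)"
   unfolding c(2) using t r by (simp add: powr_divide powr_mult)
  finally have "c ^ DIM('a) = t powr (real DIM('a) / 2) * r powr (real DIM('a) / 2) / (t + r) powr (real DIM('a) / 2)" .
  moreover have "T * R / S * (1 / T) * (1 / R) = 1 / S" if "T \<noteq> 0" "R \<noteq> 0" for T R S :: real using that by simp
  ultimately show ?thesis using t r by (simp only: powr_minus_divide) simp
 qed
 finally show ?thesis by (simp add: gau_def)
qed

lemma gau_integral:
 assumes t: "0 < t"
 shows "(\<integral>\<^sup>+y. ennreal (gau t (y::'a::euclidean_space))) = ennreal (gau_const TYPE('a))"
proof -
 have st: "sqrt t > 0" using t by simp
 let ?f = "\<lambda>y::'a. ennreal (gau t y)"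
 have ff: "?f (sqrt t *\<^sub>R x) = ennreal (t powr - (real DIM('a) / 2)) * ennreal (exp (- (norm x)\<^sup>2))" for x
  using t by (simp add: gau_def ennreal_mult power_mult_distrib)
 have "(\<integral>\<^sup>+x. ?f (sqrt t *\<^sub>R x)) = ennreal (1 / sqrt t ^ DIM('a)) * (\<integral>\<^sup>+y. ?f y)"
  by (rule nn_integral_lborel_scale) (use st in auto)
 also have "1 / sqrt t ^ DIM('a) = t powr - (real DIM('a) / 2)"
 proof -
  have "sqrt t ^ DIM('a) = sqrt t powr real DIM('a)" using st by (simp add: powr_realpow)
  also have "... = t powr (1 / 2 * real DIM('a))" using t by (simp only: powr_half_sqrt[symmetric] powr_powr)
  finally show ?thesis by (simp add: powr_minus_divide)
 qed
 finally have "ennreal (t powr - (real DIM('a) / 2)) * ennreal (gau_const TYPE('a)) = ennreal (t powr - (real DIM('a) / 2)) * (\<integral>\<^sup>+y. ?f y)"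
  unfolding ff by (subst (asm) nn_integral_cmult) (auto simp: gau_const)
 moreover have "ennreal (t powr - (real DIM('a) / 2)) \<noteq> 0" using t by (simp add: ennreal_eq_0_iff)
 ultimately show ?thesis by (subst (asm) ennreal_mult_cancel_left) auto
qed

section \<open>Separation of scale and ratio in the double time integral\<close>

lemma kap_scale: "c > 0 \<Longrightarrow> kap b (c * t) = c powr (- 1 - b) * kap b t"
 by (auto simp: kap_def powr_mult zero_less_mult_iff)

lemma ennreal_diff_eqI:
 fixes X :: ennreal
 assumes "X + ennreal a = ennreal b" "0 \<le> a" "0 \<le> b"
 shows "X = ennreal (b - a)"
proof -
 have "X = (X + ennreal a) - ennreal a" by simp
 also have "... = ennreal (b - a)" unfolding assms(1) using assms by (simp add: ennreal_minus)
 finally show ?thesis .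
qed

text \<open>The part of the double time integral that depends on the ratio of the times. The bracket
  is the defect of strict subadditivity of the power \<open>s\<close>, which is what makes the final
  constant positive.\<close>

definition subadd_const :: "real \<Rightarrow> ennreal" where
 "subadd_const s = (\<integral>\<^sup>+th. ennreal (kap (s/2) th * kap (s/2) (1 - th) * (th powr s + (1 - th) powr s - 1)))"

lemma powr_subadd:
 fixes th :: real assumes "0 < th" "th < 1" "0 < s" "s < 1"
 shows "1 < th powr s + (1 - th) powr s" "(1 - th) powr s \<le> 1"
proof -
 have "th powr 1 < th powr s" using assms by (intro powr_less_mono') auto
 moreover have "(1 - th) powr 1 < (1 - th) powr s" using assms by (intro powr_less_mono') auto
 ultimately show "1 < th powr s + (1 - th) powr s" using assms by simp
 show "(1 - th) powr s \<le> 1" using assms by (intro powr_le1) auto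
qed

text \<open>Near \<open>th = 0\<close> the bracket is at most \<open>th powr s\<close>, which
  improves the exponent \<open>- 1 - s/2\<close> of \<open>kap\<close> to the integrable
  \<open>- 1 + s/2\<close>; near \<open>th = 1\<close> the symmetry of the integrand
  applies.\<close>

lemma subadd_const:
 assumes s: "0 < s" "s < 1"
 obtains J where "0 < J" "subadd_const s = ennreal J"
proof -
 let ?f = "\<lambda>th. kap (s/2) th * kap (s/2) (1 - th) * (th powr s + (1 - th) powr s - 1)"
 let ?C = "(1/2) powr (- 1 - s/2)"
 let ?h = "\<lambda>th::real. ennreal ?C * (ennreal (kr (- (s/2)) th) * indicator {th. norm th < 1} th)"
 have half: "?f th \<le> ?C * kr (- (s/2)) th" if "0 < th" "th \<le> 1/2" for th
 proof -
  have "?f th \<le> kap (s/2) th * kap (s/2) (1 - th) * th powr s"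
   using powr_subadd(2)[of th s] that s by (intro mult_left_mono) auto
  also have "... = (th powr (- 1 - s/2) * th powr s) * (1 - th) powr (- 1 - s/2)" using that by (simp add: kap_def)
  also have "... \<le> (th powr (- 1 - s/2) * th powr s) * ?C"
   using that s by (intro mult_left_mono powr_mono2') auto
  also have "th powr (- 1 - s/2) * th powr s = th powr - (1 - s/2)" by (simp add: powr_add[symmetric] algebra_simps)
  also have "... = kr (- (s/2)) th" using that by (simp only: kr_def powr_minus_divide) simp
  finally show ?thesis by (simp add: mult.commute)
 qed
 have "subadd_const s \<le> (\<integral>\<^sup>+th. ?h th + ?h (1 - th))"
  unfolding subadd_const_def
 proof (rule nn_integral_mono)
  fix th :: real
  consider "th \<le> 0 \<or> 1 \<le> th" | "0 < th" "th \<le> 1/2" | "1/2 < th" "th < 1" by linarith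
  then show "ennreal (?f th) \<le> ?h th + ?h (1 - th)"
  proof cases
   case 1 then show ?thesis by (auto simp: kap_def)
  next
   case 2
   have "ennreal (?f th) \<le> ?h th" using half[OF 2] 2 by (simp add: ennreal_mult[symmetric] ennreal_leI)
   then show ?thesis by (rule add_increasing2[rotated]) simp
  next
   case 3
   have "?f th = ?f (1 - th)" by (simp add: algebra_simps)
   then have "?f th \<le> ?C * kr (- (s/2)) (1 - th)" using half[of "1 - th"] 3 by linarith
   then have "ennreal (?f th) \<le> ?h (1 - th)" using 3 by (simp add: ennreal_mult[symmetric] ennreal_leI)
   then show ?thesis by (rule add_increasing[rotated]) simp
  qed
 qed
 also have "... = (\<integral>\<^sup>+th. ?h th) + (\<integral>\<^sup>+th. ?h (1 - th))"
  by (rule nn_integral_add) measurable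
 also have "(\<integral>\<^sup>+th. ?h (1 - th)) = (\<integral>\<^sup>+th. ?h th)"
  by (rule nn_integral_lborel_reflect[where f="?h"]) measurable
 also have "(\<integral>\<^sup>+th. ?h th) = ennreal ?C * (\<integral>\<^sup>+th\<in>{th. norm th < 1}. kr (- (s/2)) (th::real) \<partial>lborel)"
  by (rule nn_integral_cmult) measurable
 also have "ennreal ?C * (\<integral>\<^sup>+th\<in>{th. norm th < 1}. kr (- (s/2)) (th::real) \<partial>lborel) + ennreal ?C * (\<integral>\<^sup>+th\<in>{th. norm th < 1}. kr (- (s/2)) (th::real) \<partial>lborel) < \<infinity>"
  using order_le_less_trans[OF kr_core[of 1 "s/2", where 'a=real] ennreal_less_top] s
  by (simp add: ennreal_mult_less_top)
 finally have fin: "subadd_const s < \<infinity>" .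
 show ?thesis
  by (rule nn_integral_positive_finite[OF _ fin[unfolded subadd_const_def], of "{0<..<1}"])
   (use powr_subadd(1) s in \<open>auto simp: subadd_const_def kap_def intro!: that mult_pos_pos\<close>)
qed

text \<open>The substitution \<open>t = R th\<close>, \<open>r = R (1 - th)\<close> turns the double integral into a product,
 because the inner integral of each of the three terms is a multiple of the same integral.\<close>

lemma subadd_integral:
 fixes M :: "real \<Rightarrow> real" and E :: "real \<Rightarrow> real \<Rightarrow> ennreal"
 assumes s: "0 < s" "s < 1" and [measurable]: "M \<in> borel_measurable borel" "case_prod E \<in> borel_measurable (borel \<Otimes>\<^sub>M borel)"
  and M0: "\<And>t. 0 \<le> M t"
  and E: "\<And>t r. 0 < t \<Longrightarrow> 0 < r \<Longrightarrow> E t r + ennreal (M (t + r)) = ennreal (M t + M r)"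
  and I: "(\<integral>\<^sup>+R. ennreal (M R * kap s R)) = ennreal I" "0 \<le> I"
 shows "(\<integral>\<^sup>+t. (\<integral>\<^sup>+r. E t r * ennreal (kap (s/2) t * kap (s/2) r))) = subadd_const s * ennreal I"
proof -
 let ?e = "\<lambda>R th. E (R * th) (R * (1 - th)) * ennreal (kap (s/2) th * kap (s/2) (1 - th))"
 have sw: "A * (X * B) = C * (X * D)" if "A * B = C * D" for A B C D X :: ennreal
  using that by (metis mult.left_commute)
 let ?g = "\<lambda>t r. E t r * ennreal (kap (s/2) t * kap (s/2) r)"
 have mE [measurable]: "(\<lambda>p. E (f p) (h p)) \<in> borel_measurable (borel \<Otimes>\<^sub>M borel)" if [measurable]: "f \<in> borel_measurable (borel \<Otimes>\<^sub>M borel)" "h \<in> borel_measurable (borel \<Otimes>\<^sub>M borel)" for f h :: "real \<times> real \<Rightarrow> real"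
  using measurable_compose[of "\<lambda>x. (f x, h x)" "borel \<Otimes>\<^sub>M borel" "borel \<Otimes>\<^sub>M borel" "case_prod E"] by simp
 have "(\<integral>\<^sup>+t. (\<integral>\<^sup>+r. ?g t r)) = (\<integral>\<^sup>+t. (\<integral>\<^sup>+R. ?g t (R - t)))"
 proof (rule nn_integral_cong, goal_cases)
  case (1 t)
  have "(\<lambda>r. ?g t r) \<in> borel_measurable borel"
   using measurable_compose[of "\<lambda>r. (t, r)" borel "borel \<Otimes>\<^sub>M borel" "case_prod E"] by simp
  from nn_integral_lborel_shift[OF this, of "- t"]
  show ?case by (simp add: algebra_simps)
 qed
 also have "... = (\<integral>\<^sup>+R. (\<integral>\<^sup>+t. ?g t (R - t)))"
  by (rule lborel_pair.Fubini') (unfold split_beta', measurable)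
 also have "... = (\<integral>\<^sup>+R. (\<integral>\<^sup>+th. ennreal (kap s R) * ?e R th))"
 proof (rule nn_integral_cong)
  fix R :: real
  show "(\<integral>\<^sup>+t. ?g t (R - t)) = (\<integral>\<^sup>+th. ennreal (kap s R) * ?e R th)"
  proof (cases "0 < R")
   case False
   then have z: "(\<lambda>t. ?g t (R - t)) = (\<lambda>t. 0)" by (auto simp: kap_def)
   show ?thesis unfolding z using False by (simp add: kap_def)
  next
   case True
   have "(\<lambda>t. ?g t (R - t)) \<in> borel_measurable borel"
    using measurable_compose[of "\<lambda>t. (t, R - t)" borel "borel \<Otimes>\<^sub>M borel" "case_prod E"] by simp
   from nn_integral_real_affine[OF this, of R 0] True
   have "(\<integral>\<^sup>+t. ?g t (R - t)) = ennreal R * (\<integral>\<^sup>+th. ?g (R * th) (R - R * th))" by simp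
   also have "... = (\<integral>\<^sup>+th. ennreal R * ?g (R * th) (R - R * th))"
    using measurable_compose[of "\<lambda>th. (R * th, R - R * th)" borel "borel \<Otimes>\<^sub>M borel" "case_prod E"]
    by (intro nn_integral_cmult[symmetric]) simp
   also have "... = (\<integral>\<^sup>+th. ennreal (kap s R) * ?e R th)"
   proof (rule nn_integral_cong, goal_cases)
    case (1 th)
    have "R * (R powr (- 1 - s/2) * R powr (- 1 - s/2)) = R powr (1 + ((- 1 - s/2) + (- 1 - s/2)))"
     using True by (simp only: powr_add) simp
    also have "1 + ((- 1 - s/2) + (- 1 - s/2)) = - 1 - s" by simp
    finally have RR: "R * (R powr (- 1 - s/2) * R powr (- 1 - s/2)) = kap s R" using True by (simp add: kap_def)
    have e: "R - R * th = R * (1 - th)" by (simp add: algebra_simps)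
    have "ennreal R * ennreal (kap (s/2) (R * th) * kap (s/2) (R * (1 - th))) = ennreal ((R * (R powr (- 1 - s/2) * R powr (- 1 - s/2))) * (kap (s/2) th * kap (s/2) (1 - th)))"
     using True by (simp only: kap_scale[OF True]) (simp add: ennreal_mult[symmetric] mult_ac)
    also have "... = ennreal (kap s R) * ennreal (kap (s/2) th * kap (s/2) (1 - th))"
     unfolding RR by (simp add: ennreal_mult)
    finally show ?case
     unfolding e by (rule sw)
   qed
   finally show ?thesis .
  qed
 qed
 also have "... = (\<integral>\<^sup>+th. (\<integral>\<^sup>+R. ennreal (kap s R) * ?e R th))"
  by (rule lborel_pair.Fubini') (unfold split_beta', measurable)
 also have "... = (\<integral>\<^sup>+th. ennreal (kap (s/2) th * kap (s/2) (1 - th) * (th powr s + (1 - th) powr s - 1)) * ennreal I)"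
 proof (rule nn_integral_cong)
  fix th :: real
  show "(\<integral>\<^sup>+R. ennreal (kap s R) * ?e R th) = ennreal (kap (s/2) th * kap (s/2) (1 - th) * (th powr s + (1 - th) powr s - 1)) * ennreal I"
  proof (cases "0 < th \<and> th < 1")
   case False
   then have k0: "kap (s/2) th * kap (s/2) (1 - th) = 0" by (auto simp: kap_def)
   show ?thesis unfolding k0 by simp
  next
   case True
   \<comment> \<open>By scaling, each term on the right of \<open>E\<close> integrates to a multiple
     of the same \<open>I\<close>, with factor \<open>c powr s\<close> for \<open>c = th\<close> and
     \<open>c = 1 - th\<close>.\<close>
   have sc: "(\<integral>\<^sup>+R. ennreal (M (R * c) * kap s R)) = ennreal (c powr s * I)" if c: "0 < c" for c
   proof -
    have "(\<integral>\<^sup>+R. ennreal (M R * kap s R)) = ennreal \<bar>c\<bar> * (\<integral>\<^sup>+R. ennreal (M (0 + c * R) * kap s (0 + c * R)))"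
     by (rule nn_integral_real_affine) (use c in auto)
    also have "(\<integral>\<^sup>+R. ennreal (M (0 + c * R) * kap s (0 + c * R))) = (\<integral>\<^sup>+R. ennreal (c powr (- 1 - s)) * ennreal (M (R * c) * kap s R))"
     using M0 by (intro nn_integral_cong) (simp only: add_0_left kap_scale[OF c], simp add: ennreal_mult[symmetric] mult_ac)
    also have "... = ennreal (c powr (- 1 - s)) * (\<integral>\<^sup>+R. ennreal (M (R * c) * kap s R))"
     by (rule nn_integral_cmult) measurable
    finally have "ennreal (c powr s) * ennreal I = ennreal (c powr s) * (ennreal c * (ennreal (c powr (- 1 - s)) * (\<integral>\<^sup>+R. ennreal (M (R * c) * kap s R))))"
     using I c by simp
    also have "... = ennreal (c powr s * (c powr 1 * c powr (- 1 - s))) * (\<integral>\<^sup>+R. ennreal (M (R * c) * kap s R))"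
     using c by (simp add: ennreal_mult mult.assoc)
    also have "c powr s * (c powr 1 * c powr (- 1 - s)) = 1" using c by (simp only: powr_add[symmetric]) simp
    finally show ?thesis using I by (simp add: ennreal_mult)
   qed
   let ?X = "\<integral>\<^sup>+R. E (R * th) (R * (1 - th)) * ennreal (kap s R)"
   have mE1 [measurable]: "(\<lambda>R. E (R * th) (R * (1 - th))) \<in> borel_measurable borel"
    using measurable_compose[of "\<lambda>R. (R * th, R * (1 - th))" borel "borel \<Otimes>\<^sub>M borel" "case_prod E"] by simp
   have "?X + (\<integral>\<^sup>+R. ennreal (M R * kap s R)) = (\<integral>\<^sup>+R. E (R * th) (R * (1 - th)) * ennreal (kap s R) + ennreal (M R * kap s R))"
    by (rule nn_integral_add[symmetric]) measurable
   also have "... = (\<integral>\<^sup>+R. ennreal (M (R * th) * kap s R) + ennreal (M (R * (1 - th)) * kap s R))"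
   proof (rule nn_integral_cong, goal_cases)
    case (1 R)
    show ?case
    proof (cases "0 < R")
     case R: True
     have "E (R * th) (R * (1 - th)) + ennreal (M R) = ennreal (M (R * th) + M (R * (1 - th)))"
      using E[of "R * th" "R * (1 - th)"] R True by (simp add: algebra_simps)
     then have "(E (R * th) (R * (1 - th)) + ennreal (M R)) * ennreal (kap s R) = ennreal (M (R * th) + M (R * (1 - th))) * ennreal (kap s R)" by simp
     then show ?thesis using M0 by (simp add: distrib_right ennreal_mult ennreal_plus)
    qed (simp add: kap_def)
   qed
   also have "... = ennreal (th powr s * I) + ennreal ((1 - th) powr s * I)"
    by (subst nn_integral_add) (use True in \<open>auto simp: sc\<close>)
   finally have "?X + ennreal I = ennreal (th powr s * I + (1 - th) powr s * I)"
    using I by simp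
   \<comment> \<open>Subtraction happens only here, after integration, where the subtrahend
     \<open>I\<close> is known to be finite.\<close>
   then have "?X = ennreal (th powr s * I + (1 - th) powr s * I - I)" using I by (intro ennreal_diff_eqI) auto
   then have X: "?X = ennreal ((th powr s + (1 - th) powr s - 1) * I)" by (simp add: algebra_simps)
   have "(\<integral>\<^sup>+R. ennreal (kap s R) * ?e R th) = ?X * ennreal (kap (s/2) th * kap (s/2) (1 - th))"
    by (subst nn_integral_multc[symmetric]) (auto simp: mult_ac)
   also have "... = ennreal (kap (s/2) th * kap (s/2) (1 - th) * (th powr s + (1 - th) powr s - 1)) * ennreal I"
    unfolding X using powr_subadd(1)[of th s] True s I by (simp add: ennreal_mult[symmetric] mult_ac)
   finally show ?thesis .
  qed
 qed
 also have "... = subadd_const s * ennreal I"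
  unfolding subadd_const_def by (rule nn_integral_multc) measurable
 finally show ?thesis .
qed

lemma Nw_0 [simp]: "Nw w 0 = 0"
 by (simp add: Nw_def)

lemma Bw_0: "sqint w \<Longrightarrow> Bw w 0 z = 0" "Bw w y 0 = 0"
 by (simp_all add: Bw_def Nw_minus)

lemma borel_measurable_nn_integral_lborel2 [measurable (raw)]:
 fixes f :: "'b \<Rightarrow> 'a::euclidean_space \<Rightarrow> ennreal"
 assumes "case_prod f \<in> borel_measurable (N \<Otimes>\<^sub>M borel)"
 shows "(\<lambda>x. \<integral>\<^sup>+y. f x y) \<in> borel_measurable N"
 by (rule lborel.borel_measurable_nn_integral) (use assms in \<open>simp cong: measurable_cong_sets\<close>)

text \<open>In the definition of \<open>Bw\<close> the terms in \<open>y\<close> and in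
  \<open>z\<close> separate, while those in \<open>y + z\<close> and \<open>y - z\<close> see only
  the convolution of the two Gaussians, that is a Gaussian at time \<open>t + r\<close>. The
  identity is kept additive because differences of infinite values would be meaningless in
  \<open>ennreal\<close>.\<close>

lemma Mw_add:
 fixes w :: "'a::euclidean_space \<Rightarrow> real"
 defines "Mn \<equiv> \<lambda>w t. \<integral>\<^sup>+z. ennreal (Nw w z * gau t z)"
 assumes w: "sqint w" and t: "0 < t" and r: "0 < r"
 shows "(\<integral>\<^sup>+p. ennreal ((1/4) * Bw w (fst p) (snd p) * (gau t (fst p) * gau r (snd p))) \<partial>lborel2) + ennreal (gau_const TYPE('a) / 2) * Mn w (t + r)
   = ennreal (gau_const TYPE('a) / 2) * (Mn w t + Mn w r)"
proof -
 note [measurable] = sqint_measurable[OF w]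
 let ?M = "lborel2 :: ('a \<times> 'a) measure"
 let ?G = "gau_const TYPE('a)"
 have G: "0 < ?G" by (rule gau_const)
 let ?A = "\<lambda>p::'a\<times>'a. ennreal ((1/4) * Bw w (fst p) (snd p) * (gau t (fst p) * gau r (snd p)))"
 let ?B = "\<lambda>p::'a\<times>'a. ennreal ((1/4) * Nw w (fst p + snd p) * (gau t (fst p) * gau r (snd p)))"
 let ?B' = "\<lambda>p::'a\<times>'a. ennreal ((1/4) * Nw w (fst p - snd p) * (gau t (fst p) * gau r (snd p)))"
 let ?D = "\<lambda>p::'a\<times>'a. ennreal ((1/2) * Nw w (fst p) * (gau t (fst p) * gau r (snd p)))"
 let ?D' = "\<lambda>p::'a\<times>'a. ennreal ((1/2) * Nw w (snd p) * (gau t (fst p) * gau r (snd p)))"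
 have [measurable]: "?A \<in> borel_measurable ?M" "?B \<in> borel_measurable ?M" "?B' \<in> borel_measurable ?M" "?D \<in> borel_measurable ?M" "?D' \<in> borel_measurable ?M"
  by measurable
 have "(\<integral>\<^sup>+p. ?A p \<partial>?M) + ((\<integral>\<^sup>+p. ?B p \<partial>?M) + (\<integral>\<^sup>+p. ?B' p \<partial>?M)) = (\<integral>\<^sup>+p. ?A p + (?B p + ?B' p) \<partial>?M)"
  by (simp add: nn_integral_add)
 also have "... = (\<integral>\<^sup>+p. ?D p + ?D' p \<partial>?M)"
 proof (rule nn_integral_cong, goal_cases)
  case (1 p)
  have "?A p + (?B p + ?B' p) = ennreal ((1/4) * Bw w (fst p) (snd p) * (gau t (fst p) * gau r (snd p)) + ((1/4) * Nw w (fst p + snd p) * (gau t (fst p) * gau r (snd p)) + (1/4) * Nw w (fst p - snd p) * (gau t (fst p) * gau r (snd p))))"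
   using Bw_nonneg[OF w] by (simp add: ennreal_plus)
  also have "... = ennreal ((1/2) * Nw w (fst p) * (gau t (fst p) * gau r (snd p)) + (1/2) * Nw w (snd p) * (gau t (fst p) * gau r (snd p)))"
   by (rule arg_cong[where f=ennreal]) (simp add: Bw_def algebra_simps)
  also have "... = ?D p + ?D' p" by (rule ennreal_plus) auto
  finally show ?case .
 qed
 also have "... = (\<integral>\<^sup>+p. ?D p \<partial>?M) + (\<integral>\<^sup>+p. ?D' p \<partial>?M)"
  by (rule nn_integral_add) measurable
 also have "(\<integral>\<^sup>+p. ?D p \<partial>?M) = ennreal (?G / 2) * Mn w t"
 proof -
  have "(\<integral>\<^sup>+p. ?D p \<partial>?M) = (\<integral>\<^sup>+y. (\<integral>\<^sup>+z. ?D (y, z)))" by (rule lborel.nn_integral_fst[symmetric]) measurable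
  also have "... = (\<integral>\<^sup>+y. ennreal (?G / 2) * ennreal (Nw w y * gau t y))"
  proof (rule nn_integral_cong, goal_cases)
   case (1 y)
   have "(\<integral>\<^sup>+z. ?D (y, z)) = (\<integral>\<^sup>+z. ennreal (1/2 * (Nw w y * gau t y)) * ennreal (gau r (z::'a)))"
    by (rule nn_integral_cong) (simp add: ennreal_mult[symmetric] mult_ac)
   also have "... = ennreal (1/2 * (Nw w y * gau t y)) * ennreal ?G"
    by (subst nn_integral_cmult) (auto simp: gau_integral[OF r])
   finally show ?case
    using G by (simp add: ennreal_mult[symmetric] mult_ac)
  qed
  also have "... = ennreal (?G / 2) * Mn w t" unfolding Mn_def by (rule nn_integral_cmult) measurable
  finally show ?thesis .
 qed
 also have "(\<integral>\<^sup>+p. ?D' p \<partial>?M) = ennreal (?G / 2) * Mn w r"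
 proof -
  have "(\<integral>\<^sup>+p. ?D' p \<partial>?M) = (\<integral>\<^sup>+y. (\<integral>\<^sup>+z. ?D' (y, z)))" by (rule lborel.nn_integral_fst[symmetric]) measurable
  also have "... = (\<integral>\<^sup>+y. ennreal (gau t (y::'a)) * (ennreal (1 / 2) * Mn w r))"
  proof (rule nn_integral_cong, goal_cases)
   case (1 y)
   have "(\<integral>\<^sup>+z. ?D' (y, z)) = (\<integral>\<^sup>+z. ennreal (1/2 * gau t y) * ennreal (Nw w z * gau r z))"
    by (rule nn_integral_cong) (simp add: ennreal_mult[symmetric] mult_ac)
   also have "... = ennreal (1/2 * gau t y) * Mn w r"
    unfolding Mn_def by (rule nn_integral_cmult) measurable
   also have "ennreal (1/2 * gau t y) = ennreal (gau t y) * ennreal (1/2)" by (subst ennreal_mult[symmetric]) (auto simp: mult.commute)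
   finally show ?case
    by (simp only: mult.assoc)
  qed
  also have "... = ennreal ?G * (ennreal (1 / 2) * Mn w r)" by (subst nn_integral_multc) (auto simp: gau_integral[OF t])
  also have "... = ennreal (?G / 2) * Mn w r" using G by (simp add: ennreal_mult[symmetric] mult.assoc[symmetric] del: ennreal_half)
  finally show ?thesis .
 qed
 also
 have B: "(\<integral>\<^sup>+p. ?B p \<partial>?M) = ennreal (?G / 4) * Mn w (t + r)"
 proof -
  have "(\<integral>\<^sup>+p. ?B p \<partial>?M) = (\<integral>\<^sup>+y. (\<integral>\<^sup>+z. ?B (y, z)))" by (rule lborel.nn_integral_fst[symmetric]) measurable
  also have "... = (\<integral>\<^sup>+y. (\<integral>\<^sup>+v. ennreal ((1/4) * Nw w v) * ennreal (gau t y * gau r (v - y))))"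
  proof (rule nn_integral_cong, goal_cases)
   case (1 y)
   have "(\<lambda>v. ennreal ((1/4) * Nw w v) * ennreal (gau t y * gau r (v - y))) \<in> borel_measurable borel" by measurable
   from nn_integral_lborel_shift[OF this, of y]
   show ?case
    by (simp add: ennreal_mult[symmetric] mult_ac)
  qed
  also have "... = (\<integral>\<^sup>+v. (\<integral>\<^sup>+y. ennreal ((1/4) * Nw w v) * ennreal (gau t y * gau r (v - y))))"
   by (rule lborel_pair.Fubini') measurable
  also have "... = (\<integral>\<^sup>+v. ennreal (?G / 4) * ennreal (Nw w v * gau (t + r) v))"
   using G by (intro nn_integral_cong, subst nn_integral_cmult) (auto simp: gau_conv[OF t r] ennreal_mult[symmetric] mult_ac)
  also have "... = ennreal (?G / 4) * Mn w (t + r)" unfolding Mn_def by (rule nn_integral_cmult) measurable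
  finally show ?thesis .
 qed
 have B': "(\<integral>\<^sup>+p. ?B' p \<partial>?M) = ennreal (?G / 4) * Mn w (t + r)"
 proof -
  have "(\<integral>\<^sup>+p. ?B' p \<partial>?M) = (\<integral>\<^sup>+y. (\<integral>\<^sup>+z. ?B' (y, z)))" by (rule lborel.nn_integral_fst[symmetric]) measurable
  also have "... = (\<integral>\<^sup>+y. (\<integral>\<^sup>+z. ?B (y, z)))"
  proof (rule nn_integral_cong, goal_cases)
   case (1 y)
   have "(\<lambda>z. ?B (y, z)) \<in> borel_measurable borel" by measurable
   from nn_integral_lborel_reflect[OF this, of 0] show ?case by (simp add: gau_minus)
  qed
  also have "... = (\<integral>\<^sup>+p. ?B p \<partial>?M)" by (rule lborel.nn_integral_fst) measurable
  finally show ?thesis unfolding B .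
 qed
 note B
 also note B'
 also have "ennreal (?G / 4) * Mn w (t + r) + ennreal (?G / 4) * Mn w (t + r) = ennreal (?G / 2) * Mn w (t + r)"
  using G by (simp add: distrib_right[symmetric] ennreal_plus[symmetric] del: ennreal_plus)
 finally show ?thesis by (simp add: distrib_left)
qed

text \<open>Stands in for \<open>|\<xi>|^s |\<xi>|^s = |\<xi>|^(2 s)\<close>: both forms are
  superpositions of Gaussian averages of \<open>Nw\<close>. Writing each \<open>kr s\<close> as a
  mixture makes \<open>Mw_add\<close> applicable for every pair of times, and
  \<open>subadd_integral\<close> collapses the double time integral to the mixture that represents
  \<open>kr (2 * s)\<close>.\<close>

proposition Qf_gag:
 assumes s: "0 < s" "s < 1"
 obtains C where "0 < C" "\<And>w :: 'a::euclidean_space \<Rightarrow> real. sqint w \<Longrightarrow> gag s w < \<infinity> \<Longrightarrow>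
  (\<integral>\<^sup>+p. Qf s w p \<partial>lborel2) = ennreal C * gag s w"
proof -
 let ?M = "lborel2 :: ('a \<times> 'a) measure"
 let ?G = "gau_const TYPE('a)"
 have G: "0 < ?G" by (rule gau_const)
 obtain c where c: "0 < c" "\<And>z::'a. z \<noteq> 0 \<Longrightarrow> (\<integral>\<^sup>+t. ennreal (kap (s/2) t * gau t z)) = ennreal (c * kr s z)"
  using gauss_mixture[OF s(1)] by blast
 have "2 * s > 0" using s by simp
 from gauss_mixture[OF this, where 'a='a] obtain c2 where c2: "0 < c2" "\<And>z::'a. z \<noteq> 0 \<Longrightarrow> (\<integral>\<^sup>+t. ennreal (kap s t * gau t z)) = ennreal (c2 * kr (2 * s) z)"
  by auto
 obtain J where J: "0 < J" "subadd_const s = ennreal J" by (rule subadd_const[OF s])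
 show ?thesis
 proof (rule that)
  show "0 < ?G / 2 * J * c2 / c\<^sup>2" using G J c c2 by simp
  fix w :: "'a \<Rightarrow> real" assume w: "sqint w" and fin: "gag s w < \<infinity>"
  note [measurable] = sqint_measurable[OF w]
  let ?L = "lborel :: ('a \<times> 'a) measure"
  let ?B = "\<lambda>t r (p :: 'a \<times> 'a). (1/4) * Bw w (fst p) (snd p) * (gau t (fst p) * gau r (snd p))"
  let ?H = "\<lambda>t r (p :: 'a \<times> 'a). ennreal ((1/4) * Bw w (fst p) (snd p) * (kap (s/2) t * gau t (fst p)) * (kap (s/2) r * gau r (snd p)))"
  define Mn where "Mn t = (\<integral>\<^sup>+z. ennreal (Nw w z * gau t z))" for t
  have [measurable]: "Mn \<in> borel_measurable borel" unfolding Mn_def by measurable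
  define M where "M t = (if 0 < t then enn2real (Mn t) else 0)" for t
  have Mn_fin: "Mn t < \<infinity>" if t: "0 < t" for t
  proof -
   have "Mn t \<le> (\<integral>\<^sup>+z. ennreal (4 * (\<integral>x. (w x)\<^sup>2)) * ennreal (gau t (z::'a)))"
    unfolding Mn_def using Nw_le[OF w] by (intro nn_integral_mono) (simp add: ennreal_mult[symmetric] ennreal_leI mult_right_mono)
   also have "... = ennreal (4 * (\<integral>x. (w x)\<^sup>2)) * ennreal ?G"
    by (subst nn_integral_cmult) (auto simp: gau_integral[OF t])
   also have "... < \<infinity>" by (simp add: ennreal_mult_less_top)
   finally show ?thesis .
  qed
  then have MMn: "ennreal (M t) = Mn t" if "0 < t" for t using that by (simp add: M_def)
  have M0: "0 \<le> M t" for t by (simp add: M_def)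
  have [measurable]: "M \<in> borel_measurable borel" unfolding M_def by measurable
  \<comment> \<open>The factor \<open>2 / ?G\<close> brings \<open>Mw_add\<close> into the form
    \<open>E t r + M (t + r) = M t + M r\<close> that \<open>subadd_integral\<close>
    expects.\<close>
  define E where "E t r = (\<integral>\<^sup>+p. ennreal ((2 / ?G) * (?B t r p)) \<partial>?M)" for t r
  have mE: "case_prod E \<in> borel_measurable (borel \<Otimes>\<^sub>M borel)"
  proof -
   have "(\<lambda>q. \<integral>\<^sup>+p. ennreal ((2 / ?G) * ((1/4) * Bw w (fst p) (snd p) * (gau (fst q) (fst p) * gau (snd q) (snd p)))) \<partial>?L) \<in> borel_measurable (borel \<Otimes>\<^sub>M borel)"
    by (rule lborel.borel_measurable_nn_integral) (unfold lborel_prod[symmetric] split_beta', measurable)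
   then show ?thesis unfolding E_def split_beta' lborel_prod .
  qed
  have AE_eq: "(\<integral>\<^sup>+p. ennreal (?B t r p) \<partial>?M) = ennreal (?G / 2) * E t r" for t r
  proof -
   have "ennreal (?G / 2) * E t r = (\<integral>\<^sup>+p. ennreal (?G / 2) * ennreal ((2 / ?G) * (?B t r p)) \<partial>?M)"
    unfolding E_def by (rule nn_integral_cmult[symmetric]) measurable
   also have "... = (\<integral>\<^sup>+p. ennreal (?B t r p) \<partial>?M)"
    using G Bw_nonneg[OF w] by (intro nn_integral_cong) (simp add: ennreal_mult[symmetric])
   finally show ?thesis by simp
  qed
  have E: "E t r + ennreal (M (t + r)) = ennreal (M t + M r)" if tr: "0 < t" "0 < r" for t r
  proof -
   have "ennreal (?G / 2) * (E t r + ennreal (M (t + r))) = ennreal (?G / 2) * (ennreal (M t + M r))"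
   proof -
    have "ennreal (?G / 2) * E t r + ennreal (?G / 2) * Mn (t + r) = ennreal (?G / 2) * (Mn t + Mn r)"
     using Mw_add[OF w tr] unfolding AE_eq Mn_def .
    then show ?thesis using tr M0 by (simp add: MMn distrib_left ennreal_plus)
   qed
   moreover have "ennreal (?G / 2) \<noteq> 0" "ennreal (?G / 2) \<noteq> top" using G by (auto simp: ennreal_eq_0_iff)
   ultimately show ?thesis by (subst (asm) ennreal_mult_cancel_left) auto
  qed
  have I: "(\<integral>\<^sup>+R. ennreal (M R * kap s R)) = ennreal c2 * gag s w"
  proof -
   have "(\<integral>\<^sup>+R. ennreal (M R * kap s R)) = (\<integral>\<^sup>+R. (\<integral>\<^sup>+z. ennreal (Nw w z * (kap s R * gau R z))))"
   proof (rule nn_integral_cong, goal_cases)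
    case (1 R)
    show ?case
    proof (cases "0 < R")
     case True
     have "ennreal (M R * kap s R) = (\<integral>\<^sup>+z. ennreal (Nw w z * gau R z)) * ennreal (kap s R)"
      using True M0 by (simp add: ennreal_mult MMn Mn_def)
     also have "... = (\<integral>\<^sup>+z. ennreal (Nw w z * gau R z) * ennreal (kap s R))"
      by (rule nn_integral_multc[symmetric]) measurable
     finally show ?thesis by (simp add: ennreal_mult[symmetric] mult_ac)
    qed (simp add: kap_def)
   qed
   also have "... = (\<integral>\<^sup>+z. (\<integral>\<^sup>+R. ennreal (Nw w z * (kap s R * gau R z))))"
    by (rule lborel_pair.Fubini') measurable
   also have "... = (\<integral>\<^sup>+z. ennreal c2 * ennreal (Nw w z * kr (2 * s) z))"
   proof (rule nn_integral_cong, goal_cases)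
    case (1 z)
    show ?case
    proof (cases "z = 0")
     case False
     have "(\<integral>\<^sup>+R. ennreal (Nw w z * (kap s R * gau R z))) = (\<integral>\<^sup>+R. ennreal (Nw w z) * ennreal (kap s R * gau R z))"
      by (simp add: ennreal_mult)
     also have "... = ennreal (Nw w z) * (\<integral>\<^sup>+R. ennreal (kap s R * gau R z))" by (rule nn_integral_cmult) measurable
     finally show ?thesis using c2 False by (simp add: ennreal_mult[symmetric] mult_ac)
    qed simp
   qed
   also have "... = ennreal c2 * gag s w" unfolding gag_def by (rule nn_integral_cmult) measurable
   finally show ?thesis .
  qed
  define g where "g = enn2real (gag s w)"
  have g: "gag s w = ennreal g" "0 \<le> g" using fin by (auto simp: g_def)
  have "ennreal (c\<^sup>2) * (\<integral>\<^sup>+p. Qf s w p \<partial>?M) = (\<integral>\<^sup>+p. ennreal (c\<^sup>2) * Qf s w p \<partial>?M)"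
   by (rule nn_integral_cmult[symmetric]) measurable
  also have "... = (\<integral>\<^sup>+p. (\<integral>\<^sup>+t. (\<integral>\<^sup>+r. ?H t r p)) \<partial>?M)"
  proof (rule nn_integral_cong)
   fix p :: "'a \<times> 'a"
   obtain y z where p: "p = (y, z)" by (cases p)
   show "ennreal (c\<^sup>2) * Qf s w p = (\<integral>\<^sup>+t. (\<integral>\<^sup>+r. ?H t r p))"
   proof (cases "y = 0 \<or> z = 0")
    case True
    then show ?thesis by (auto simp: p Qf_def Bw_0 w)
   next
    case False
    have b: "0 \<le> Bw w y z" by (rule Bw_nonneg[OF w])
    have "(\<integral>\<^sup>+t. (\<integral>\<^sup>+r. ennreal ((1/4) * Bw w y z * (kap (s/2) t * gau t y) * (kap (s/2) r * gau r z))))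
     = (\<integral>\<^sup>+t. (\<integral>\<^sup>+r. ennreal ((1/4) * Bw w y z * (kap (s/2) t * gau t y)) * ennreal (kap (s/2) r * gau r z)))"
     using b by (intro nn_integral_cong) (simp add: ennreal_mult[symmetric])
    also have "... = (\<integral>\<^sup>+t. ennreal ((1/4) * Bw w y z * (kap (s/2) t * gau t y)) * ennreal (c * kr s z))"
     using False by (intro nn_integral_cong, subst nn_integral_cmult) (auto simp: c)
    also have "... = (\<integral>\<^sup>+t. ennreal ((1/4) * Bw w y z * (c * kr s z)) * ennreal (kap (s/2) t * gau t y))"
     using b c by (intro nn_integral_cong) (simp add: ennreal_mult[symmetric] mult_ac)
    also have "... = ennreal ((1/4) * Bw w y z * (c * kr s z)) * ennreal (c * kr s y)"
     using False by (subst nn_integral_cmult) (auto simp: c)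
    also have "... = ennreal (c\<^sup>2) * Qf s w p"
     using b c by (simp add: p Qf_def ennreal_mult[symmetric] power2_eq_square mult_ac)
    finally show ?thesis by (simp add: p)
   qed
  qed
  also have "... = (\<integral>\<^sup>+t. (\<integral>\<^sup>+r. (\<integral>\<^sup>+p. ?H t r p \<partial>?L)))"
  proof -
   have "(\<integral>\<^sup>+p. (\<integral>\<^sup>+t. (\<integral>\<^sup>+r. ?H t r p)) \<partial>?L)
    = (\<integral>\<^sup>+t. (\<integral>\<^sup>+p. (\<integral>\<^sup>+r. ?H t r p) \<partial>?L))"
    by (rule lborel_pair.Fubini') (unfold lborel_prod[symmetric] split_beta', measurable)
   also have "... = (\<integral>\<^sup>+t. (\<integral>\<^sup>+r. (\<integral>\<^sup>+p. ?H t r p \<partial>?L)))"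
    by (rule nn_integral_cong, rule lborel_pair.Fubini') (unfold lborel_prod[symmetric] split_beta', measurable)
   finally show ?thesis by (simp only: lborel_prod)
  qed
  also have "... = (\<integral>\<^sup>+t. (\<integral>\<^sup>+r. ennreal (?G / 2) * (E t r * ennreal (kap (s/2) t * kap (s/2) r))))"
  proof (rule nn_integral_cong, rule nn_integral_cong)
   fix t r :: real
   have "(\<integral>\<^sup>+p. ?H t r p \<partial>?M)
    = (\<integral>\<^sup>+p. ennreal (?B t r p) * ennreal (kap (s/2) t * kap (s/2) r) \<partial>?M)"
    using Bw_nonneg[OF w] by (intro nn_integral_cong) (simp add: ennreal_mult[symmetric] mult_ac)
   also have "... = (ennreal (?G / 2) * E t r) * ennreal (kap (s/2) t * kap (s/2) r)"
    by (simp only: AE_eq[symmetric], rule nn_integral_multc) measurable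
   finally show "(\<integral>\<^sup>+p. ?H t r p \<partial>?L) = ennreal (?G / 2) * (E t r * ennreal (kap (s/2) t * kap (s/2) r))"
    by (simp only: lborel_prod mult.assoc)
  qed
  also have "... = ennreal (?G / 2) * (\<integral>\<^sup>+t. (\<integral>\<^sup>+r. E t r * ennreal (kap (s/2) t * kap (s/2) r)))"
  proof -
   have m1: "(\<lambda>(t, r). E t r * ennreal (kap (s/2) t * kap (s/2) r)) \<in> borel_measurable (borel \<Otimes>\<^sub>M borel)"
    using mE unfolding split_beta' by measurable
   have m2: "(\<lambda>r. E t r * ennreal (kap (s/2) t * kap (s/2) r)) \<in> borel_measurable borel" for t
    using measurable_compose[of "\<lambda>r. (t, r)" borel, OF _ m1] by simp
   have m3: "(\<lambda>t. \<integral>\<^sup>+r. E t r * ennreal (kap (s/2) t * kap (s/2) r)) \<in> borel_measurable borel"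
    by (rule borel_measurable_nn_integral_lborel2) (use m1 in simp)
   show ?thesis using m2 m3 by (simp add: nn_integral_cmult)
  qed
  also have "(\<integral>\<^sup>+t. (\<integral>\<^sup>+r. E t r * ennreal (kap (s/2) t * kap (s/2) r))) = subadd_const s * ennreal (c2 * g)"
   using c2 g by (intro subadd_integral[OF s _ mE M0 E]) (auto simp: I ennreal_mult)
  also have "ennreal (?G / 2) * (subadd_const s * ennreal (c2 * g)) = ennreal (?G / 2 * J * c2 * g)"
   using G J c2 g by (simp add: ennreal_mult[symmetric] mult_ac)
  finally have "ennreal (1 / c\<^sup>2) * (ennreal (c\<^sup>2) * (\<integral>\<^sup>+p. Qf s w p \<partial>?M)) = ennreal (1 / c\<^sup>2) * ennreal (?G / 2 * J * c2 * g)" by simp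
  moreover have "ennreal (1 / c\<^sup>2) * ennreal (c\<^sup>2) = 1" using c by (simp add: ennreal_mult[symmetric])
  moreover have "ennreal (1 / c\<^sup>2) * ennreal (?G / 2 * J * c2 * g) = ennreal (?G / 2 * J * c2 / c\<^sup>2) * gag s w"
   using G J c2 g c by (simp add: ennreal_mult[symmetric])
  ultimately show "(\<integral>\<^sup>+p. Qf s w p \<partial>?M) = ennreal (?G / 2 * J * c2 / c\<^sup>2) * gag s w"
   by (metis mult.assoc mult_1)
 qed
qed

subsection \<open>Principal values\<close>

definition tent_const :: "'a::euclidean_space itself \<Rightarrow> real" where
 "tent_const _ = (\<integral>y. max 0 (1 - norm (y::'a)))"

text \<open>Tent mollifier. Being Lipschitz, it cancels one power of the singularity of
  \<open>kr s\<close>, which is enough since \<open>s < 1\<close>.\<close>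

definition rho :: "real \<Rightarrow> 'a::euclidean_space \<Rightarrow> real" where
 "rho t y = max 0 (1 - norm y / t) / (tent_const TYPE('a) * t ^ DIM('a))"

lemma rho_measurable [measurable]: "rho t \<in> borel_measurable borel"
 unfolding rho_def by measurable

lemma tent_integrable: "integrable lborel (\<lambda>y::'a::euclidean_space. max 0 (1 - norm y))"
proof (rule Bochner_Integration.integrable_bound)
 show "integrable lborel (\<lambda>y::'a. indicator (ball 0 1) y :: real)"
  using emeasure_lborel_ball_finite[of "0::'a" 1] by (intro integrable_real_indicator) auto
qed (auto simp: indicator_def)

lemma tent_const_pos: "0 < tent_const TYPE('a::euclidean_space)"
proof -
 have "(\<integral>y. (1/2) * indicator (ball 0 (1/2)) (y::'a)) \<le> tent_const TYPE('a)"
  unfolding tent_const_def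
 proof (rule integral_mono[OF _ tent_integrable])
  show "integrable lborel (\<lambda>y::'a. 1/2 * indicator (ball 0 (1/2)) y :: real)"
   using emeasure_lborel_ball_finite[of "0::'a" "1/2"] by (intro integrable_mult_right integrable_real_indicator) auto
 qed (auto simp: indicator_def)
 moreover have "(\<integral>y. (1/2) * indicator (ball 0 (1/2)) (y::'a)) = (1/2) * measure lborel (ball (0::'a) (1/2))" by simp
 moreover have "0 < measure lborel (ball (0::'a) (1/2))" using content_ball_gt_0_iff[of "0::'a" "1/2"] by simp
 ultimately show ?thesis by linarith
qed

lemma rho_nonneg [simp]: "0 < t \<Longrightarrow> 0 \<le> rho t y"
 using tent_const_pos[where 'a='a] by (simp add: rho_def)

lemma rho_eq_0: "0 < t \<Longrightarrow> t \<le> norm y \<Longrightarrow> rho t y = 0"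
 by (simp add: rho_def)

lemma rho_le: "0 < t \<Longrightarrow> rho t (y::'a::euclidean_space) \<le> 1 / (tent_const TYPE('a) * t ^ DIM('a))"
 using tent_const_pos[where 'a='a] unfolding rho_def by (intro divide_right_mono) auto

lemma rho_diff: 
 assumes t: "0 < t"
 shows "\<bar>rho t x - rho t (y::'a::euclidean_space)\<bar> \<le> min 1 (norm (x - y) / t) / (tent_const TYPE('a) * t ^ DIM('a))"
proof -
 have c: "0 < tent_const TYPE('a) * t ^ DIM('a)" using t tent_const_pos[where 'a='a] by simp
 have "\<bar>norm x / t - norm y / t\<bar> \<le> norm (x - y) / t"
  using t norm_triangle_ineq3[of x y] by (simp add: diff_divide_distrib[symmetric] divide_right_mono)
 moreover have "0 \<le> norm x / t" "0 \<le> norm y / t" using t by simp_all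
 ultimately have "\<bar>max 0 (1 - norm x / t) - max 0 (1 - norm y / t)\<bar> \<le> min 1 (norm (x - y) / t)"
  unfolding max_def min_def by (auto split: if_splits)
 moreover have "\<bar>rho t x - rho t y\<bar> = \<bar>max 0 (1 - norm x / t) - max 0 (1 - norm y / t)\<bar> / (tent_const TYPE('a) * t ^ DIM('a))"
  using c by (simp add: rho_def diff_divide_distrib[symmetric] abs_divide)
 ultimately show ?thesis using c by (simp add: divide_right_mono)
qed

lemma rho_integral:
 assumes t: "0 < t"
 shows "integrable lborel (rho t :: 'a::euclidean_space \<Rightarrow> real)" "(\<integral>y. rho t (y::'a)) = 1"
proof -
 have e: "rho t = (\<lambda>y::'a. (1 / (tent_const TYPE('a) * t ^ DIM('a))) * max 0 (1 - norm (0 + (1 / t) *\<^sub>R y)))"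
  using t by (auto simp: rho_def fun_eq_iff)
 show "integrable lborel (rho t :: 'a \<Rightarrow> real)"
  unfolding e using t by (intro integrable_mult_right integrable_lborel_affine[OF tent_integrable]) auto
 have "(\<integral>y. max 0 (1 - norm (0 + (1 / t) *\<^sub>R (y::'a)))) = t ^ DIM('a) * tent_const TYPE('a)"
  using t by (subst integral_lborel_affine[where f="\<lambda>y. max 0 (1 - norm y)"]) (auto simp: tent_const_def power_one_over divide_simps)
 then show "(\<integral>y. rho t (y::'a)) = 1"
  unfolding e using t tent_const_pos[where 'a='a] by simp
qed

lemma rho_sqint: assumes t: "0 < t" shows "sqint (rho t :: 'a::euclidean_space \<Rightarrow> real)"
proof (rule sqintI)
 show "integrable lborel (\<lambda>x::'a. (rho t x)\<^sup>2)"
 proof (rule Bochner_Integration.integrable_bound[OF integrable_mult_right[OF rho_integral(1)[OF t], of "1 / (tent_const TYPE('a) * t ^ DIM('a))"]])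
  show "AE x::'a in lborel. norm ((rho t x)\<^sup>2) \<le> norm (1 / (tent_const TYPE('a) * t ^ DIM('a)) * rho t x)"
  proof (rule AE_I2, goal_cases)
   case (1 x)
   have "rho t x * rho t x \<le> 1 / (tent_const TYPE('a) * t ^ DIM('a)) * rho t x"
    using t by (intro mult_right_mono rho_le) auto
   moreover have "norm ((rho t x)\<^sup>2) = rho t x * rho t x" by (simp add: power2_eq_square)
   ultimately show ?case
    by (metis abs_ge_self order_trans real_norm_def)
  qed
 qed measurable
qed measurable

definition Pt :: "real \<Rightarrow> ('a::euclidean_space \<Rightarrow> real) \<Rightarrow> 'a \<Rightarrow> real" where
 "Pt t v x = (\<integral>y. rho t y * v (x + y))"

lemma sqint_shift_left: "sqint v \<Longrightarrow> sqint (\<lambda>y. v (x + y))"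
 using sqint_shift[of v x] by (simp add: add.commute)

lemma Pt_integrable: "sqint v \<Longrightarrow> 0 < t \<Longrightarrow> integrable lborel (\<lambda>y. rho t y * v (x + y))"
 by (intro sqint_prod_integrable rho_sqint sqint_shift_left)

lemma Pt_diff: "sqint v \<Longrightarrow> sqint u \<Longrightarrow> 0 < t \<Longrightarrow> Pt t (\<lambda>x. v x - u x) x = Pt t v x - Pt t u x"
 by (simp add: Pt_def right_diff_distrib Pt_integrable)

text \<open>Jensen's inequality, from the nonnegativity of the variance of \<open>v\<close> under
  the probability density \<open>rho t\<close>; the density is then replaced by its supremum on the
  ball.\<close>

lemma Pt_sq:
 fixes v :: "'a::euclidean_space \<Rightarrow> real"
 assumes v: "sqint v" and t: "0 < t"
 shows "ennreal ((Pt t v x)\<^sup>2) \<le> ennreal (1 / (tent_const TYPE('a) * t ^ DIM('a))) * (\<integral>\<^sup>+y\<in>ball x t. ennreal ((v y)\<^sup>2) \<partial>lborel)"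
proof -
 let ?N = "tent_const TYPE('a) * t ^ DIM('a)"
 note [measurable] = sqint_measurable[OF v]
 have [measurable]: "ball x t \<in> sets borel" by simp
 define m where "m = Pt t v x"
 have i: "integrable lborel (\<lambda>y. (v (x + y))\<^sup>2)" using sqint_integrable[OF sqint_shift_left[OF v]] .
 have ir: "integrable lborel (\<lambda>y. rho t y * (v (x + y))\<^sup>2)"
 proof (rule Bochner_Integration.integrable_bound[OF integrable_mult_right[OF i, of "1 / ?N"]])
  show "AE y in lborel. norm (rho t y * (v (x + y))\<^sup>2) \<le> norm (1 / ?N * (v (x + y))\<^sup>2)"
  proof (rule AE_I2, goal_cases)
   case (1 y)
   have "rho t y * (v (x + y))\<^sup>2 \<le> 1 / ?N * (v (x + y))\<^sup>2"
    by (intro mult_right_mono rho_le t) auto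
   moreover have "norm (rho t y * (v (x + y))\<^sup>2) = rho t y * (v (x + y))\<^sup>2" using t by (simp add: abs_mult)
   ultimately show ?case
    by (metis abs_ge_self order_trans real_norm_def)
  qed
 qed measurable
 have "0 \<le> (\<integral>y. rho t y * (v (x + y) - m)\<^sup>2)" using t by simp
 also have "(\<lambda>y. rho t y * (v (x + y) - m)\<^sup>2) = (\<lambda>y. rho t y * (v (x + y))\<^sup>2 - (2 * m) * (rho t y * v (x + y)) + m\<^sup>2 * rho t y)"
  by (simp add: fun_eq_iff power2_eq_square algebra_simps)
 also have "(\<integral>y. (rho t y * (v (x + y))\<^sup>2 - (2 * m) * (rho t y * v (x + y)) + m\<^sup>2 * rho t y)) = (\<integral>y. rho t y * (v (x + y))\<^sup>2) - (2 * m) * m + m\<^sup>2 * 1"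
  using ir Pt_integrable[OF v t, of x] rho_integral[OF t, where 'a='a] by (simp add: m_def Pt_def)
 finally have "m\<^sup>2 \<le> (\<integral>y. rho t y * (v (x + y))\<^sup>2)" by (simp add: power2_eq_square)
 then have "ennreal (m\<^sup>2) \<le> ennreal (\<integral>y. rho t y * (v (x + y))\<^sup>2)" by (rule ennreal_leI)
 also have "... = (\<integral>\<^sup>+y. ennreal (rho t y * (v (x + y))\<^sup>2))"
  using t by (intro nn_integral_eq_integral[OF ir, symmetric]) auto
 also have "... \<le> (\<integral>\<^sup>+y. ennreal (1 / ?N) * (ennreal ((v (x + y))\<^sup>2) * indicator (ball x t) (x + y)))"
 proof (rule nn_integral_mono, goal_cases)
  case (1 y)
  show ?case
  proof (cases "norm y < t")
   case True
   have "ennreal (rho t y * (v (x + y))\<^sup>2) \<le> ennreal (1 / ?N * (v (x + y))\<^sup>2)"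
    by (intro ennreal_leI mult_right_mono rho_le t) auto
   also have "... = ennreal (1 / ?N) * ennreal ((v (x + y))\<^sup>2)"
    using t tent_const_pos[where 'a='a] by (intro ennreal_mult) auto
   finally show ?thesis using True by (simp add: dist_norm)
  qed (use t rho_eq_0[OF t, of y] in simp)
 qed
 also have "... = (\<integral>\<^sup>+y. ennreal (1 / ?N) * (ennreal ((v y)\<^sup>2) * indicator (ball x t) y))"
  by (rule nn_integral_lborel_shift[where f="\<lambda>y. ennreal (1 / ?N) * (ennreal ((v y)\<^sup>2) * indicator (ball x t) y)"]) measurable
 also have "... = ennreal (1 / ?N) * (\<integral>\<^sup>+y\<in>ball x t. ennreal ((v y)\<^sup>2) \<partial>lborel)"
  by (rule nn_integral_cmult) measurable
 finally show ?thesis by (simp add: m_def)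
qed

text \<open>Envelope for the error kernels: of size \<open>t powr - (n + s)\<close> up to distance
  \<open>t\<close>, and farther out with one more power of decay than \<open>kr s\<close>, paid for
  by the factor \<open>t\<close>.\<close>

definition mt :: "real \<Rightarrow> real \<Rightarrow> 'a::euclidean_space \<Rightarrow> real" where
 "mt s t z = t / (t + norm z) powr (real DIM('a) + s + 1)"

lemma mt_measurable [measurable]: "mt s t \<in> borel_measurable borel"
 unfolding mt_def by measurable

lemma mt_nonneg [simp]: "0 < t \<Longrightarrow> 0 \<le> mt s t z"
 by (simp add: mt_def)

section \<open>Pointwise comparison of truncations with averages\<close>

lemma powr_diff_bound:
 fixes a b q p :: real
 assumes q: "0 < q" "q \<le> a" "q \<le> b" and p: "0 < p"
 shows "\<bar>a powr - p - b powr - p\<bar> \<le> p * q powr (- p - 1) * \<bar>a - b\<bar>"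
proof -
 have "norm (a powr - p - b powr - p) \<le> (p * q powr (- p - 1)) * norm (a - b)"
 proof (rule field_differentiable_bound[of "{q..}"])
  fix z assume z: "z \<in> {q..}"
  then have z0: "0 < z" using q by simp
  show "((\<lambda>z. z powr - p) has_field_derivative (- p * z powr (- p - 1))) (at z within {q..})"
   using z0 by (auto intro!: derivative_eq_intros)
  show "norm (- p * z powr (- p - 1)) \<le> p * q powr (- p - 1)"
   using z q p by (auto simp: abs_mult intro!: powr_mono2')
 qed (use q in auto)
 then show ?thesis by simp
qed

lemma kr_diff_bound:
 fixes v y :: "'a::euclidean_space"
 assumes t: "0 < t" "norm y \<le> t" "2 * t \<le> norm v" and s: "0 < s"
 shows "\<bar>kr s v - kr s (v - y)\<bar> \<le> (real DIM('a) + s) * 2 powr (real DIM('a) + s + 1) * t * norm v powr - (real DIM('a) + s + 1)"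
proof -
 let ?p = "real DIM('a) + s"
 have p: "0 < ?p" using s by (simp add: add_nonneg_pos)
 have b: "norm v / 2 \<le> norm (v - y)" using norm_triangle_ineq2[of v y] t by linarith
 have v: "0 < norm v / 2" using t by linarith
 have "kr s v - kr s (v - y) = norm v powr - ?p - norm (v - y) powr - ?p" by (simp only: kr_def powr_minus_divide)
 also have "\<bar>...\<bar> \<le> ?p * (norm v / 2) powr (- ?p - 1) * \<bar>norm v - norm (v - y)\<bar>"
  using v b by (intro powr_diff_bound p) auto
 also have "... \<le> ?p * (norm v / 2) powr (- ?p - 1) * t"
 proof (intro mult_left_mono mult_nonneg_nonneg)
  have "\<bar>norm v - norm (v - y)\<bar> \<le> norm y" using norm_triangle_ineq3[of v "v - y"] by simp
  then show "\<bar>norm v - norm (v - y)\<bar> \<le> t" using t by linarith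
 qed (use p in auto)
 also have "(norm v / 2) powr (- ?p - 1) = 2 powr (?p + 1) * norm v powr - (?p + 1)"
 proof -
  have "- ?p - 1 = - (?p + 1)" by simp
  moreover have "(norm v / 2) powr - (?p + 1) = norm v powr - (?p + 1) / 2 powr - (?p + 1)" by (rule powr_divide)
  moreover have "2 powr - (?p + 1) = 1 / 2 powr (?p + 1)" by (rule powr_minus_divide)
  ultimately show ?thesis by simp
 qed
 finally show ?thesis by (simp add: mult_ac)
qed

text \<open>The kernel of \<open>Te s t - Pt t \<circ> Te s \<delta>\<close>, up to sign.\<close>

lemma kernel_bound:
 assumes s: "0 < s" "s < 1"
 obtains C where "0 < C"
  "\<And>\<delta> t (v::'a::euclidean_space). 0 < \<delta> \<Longrightarrow> \<delta> < t \<Longrightarrow>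
   \<bar>kr s v * indicator {z. t < norm z} v + (\<integral>y. kr s (y::'a) * indicator {z. \<delta> < norm z} y) * rho t v
    - (\<integral>y. rho t y * (kr s (v - y) * indicator {z. \<delta> < norm z} (v - y)))\<bar> \<le> C * mt s t v"
proof -
 let ?n = "real DIM('a)"
 let ?p = "?n + s"
 let ?R = "tent_const TYPE('a)"
 have R: "0 < ?R" by (rule tent_const_pos)
 have p: "0 < ?p" using s by (simp add: add_nonneg_pos)
 define A where "A = kr_const TYPE('a) (- (1 - s)) + kr_const TYPE('a) s"
 have A: "0 \<le> A" unfolding A_def by (intro add_nonneg_nonneg kr_const_nonneg)
 define C1 where "C1 = (1 + A / ?R) * 3 powr (?p + 1)"
 define C2 where "C2 = ?p * 2 powr (?p + 1) * (3/2) powr (?p + 1)"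
 have C1: "0 < C1" using A R by (auto simp: C1_def intro!: mult_pos_pos add_pos_nonneg)
 have C2: "0 < C2" using p by (simp add: C2_def)
 show ?thesis
 proof (rule that)
  show "0 < C1 + C2" using C1 C2 by simp
  fix \<delta> t :: real and v :: 'a
  assume d: "0 < \<delta>" and dt: "\<delta> < t"
  have t: "0 < t" using d dt by simp
  define K where "K y = kr s y * indicator {z. \<delta> < norm z} y" for y :: 'a
  have [measurable]: "K \<in> borel_measurable borel" unfolding K_def by measurable
  have iK: "integrable lborel K" and sK: "sqint K" unfolding K_def using Te_kernel[OF d s(1)] by auto
  have K0: "0 \<le> K y" for y by (simp add: K_def)
  have irK: "integrable lborel (\<lambda>y. rho t y * K (v - y))"
   using sqint_prod_integrable[OF rho_sqint[OF t] sqint_affine[OF sK, of "-1" v]] by simp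
  let ?k = "kr s v * indicator {z. t < norm z} v + (\<integral>y. K y) * rho t v - (\<integral>y. rho t y * K (v - y))"
  have "\<bar>?k\<bar> \<le> (C1 + C2) * mt s t v"
  \<comment> \<open>Within distance \<open>2 * t\<close> only sizes matter, except that the singular
    truncated kernel has to be paired with differences of \<open>rho\<close>. Farther out the kernel
    is compared with its own average over a ball of radius \<open>t\<close>.\<close>
  proof (cases "norm v \<le> 2 * t")
   case True
   have k1: "\<bar>kr s v * indicator {z. t < norm z} v\<bar> \<le> 1 / t powr ?p"
   proof (cases "t < norm v")
    case True
    then have "kr s v \<le> 1 / t powr ?p" unfolding kr_def using t p by (intro divide_left_mono powr_mono2 mult_pos_pos) auto
    then show ?thesis using True by simp
   qed simp
   have irK': "integrable lborel (\<lambda>y. rho t (v - y) * K y)" using integrable_lborel_reflect[OF irK, of v] by simp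
   have "(\<integral>y. rho t y * K (v - y)) = (\<integral>y. rho t (v - y) * K y)"
    using integral_lborel_reflect[of "\<lambda>y. rho t y * K (v - y)" v] by simp
   \<comment> \<open>The mass of \<open>K\<close> blows up as \<open>\<delta>\<close> tends to zero.
     Combined with the convolution it becomes an integral of \<open>K\<close> against
     \<open>rho t v - rho t (v - y)\<close>, and the Lipschitz bound on \<open>rho\<close> makes the
     estimate uniform in \<open>\<delta>\<close>.\<close>
   then have "(\<integral>y. K y) * rho t v - (\<integral>y. rho t y * K (v - y)) = (\<integral>y. K y * rho t v - rho t (v - y) * K y)"
    using iK irK' by simp
   also have "\<bar>...\<bar> \<le> (\<integral>y. \<bar>K y * rho t v - rho t (v - y) * K y\<bar>)" by (rule integral_abs_bound)
   finally have "ennreal \<bar>(\<integral>y. K y) * rho t v - (\<integral>y. rho t y * K (v - y))\<bar> \<le> ennreal (\<integral>y. \<bar>K y * rho t v - rho t (v - y) * K y\<bar>)"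
    by (rule ennreal_leI)
   also have "... = (\<integral>\<^sup>+y. ennreal \<bar>K y * rho t v - rho t (v - y) * K y\<bar>)"
    using iK irK' by (intro nn_integral_eq_integral[symmetric]) auto
   also have "... \<le> (\<integral>\<^sup>+(y::'a). ennreal (1 / (?R * t ^ DIM('a)) * (1 / t)) * (ennreal (kr (- (1 - s)) y) * indicator {y. norm y < t} y) + ennreal (1 / (?R * t ^ DIM('a))) * (ennreal (kr s y) * indicator {y. t \<le> norm y} y))"
   proof (rule nn_integral_mono)
    fix y :: 'a
    have "\<bar>K y * rho t v - rho t (v - y) * K y\<bar> = K y * \<bar>rho t v - rho t (v - y)\<bar>"
    proof -
     have "K y * rho t v - rho t (v - y) * K y = K y * (rho t v - rho t (v - y))" by (simp add: right_diff_distrib)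
     then show ?thesis using K0[of y] by (simp add: abs_mult)
    qed
    also have "... \<le> kr s y * (min 1 (norm y / t) / (?R * t ^ DIM('a)))"
     using rho_diff[OF t, of v "v - y"] by (intro mult_mono) (auto simp: K_def indicator_def)
    finally have le: "\<bar>K y * rho t v - rho t (v - y) * K y\<bar> \<le> kr s y * (min 1 (norm y / t) / (?R * t ^ DIM('a)))" .
    show "ennreal \<bar>K y * rho t v - rho t (v - y) * K y\<bar> \<le> ennreal (1 / (?R * t ^ DIM('a)) * (1 / t)) * (ennreal (kr (- (1 - s)) y) * indicator {y. norm y < t} y) + ennreal (1 / (?R * t ^ DIM('a))) * (ennreal (kr s y) * indicator {y. t \<le> norm y} y)"
    proof (cases "norm y < t")
     case yt: True
     have "norm y * kr s y = kr (- (1 - s)) y"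
     proof (cases "y = 0")
      case False then show ?thesis using kr_mult_norm[of y 1 s] by simp
     qed simp
     moreover have "kr s y * (norm y / t / (?R * t ^ DIM('a))) = 1 / (?R * t ^ DIM('a)) * (1 / t) * (norm y * kr s y)" by (simp add: mult.commute)
     moreover have "min 1 (norm y / t) = norm y / t" using yt t by (simp add: min_def)
     ultimately have "kr s y * (min 1 (norm y / t) / (?R * t ^ DIM('a))) = 1 / (?R * t ^ DIM('a)) * (1 / t) * kr (- (1 - s)) y"
      by (simp only:)
     then show ?thesis using le yt t R by (simp add: ennreal_mult[symmetric] ennreal_leI)
    next
     case yt: False
     have "kr s y * (min 1 (norm y / t) / (?R * t ^ DIM('a))) = 1 / (?R * t ^ DIM('a)) * kr s y"
      using yt t by (simp add: min_def)
     then show ?thesis using le yt t R by (simp add: ennreal_mult[symmetric] ennreal_leI)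
    qed
   qed
   also have "... = ennreal (1 / (?R * t ^ DIM('a)) * (1 / t)) * (\<integral>\<^sup>+y\<in>{y. norm y < t}. ennreal (kr (- (1 - s)) (y::'a)) \<partial>lborel) + ennreal (1 / (?R * t ^ DIM('a))) * (\<integral>\<^sup>+y\<in>{y. t \<le> norm y}. ennreal (kr s (y::'a)) \<partial>lborel)"
    by (subst nn_integral_add) (auto simp: nn_integral_cmult)
   also have "... \<le> ennreal (1 / (?R * t ^ DIM('a)) * (1 / t)) * ennreal (kr_const TYPE('a) (- (1 - s)) * t powr (1 - s)) + ennreal (1 / (?R * t ^ DIM('a))) * ennreal (kr_const TYPE('a) s * t powr - s)"
    using s t by (intro add_mono mult_left_mono kr_core kr_tail) auto
   also have "... = ennreal (1 / (?R * t ^ DIM('a)) * (1 / t) * (kr_const TYPE('a) (- (1 - s)) * t powr (1 - s)) + 1 / (?R * t ^ DIM('a)) * (kr_const TYPE('a) s * t powr - s))"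
    using t R kr_const_nonneg[where 'a='a, of s] kr_const_nonneg[where 'a='a, of "- (1 - s)"]
    by (subst ennreal_plus) (auto simp: ennreal_mult[symmetric] simp del: ennreal_plus)
   also have "1 / (?R * t ^ DIM('a)) * (1 / t) * (kr_const TYPE('a) (- (1 - s)) * t powr (1 - s)) + 1 / (?R * t ^ DIM('a)) * (kr_const TYPE('a) s * t powr - s) = (A / ?R) * (1 / t powr ?p)"
   proof -
    have "t powr (1 - s) = t * t powr - s" using t by (simp add: powr_diff powr_minus divide_inverse)
    moreover have "1 / t powr ?p = t powr - s / t ^ DIM('a)" using t by (simp add: powr_add powr_realpow powr_minus divide_inverse)
    ultimately show ?thesis using t by (simp add: A_def add_divide_distrib distrib_right distrib_left mult_ac)
   qed
   finally have k2: "\<bar>(\<integral>y. K y) * rho t v - (\<integral>y. rho t y * K (v - y))\<bar> \<le> (A / ?R) * (1 / t powr ?p)"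
    using A R by (subst (asm) ennreal_le_iff) auto
   have "\<bar>?k\<bar> \<le> (1 + A / ?R) * (1 / t powr ?p)" using k1 k2 unfolding distrib_right by linarith
   also have "1 / t powr ?p \<le> 3 powr (?p + 1) * mt s t v"
   proof -
    have "(t + norm v) powr (?p + 1) \<le> (3 * t) powr (?p + 1)" using True t p by (intro powr_mono2) auto
    also have "... = 3 powr (?p + 1) * (t powr ?p * t)" using t by (simp add: powr_mult powr_add)
    finally have "t / (3 powr (?p + 1) * (t powr ?p * t)) \<le> t / (t + norm v) powr (?p + 1)"
    proof (intro divide_left_mono)
     have "0 < t + norm v" using t by (intro add_pos_nonneg) auto
     then show "0 < 3 powr (?p + 1) * (t powr ?p * t) * (t + norm v) powr (?p + 1)"
      using t by (intro mult_pos_pos) auto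
    qed (use t in auto)
    then have "3 powr (?p + 1) * (t / (3 powr (?p + 1) * (t powr ?p * t))) \<le> 3 powr (?p + 1) * (t / (t + norm v) powr (?p + 1))"
     by (intro mult_left_mono) auto
    then show ?thesis using t by (simp add: mt_def)
   qed
   finally have "\<bar>?k\<bar> \<le> C1 * mt s t v"
    using A R by (simp add: C1_def mult.assoc mult_left_mono add_nonneg_nonneg)
   also have "... \<le> (C1 + C2) * mt s t v" using C2 t by (intro mult_right_mono) auto
   finally show ?thesis .
  next
   case False
   then have v: "2 * t \<le> norm v" "t < norm v" "0 < norm v" using t by auto
   have r0: "rho t v = 0" using v t by (intro rho_eq_0) auto
   have i1: "indicator {z. t < norm z} v = (1::real)" using v(2) by (simp only: indicator_simps mem_Collect_eq)
   have "?k = (\<integral>y. rho t (y::'a) * kr s v) - (\<integral>y. rho t y * K (v - y))"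
    by (simp add: i1 r0 rho_integral(2)[OF t])
   also have "... = (\<integral>y. rho t y * kr s v - rho t y * K (v - y))"
    using irK rho_integral[OF t, where 'a='a] by simp
   also have "\<bar>...\<bar> \<le> (\<integral>y. \<bar>rho t y * kr s v - rho t y * K (v - y)\<bar>)" by (rule integral_abs_bound)
   also have "... \<le> (\<integral>y. rho t (y::'a) * (?p * 2 powr (?p + 1) * t * norm v powr - (?p + 1)))"
   proof (rule integral_mono)
    show "integrable lborel (\<lambda>y. \<bar>rho t y * kr s v - rho t y * K (v - y)\<bar>)"
     using irK rho_integral[OF t, where 'a='a] by simp
    show "integrable lborel (\<lambda>y. rho t (y::'a) * (?p * 2 powr (?p + 1) * t * norm v powr - (?p + 1)))"
     using rho_integral[OF t, where 'a='a] by simp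
    fix y :: 'a
    show "\<bar>rho t y * kr s v - rho t y * K (v - y)\<bar> \<le> rho t y * (?p * 2 powr (?p + 1) * t * norm v powr - (?p + 1))"
    proof (cases "norm y < t")
     case True
     \<comment> \<open>Since \<open>norm v \<ge> 2 * t\<close> and \<open>norm y < t\<close>, the
       point \<open>v - y\<close> stays beyond distance \<open>t\<close>, so the inner truncation is
       invisible here.\<close>
     have "\<delta> < norm (v - y)" using norm_triangle_ineq2[of v y] True v dt by linarith
     then have "\<bar>rho t y * kr s v - rho t y * K (v - y)\<bar> = rho t y * \<bar>kr s v - kr s (v - y)\<bar>"
      using t by (simp add: K_def abs_mult flip: right_diff_distrib)
     also have "... \<le> rho t y * (?p * 2 powr (?p + 1) * t * norm v powr - (?p + 1))"
      using t True v s by (intro mult_left_mono kr_diff_bound) auto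
     finally show ?thesis .
    qed (use rho_eq_0[OF t, of y] in simp)
   qed
   also have "... = ?p * 2 powr (?p + 1) * t * norm v powr - (?p + 1)"
    using rho_integral[OF t, where 'a='a] by simp
   also have "... \<le> C2 * mt s t v"
   proof -
    have "(t + norm v) powr (?p + 1) \<le> (3/2 * norm v) powr (?p + 1)" using v t p by (intro powr_mono2) auto
    also have "... = (3/2) powr (?p + 1) * norm v powr (?p + 1)" by (rule powr_mult) 
    finally have le: "(t + norm v) powr (?p + 1) \<le> (3/2) powr (?p + 1) * norm v powr (?p + 1)" .
    have "0 < t + norm v" using t by (intro add_pos_nonneg) auto
    then have "t / ((3/2) powr (?p + 1) * norm v powr (?p + 1)) \<le> mt s t v"
     unfolding mt_def using le t v by (intro divide_left_mono mult_pos_pos) auto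
    then have "?p * 2 powr (?p + 1) * (3/2) powr (?p + 1) * (t / ((3/2) powr (?p + 1) * norm v powr (?p + 1))) \<le> C2 * mt s t v"
     unfolding C2_def using p by (intro mult_left_mono) auto
    moreover have "X * Y * T * (t / (T * Z)) = X * Y * t * (1 / Z)" if "T \<noteq> 0" for X Y T Z :: real using that by simp
    ultimately show ?thesis by (simp only: powr_minus_divide) simp
   qed
   also have "... \<le> (C1 + C2) * mt s t v" using C1 t by (intro mult_right_mono) auto
   finally show ?thesis .
  qed
  then show "\<bar>kr s v * indicator {z. t < norm z} v + (\<integral>y. kr s (y::'a) * indicator {z. \<delta> < norm z} y) * rho t v
    - (\<integral>y. rho t y * (kr s (v - y) * indicator {z. \<delta> < norm z} (v - y)))\<bar> \<le> (C1 + C2) * mt s t v"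
   by (simp add: K_def)
 qed
qed

text \<open>A Cotlar type inequality: truncation at scale \<open>t\<close> is nearly the average at
  scale \<open>t\<close> of any finer truncation. The bound is independent of
  \<open>\<delta>\<close>, so the finer truncation may later be replaced by its limit in the
  mean.\<close>

lemma Te_Pt_bound:
 assumes s: "0 < s" "s < 1"
 obtains C where "0 < C"
  "\<And>(w :: 'a::euclidean_space \<Rightarrow> real) x \<delta> t. sqint w \<Longrightarrow> 0 < \<delta> \<Longrightarrow> \<delta> < t \<Longrightarrow>
   ennreal \<bar>Te s t w x - Pt t (Te s \<delta> w) x\<bar> \<le> ennreal C * (\<integral>\<^sup>+z. ennreal (mt s t z * \<bar>w (x + z) - w x\<bar>))"
proof -
 obtain C where C: "0 < C" "\<And>\<delta> t (v::'a). 0 < \<delta> \<Longrightarrow> \<delta> < t \<Longrightarrow>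
   \<bar>kr s v * indicator {z. t < norm z} v + (\<integral>y. kr s (y::'a) * indicator {z. \<delta> < norm z} y) * rho t v
    - (\<integral>y. rho t y * (kr s (v - y) * indicator {z. \<delta> < norm z} (v - y)))\<bar> \<le> C * mt s t v"
  using kernel_bound[OF s] by blast
 show ?thesis
 proof (rule that[OF C(1)])
  fix w :: "'a \<Rightarrow> real" and x :: 'a and \<delta> t :: real assume w: "sqint w" and d: "0 < \<delta>" and dt: "\<delta> < t"
  have t: "0 < t" using d dt by simp
  note [measurable] = sqint_measurable[OF w]
  define K where "K y = kr s y * indicator {z. \<delta> < norm z} y" for y :: 'a
  let ?r = "\<lambda>v. \<integral>y. rho t y * K (v - y)"
  define H where "H y = kr s y * indicator {z. t < norm z} y" for y :: 'a
  have [measurable]: "K \<in> borel_measurable borel" "H \<in> borel_measurable borel" unfolding K_def H_def by measurable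
  have iK: "integrable lborel K" and sK: "sqint K" unfolding K_def using Te_kernel[OF d s(1)] by auto
  have iH: "integrable lborel H" and sH: "sqint H" unfolding H_def using Te_kernel[OF t s(1)] by auto
  have K0: "0 \<le> K y" for y by (simp add: K_def)
  \<comment> \<open>\<open>TK\<close> annihilates constants, so everything can be written through
    increments from \<open>x\<close>; these are what finite energy at the point \<open>x\<close>
    controls.\<close>
  define D where "D z = w (x + z) - w x" for z
  have [measurable]: "D \<in> borel_measurable borel" unfolding D_def by measurable
  define a where "a = (\<integral>y. K y)"
  have iD: "integrable lborel (\<lambda>v. D v * g (v - y))" if "sqint g" "integrable lborel g" for g y
  proof -
   have "integrable lborel (\<lambda>v. w (x + v) * g (v - y) - w x * g (v - y))"
    using sqint_prod_integrable[OF sqint_shift_left[OF w, of x] sqint_affine[OF that(1), of 1 "- y"]] integrable_lborel_shift[OF that(2), of "- y"]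
    by (intro Bochner_Integration.integrable_diff integrable_mult_right) simp_all
   then show ?thesis by (simp add: D_def left_diff_distrib)
  qed
  have irD: "integrable lborel (\<lambda>v. D v * rho t v)"
   using iD[of "rho t" 0] rho_sqint[OF t] rho_integral[OF t] by simp
  have iHD: "integrable lborel (\<lambda>v. D v * H v)" using iD[of H 0] iH sH by simp
  have TeD: "Te s \<delta> w (x + y) = a * D y - (\<integral>v. D v * K (v - y))" for y
  proof -
   have "Te s \<delta> w (x + y) = (\<integral>z. (w (x + y) - w (x + y + z)) * K z)" by (simp add: Te_def TK_def K_def)
   also have "... = (\<integral>v. (w (x + y) - w (x + v)) * K (v - y))"
    using integral_lborel_shift[of "\<lambda>z. (w (x + y) - w (x + y + z)) * K z" "- y"] by (simp add: algebra_simps)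
   also have "... = (\<integral>v. D y * K (v - y) - D v * K (v - y))"
    by (intro Bochner_Integration.integral_cong) (simp_all add: D_def algebra_simps)
   also have "... = D y * (\<integral>v. K (v - y)) - (\<integral>v. D v * K (v - y))"
    using iD[OF sK iK] integrable_lborel_shift[OF iK, of "- y"] by simp
   also have "(\<integral>v. K (v - y)) = a" using integral_lborel_shift[of K "- y"] by (simp add: a_def)
   finally show ?thesis by (simp add: mult.commute)
  qed
  define B where "B = (\<integral>x. (w x)\<^sup>2) + (\<integral>x. (K x)\<^sup>2) + \<bar>w x\<bar> * a"
  have Bb: "(\<integral>v. norm (D v * K (v - y))) \<le> B" for y
  proof -
   have i1: "integrable lborel (\<lambda>v. (w (x + v))\<^sup>2)" using sqint_integrable[OF sqint_shift_left[OF w]] .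
   have i2: "integrable lborel (\<lambda>v. (K (v - y))\<^sup>2)" using integrable_lborel_shift[OF sqint_integrable[OF sK], of "- y"] by simp
   have i3: "integrable lborel (\<lambda>v. \<bar>w x\<bar> * K (v - y))" using integrable_lborel_shift[OF iK, of "- y"] by simp
   have "(\<integral>v. norm (D v * K (v - y))) \<le> (\<integral>v. (w (x + v))\<^sup>2 + (K (v - y))\<^sup>2 + \<bar>w x\<bar> * K (v - y))"
   proof (rule integral_mono)
    fix v
    have "0 \<le> (\<bar>w (x + v)\<bar> - K (v - y))\<^sup>2" by simp
    then have "2 * (\<bar>w (x + v)\<bar> * K (v - y)) \<le> (w (x + v))\<^sup>2 + (K (v - y))\<^sup>2" by (simp add: power2_diff)
    moreover have "0 \<le> \<bar>w (x + v)\<bar> * K (v - y)" using K0 by simp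
    moreover have "norm (D v * K (v - y)) \<le> (\<bar>w (x + v)\<bar> + \<bar>w x\<bar>) * K (v - y)"
     unfolding D_def real_norm_def abs_mult using K0[of "v - y"] by (intro mult_mono) auto
    ultimately show "norm (D v * K (v - y)) \<le> (w (x + v))\<^sup>2 + (K (v - y))\<^sup>2 + \<bar>w x\<bar> * K (v - y)"
     by (simp add: distrib_right)
   qed (intro integrable_norm iD[OF sK iK] Bochner_Integration.integrable_add i1 i2 i3)+
   also have "... = (\<integral>v. (w (x + v))\<^sup>2) + (\<integral>v. (K (v - y))\<^sup>2) + (\<integral>v. \<bar>w x\<bar> * K (v - y))"
    using i1 i2 i3 by simp
   also have "... = B"
    using integral_lborel_shift[of "\<lambda>v. (w v)\<^sup>2" x] integral_lborel_shift[of "\<lambda>v. (K v)\<^sup>2" "- y"] integral_lborel_shift[of K "- y"]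
    by (simp add: B_def a_def)
   finally show ?thesis .
  qed
  have iF: "integrable lborel2 (\<lambda>(y, v). rho t y * (D v * K (v - y)))"
  proof (rule lborel_pair.Fubini_integrable)
   show "(\<lambda>(y, v). rho t y * (D v * K (v - y))) \<in> borel_measurable lborel2" by measurable
   show "AE y in lborel. integrable lborel (\<lambda>v. case (y, v) of (y, v) \<Rightarrow> rho t y * (D v * K (v - y)))"
    using iD[OF sK iK] by simp
   show "integrable lborel (\<lambda>y. \<integral>v. norm (case (y, v) of (y, v) \<Rightarrow> rho t y * (D v * K (v - y))))"
   proof (rule Bochner_Integration.integrable_bound[OF integrable_mult_left[OF rho_integral(1)[OF t], of B]])
    show "AE y in lborel. norm (\<integral>v. norm (case (y, v) of (y, v) \<Rightarrow> rho t y * (D v * K (v - y)))) \<le> norm (rho t y * B)"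
    proof (rule AE_I2, goal_cases)
     case (1 y)
     have "(\<integral>v. norm (rho t y * (D v * K (v - y)))) = rho t y * (\<integral>v. norm (D v * K (v - y)))"
      using t by (simp add: abs_mult mult.assoc)
     also have "... \<le> rho t y * B" using t by (intro mult_left_mono Bb) auto
     also have "... \<le> norm (rho t y * B)" by simp
     finally show ?case
      by (simp only: split) simp
    qed
   qed measurable
  qed
  have "Pt t (Te s \<delta> w) x = (\<integral>y. rho t y * (a * D y) - rho t y * (\<integral>v. D v * K (v - y)))"
   unfolding Pt_def TeD right_diff_distrib ..
  also have "... = (\<integral>y. a * (D y * rho t y) - (\<integral>v. rho t y * (D v * K (v - y))))"
  proof (rule Bochner_Integration.integral_cong[OF refl])
   fix y
   show "rho t y * (a * D y) - rho t y * (\<integral>v. D v * K (v - y)) = a * (D y * rho t y) - (\<integral>v. rho t y * (D v * K (v - y)))"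
    by (subst integral_mult_right_zero) (simp add: mult_ac)
  qed
  also have "... = a * (\<integral>y. D y * rho t y) - (\<integral>y. (\<integral>v. rho t y * (D v * K (v - y))))"
   using irD lborel_pair.integrable_fst'[OF iF] by simp
  also have "(\<integral>y. (\<integral>v. rho t y * (D v * K (v - y)))) = (\<integral>v. (\<integral>y. rho t y * (D v * K (v - y))))"
   using lborel_pair.Fubini_integral[OF iF] by simp
  also have "... = (\<integral>v. D v * ?r v)"
  proof (rule Bochner_Integration.integral_cong[OF refl])
   fix v
   have "(\<integral>y. rho t y * (D v * K (v - y))) = (\<integral>y. D v * (rho t y * K (v - y)))" by (simp add: mult_ac)
   then show "(\<integral>y. rho t y * (D v * K (v - y))) = D v * ?r v" by simp
  qed
  finally have P: "Pt t (Te s \<delta> w) x = a * (\<integral>y. D y * rho t y) - (\<integral>v. D v * ?r v)" .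
  have iL: "integrable lborel (\<lambda>v. D v * ?r v)"
  proof -
   have "integrable lborel (\<lambda>v. \<integral>y. rho t y * (D v * K (v - y)))"
    using lborel_pair.integrable_snd[OF iF] by simp
   moreover have "(\<integral>y. rho t y * (D v * K (v - y))) = D v * ?r v" for v
   proof -
    have "(\<integral>y. rho t y * (D v * K (v - y))) = (\<integral>y. D v * (rho t y * K (v - y)))" by (simp add: mult_ac)
    then show ?thesis by simp
   qed
   ultimately show ?thesis by simp
  qed
  have T: "Te s t w x = - (\<integral>v. D v * H v)"
  proof -
   have "Te s t w x = (\<integral>z. - (D z * H z))"
    unfolding Te_def TK_def by (intro Bochner_Integration.integral_cong) (simp_all add: D_def H_def algebra_simps)
   then show ?thesis by simp
  qed
  let ?k = "\<lambda>v. H v + a * rho t v - ?r v"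
  have "Te s t w x - Pt t (Te s \<delta> w) x = - (\<integral>v. D v * H v + a * (D v * rho t v) - D v * ?r v)"
   unfolding T P using iHD irD iL by simp
  also have "(\<lambda>v. D v * H v + a * (D v * rho t v) - D v * ?r v) = (\<lambda>v. D v * ?k v)"
   by (simp add: fun_eq_iff algebra_simps)
  finally have e: "Te s t w x - Pt t (Te s \<delta> w) x = - (\<integral>v. D v * ?k v)" .
  have iDk: "integrable lborel (\<lambda>v. D v * ?k v)"
  proof -
   have "integrable lborel (\<lambda>v. D v * H v + a * (D v * rho t v) - D v * ?r v)"
    using iHD irD iL by simp
   then show ?thesis by (simp add: algebra_simps)
  qed
  have "ennreal \<bar>Te s t w x - Pt t (Te s \<delta> w) x\<bar> = ennreal (norm (\<integral>v. D v * ?k v))" unfolding e by simp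
  also have "... \<le> (\<integral>\<^sup>+v. ennreal (norm (D v * ?k v)))"
   by (rule integral_norm_bound_ennreal[OF iDk])
  also have "... \<le> (\<integral>\<^sup>+v. ennreal C * ennreal (mt s t v * \<bar>w (x + v) - w x\<bar>))"
  proof (rule nn_integral_mono, goal_cases)
   case (1 v)
   have "\<bar>?k v\<bar> \<le> C * mt s t v" using C(2)[OF d dt, of v] by (simp add: K_def H_def a_def)
   then have "norm (D v * ?k v) \<le> \<bar>D v\<bar> * (C * mt s t v)" unfolding real_norm_def abs_mult by (rule mult_left_mono) simp
   then show ?case
    using C(1) t by (simp add: D_def ennreal_mult[symmetric] ennreal_leI mult_ac)
  qed
  also have "... = ennreal C * (\<integral>\<^sup>+v. ennreal (mt s t v * \<bar>w (x + v) - w x\<bar>))"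
   by (rule nn_integral_cmult) measurable
  finally show "ennreal \<bar>Te s t w x - Pt t (Te s \<delta> w) x\<bar> \<le> ennreal C * (\<integral>\<^sup>+z. ennreal (mt s t z * \<bar>w (x + z) - w x\<bar>))" .
 qed
qed

lemma ennreal_combine:
 fixes A T U X Y Z P :: ennreal
 assumes "T \<le> X + Y" "U = Z" "A \<le> T + U"
 shows "A \<le> Z + (X + (Y + P))"
proof -
 have "A \<le> (X + Y) + Z" using assms by (metis add_right_mono order_trans)
 also have "... \<le> ((X + Y) + Z) + P" by (rule add_increasing2) simp_all
 also have "... = Z + (X + (Y + P))" by (simp add: add_ac)
 finally show ?thesis .
qed

lemma two_mult_le: "a * b \<le> a\<^sup>2 + b\<^sup>2" for a b :: real
proof -
 have "0 \<le> (a - b)\<^sup>2" "0 \<le> (a + b)\<^sup>2" by simp_all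
 then show ?thesis by (simp add: power2_eq_square algebra_simps)
qed

text \<open>Weighted Cauchy-Schwarz against the energy density
  \<open>(D z)\<^sup>2 * kr (2 * s) z\<close>: close to the origin the energy is small, farther away
  the envelope carries a factor \<open>t\<close>.\<close>

lemma mt_integral_small:
 fixes D :: "'a::euclidean_space \<Rightarrow> real"
 assumes s: "0 < s" and [measurable]: "D \<in> borel_measurable borel" and D0: "D 0 = 0"
  and fin: "(\<integral>\<^sup>+z. ennreal ((D z)\<^sup>2 * kr (2 * s) z)) < \<infinity>" and e: "0 < e"
 shows "eventually (\<lambda>t. (\<integral>\<^sup>+z. ennreal (mt s t z * \<bar>D z\<bar>)) \<le> ennreal e) (at_right 0)"
proof -
 let ?k = "\<lambda>z. (D z)\<^sup>2 * kr (2 * s) z"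
 let ?n = "real DIM('a)"
 define V where "V = measure lborel (ball (0::'a) 1)"
 define c where "c = kr_const TYPE('a) 2"
 have c: "0 \<le> c" unfolding c_def by (rule kr_const_nonneg)
 have V: "0 \<le> V" by (simp add: V_def)
 define G where "G = enn2real (\<integral>\<^sup>+z. ennreal (?k z))"
 have G: "(\<integral>\<^sup>+z. ennreal (?k z)) = ennreal G" "0 \<le> G" using fin by (auto simp: G_def)
 \<comment> \<open>\<open>V + c\<close> bounds the integral of the weight \<open>U\<close> below for
   every \<open>t\<close>, so that part is at most \<open>e / 3\<close>. The local energy enters
   with \<open>1 / \<theta>\<close> and must therefore be below \<open>\<theta> * (e / 3)\<close>,
   which determines the radius \<open>\<eta>\<close>.\<close>
 define \<theta> where "\<theta> = e / (3 * (V + c + 1))"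
 have th: "0 < \<theta>" "\<theta> * (V + c) \<le> e / 3" using e V c by (auto simp: \<theta>_def field_simps add_pos_nonneg)
 define g where "g k = (\<integral>\<^sup>+z. ennreal (?k z) * indicator {z. norm z < 1 / real (Suc k)} z)" for k
 have "g \<longlonglongrightarrow> (\<integral>\<^sup>+(z::'a). 0)"
  unfolding g_def
 proof (rule nn_integral_dominated_convergence[where w="\<lambda>z. ennreal (?k z)"])
  show "AE z in lborel. (\<lambda>k. ennreal (?k z) * indicator {z. norm z < 1 / real (Suc k)} z) \<longlonglongrightarrow> 0"
  proof (rule AE_I2, goal_cases)
   case (1 z)
   show ?case
   proof (cases "z = 0")
    case False
    have "(\<lambda>k. 1 / real (Suc k)) \<longlonglongrightarrow> 0" by (rule LIMSEQ_Suc[OF lim_1_over_n])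
    then have "eventually (\<lambda>k. 1 / real (Suc k) < norm z) sequentially"
     using False by (intro order_tendstoD) auto
    then have "eventually (\<lambda>k. ennreal (?k z) * indicator {z. norm z < 1 / real (Suc k)} z = 0) sequentially"
     by eventually_elim (auto simp: indicator_def)
    then show ?thesis by (rule tendsto_eventually)
   qed simp
  qed
 qed (use fin in \<open>auto simp: indicator_def\<close>)
 then have "g \<longlonglongrightarrow> 0" by simp
 moreover have "0 < \<theta> * (e / 3)" using th e by simp
 then have "0 < ennreal (\<theta> * (e / 3))" by simp
 ultimately have "eventually (\<lambda>k. g k < ennreal (\<theta> * (e / 3))) sequentially"
  by (intro order_tendstoD)
 then obtain k where k: "g k < ennreal (\<theta> * (e / 3))" by (auto simp: eventually_sequentially)
 define \<eta> where "\<eta> = 1 / real (Suc k)"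
 have eta: "0 < \<eta>" by (simp add: \<eta>_def)
 define C3 where "C3 = G + c * \<eta> powr - 2"
 have C3: "0 \<le> C3" using G c by (simp add: C3_def)
 have main: "(\<integral>\<^sup>+z. ennreal (mt s t z * \<bar>D z\<bar>)) \<le> ennreal e" if t: "0 < t" and t3: "t * C3 \<le> e / 3" for t
 proof -
  \<comment> \<open>\<open>?f1\<close> is the local energy, \<open>?f2\<close> and
    \<open>?f3\<close> bound the weight inside and outside \<open>ball 0 t\<close>, and
    \<open>?f4\<close>, \<open>?f5\<close> come from the region beyond
    \<open>\<eta>\<close>.\<close>
  let ?f1 = "\<lambda>z::'a. ennreal (1 / \<theta>) * (ennreal (?k z) * indicator {z. norm z < \<eta>} z)"
  let ?f2 = "\<lambda>z::'a. ennreal (\<theta> / t ^ DIM('a)) * indicator (ball 0 t) z"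
  let ?f3 = "\<lambda>z::'a. ennreal (\<theta> * t\<^sup>2) * (ennreal (kr 2 z) * indicator {z. t \<le> norm z} z)"
  let ?f4 = "\<lambda>z::'a. ennreal t * ennreal (?k z)"
  let ?f5 = "\<lambda>z::'a. ennreal t * (ennreal (kr 2 z) * indicator {z. \<eta> \<le> norm z} z)"
  have "(\<integral>\<^sup>+z. ennreal (mt s t z * \<bar>D z\<bar>)) \<le> (\<integral>\<^sup>+z. ?f1 z + (?f2 z + (?f3 z + (?f4 z + ?f5 z))))"
  proof (rule nn_integral_mono)
   fix z :: 'a
   show "ennreal (mt s t z * \<bar>D z\<bar>) \<le> ?f1 z + (?f2 z + (?f3 z + (?f4 z + ?f5 z)))"
   proof (cases "z = 0")
    case True then show ?thesis by (simp add: D0)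
   next
    case False
    then have z: "0 < norm z" by simp
    have tz: "0 < t + norm z" using t z by (rule add_pos_pos)
    show ?thesis
    proof (cases "norm z < \<eta>")
     case near: True
     \<comment> \<open>The square of the envelope divided by \<open>kr (2 * s) z\<close>, so that
       \<open>mt s t z * \<bar>D z\<bar>\<close> is \<open>sqrt U\<close> times the square root of
       the energy density.\<close>
     define U where "U = (mt s t z)\<^sup>2 * norm z powr (?n + 2 * s)"
     have "(mt s t z)\<^sup>2 * norm z powr (?n + 2 * s) \<le> (mt s t z)\<^sup>2 * (t + norm z) powr (?n + 2 * s)"
      using t z s by (intro mult_left_mono powr_mono2) auto
     also have "... = t\<^sup>2 * ((t + norm z) powr (?n + 2 * s) / ((t + norm z) powr (?n + s + 1) * (t + norm z) powr (?n + s + 1)))"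
      by (simp add: mt_def power2_eq_square)
     also have "(t + norm z) powr (?n + s + 1) * (t + norm z) powr (?n + s + 1) = (t + norm z) powr (?n + 2 * s) * (t + norm z) powr (?n + 2)"
      by (simp only: powr_add[symmetric]) (rule arg_cong[where f="\<lambda>e. (t + norm z) powr e"], simp)
     finally have U: "U \<le> t\<^sup>2 / (t + norm z) powr (?n + 2)" using tz by (simp add: U_def)
     have "mt s t z * \<bar>D z\<bar> = (sqrt \<theta> * sqrt U) * (sqrt (1 / \<theta>) * sqrt (?k z))"
     proof -
      have "sqrt U * sqrt (?k z) = sqrt ((mt s t z * \<bar>D z\<bar>)\<^sup>2 * (norm z powr (?n + 2 * s) * kr (2 * s) z))"
       by (simp add: U_def real_sqrt_mult[symmetric] power_mult_distrib mult_ac)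
      also have "norm z powr (?n + 2 * s) * kr (2 * s) z = 1" using z by (simp add: kr_def)
      finally have "sqrt U * sqrt (?k z) = mt s t z * \<bar>D z\<bar>" using t by simp
      moreover have "sqrt \<theta> * sqrt (1 / \<theta>) = 1" using th by (simp add: real_sqrt_mult[symmetric])
      moreover have "(sqrt \<theta> * sqrt U) * (sqrt (1 / \<theta>) * sqrt (?k z)) = (sqrt \<theta> * sqrt (1 / \<theta>)) * (sqrt U * sqrt (?k z))" by (simp only: mult_ac)
      ultimately show ?thesis by (simp only: mult_1)
     qed
     also have "... \<le> (sqrt \<theta> * sqrt U)\<^sup>2 + (sqrt (1 / \<theta>) * sqrt (?k z))\<^sup>2" by (rule two_mult_le)
     also have "... = \<theta> * U + (1 / \<theta>) * (?k z)"
      using th by (simp add: power_mult_distrib U_def)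
     finally have le: "mt s t z * \<bar>D z\<bar> \<le> \<theta> * U + (1 / \<theta>) * (?k z)" .
     have "ennreal (\<theta> * U) \<le> ?f2 z + ?f3 z"
     proof (cases "norm z < t")
      case True
      have "(t + norm z) powr (?n + 2) \<ge> t powr (?n + 2)" using t z by (intro powr_mono2) auto
      then have "t\<^sup>2 / (t + norm z) powr (?n + 2) \<le> t\<^sup>2 / t powr (?n + 2)" using t tz by (intro divide_left_mono mult_pos_pos) auto
      also have "... = 1 / t ^ DIM('a)" using t by (simp add: powr_add powr_realpow)
      finally have "\<theta> * U \<le> \<theta> * (1 / t ^ DIM('a))" using U th by (intro mult_left_mono) auto
      then show ?thesis using True by (simp add: ennreal_leI add_increasing2)
     next
      case False
      have "(t + norm z) powr (?n + 2) \<ge> norm z powr (?n + 2)" using t z by (intro powr_mono2) auto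
      then have "t\<^sup>2 / (t + norm z) powr (?n + 2) \<le> t\<^sup>2 / norm z powr (?n + 2)" using z tz by (intro divide_left_mono mult_pos_pos) auto
      then have "\<theta> * U \<le> \<theta> * (t\<^sup>2 * kr 2 z)" using U th by (intro mult_left_mono) (auto simp: kr_def)
      then show ?thesis using False th t by (simp add: ennreal_leI ennreal_mult[symmetric] mult.assoc)
     qed
     moreover have "ennreal ((1 / \<theta>) * (?k z)) = ?f1 z" using near th by (simp add: ennreal_mult[symmetric])
     moreover have "ennreal (mt s t z * \<bar>D z\<bar>) \<le> ennreal (\<theta> * U) + ennreal ((1 / \<theta>) * (?k z))"
     proof -
      have "0 \<le> U" by (simp add: U_def)
      then show ?thesis using le th by (subst ennreal_plus[symmetric]) (auto intro!: ennreal_leI mult_nonneg_nonneg simp del: ennreal_plus)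
     qed
     ultimately show ?thesis by (intro ennreal_combine)
    next
     case far: False
     have "mt s t z \<le> t * kr (s + 1) z"
     proof -
      have "(t + norm z) powr (?n + s + 1) \<ge> norm z powr (?n + s + 1)" using t z s by (intro powr_mono2) auto
      then have "t / (t + norm z) powr (?n + s + 1) \<le> t / norm z powr (?n + s + 1)" using t z tz by (intro divide_left_mono mult_pos_pos) auto
      then show ?thesis by (simp add: mt_def kr_def add.assoc)
     qed
     then have "mt s t z * \<bar>D z\<bar> \<le> t * (kr (s + 1) z * \<bar>D z\<bar>)" by (simp add: mult.assoc[symmetric] mult_right_mono)
     also have "kr (s + 1) z * \<bar>D z\<bar> = sqrt (?k z) * sqrt (kr 2 z)"
     proof -
      have "kr (2 * s) z * kr 2 z = (kr (s + 1) z)\<^sup>2"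
      proof -
       have "norm z powr (?n + 2 * s) * norm z powr (?n + 2) = norm z powr (?n + (s + 1)) * norm z powr (?n + (s + 1))"
        by (simp only: powr_add[symmetric]) (rule arg_cong[where f="\<lambda>e. norm z powr e"], simp)
       then show ?thesis by (simp add: kr_def power2_eq_square)
      qed
      then have "sqrt (?k z) * sqrt (kr 2 z) = sqrt ((D z)\<^sup>2 * (kr (s + 1) z)\<^sup>2)"
       by (simp add: real_sqrt_mult[symmetric] mult.assoc)
      then show ?thesis by (auto simp add: real_sqrt_mult)
     qed
     also have "... \<le> (D z)\<^sup>2 * kr (2 * s) z + kr 2 z"
      using two_mult_le[of "sqrt (?k z)" "sqrt (kr 2 z)"] by simp
     finally have "ennreal (mt s t z * \<bar>D z\<bar>) \<le> ennreal (t * (?k z) + t * kr 2 z)"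
      using t by (intro ennreal_leI) (simp add: distrib_left)
     also have "... = ?f4 z + ?f5 z" using far t by (simp add: ennreal_mult[symmetric])
     also have "... \<le> ?f1 z + (?f2 z + (?f3 z + (?f4 z + ?f5 z)))" by (rule add_increasing[OF _ add_increasing[OF _ add_increasing[OF _ order_refl]]]) simp_all
     finally show ?thesis .
    qed
   qed
  qed
  also have "... = (\<integral>\<^sup>+z. ?f1 z) + ((\<integral>\<^sup>+z. ?f2 z) + ((\<integral>\<^sup>+z. ?f3 z) + ((\<integral>\<^sup>+z. ?f4 z) + (\<integral>\<^sup>+z. ?f5 z))))"
  proof -
   have [measurable]: "ball (0::'a) t \<in> sets borel" by simp
   show ?thesis by (simp add: nn_integral_add)
  qed
  also have "... \<le> ennreal (e / 3) + (ennreal (\<theta> * V) + (ennreal (\<theta> * c) + (ennreal (t * G) + ennreal (t * (c * \<eta> powr - 2)))))"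
  proof (intro add_mono)
   have "(\<integral>\<^sup>+z. ?f1 z) = ennreal (1 / \<theta>) * g k" unfolding g_def \<eta>_def by (rule nn_integral_cmult) measurable
   also have "... \<le> ennreal (1 / \<theta>) * ennreal (\<theta> * (e / 3))" using k by (intro mult_left_mono) auto
   also have "... = ennreal (e / 3)" using th e by (simp add: ennreal_mult[symmetric])
   finally show "(\<integral>\<^sup>+z. ?f1 z) \<le> ennreal (e / 3)" .
   have "(\<integral>\<^sup>+z. ?f2 z) = ennreal (\<theta> / t ^ DIM('a)) * emeasure lborel (ball (0::'a) t)" by (rule nn_integral_cmult_indicator) simp
   also have "emeasure lborel (ball (0::'a) t) = ennreal (t ^ DIM('a) * V)"
    using t by (simp add: V_def emeasure_ball content_ball mult.commute)
   also have "ennreal (\<theta> / t ^ DIM('a)) * ennreal (t ^ DIM('a) * V) = ennreal (\<theta> * V)" using t th V by (simp add: ennreal_mult[symmetric])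
   finally show "(\<integral>\<^sup>+z. ?f2 z) \<le> ennreal (\<theta> * V)" by simp
   have "(\<integral>\<^sup>+z. ?f3 z) = ennreal (\<theta> * t\<^sup>2) * (\<integral>\<^sup>+z\<in>{z. t \<le> norm z}. ennreal (kr 2 (z::'a)) \<partial>lborel)" by (rule nn_integral_cmult) measurable
   also have "... \<le> ennreal (\<theta> * t\<^sup>2) * ennreal (c * t powr - 2)" unfolding c_def using t by (intro mult_left_mono kr_tail) auto
   also have "... = ennreal (\<theta> * c)" 
   proof -
    have "t powr - 2 = 1 / t\<^sup>2" using t by (simp add: powr_minus_divide)
    then show ?thesis using t th c by (simp add: ennreal_mult[symmetric])
   qed
   finally show "(\<integral>\<^sup>+z. ?f3 z) \<le> ennreal (\<theta> * c)" .
   have "(\<integral>\<^sup>+z. ?f4 z) = ennreal t * ennreal G" unfolding G(1)[symmetric] by (rule nn_integral_cmult) measurable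
   then show "(\<integral>\<^sup>+z. ?f4 z) \<le> ennreal (t * G)" using t G by (simp add: ennreal_mult)
   have "(\<integral>\<^sup>+z. ?f5 z) = ennreal t * (\<integral>\<^sup>+z\<in>{z. \<eta> \<le> norm z}. ennreal (kr 2 (z::'a)) \<partial>lborel)" by (rule nn_integral_cmult) measurable
   also have "... \<le> ennreal t * ennreal (c * \<eta> powr - 2)" unfolding c_def using eta by (intro mult_left_mono kr_tail) auto
   also have "... = ennreal (t * (c * \<eta> powr - 2))" using t c by (simp add: ennreal_mult)
   finally show "(\<integral>\<^sup>+z. ?f5 z) \<le> ennreal (t * (c * \<eta> powr - 2))" .
  qed
  also have "... = ennreal (e / 3 + (\<theta> * V + (\<theta> * c + (t * G + t * (c * \<eta> powr - 2)))))"
   using e th V c t G by (simp add: ennreal_plus[symmetric] add_nonneg_nonneg del: ennreal_plus)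
  also have "... \<le> ennreal e"
  proof (rule ennreal_leI)
   have "\<theta> * V + \<theta> * c \<le> e / 3" using th by (simp add: distrib_left)
   moreover have "t * G + t * (c * \<eta> powr - 2) \<le> e / 3" using t3 by (simp add: C3_def distrib_left)
   ultimately show "e / 3 + (\<theta> * V + (\<theta> * c + (t * G + t * (c * \<eta> powr - 2)))) \<le> e" by linarith
  qed
  finally show ?thesis .
 qed
 show ?thesis
  unfolding eventually_at_right_field
 proof (intro exI[of _ "e / (3 * (C3 + 1))"] conjI allI impI)
  show "0 < e / (3 * (C3 + 1))" using e C3 by simp
  fix t :: real assume t: "0 < t" "t < e / (3 * (C3 + 1))"
  then have "t * (3 * (C3 + 1)) < e" using C3 by (simp add: pos_less_divide_eq)
  then have "t * C3 \<le> e / 3" using t by (simp add: algebra_simps)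
  then show "(\<integral>\<^sup>+z. ennreal (mt s t z * \<bar>D z\<bar>)) \<le> ennreal e" using t by (intro main)
 qed
qed

text \<open>The restriction \<open>t \<le> 1\<close> makes the envelope, of size
  \<open>t powr - (n + s)\<close> on the ball, dominate the mollifier, of size
  \<open>t powr - n\<close>. With \<open>mt_integral_small\<close> this replaces Lebesgue
  differentiation for functions of finite energy.\<close>

lemma Pt_bound:
 assumes s: "0 < s"
 obtains C where "0 < C" "\<And>(v :: 'a::euclidean_space \<Rightarrow> real) x t. sqint v \<Longrightarrow> 0 < t \<Longrightarrow> t \<le> 1 \<Longrightarrow>
   ennreal \<bar>Pt t v x - v x\<bar> \<le> ennreal C * (\<integral>\<^sup>+z. ennreal (mt s t z * \<bar>v (x + z) - v x\<bar>))"
proof -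
 let ?p = "real DIM('a) + s + 1"
 let ?R = "tent_const TYPE('a)"
 define C where "C = 2 powr ?p / ?R"
 have C: "0 < C" using tent_const_pos[where 'a='a] by (simp add: C_def)
 show ?thesis
 proof (rule that[OF C])
  fix v :: "'a \<Rightarrow> real" and x :: 'a and t :: real assume v: "sqint v" and t: "0 < t" "t \<le> 1"
  note [measurable] = sqint_measurable[OF v]
  have le: "rho t z \<le> C * mt s t z" for z :: 'a
  proof (cases "norm z < t")
   case True
   have "(t + norm z) powr ?p \<le> (2 * t) powr ?p" using True t s by (intro powr_mono2) auto
   also have "... = 2 powr ?p * (t powr s * t ^ DIM('a) * t)" using t by (simp add: powr_mult powr_add powr_realpow)
   also have "... \<le> 2 powr ?p * (1 * t ^ DIM('a) * t)" using t s by (intro mult_left_mono mult_right_mono powr_le1) auto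
   finally have le: "(t + norm z) powr ?p \<le> 2 powr ?p * (1 * t ^ DIM('a) * t)" .
   have "0 < t + norm z" using t by (intro add_pos_nonneg) auto
   then have "0 < (t + norm z) powr ?p" by simp
   then have "t / (2 powr ?p * (1 * t ^ DIM('a) * t)) \<le> mt s t z"
    unfolding mt_def using t le by (intro divide_left_mono mult_pos_pos) auto
   then have "C * (t / (2 powr ?p * (1 * t ^ DIM('a) * t))) \<le> C * mt s t z" using C by (intro mult_left_mono) auto
   moreover have "C * (t / (2 powr ?p * (1 * t ^ DIM('a) * t))) = 1 / (?R * t ^ DIM('a))" using t by (simp add: C_def)
   ultimately show ?thesis using rho_le[OF t(1), of z] by linarith
  next
   case False
   then show ?thesis using rho_eq_0[OF t(1), of z] C t by simp
  qed
  have i: "integrable lborel (\<lambda>y. rho t y * (v (x + y) - v x))"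
  proof -
   have "integrable lborel (\<lambda>y. rho t y * v (x + y) - v x * rho t y)"
    using Pt_integrable[OF v t(1)] rho_integral[OF t(1), where 'a='a] by simp
   then show ?thesis by (simp add: algebra_simps)
  qed
  have "Pt t v x - v x = (\<integral>y. rho t y * v (x + y) - v x * rho t y)"
   using Pt_integrable[OF v t(1)] rho_integral[OF t(1), where 'a='a] by (simp add: Pt_def)
  also have "... = (\<integral>y. rho t y * (v (x + y) - v x))"
   by (intro Bochner_Integration.integral_cong) (simp_all add: algebra_simps)
  finally have "ennreal \<bar>Pt t v x - v x\<bar> = ennreal (norm (\<integral>y. rho t y * (v (x + y) - v x)))" by simp
  also have "... \<le> (\<integral>\<^sup>+y. ennreal (norm (rho t y * (v (x + y) - v x))))" by (rule integral_norm_bound_ennreal[OF i])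
  also have "... \<le> (\<integral>\<^sup>+y. ennreal C * ennreal (mt s t y * \<bar>v (x + y) - v x\<bar>))"
  proof (rule nn_integral_mono, goal_cases)
   case (1 y)
   have "norm (rho t y * (v (x + y) - v x)) \<le> (C * mt s t y) * \<bar>v (x + y) - v x\<bar>"
    unfolding real_norm_def abs_mult using le[of y] t by (intro mult_right_mono) auto
   then show ?case
    using C t by (simp add: ennreal_mult[symmetric] ennreal_leI mult_ac)
  qed
  also have "... = ennreal C * (\<integral>\<^sup>+y. ennreal (mt s t y * \<bar>v (x + y) - v x\<bar>))"
   by (rule nn_integral_cmult) measurable
  finally show "ennreal \<bar>Pt t v x - v x\<bar> \<le> ennreal C * (\<integral>\<^sup>+z. ennreal (mt s t z * \<bar>v (x + z) - v x\<bar>))" .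
 qed
qed

text \<open>The covers \<open>T\<close> play the part of an outer measure: the bad sets treated this
  way involve uncountably many scales, so measurability is never asked of \<open>N\<close>
  itself.\<close>

lemma AE_not_in_small:
 assumes "\<And>k::nat. \<exists>T\<in>sets M. N \<subseteq> T \<and> emeasure M T \<le> ennreal (c k)" and c: "c \<longlonglongrightarrow> 0"
 shows "AE x in M. x \<notin> N"
proof -
 obtain T where T: "\<And>k. T k \<in> sets M" "\<And>k. N \<subseteq> T k" "\<And>k. emeasure M (T k) \<le> ennreal (c k)"
  using assms(1) by metis
 have m: "(\<Inter>k. T k) \<in> sets M" using T by auto
 have "emeasure M (\<Inter>k. T k) \<le> ennreal (c k)" for k
  by (rule order_trans[OF emeasure_mono T(3)[of k]]) (use T in auto)
 moreover have "(\<lambda>k. ennreal (c k)) \<longlonglongrightarrow> ennreal 0" by (intro tendsto_ennrealI c)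
 ultimately have "emeasure M (\<Inter>k. T k) \<le> 0"
  by (intro LIMSEQ_le_const[of "\<lambda>k. ennreal (c k)"]) auto
 then have "(\<Inter>k. T k) \<in> null_sets M" using m by auto
 then have "AE x in M. x \<notin> (\<Inter>k. T k)" by (rule AE_not_in)
 then show ?thesis by eventually_elim (use T in auto)
qed

text \<open>Weak type bound for the maximal function of the square, by the Vitali covering lemma for
  balls of radius below one. The conclusion speaks of a Borel cover, because the superlevel set is a
  union over uncountably many \<open>t\<close>.\<close>

lemma Pt_maximal:
 obtains c where "0 < c" "\<And>(v :: 'a::euclidean_space \<Rightarrow> real) \<alpha>. sqint v \<Longrightarrow> 0 < \<alpha> \<Longrightarrow>
   \<exists>T\<in>sets lborel. {x. \<exists>t. 0 < t \<and> t < 1 \<and> \<alpha> < (Pt t v x)\<^sup>2} \<subseteq> T \<and> emeasure lborel T \<le> ennreal (c / \<alpha> * (\<integral>x. (v x)\<^sup>2))"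
proof -
 let ?R = "tent_const TYPE('a)"
 define V where "V = measure lborel (ball (0::'a) 1)"
 have V: "0 < V" unfolding V_def using content_ball_gt_0_iff[of "0::'a" 1] by simp
 have R: "0 < ?R" by (rule tent_const_pos)
 define c where "c = 5 ^ DIM('a) * V / ?R"
 show ?thesis
 proof (rule that)
  show "0 < c" using V R by (simp add: c_def)
  fix v :: "'a \<Rightarrow> real" and \<alpha> :: real assume v: "sqint v" and al: "0 < \<alpha>"
  note [measurable] = sqint_measurable[OF v]
  define S where "S = {x. \<exists>t. 0 < t \<and> t < 1 \<and> \<alpha> < (Pt t v x)\<^sup>2}"
  have "\<exists>r. \<forall>x\<in>S. 0 < r x \<and> r x < 1 \<and> \<alpha> < (Pt (r x) v x)\<^sup>2"
   by (rule bchoice) (auto simp: S_def)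
  then obtain r where r: "\<And>x. x \<in> S \<Longrightarrow> 0 < r x" "\<And>x. x \<in> S \<Longrightarrow> r x < 1" "\<And>x. x \<in> S \<Longrightarrow> \<alpha> < (Pt (r x) v x)\<^sup>2" by blast
  \<comment> \<open>Under the measure with density \<open>(v x)\<^sup>2\<close>, countable
    additivity on the disjoint selected balls sums the local integrals to at most the full
    one.\<close>
  define N where "N = density lborel (\<lambda>x. ennreal ((v x)\<^sup>2))"
  have N: "emeasure N A = (\<integral>\<^sup>+x\<in>A. ennreal ((v x)\<^sup>2) \<partial>lborel)" if "A \<in> sets borel" for A
   unfolding N_def using that by (intro emeasure_density) auto
  have big: "emeasure lborel (cball x (5 * r x)) \<le> ennreal (c / \<alpha>) * emeasure N (cball x (r x))" if x: "x \<in> S" for x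
  proof -
   have rx: "0 < r x" using r x by simp
   have bb: "ball x (r x) \<in> sets borel" "cball x (r x) \<in> sets borel" by auto
   have "ennreal \<alpha> \<le> ennreal ((Pt (r x) v x)\<^sup>2)" using r(3)[OF x] by (intro ennreal_leI) simp
   also have "... \<le> ennreal (1 / (?R * r x ^ DIM('a))) * (\<integral>\<^sup>+y\<in>ball x (r x). ennreal ((v y)\<^sup>2) \<partial>lborel)"
    by (rule Pt_sq[OF v rx])
   also have "(\<integral>\<^sup>+y\<in>ball x (r x). ennreal ((v y)\<^sup>2) \<partial>lborel) \<le> emeasure N (cball x (r x))"
    unfolding N[OF bb(2)] by (intro nn_integral_mono) (auto simp: indicator_def)
   finally have le: "ennreal \<alpha> \<le> ennreal (1 / (?R * r x ^ DIM('a))) * emeasure N (cball x (r x))"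
    by (simp add: mult_left_mono)
   have "emeasure lborel (cball x (5 * r x)) = ennreal (V * (5 * r x) ^ DIM('a))"
    using rx by (simp add: emeasure_cball V_def content_ball)
   also have "... = ennreal (V * (5 * r x) ^ DIM('a) / \<alpha>) * ennreal \<alpha>" using al V rx by (simp add: ennreal_mult[symmetric])
   also have "... \<le> ennreal (V * (5 * r x) ^ DIM('a) / \<alpha>) * (ennreal (1 / (?R * r x ^ DIM('a))) * emeasure N (cball x (r x)))"
    by (intro mult_left_mono le) simp
   also have "... = ennreal (V * (5 * r x) ^ DIM('a) / \<alpha> * (1 / (?R * r x ^ DIM('a)))) * emeasure N (cball x (r x))"
    using al V rx R by (subst ennreal_mult) (auto simp: mult.assoc)
   also have "V * (5 * r x) ^ DIM('a) / \<alpha> * (1 / (?R * r x ^ DIM('a))) = c / \<alpha>"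
    using rx by (simp add: c_def power_mult_distrib mult.commute)
   finally show ?thesis .
  qed
  have cov: "S \<subseteq> (\<Union>i\<in>S. cball i (r i))" using r(1) by force
  have rb: "\<And>i. i \<in> S \<Longrightarrow> 0 < r i \<and> r i \<le> 1" using r(1,2) by (auto intro: less_imp_le)
  obtain C where C: "countable C" "C \<subseteq> S" "pairwise (\<lambda>i j. disjnt (cball i (r i)) (cball j (r j))) C" "S \<subseteq> (\<Union>i\<in>C. cball i (5 * r i))"
   by (rule Vitali_covering_lemma_cballs[where a="\<lambda>x. x", OF cov rb])
  define T where "T = (\<Union>i\<in>C. cball i (5 * r i))"
  have T: "T \<in> sets lborel" unfolding T_def using C(1) by (intro sets.countable_UN') auto
  have "emeasure lborel T = (\<integral>\<^sup>+x. indicator T x)" using T by simp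
  also have "... \<le> (\<integral>\<^sup>+x. (\<integral>\<^sup>+i. indicator (cball i (5 * r i)) x \<partial>count_space C))"
  proof (rule nn_integral_mono, goal_cases)
   case (1 x)
   show ?case
   proof (cases "x \<in> T")
    case True
    then obtain i where "i \<in> C" "x \<in> cball i (5 * r i)" by (auto simp: T_def)
    then show ?thesis using True nn_integral_ge_point[of i C "\<lambda>i. indicator (cball i (5 * r i)) x"] by simp
   qed simp
  qed
  also have "... = (\<integral>\<^sup>+i. (\<integral>\<^sup>+x. indicator (cball i (5 * r i)) x) \<partial>count_space C)"
   by (rule nn_integral_count_space_nn_integral[OF C(1)]) (simp add: borel_measurable_indicator)
  also have "... \<le> (\<integral>\<^sup>+i. ennreal (c / \<alpha>) * emeasure N (cball i (r i)) \<partial>count_space C)"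
   using C(2) by (intro nn_integral_mono) (auto intro!: big)
  also have "... = ennreal (c / \<alpha>) * (\<integral>\<^sup>+i. emeasure N (cball i (r i)) \<partial>count_space C)"
   by (rule nn_integral_cmult) simp
  also have "(\<integral>\<^sup>+i. emeasure N (cball i (r i)) \<partial>count_space C) = emeasure N (\<Union>i\<in>C. cball i (r i))"
   using C by (intro emeasure_UN_countable[symmetric]) (auto simp: N_def disjoint_family_on_def pairwise_def disjnt_def)
  also have "... \<le> emeasure N UNIV" by (intro emeasure_mono) (auto simp: N_def)
  also have "... = (\<integral>\<^sup>+x. ennreal ((v x)\<^sup>2))" by (simp add: N)
  also have "... = ennreal (\<integral>x. (v x)\<^sup>2)" by (rule nn_integral_eq_integral[OF sqint_integrable[OF v]]) simp
  also have "ennreal (c / \<alpha>) * ... = ennreal (c / \<alpha> * (\<integral>x. (v x)\<^sup>2))"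
   using al \<open>0 < c\<close> by (subst ennreal_mult[symmetric]) auto
  finally have "emeasure lborel T \<le> ennreal (c / \<alpha> * (\<integral>x. (v x)\<^sup>2))" by (simp add: mult_left_mono)
  then show "\<exists>T\<in>sets lborel. {x. \<exists>t. 0 < t \<and> t < 1 \<and> \<alpha> < (Pt t v x)\<^sup>2} \<subseteq> T \<and> emeasure lborel T \<le> ennreal (c / \<alpha> * (\<integral>x. (v x)\<^sup>2))"
   using T C(4) unfolding S_def[symmetric] T_def[symmetric] by blast
 qed
qed

section \<open>Almost everywhere convergence of the truncations\<close>

lemma gag_point_finite:
 fixes w :: "'a::euclidean_space \<Rightarrow> real"
 assumes w: "sqint w" and fin: "gag s w < \<infinity>"
 shows "AE x in lborel. (\<integral>\<^sup>+z. ennreal ((w (x + z) - w x)\<^sup>2 * kr (2 * s) z)) < \<infinity>"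
proof -
 let ?k = "\<lambda>x z. (w (x + z) - w x)\<^sup>2 * kr (2 * s) z"
 note [measurable] = sqint_measurable[OF w]
 have "(\<integral>\<^sup>+y. ennreal ((w x - w y)\<^sup>2 * kr (2 * s) (x - y))) = (\<integral>\<^sup>+z. ennreal (?k x z))" for x
  using nn_integral_lborel_shift[where f="\<lambda>y. ennreal ((w x - w y)\<^sup>2 * kr (2 * s) (x - y))" and t=x]
  by (simp add: power2_commute)
 then have "(\<integral>\<^sup>+x. (\<integral>\<^sup>+z. ennreal (?k x z))) = gag s w"
  using gag_eq[OF w, of s] by simp
 then have "(\<integral>\<^sup>+x. (\<integral>\<^sup>+z. ennreal (?k x z))) \<noteq> \<infinity>" using fin by simp
 then have "AE x in lborel. (\<integral>\<^sup>+z. ennreal (?k x z)) \<noteq> \<infinity>"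
  by (intro nn_integral_PInf_AE) auto
 then show ?thesis by eventually_elim (simp add: less_top)
qed

text \<open>A crude bound through the mass of the kernel. Its growth as the truncation is refined is
  harmless, because it is applied at a fixed \<open>\<epsilon>\<close>.\<close>

lemma TK_norm_le:
 fixes v :: "'a::euclidean_space \<Rightarrow> real"
 assumes v: "sqint v" and K: "sqint K" "integrable lborel K" "\<And>z. 0 \<le> K z" "\<And>z. K (- z) = K z"
 shows "(\<integral>x. (TK K v x)\<^sup>2) \<le> 4 * (\<integral>z. K z)\<^sup>2 * (\<integral>x. (v x)\<^sup>2)"
proof -
 note [measurable] = sqint_measurable[OF v] sqint_measurable[OF K(1)]
 define S where "S = 4 * (\<integral>x. (v x)\<^sup>2)"
 have S0: "0 \<le> S" by (simp add: S_def)
 have i: "integrable lborel2 (\<lambda>p. S * (K (fst p) * K (snd p)))"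
  by (intro integrable_mult_right integrable_lborel_pair_mult K)
 have "ennreal (\<integral>x. (TK K v x)\<^sup>2) = (\<integral>\<^sup>+p. ennreal ((1/4) * Bw v (fst p) (snd p) * (K (fst p) * K (snd p))) \<partial>lborel2)"
  by (rule TK_norm[OF v K])
 also have "... \<le> (\<integral>\<^sup>+p. ennreal (S * (K (fst p) * K (snd p))) \<partial>lborel2)"
 proof (rule nn_integral_mono, goal_cases)
  case (1 p)
  have "(1/4) * Bw v (fst p) (snd p) \<le> S"
   using Bw_le[OF v, of "fst p" "snd p"] Nw_le[OF v, of "fst p"] by (simp add: S_def)
  then show ?case
   using K by (intro ennreal_leI mult_right_mono) auto
 qed
 also have "... = ennreal (\<integral>p. S * (K (fst p) * K (snd p)) \<partial>lborel2)"
  using S0 K by (intro nn_integral_eq_integral[OF i]) auto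
 also have "(\<integral>p. S * (K (fst p) * K (snd p)) \<partial>lborel2) = (\<integral>y. (\<integral>z. S * (K y * K z)))"
  using lborel_pair.integral_fst'[OF i, symmetric] by (simp only: fst_conv snd_conv)
 also have "... = S * (\<integral>z. K z)\<^sup>2" by (simp add: power2_eq_square mult.assoc[symmetric])
 finally have "(\<integral>x. (TK K v x)\<^sup>2) \<le> S * (\<integral>z. K z)\<^sup>2"
  using S0 by (subst (asm) ennreal_le_iff) auto
 then show ?thesis by (simp add: S_def mult_ac)
qed

text \<open>\<open>Pt_bound\<close> and \<open>mt_integral_small\<close> are applied to the
  approximants \<open>Te s \<epsilon> w\<close> as well, so these need finite energy. Truncated
  operators commute with translations and are bounded on square integrable functions, hence they
  multiply \<open>Nw\<close> by at most a constant.\<close>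

lemma gag_Te_finite:
 fixes w :: "'a::euclidean_space \<Rightarrow> real"
 assumes w: "sqint w" and s: "0 < s" and e: "0 < \<epsilon>" and fin: "gag s w < \<infinity>"
 shows "gag s (Te s \<epsilon> w) < \<infinity>"
proof -
 note [measurable] = sqint_measurable[OF w]
 define a where "a = (\<integral>z. kr s (z::'a) * indicator {z. \<epsilon> < norm z} z)"
 have "Nw (Te s \<epsilon> w) z \<le> 4 * a\<^sup>2 * Nw w z" for z
 proof -
  have wz: "sqint (\<lambda>x. w (x + z))" "sqint (\<lambda>x. w (x + z) - w x)" using w by (auto intro: sqint_shift sqint_diff)
  have "Te s \<epsilon> w (x + z) - Te s \<epsilon> w x = Te s \<epsilon> (\<lambda>x. w (x + z) - w x) x" for x
   using Te_lin[OF wz(1) w e s, of 1 "-1" x] by (simp add: Te_def TK_def add_ac)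
  then have "Nw (Te s \<epsilon> w) z = (\<integral>x. (Te s \<epsilon> (\<lambda>x. w (x + z) - w x) x)\<^sup>2)" by (simp add: Nw_def)
  also have "... \<le> 4 * a\<^sup>2 * (\<integral>x. (w (x + z) - w x)\<^sup>2)"
   unfolding Te_def a_def by (rule TK_norm_le[OF wz(2) Te_kernel[OF e s]]) (auto simp: indicator_def)
  finally show ?thesis by (simp add: Nw_def)
 qed
 then have "gag s (Te s \<epsilon> w) \<le> (\<integral>\<^sup>+z. ennreal (4 * a\<^sup>2) * ennreal (Nw w z * kr (2 * s) z))"
  unfolding gag_def by (intro nn_integral_mono) (simp add: ennreal_mult[symmetric] mult.assoc[symmetric] ennreal_leI mult_right_mono)
 also have "... = ennreal (4 * a\<^sup>2) * gag s w" unfolding gag_def by (rule nn_integral_cmult) measurable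
 also have "... < \<infinity>" using fin by (simp add: ennreal_mult_less_top)
 finally show ?thesis .
qed

text \<open>The limit in the mean from \<open>Te_limit\<close> is identified as the pointwise limit
  by the density argument behind the Lebesgue differentiation theorem, with the truncations
  \<open>v k\<close> as the approximating good functions.\<close>

proposition Te_AE_limit:
 fixes w :: "'a::euclidean_space \<Rightarrow> real"
 assumes w: "sqint w" and s: "0 < s" "s < 1" and fin: "gag s w < \<infinity>"
 obtains g where "sqint g" "AE x in lborel. ((\<lambda>t. Te s t w x) \<longlongrightarrow> g x) (at_right 0)"
  "ennreal (\<integral>x. (g x)\<^sup>2) = (\<integral>\<^sup>+p. Qf s w p \<partial>lborel2)"
proof -
 note [measurable] = sqint_measurable[OF w]
 define v where "v k = Te s (1 / real (Suc k)) w" for k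
 obtain g where g: "sqint g" "(\<lambda>k. \<integral>x. (v k x - g x)\<^sup>2) \<longlonglongrightarrow> 0"
  "ennreal (\<integral>x. (g x)\<^sup>2) = (\<integral>\<^sup>+p. Qf s w p \<partial>lborel2)"
  using Te_limit[OF w s(1) fin] unfolding v_def by blast
 note [measurable] = sqint_measurable[OF g(1)]
 define d where "d k = (\<integral>x. (v k x - g x)\<^sup>2)" for k
 have d0: "d \<longlonglongrightarrow> 0" using g(2) by (simp add: d_def[abs_def])
 have vs: "sqint (v k)" for k unfolding v_def using w s by (intro Te_sqint) auto
 note [measurable] = sqint_measurable[OF vs]
 have dsym: "(\<integral>x. (g x - v k x)\<^sup>2) = d k" for k by (simp add: d_def power2_commute)
 define Gd where "Gd u x = (\<integral>\<^sup>+z. ennreal ((u (x + z) - u x)\<^sup>2 * kr (2 * s) z))" for u :: "'a \<Rightarrow> real" and x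
 have good: "AE x in lborel. Gd w x < \<infinity> \<and> (\<forall>k. Gd (v k) x < \<infinity>)"
  unfolding AE_all_countable AE_conj_iff Gd_def
 proof (intro conjI allI)
  show "AE x in lborel. (\<integral>\<^sup>+z. ennreal ((w (x + z) - w x)\<^sup>2 * kr (2 * s) z)) < \<infinity>"
   by (rule gag_point_finite[OF w fin])
  fix k
  have "gag s (v k) < \<infinity>" unfolding v_def using w s fin by (intro gag_Te_finite) auto
  then show "AE x in lborel. (\<integral>\<^sup>+z. ennreal ((v k (x + z) - v k x)\<^sup>2 * kr (2 * s) z)) < \<infinity>"
   by (rule gag_point_finite[OF vs])
 qed
 obtain C where C: "0 < C"
  "\<And>(w :: 'a \<Rightarrow> real) x \<delta> t. sqint w \<Longrightarrow> 0 < \<delta> \<Longrightarrow> \<delta> < t \<Longrightarrow>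
   ennreal \<bar>Te s t w x - Pt t (Te s \<delta> w) x\<bar> \<le> ennreal C * (\<integral>\<^sup>+z. ennreal (mt s t z * \<bar>w (x + z) - w x\<bar>))"
  using Te_Pt_bound[OF s, where 'a='a] by blast
 obtain C' where C': "0 < C'" "\<And>(v :: 'a \<Rightarrow> real) x t. sqint v \<Longrightarrow> 0 < t \<Longrightarrow> t \<le> 1 \<Longrightarrow>
   ennreal \<bar>Pt t v x - v x\<bar> \<le> ennreal C' * (\<integral>\<^sup>+z. ennreal (mt s t z * \<bar>v (x + z) - v x\<bar>))"
  using Pt_bound[OF s(1), where 'a='a] by blast
 obtain c where c: "0 < c" "\<And>(v :: 'a \<Rightarrow> real) \<alpha>. sqint v \<Longrightarrow> 0 < \<alpha> \<Longrightarrow>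
   \<exists>T\<in>sets lborel. {x. \<exists>t. 0 < t \<and> t < 1 \<and> \<alpha> < (Pt t v x)\<^sup>2} \<subseteq> T \<and> emeasure lborel T \<le> ennreal (c / \<alpha> * (\<integral>x. (v x)\<^sup>2))"
  using Pt_maximal[where 'a='a] by blast
 \<comment> \<open>Let \<open>\<delta> = 1 / (k + 1)\<close> tend to zero in
   \<open>Te_Pt_bound\<close> at fixed \<open>t\<close>; by \<open>Pt_sq\<close>, convergence in the
   mean implies convergence of the averages at each point.\<close>
 have TeP: "ennreal \<bar>Te s t w x - Pt t g x\<bar> \<le> ennreal C * (\<integral>\<^sup>+z. ennreal (mt s t z * \<bar>w (x + z) - w x\<bar>))" if t: "0 < t" for t x
 proof -
  have "(\<lambda>k. (Pt t (v k) x - Pt t g x)\<^sup>2) \<longlonglongrightarrow> 0"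
  proof (rule tendsto_sandwich[OF _ _ tendsto_const])
   let ?c = "1 / (tent_const TYPE('a) * t ^ DIM('a))"
   have c0: "0 \<le> ?c" using t tent_const_pos[where 'a='a] by simp
   show "eventually (\<lambda>k. (Pt t (v k) x - Pt t g x)\<^sup>2 \<le> ?c * d k) sequentially"
   proof (intro always_eventually allI)
    fix k
    have "ennreal ((Pt t (v k) x - Pt t g x)\<^sup>2) = ennreal ((Pt t (\<lambda>x. v k x - g x) x)\<^sup>2)"
     using Pt_diff[OF vs g(1) t] by simp
    also have "... \<le> ennreal ?c * (\<integral>\<^sup>+y\<in>ball x t. ennreal ((v k y - g y)\<^sup>2) \<partial>lborel)"
     by (rule Pt_sq[OF sqint_diff[OF vs g(1)] t])
    also have "... \<le> ennreal ?c * (\<integral>\<^sup>+y. ennreal ((v k y - g y)\<^sup>2))"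
     by (intro mult_left_mono nn_integral_mono) (auto simp: indicator_def)
    also have "(\<integral>\<^sup>+y. ennreal ((v k y - g y)\<^sup>2)) = ennreal (d k)"
     unfolding d_def by (rule nn_integral_eq_integral[OF sqint_integrable[OF sqint_diff[OF vs g(1)]]]) simp
    also have "ennreal ?c * ennreal (d k) = ennreal (?c * d k)" using c0 by (intro ennreal_mult[symmetric]) (auto simp: d_def)
    finally show "(Pt t (v k) x - Pt t g x)\<^sup>2 \<le> ?c * d k" using c0 by (subst (asm) ennreal_le_iff) (auto simp: d_def)
   qed
   show "(\<lambda>k. ?c * d k) \<longlonglongrightarrow> 0" using tendsto_mult_left[OF d0, of ?c] by simp
  qed simp
  then have "(\<lambda>k. sqrt ((Pt t (v k) x - Pt t g x)\<^sup>2)) \<longlonglongrightarrow> sqrt 0" by (rule tendsto_real_sqrt)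
  then have "(\<lambda>k. Pt t (v k) x - Pt t g x) \<longlonglongrightarrow> 0" by (simp add: tendsto_rabs_zero_iff)
  then have "(\<lambda>k. Pt t (v k) x) \<longlonglongrightarrow> Pt t g x" by (simp add: LIM_zero_iff)
  then have lim: "(\<lambda>k. ennreal \<bar>Te s t w x - Pt t (v k) x\<bar>) \<longlonglongrightarrow> ennreal \<bar>Te s t w x - Pt t g x\<bar>"
   by (intro tendsto_ennrealI tendsto_intros)
  have "(\<lambda>k. 1 / real (Suc k)) \<longlonglongrightarrow> 0" by (rule LIMSEQ_Suc[OF lim_1_over_n])
  then have "eventually (\<lambda>k. 1 / real (Suc k) < t) sequentially" using t by (intro order_tendstoD)
  then have "eventually (\<lambda>k. ennreal \<bar>Te s t w x - Pt t (v k) x\<bar> \<le> ennreal C * (\<integral>\<^sup>+z. ennreal (mt s t z * \<bar>w (x + z) - w x\<bar>))) sequentially"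
   by eventually_elim (unfold v_def, rule C(2)[OF w], auto)
  then show ?thesis by (rule tendsto_upperbound[OF lim]) simp
 qed
 \<comment> \<open>The factor \<open>4\<close> counts the links from \<open>Te s t w x\<close>
   through \<open>Pt t g x\<close>, \<open>Pt t (v k) x\<close> and \<open>v k x\<close> to
   \<open>g x\<close>. Two of them are small for every \<open>x\<close> of finite energy; the other
   two fail only on sets whose measure tends to zero with \<open>k\<close>.\<close>
 define Bad where "Bad e = {x. Gd w x < \<infinity> \<and> (\<forall>k. Gd (v k) x < \<infinity>) \<and> \<not> eventually (\<lambda>t. \<bar>Te s t w x - g x\<bar> \<le> 4 * e) (at_right 0)}" for e :: real
 have sub: "Bad e \<subseteq> {x. \<exists>t. 0 < t \<and> t < 1 \<and> e\<^sup>2 < (Pt t (\<lambda>x. g x - v k x) x)\<^sup>2} \<union> {x. e\<^sup>2 \<le> (g x - v k x)\<^sup>2}" if e: "0 < e" for e k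
 proof
  fix x assume x: "x \<in> Bad e"
  show "x \<in> {x. \<exists>t. 0 < t \<and> t < 1 \<and> e\<^sup>2 < (Pt t (\<lambda>x. g x - v k x) x)\<^sup>2} \<union> {x. e\<^sup>2 \<le> (g x - v k x)\<^sup>2}"
  proof (rule ccontr)
   assume n: "\<not> ?thesis"
   then have P: "\<bar>Pt t (\<lambda>x. g x - v k x) x\<bar> \<le> e" if "0 < t" "t < 1" for t
   proof -
    from n have "\<not> (0 < t \<and> t < 1 \<and> e\<^sup>2 < (Pt t (\<lambda>x. g x - v k x) x)\<^sup>2)" by blast
    then have "(Pt t (\<lambda>x. g x - v k x) x)\<^sup>2 \<le> e\<^sup>2" using that by linarith
    then have "\<bar>Pt t (\<lambda>x. g x - v k x) x\<bar> \<le> \<bar>e\<bar>" by (simp only: abs_le_square_iff)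
    then show ?thesis using e by simp
   qed
   have gv: "\<bar>g x - v k x\<bar> \<le> e"
   proof -
    have "(g x - v k x)\<^sup>2 \<le> e\<^sup>2" using n by (auto simp: not_le)
    then have "\<bar>g x - v k x\<bar> \<le> \<bar>e\<bar>" by (simp only: abs_le_square_iff)
    then show ?thesis using e by simp
   qed
   have ev1: "eventually (\<lambda>t. (\<integral>\<^sup>+z. ennreal (mt s t z * \<bar>w (x + z) - w x\<bar>)) \<le> ennreal (e / C)) (at_right 0)"
    using x e C by (intro mt_integral_small s) (auto simp: Bad_def Gd_def)
   have ev2: "eventually (\<lambda>t. (\<integral>\<^sup>+z. ennreal (mt s t z * \<bar>v k (x + z) - v k x\<bar>)) \<le> ennreal (e / C')) (at_right 0)"
    using x e C' by (intro mt_integral_small s) (auto simp: Bad_def Gd_def)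
   have ev3: "eventually (\<lambda>t::real. t < 1) (at_right 0)" by (auto simp: eventually_at_right_field intro: exI[of _ 1])
   have ev4: "eventually (\<lambda>t::real. 0 < t) (at_right 0)" by (simp add: eventually_at_right_less)
   have "eventually (\<lambda>t. \<bar>Te s t w x - g x\<bar> \<le> 4 * e) (at_right 0)"
    using ev1 ev2 ev3 ev4
   proof eventually_elim
    case (elim t)
    have "ennreal \<bar>Te s t w x - Pt t g x\<bar> \<le> ennreal C * ennreal (e / C)"
     by (rule order_trans[OF TeP]) (use elim in \<open>auto intro: mult_left_mono\<close>)
    also have "... = ennreal e" using C e by (simp add: ennreal_mult[symmetric])
    finally have 1: "\<bar>Te s t w x - Pt t g x\<bar> \<le> e" using e by (subst (asm) ennreal_le_iff) auto
    have "ennreal \<bar>Pt t (v k) x - v k x\<bar> \<le> ennreal C' * ennreal (e / C')"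
     by (rule order_trans[OF C'(2)[OF vs]]) (use elim in \<open>auto intro: mult_left_mono\<close>)
    also have "... = ennreal e" using C' e by (simp add: ennreal_mult[symmetric])
    finally have 2: "\<bar>Pt t (v k) x - v k x\<bar> \<le> e" using e by (subst (asm) ennreal_le_iff) auto
    have 3: "\<bar>Pt t g x - Pt t (v k) x\<bar> \<le> e" using P[of t] Pt_diff[OF g(1) vs, of t k x] elim by simp
    show ?case using 1 2 3 gv by linarith
   qed
   then show False using x by (simp add: Bad_def)
  qed
 qed
 have "AE x in lborel. x \<notin> Bad e" if e: "0 < e" for e
 \<comment> \<open>\<open>c\<close> comes from the maximal inequality, the additional
   \<open>1\<close> from Chebyshev's inequality for \<open>g - v k\<close>.\<close>
 proof (rule AE_not_in_small[where c="\<lambda>k. (c + 1) / e\<^sup>2 * d k"])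
  fix k
  obtain T where T: "T \<in> sets lborel" "{x. \<exists>t. 0 < t \<and> t < 1 \<and> e\<^sup>2 < (Pt t (\<lambda>x. g x - v k x) x)\<^sup>2} \<subseteq> T" "emeasure lborel T \<le> ennreal (c / e\<^sup>2 * d k)"
   using c(2)[OF sqint_diff[OF g(1) vs], of "e\<^sup>2" k] e unfolding dsym by auto
  define U where "U = {x \<in> space lborel. e\<^sup>2 \<le> (g x - v k x)\<^sup>2}"
  have U: "U \<in> sets lborel" unfolding U_def by measurable
  have iu: "integrable lborel (\<lambda>x. (g x - v k x)\<^sup>2)" by (rule sqint_integrable[OF sqint_diff[OF g(1) vs]])
  have "ennreal (e\<^sup>2) * emeasure lborel U = (\<integral>\<^sup>+x. ennreal (e\<^sup>2) * indicator U x)"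
   using U by (simp add: nn_integral_cmult_indicator)
  also have "... \<le> (\<integral>\<^sup>+x. ennreal ((g x - v k x)\<^sup>2))"
   by (intro nn_integral_mono) (auto simp: indicator_def U_def ennreal_leI)
  also have "... = ennreal (d k)" using nn_integral_eq_integral[OF iu] by (simp add: dsym)
  finally have "ennreal (1 / e\<^sup>2) * (ennreal (e\<^sup>2) * emeasure lborel U) \<le> ennreal (1 / e\<^sup>2) * ennreal (d k)" by (rule mult_left_mono) simp
  moreover have "ennreal (1 / e\<^sup>2) * ennreal (e\<^sup>2) = 1" using e by (simp add: ennreal_mult[symmetric])
  ultimately have Ule: "emeasure lborel U \<le> ennreal (1 / e\<^sup>2 * d k)"
   using e by (simp add: mult.assoc[symmetric] ennreal_mult[symmetric] d_def)
  show "\<exists>T\<in>sets lborel. Bad e \<subseteq> T \<and> emeasure lborel T \<le> ennreal ((c + 1) / e\<^sup>2 * d k)"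
  proof (intro bexI[of _ "T \<union> U"] conjI)
   show "Bad e \<subseteq> T \<union> U" using sub[OF e, of k] T(2) by (auto simp: U_def)
   have dk: "0 \<le> d k" by (simp add: d_def)
   have "emeasure lborel (T \<union> U) \<le> emeasure lborel T + emeasure lborel U" using T U by (intro emeasure_subadditive) auto
   also have "... \<le> ennreal (c / e\<^sup>2 * d k) + ennreal (1 / e\<^sup>2 * d k)" using T Ule by (intro add_mono) auto
   also have "... = ennreal (c / e\<^sup>2 * d k + 1 / e\<^sup>2 * d k)" using c dk e by (intro ennreal_plus[symmetric]) auto
   also have "c / e\<^sup>2 * d k + 1 / e\<^sup>2 * d k = (c + 1) / e\<^sup>2 * d k" by (simp add: add_divide_distrib distrib_right)
   finally show "emeasure lborel (T \<union> U) \<le> ennreal ((c + 1) / e\<^sup>2 * d k)" .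
  qed (use T U in auto)
 next
  show "(\<lambda>k. (c + 1) / e\<^sup>2 * d k) \<longlonglongrightarrow> 0" using tendsto_mult_left[OF d0, of "(c + 1) / e\<^sup>2"] by simp
 qed
 then have "AE x in lborel. \<forall>m::nat. x \<notin> Bad (1 / real (Suc m))" unfolding AE_all_countable by simp
 with good have "AE x in lborel. ((\<lambda>t. Te s t w x) \<longlongrightarrow> g x) (at_right 0)"
 proof eventually_elim
  case (elim x)
  show ?case
  proof (rule tendstoI)
   fix e :: real assume e: "0 < e"
   obtain m where m: "1 / real (Suc m) < e / 4" using nat_approx_posE[of "e / 4"] e by (auto simp: divide_simps)
   have "x \<notin> Bad (1 / real (Suc m))" using elim(2) by (rule spec)
   then have "eventually (\<lambda>t. \<bar>Te s t w x - g x\<bar> \<le> 4 * (1 / real (Suc m))) (at_right 0)"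
    using elim(1) by (simp add: Bad_def)
   then show "eventually (\<lambda>t. dist (Te s t w x) (g x) < e) (at_right 0)"
   proof eventually_elim
    case (elim t)
    then show ?case using m unfolding dist_real_def by linarith
   qed
  qed
 qed
 with g that show ?thesis by blast
qed

subsection \<open>The energy form\<close>

definition Hsb :: "real \<Rightarrow> ('a::euclidean_space \<Rightarrow> real) \<Rightarrow> bool" where
 "Hsb s w \<longleftrightarrow> sqint w \<and> gag s w < \<infinity>"

text \<open>Taken without the usual normalising factors; they are absorbed in the constant of
  \<open>weak_solution_energy\<close>.\<close>

definition Eb :: "real \<Rightarrow> ('a::euclidean_space \<Rightarrow> real) \<Rightarrow> ('a \<Rightarrow> real) \<Rightarrow> real" where
 "Eb s w v = (\<integral>p. (w (fst p) - w (snd p)) * (v (fst p) - v (snd p)) * kr (2 * s) (fst p - snd p) \<partial>lborel2)"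

lemma Hsb_sqint: "Hsb s w \<Longrightarrow> sqint w"
 by (simp add: Hsb_def)

lemma Hsb_measurable: "Hsb s w \<Longrightarrow> w \<in> borel_measurable borel"
 by (simp add: Hsb_def sqint_def)

lemma gag_pair:
 fixes w :: "'a::euclidean_space \<Rightarrow> real"
 assumes w: "sqint w"
 shows "(\<integral>\<^sup>+p. ennreal ((w (fst p) - w (snd p))\<^sup>2 * kr (2 * s) (fst p - snd p)) \<partial>lborel2) = gag s w"
proof -
 note [measurable] = sqint_measurable[OF w]
 have "(\<integral>\<^sup>+p. ennreal ((w (fst p) - w (snd p))\<^sup>2 * kr (2 * s) (fst p - snd p)) \<partial>lborel2)
  = (\<integral>\<^sup>+x. (\<integral>\<^sup>+y. ennreal ((w (fst (x, y)) - w (snd (x, y)))\<^sup>2 * kr (2 * s) (fst (x, y) - snd (x, y)))))"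
  by (rule lborel.nn_integral_fst[symmetric]) measurable
 then show ?thesis using gag_eq[OF w, of s] by simp
qed

lemma Hsb_integrable_sq:
 assumes w: "Hsb s w"
 shows "integrable lborel2 (\<lambda>p. (w (fst p) - w (snd p))\<^sup>2 * kr (2 * s) (fst p - snd p))"
proof (rule integrableI_nonneg)
 note [measurable] = Hsb_measurable[OF w]
 show "(\<lambda>p. (w (fst p) - w (snd p))\<^sup>2 * kr (2 * s) (fst p - snd p)) \<in> borel_measurable lborel2"
  by measurable
 show "(\<integral>\<^sup>+p. ennreal ((w (fst p) - w (snd p))\<^sup>2 * kr (2 * s) (fst p - snd p)) \<partial>lborel2) < \<infinity>"
  using w gag_pair[of w s] by (simp add: Hsb_def)
qed simp

lemma Hsb_integrable:
 fixes w v :: "'a::euclidean_space \<Rightarrow> real"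
 assumes w: "Hsb s w" and v: "Hsb s v"
 shows "integrable lborel2 (\<lambda>p. (w (fst p) - w (snd p)) * (v (fst p) - v (snd p)) * kr (2 * s) (fst p - snd p))"
proof (rule Bochner_Integration.integrable_bound[OF Bochner_Integration.integrable_add[OF Hsb_integrable_sq[OF w] Hsb_integrable_sq[OF v]]])
 note [measurable] = Hsb_measurable[OF w] Hsb_measurable[OF v]
 show "(\<lambda>p. (w (fst p) - w (snd p)) * (v (fst p) - v (snd p)) * kr (2 * s) (fst p - snd p)) \<in> borel_measurable lborel2"
  by measurable
 show "AE p in lborel2. norm ((w (fst p) - w (snd p)) * (v (fst p) - v (snd p)) * kr (2 * s) (fst p - snd p))
  \<le> norm ((w (fst p) - w (snd p))\<^sup>2 * kr (2 * s) (fst p - snd p) + (v (fst p) - v (snd p))\<^sup>2 * kr (2 * s) (fst p - snd p))"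
 proof (rule AE_I2, goal_cases)
  case (1 p)
  let ?a = "w (fst p) - w (snd p)" let ?b = "v (fst p) - v (snd p)" let ?k = "kr (2 * s) (fst p - snd p)"
  have "\<bar>?a\<bar> * \<bar>?b\<bar> * ?k \<le> (?a\<^sup>2 + ?b\<^sup>2) * ?k"
   using two_mult_le[of "\<bar>?a\<bar>" "\<bar>?b\<bar>"] by (intro mult_right_mono) auto
  then show ?case by (simp add: abs_mult distrib_right)
 qed
qed

lemma Eb_self: "Hsb s w \<Longrightarrow> ennreal (Eb s w w) = gag s w"
proof -
 assume w: "Hsb s w"
 have "gag s w = ennreal (\<integral>p. (w (fst p) - w (snd p))\<^sup>2 * kr (2 * s) (fst p - snd p) \<partial>lborel2)"
  unfolding gag_pair[OF Hsb_sqint[OF w], symmetric] by (rule nn_integral_eq_integral[OF Hsb_integrable_sq[OF w]]) simp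
 then show ?thesis by (simp add: Eb_def power2_eq_square)
qed

lemma Eb_nonneg [simp]: "0 \<le> Eb s w w"
 unfolding Eb_def by (rule Bochner_Integration.integral_nonneg) simp

lemma Eb_commute: "Eb s w v = Eb s v w"
 by (simp add: Eb_def mult_ac)

lemma Hsb_lin:
 fixes w v :: "'a::euclidean_space \<Rightarrow> real"
 assumes w: "Hsb s w" and v: "Hsb s v"
 shows "Hsb s (\<lambda>x. a * w x + b * v x)"
proof -
 have sq: "sqint (\<lambda>x. a * w x + b * v x)" using w v by (intro sqint_lin) (auto simp: Hsb_def)
 have i: "integrable lborel2 (\<lambda>p. a\<^sup>2 * ((w (fst p) - w (snd p))\<^sup>2 * kr (2 * s) (fst p - snd p)) + (2 * a * b) * ((w (fst p) - w (snd p)) * (v (fst p) - v (snd p)) * kr (2 * s) (fst p - snd p)) + b\<^sup>2 * ((v (fst p) - v (snd p))\<^sup>2 * kr (2 * s) (fst p - snd p)))"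
  using Hsb_integrable[OF w v] Hsb_integrable_sq[OF w] Hsb_integrable_sq[OF v] by simp
 have e: "(a * w x + b * v x - (a * w y + b * v y))\<^sup>2 * k = a\<^sup>2 * ((w x - w y)\<^sup>2 * k) + (2 * a * b) * ((w x - w y) * (v x - v y) * k) + b\<^sup>2 * ((v x - v y)\<^sup>2 * k)" for x y k
  by (simp add: power2_eq_square algebra_simps)
 have "gag s (\<lambda>x. a * w x + b * v x) < \<infinity>"
  unfolding gag_pair[OF sq, symmetric] e
  using i by (subst nn_integral_eq_integral) (auto simp: e[symmetric])
 then show ?thesis using sq by (simp add: Hsb_def)
qed

lemma Hsb_diff: "Hsb s w \<Longrightarrow> Hsb s v \<Longrightarrow> Hsb s (\<lambda>x. w x - v x)"
 using Hsb_lin[of s w v 1 "-1"] by simp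

lemma Hsb_add: "Hsb s w \<Longrightarrow> Hsb s v \<Longrightarrow> Hsb s (\<lambda>x. w x + v x)"
 using Hsb_lin[of s w v 1 1] by simp

lemma Hsb_cmult: "Hsb s w \<Longrightarrow> Hsb s (\<lambda>x. a * w x)"
 using Hsb_lin[of s w w a 0] by simp

lemma Eb_lin:
 assumes w: "Hsb s w" and v: "Hsb s v" and u: "Hsb s u"
 shows "Eb s (\<lambda>x. a * w x + b * v x) u = a * Eb s w u + b * Eb s v u"
proof -
 have "Eb s (\<lambda>x. a * w x + b * v x) u = (\<integral>p. a * ((w (fst p) - w (snd p)) * (u (fst p) - u (snd p)) * kr (2 * s) (fst p - snd p)) + b * ((v (fst p) - v (snd p)) * (u (fst p) - u (snd p)) * kr (2 * s) (fst p - snd p)) \<partial>lborel2)"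
  unfolding Eb_def by (intro Bochner_Integration.integral_cong) (simp_all add: algebra_simps)
 also have "... = a * Eb s w u + b * Eb s v u"
  unfolding Eb_def using Hsb_integrable[OF w u] Hsb_integrable[OF v u] by simp
 finally show ?thesis .
qed

lemma Eb_diff: "Hsb s w \<Longrightarrow> Hsb s v \<Longrightarrow> Hsb s u \<Longrightarrow> Eb s (\<lambda>x. w x - v x) u = Eb s w u - Eb s v u"
 using Eb_lin[of s w v u 1 "-1"] by simp

lemma Eb_sq_lin:
 assumes w: "Hsb s w" and v: "Hsb s v"
 shows "Eb s (\<lambda>x. a * w x + b * v x) (\<lambda>x. a * w x + b * v x) = a\<^sup>2 * Eb s w w + 2 * a * b * Eb s w v + b\<^sup>2 * Eb s v v"
proof -
 let ?u = "\<lambda>x. a * w x + b * v x"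
 have "Eb s ?u ?u = a * Eb s w ?u + b * Eb s v ?u" by (rule Eb_lin[OF w v Hsb_lin[OF w v]])
 also have "Eb s w ?u = a * Eb s w w + b * Eb s v w" unfolding Eb_commute[of s w ?u] by (rule Eb_lin[OF w v w])
 also have "Eb s v ?u = a * Eb s w v + b * Eb s v v" unfolding Eb_commute[of s v ?u] by (rule Eb_lin[OF w v v])
 finally show ?thesis by (simp add: Eb_commute[of s v w] power2_eq_square algebra_simps)
qed

text \<open>Polarisation of the norm identity. It applies because almost everywhere limits are
  additive and unique up to null sets, so the limits for \<open>w\<close>, \<open>v\<close> and
  \<open>w + v\<close> are compatible.\<close>

lemma Te_inner:
 assumes s: "0 < s" "s < 1"
 obtains C where "0 < C" "\<And>w :: 'a::euclidean_space \<Rightarrow> real. Hsb s w \<Longrightarrow>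
   \<exists>g. sqint g \<and> (AE x in lborel. ((\<lambda>t. Te s t w x) \<longlongrightarrow> g x) (at_right 0))"
  "\<And>(w :: 'a \<Rightarrow> real) v g h. Hsb s w \<Longrightarrow> Hsb s v \<Longrightarrow> sqint g \<Longrightarrow> sqint h \<Longrightarrow>
   (AE x in lborel. ((\<lambda>t. Te s t w x) \<longlongrightarrow> g x) (at_right 0)) \<Longrightarrow> (AE x in lborel. ((\<lambda>t. Te s t v x) \<longlongrightarrow> h x) (at_right 0)) \<Longrightarrow>
   (\<integral>x. g x * h x) = C * Eb s w v"
proof -
 obtain C where C: "0 < C" "\<And>w :: 'a \<Rightarrow> real. sqint w \<Longrightarrow> gag s w < \<infinity> \<Longrightarrow>
  (\<integral>\<^sup>+p. Qf s w p \<partial>lborel2) = ennreal C * gag s w"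
  using Qf_gag[OF s] by blast
 have ex: "\<exists>g. sqint g \<and> (AE x in lborel. ((\<lambda>t. Te s t w x) \<longlongrightarrow> g x) (at_right 0)) \<and> (\<integral>x. (g x)\<^sup>2) = C * Eb s w w"
  if w: "Hsb s w" for w :: "'a \<Rightarrow> real"
 proof -
  have w': "sqint w" "gag s w < \<infinity>" using w by (auto simp: Hsb_def)
  obtain g where g: "sqint g" "AE x in lborel. ((\<lambda>t. Te s t w x) \<longlongrightarrow> g x) (at_right 0)"
   "ennreal (\<integral>x. (g x)\<^sup>2) = (\<integral>\<^sup>+p. Qf s w p \<partial>lborel2)"
   by (rule Te_AE_limit[OF w'(1) s w'(2)])
  have "ennreal (\<integral>x. (g x)\<^sup>2) = ennreal (C * Eb s w w)"
   unfolding g(3) C(2)[OF w'] Eb_self[OF w, symmetric] using C(1) by (simp add: ennreal_mult)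
  then have "(\<integral>x. (g x)\<^sup>2) = C * Eb s w w" using C(1) by (subst (asm) ennreal_inj) auto
  with g show ?thesis by blast
 qed
 have norm: "(\<integral>x. (g x)\<^sup>2) = C * Eb s w w"
  if w: "Hsb s w" and g: "sqint g" "AE x in lborel. ((\<lambda>t. Te s t w x) \<longlongrightarrow> g x) (at_right 0)" for w g :: "'a \<Rightarrow> real"
 proof -
  obtain g' where g': "sqint g'" "AE x in lborel. ((\<lambda>t. Te s t w x) \<longlongrightarrow> g' x) (at_right 0)" "(\<integral>x. (g' x)\<^sup>2) = C * Eb s w w"
   using ex[OF w] by blast
  note [measurable] = sqint_measurable[OF g(1)] sqint_measurable[OF g'(1)]
  have "AE x in lborel. g x = g' x" using g(2) g'(2)
   by eventually_elim (rule tendsto_unique[OF trivial_limit_at_right_real])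
  then have "(\<integral>x. (g x)\<^sup>2) = (\<integral>x. (g' x)\<^sup>2)" by (intro integral_cong_AE) auto
  then show ?thesis using g' by simp
 qed
 show ?thesis
 proof (rule that[OF C(1)])
  fix w :: "'a \<Rightarrow> real" assume "Hsb s w"
  then show "\<exists>g. sqint g \<and> (AE x in lborel. ((\<lambda>t. Te s t w x) \<longlongrightarrow> g x) (at_right 0))" using ex by blast
 next
  fix w v g h :: "'a \<Rightarrow> real"
  assume w: "Hsb s w" and v: "Hsb s v" and g: "sqint g" and h: "sqint h"
   and lg: "AE x in lborel. ((\<lambda>t. Te s t w x) \<longlongrightarrow> g x) (at_right 0)" and lh: "AE x in lborel. ((\<lambda>t. Te s t v x) \<longlongrightarrow> h x) (at_right 0)"
  have "AE x in lborel. ((\<lambda>t. Te s t (\<lambda>x. 1 * w x + 1 * v x) x) \<longlongrightarrow> 1 * g x + 1 * h x) (at_right 0)"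
   using lg lh
  proof eventually_elim
   case (elim x)
   have "((\<lambda>t. 1 * Te s t w x + 1 * Te s t v x) \<longlongrightarrow> 1 * g x + 1 * h x) (at_right 0)"
    by (intro tendsto_intros elim)
   moreover have "eventually (\<lambda>t. 1 * Te s t w x + 1 * Te s t v x = Te s t (\<lambda>x. 1 * w x + 1 * v x) x) (at_right 0)"
    using eventually_at_right_less
    by eventually_elim (rule Te_lin[OF Hsb_sqint[OF w] Hsb_sqint[OF v] _ s(1), symmetric])
   ultimately show ?case by (rule Lim_transform_eventually)
  qed
  then have "(\<integral>x. (1 * g x + 1 * h x)\<^sup>2) = C * Eb s (\<lambda>x. 1 * w x + 1 * v x) (\<lambda>x. 1 * w x + 1 * v x)"
   by (rule norm[OF Hsb_lin[OF w v] sqint_lin[OF g h]])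
  also have "... = C * (Eb s w w + 2 * Eb s w v + Eb s v v)"
   unfolding Eb_sq_lin[OF w v] by simp
  also have "(\<integral>x. (1 * g x + 1 * h x)\<^sup>2) = (\<integral>x. (g x)\<^sup>2 + 2 * (g x * h x) + (h x)\<^sup>2)"
   by (intro Bochner_Integration.integral_cong) (simp_all add: power2_eq_square algebra_simps)
  also have "... = (\<integral>x. (g x)\<^sup>2) + 2 * (\<integral>x. g x * h x) + (\<integral>x. (h x)\<^sup>2)"
   using sqint_integrable[OF g] sqint_integrable[OF h] sqint_prod_integrable[OF g h] by simp
  finally show "(\<integral>x. g x * h x) = C * Eb s w v"
   using norm[OF w g lg] norm[OF v h lh] by (simp add: algebra_simps)
 qed
qed

section \<open>From the weak formulation to the energy form\<close>

lemma Hs_borel: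
 fixes u :: "'a::euclidean_space \<Rightarrow> real"
 assumes u: "u \<in> Hs s" and w[measurable]: "w \<in> borel_measurable borel" and ae: "AE x in lborel. u x = w x"
 shows "Hsb s w"
proof -
 have um: "u \<in> borel_measurable lebesgue" and u2: "integrable lebesgue (\<lambda>x. (u x)\<^sup>2)"
  and ug: "(\<integral>\<^sup>+ x. (\<integral>\<^sup>+ y. ennreal ((u x - u y)\<^sup>2 / norm (x - y) powr (real DIM('a) + 2 * s)) \<partial>lebesgue) \<partial>lebesgue) < \<infinity>"
  using u by (auto simp: Hs_def)
 have ael: "AE x in lebesgue. u x = w x" using ae by (rule AE_completion)
 have wl: "w \<in> borel_measurable lebesgue" using measurable_completion[of w lborel borel] by simp
 have "integrable lebesgue (\<lambda>x. (w x)\<^sup>2)"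
  by (rule integrable_cong_AE_imp[OF u2]) (use wl ael in auto)
 then have "integrable lborel (\<lambda>x. (w x)\<^sup>2)" by (subst (asm) integrable_completion) auto
 then have sq: "sqint w" by (intro sqintI) auto
 have "gag s w = (\<integral>\<^sup>+x. (\<integral>\<^sup>+y. ennreal ((w x - w y)\<^sup>2 * kr (2 * s) (x - y))))" by (rule gag_eq[OF sq, symmetric])
 also have "... = (\<integral>\<^sup>+ x. (\<integral>\<^sup>+ y. ennreal ((u x - u y)\<^sup>2 / norm (x - y) powr (real DIM('a) + 2 * s))))"
 proof (rule nn_integral_cong_AE, use ae in eventually_elim)
  fix x assume x: "u x = w x"
  show "(\<integral>\<^sup>+y. ennreal ((w x - w y)\<^sup>2 * kr (2 * s) (x - y))) = (\<integral>\<^sup>+ y. ennreal ((u x - u y)\<^sup>2 / norm (x - y) powr (real DIM('a) + 2 * s)))"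
   by (rule nn_integral_cong_AE, use ae in eventually_elim) (simp add: x kr_def)
 qed
 also have "... < \<infinity>" using ug by (simp add: nn_integral_completion)
 finally show ?thesis using sq by (simp add: Hsb_def)
qed

lemma Hsb_Hs:
 fixes w :: "'a::euclidean_space \<Rightarrow> real"
 assumes w: "Hsb s w"
 shows "w \<in> Hs s"
proof -
 note [measurable] = Hsb_measurable[OF w]
 have "w \<in> borel_measurable lebesgue" using measurable_completion[of w lborel borel] by simp
 moreover have "integrable lebesgue (\<lambda>x. (w x)\<^sup>2)"
  using sqint_integrable[OF Hsb_sqint[OF w]] by (subst integrable_completion) auto
 moreover have "(\<integral>\<^sup>+ x. (\<integral>\<^sup>+ y. ennreal ((w x - w y)\<^sup>2 / norm (x - y) powr (real DIM('a) + 2 * s)) \<partial>lebesgue) \<partial>lebesgue) = gag s w"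
  unfolding gag_eq[OF Hsb_sqint[OF w], symmetric] by (simp add: nn_integral_completion kr_def)
 ultimately show ?thesis using w by (simp add: Hs_def Hsb_def)
qed

text \<open>\<open>frac_laplacian\<close> takes unspecified values where its limit fails, so its
  measurability is derived from agreement almost everywhere and completeness of Lebesgue
  measure.\<close>

lemma borel_measurable_lebesgue_AE:
 fixes f g :: "'a::euclidean_space \<Rightarrow> real"
 assumes g: "g \<in> borel_measurable lebesgue" and ae: "AE x in lebesgue. f x = g x"
 shows "f \<in> borel_measurable lebesgue"
proof (rule measurableI)
 fix A :: "real set" assume A: "A \<in> sets borel"
 obtain N where N: "N \<in> null_sets lebesgue" "{x \<in> space lebesgue. f x \<noteq> g x} \<subseteq> N"
 proof -
  from AE_E[OF ae] obtain N where "{x \<in> space lebesgue. f x \<noteq> g x} \<subseteq> N" "emeasure lebesgue N = 0" "N \<in> sets lebesgue" by blast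
  then show ?thesis by (intro that[of N] null_setsI)
 qed
 have "f -` A \<inter> N \<in> null_sets lebesgue" by (rule null_sets_completion_subset[OF _ N(1)]) auto
 then have "(g -` A \<inter> space lebesgue - N) \<union> (f -` A \<inter> N) \<in> sets lebesgue"
  using measurable_sets[OF g A] N(1) by (intro sets.Un sets.Diff) auto
 also have "(g -` A \<inter> space lebesgue - N) \<union> (f -` A \<inter> N) = f -` A \<inter> space lebesgue"
  using N(2) by auto
 finally show "f -` A \<inter> space lebesgue \<in> sets lebesgue" .
qed simp

text \<open>Half order \<open>s / 2\<close> gives the exponent \<open>n + s\<close>, hence the
  kernel \<open>kr s\<close>. Agreement of \<open>u\<close> and \<open>w\<close> at the point
  \<open>x\<close> itself is required, since \<open>u x\<close> enters the integrand for every
  \<open>y\<close>.\<close>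

lemma frac_laplacian_Te:
 fixes u :: "'a::euclidean_space \<Rightarrow> real"
 assumes u: "u \<in> borel_measurable lebesgue" and w[measurable]: "w \<in> borel_measurable borel" and ae: "AE x in lborel. u x = w x"
  and x: "u x = w x" and lim: "((\<lambda>t. Te s t w x) \<longlongrightarrow> g) (at_right 0)"
 shows "frac_laplacian (s / 2) u x = frac_const DIM('a) (s / 2) * g"
proof -
 have ael: "AE x in lebesgue. u x = w x" using ae by (rule AE_completion)
 have wl: "w \<in> borel_measurable lebesgue" using measurable_completion[of w lborel borel] by simp
 have "(LINT y:{y. \<epsilon> < norm (x - y)}|lebesgue. (u x - u y) / norm (x - y) powr (real DIM('a) + 2 * (s / 2))) = Te s \<epsilon> w x" for \<epsilon>
 proof -
  let ?f = "\<lambda>y. indicator {y. \<epsilon> < norm (x - y)} y *\<^sub>R ((w x - w y) / norm (x - y) powr (real DIM('a) + s))"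
  have f[measurable]: "?f \<in> borel_measurable borel" by measurable
  have k: "(\<lambda>y. norm (x - y) powr (real DIM('a) + s)) \<in> borel_measurable lebesgue"
   by (rule measurable_completion) measurable
  have i: "(\<lambda>y. indicator {y. \<epsilon> < norm (x - y)} y :: real) \<in> borel_measurable lebesgue"
   by (rule measurable_completion) measurable
  have "(LINT y:{y. \<epsilon> < norm (x - y)}|lebesgue. (u x - u y) / norm (x - y) powr (real DIM('a) + 2 * (s / 2)))
   = (\<integral>y. indicator {y. \<epsilon> < norm (x - y)} y *\<^sub>R ((u x - u y) / norm (x - y) powr (real DIM('a) + s)) \<partial>lebesgue)"
   by (simp add: set_lebesgue_integral_def)
  also have "... = (\<integral>y. ?f y \<partial>lebesgue)"
  proof (rule integral_cong_AE)
   show "(\<lambda>y. indicator {y. \<epsilon> < norm (x - y)} y *\<^sub>R ((u x - u y) / norm (x - y) powr (real DIM('a) + s))) \<in> borel_measurable lebesgue"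
    using u k i by (intro borel_measurable_scaleR borel_measurable_divide borel_measurable_diff) auto
   show "?f \<in> borel_measurable lebesgue" by (rule measurable_completion) simp
   show "AE y in lebesgue. indicator {y. \<epsilon> < norm (x - y)} y *\<^sub>R ((u x - u y) / norm (x - y) powr (real DIM('a) + s)) = ?f y"
    using ael by eventually_elim (simp add: x)
  qed
  also have "... = (\<integral>y. ?f y)" by (rule integral_completion) simp
  also have "... = (\<integral>z. ?f (x + z))" by (rule integral_lborel_shift[OF f, symmetric])
  also have "... = Te s \<epsilon> w x"
   unfolding Te_def TK_def by (intro Bochner_Integration.integral_cong) (auto simp: kr_def indicator_def)
  finally show ?thesis .
 qed
 then show ?thesis unfolding frac_laplacian_def using tendsto_Lim[OF trivial_limit_at_right_real lim] by simp
qed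

text \<open>The constant is the square of the normalisation of the half order operator times the
  constant of \<open>Te_inner\<close>; it depends on the dimension and on \<open>s\<close>
  only.\<close>

proposition weak_solution_energy:
 assumes s: "0 < s" "s < 1"
 obtains c where "0 < c" "\<And>(\<Omega> :: 'a::euclidean_space set) f u w \<phi>. weak_solution s \<Omega> f u \<Longrightarrow> open \<Omega> \<Longrightarrow> continuous_on UNIV f \<Longrightarrow>
   w \<in> borel_measurable borel \<Longrightarrow> (AE x in lborel. u x = w x) \<Longrightarrow> Hsb s \<phi> \<Longrightarrow> (\<And>x. x \<notin> \<Omega> \<Longrightarrow> \<phi> x = 0) \<Longrightarrow>
   c * Eb s w \<phi> = (\<integral>x. f (w x) * \<phi> x)"
proof -
 obtain C where C: "0 < C" "\<And>w :: 'a::euclidean_space \<Rightarrow> real. Hsb s w \<Longrightarrow>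
   \<exists>g. sqint g \<and> (AE x in lborel. ((\<lambda>t. Te s t w x) \<longlongrightarrow> g x) (at_right 0))"
  "\<And>(w :: 'a \<Rightarrow> real) v g h. Hsb s w \<Longrightarrow> Hsb s v \<Longrightarrow> sqint g \<Longrightarrow> sqint h \<Longrightarrow>
   (AE x in lborel. ((\<lambda>t. Te s t w x) \<longlongrightarrow> g x) (at_right 0)) \<Longrightarrow> (AE x in lborel. ((\<lambda>t. Te s t v x) \<longlongrightarrow> h x) (at_right 0)) \<Longrightarrow>
   (\<integral>x. g x * h x) = C * Eb s w v"
  using Te_inner[OF s, where 'a='a] by blast
 define F where "F = frac_const DIM('a) (s / 2)"
 have F: "0 < F" unfolding F_def frac_const_def using s
  by (intro divide_pos_pos mult_pos_pos Gamma_real_pos) (auto simp: add_nonneg_pos)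
 show ?thesis
 proof (rule that)
  show "0 < F\<^sup>2 * C" using F C by simp
  fix \<Omega> :: "'a set" and f u w \<phi>
  assume ws: "weak_solution s \<Omega> f u" and op: "open \<Omega>" and f: "continuous_on UNIV f" and w[measurable]: "w \<in> borel_measurable borel"
   and ae: "AE x in lborel. u x = w x" and ph: "Hsb s \<phi>" and ph0: "\<And>x. x \<notin> \<Omega> \<Longrightarrow> \<phi> x = 0"
  have uHs: "u \<in> Hs s" using ws by (auto simp: weak_solution_def Hs0_def)
  then have um: "u \<in> borel_measurable lebesgue" by (simp add: Hs_def)
  have wH: "Hsb s w" by (rule Hs_borel[OF uHs w ae])
  note [measurable] = Hsb_measurable[OF ph]
  have fm[measurable]: "f \<in> borel_measurable borel" using f by (rule borel_measurable_continuous_onI)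
  have phH: "\<phi> \<in> Hs s" by (rule Hsb_Hs[OF ph])
  then have phm: "\<phi> \<in> borel_measurable lebesgue" by (simp add: Hs_def)
  have "\<phi> \<in> Hs0 s \<Omega>" using phH ph0 by (simp add: Hs0_def)
  then have eq: "(LINT x|lebesgue. frac_laplacian (s / 2) u x * frac_laplacian (s / 2) \<phi> x) = (LINT x:\<Omega>|lebesgue. f (u x) * \<phi> x)"
   using ws by (auto simp: weak_solution_def)
  obtain g where g: "sqint g" "AE x in lborel. ((\<lambda>t. Te s t w x) \<longlongrightarrow> g x) (at_right 0)" using C(2)[OF wH] by blast
  obtain h where h: "sqint h" "AE x in lborel. ((\<lambda>t. Te s t \<phi> x) \<longlongrightarrow> h x) (at_right 0)" using C(2)[OF ph] by blast
  note [measurable] = sqint_measurable[OF g(1)] sqint_measurable[OF h(1)]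
  have fg: "AE x in lebesgue. frac_laplacian (s / 2) u x = F * g x"
   by (rule AE_completion) (use g(2) ae in \<open>eventually_elim, simp add: F_def frac_laplacian_Te[OF um w ae]\<close>)
  have fh: "AE x in lebesgue. frac_laplacian (s / 2) \<phi> x = F * h x"
   by (rule AE_completion) (use h(2) in \<open>eventually_elim, simp add: F_def frac_laplacian_Te[OF phm Hsb_measurable[OF ph]]\<close>)
  have gl: "(\<lambda>x. F * g x) \<in> borel_measurable lebesgue" "(\<lambda>x. F * h x) \<in> borel_measurable lebesgue"
   by (rule measurable_completion, measurable)+
  have "(LINT x|lebesgue. frac_laplacian (s / 2) u x * frac_laplacian (s / 2) \<phi> x) = (\<integral>x. (F * g x) * (F * h x) \<partial>lebesgue)"
  proof (rule integral_cong_AE)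
   show "(\<lambda>x. frac_laplacian (s / 2) u x * frac_laplacian (s / 2) \<phi> x) \<in> borel_measurable lebesgue"
    by (intro borel_measurable_times borel_measurable_lebesgue_AE[OF gl(1) fg] borel_measurable_lebesgue_AE[OF gl(2) fh])
   show "AE x in lebesgue. frac_laplacian (s / 2) u x * frac_laplacian (s / 2) \<phi> x = (F * g x) * (F * h x)"
    using fg fh by eventually_elim simp
  qed (intro borel_measurable_times gl)
  also have "... = (\<integral>x. (F * g x) * (F * h x))" by (rule integral_completion) measurable
  also have "... = F\<^sup>2 * (\<integral>x. g x * h x)"
  proof -
   have "(\<lambda>x. (F * g x) * (F * h x)) = (\<lambda>x. F\<^sup>2 * (g x * h x))" by (simp add: fun_eq_iff power2_eq_square mult_ac)
   then show ?thesis by simp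
  qed
  also have "(\<integral>x. g x * h x) = C * Eb s w \<phi>" by (rule C(3)[OF wH ph g(1) h(1) g(2) h(2)])
  finally have L: "(LINT x|lebesgue. frac_laplacian (s / 2) u x * frac_laplacian (s / 2) \<phi> x) = F\<^sup>2 * (C * Eb s w \<phi>)" .
  have fwl: "(\<lambda>x. f (w x) * \<phi> x) \<in> borel_measurable lebesgue" by (rule measurable_completion) measurable
  have "(LINT x:\<Omega>|lebesgue. f (u x) * \<phi> x) = (\<integral>x. f (w x) * \<phi> x \<partial>lebesgue)"
   unfolding set_lebesgue_integral_def
  proof (rule integral_cong_AE)
   show ae2: "AE x in lebesgue. indicator \<Omega> x *\<^sub>R (f (u x) * \<phi> x) = f (w x) * \<phi> x"
    using AE_completion[OF ae] by eventually_elim (auto simp: indicator_def ph0)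
   show "(\<lambda>x. indicator \<Omega> x *\<^sub>R (f (u x) * \<phi> x)) \<in> borel_measurable lebesgue"
    by (rule borel_measurable_lebesgue_AE[OF fwl ae2])
  qed (rule fwl)
  also have "... = (\<integral>x. f (w x) * \<phi> x)" by (rule integral_completion) measurable
  finally show "F\<^sup>2 * C * Eb s w \<phi> = (\<integral>x. f (w x) * \<phi> x)"
   using eq L by (simp add: mult.assoc)
 qed
qed

subsection \<open>Dilations and the Pohozaev inequality\<close>

lemma Hsb_iff:
 "Hsb s w \<longleftrightarrow> sqint w \<and> integrable lborel2 (\<lambda>p. (w (fst p) - w (snd p))\<^sup>2 * kr (2 * s) (fst p - snd p))"
proof
 assume "Hsb s w"
 then show "sqint w \<and> integrable lborel2 (\<lambda>p. (w (fst p) - w (snd p))\<^sup>2 * kr (2 * s) (fst p - snd p))"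
  using Hsb_integrable_sq Hsb_sqint by blast
next
 assume r: "sqint w \<and> integrable lborel2 (\<lambda>p. (w (fst p) - w (snd p))\<^sup>2 * kr (2 * s) (fst p - snd p))"
 then have "gag s w = ennreal (\<integral>p. (w (fst p) - w (snd p))\<^sup>2 * kr (2 * s) (fst p - snd p) \<partial>lborel2)"
  unfolding gag_pair[OF r[THEN conjunct1], symmetric] by (intro nn_integral_eq_integral) auto
 then show "Hsb s w" using r by (simp add: Hsb_def)
qed

lemma Hsb_affine:
 fixes w :: "'a::euclidean_space \<Rightarrow> real"
 assumes w: "Hsb s w" and c: "0 < c"
 shows "Hsb s (\<lambda>x. w (a + c *\<^sub>R x))"
  and "Hsb s v \<Longrightarrow> Eb s (\<lambda>x. w (a + c *\<^sub>R x)) (\<lambda>x. v (a + c *\<^sub>R x)) = c powr (2 * s - real DIM('a)) * Eb s w v"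
proof -
 let ?w = "\<lambda>p. w (a + c *\<^sub>R fst p) - w (a + c *\<^sub>R snd p)"
 note [measurable] = Hsb_measurable[OF w]
 let ?n = "real DIM('a)"
 have k: "kr (2 * s) (x - y) = c powr (?n + 2 * s) * kr (2 * s) ((a + c *\<^sub>R x) - (a + c *\<^sub>R y))" for x y :: 'a
 proof -
  have "(a + c *\<^sub>R x) - (a + c *\<^sub>R y) = c *\<^sub>R (x - y)" by (simp add: scaleR_diff_right)
  then have "kr (2 * s) ((a + c *\<^sub>R x) - (a + c *\<^sub>R y)) = c powr - (?n + 2 * s) * kr (2 * s) (x - y)"
   by (simp only: kr_scale[OF c])
  then have "c powr (?n + 2 * s) * kr (2 * s) ((a + c *\<^sub>R x) - (a + c *\<^sub>R y)) = (c powr (?n + 2 * s) * c powr - (?n + 2 * s)) * kr (2 * s) (x - y)"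
   by (simp only: mult.assoc)
  also have "c powr (?n + 2 * s) * c powr - (?n + 2 * s) = 1" using c by (simp only: powr_add[symmetric]) simp
  finally show ?thesis by simp
 qed
 have int: "integrable lborel2 (\<lambda>p. F (a + c *\<^sub>R fst p, a + c *\<^sub>R snd p))" if F: "integrable lborel2 F" for F :: "'a \<times> 'a \<Rightarrow> real"
 proof -
  have "integrable (lborel :: ('a \<times> 'a) measure) (\<lambda>p. F ((a, a) + c *\<^sub>R p))"
   using F c by (intro integrable_lborel_affine) (auto simp: lborel_prod)
  then show ?thesis unfolding lborel_prod by (simp add: plus_prod_def scaleR_prod_def)
 qed
 have intg: "(\<integral>p. F (a + c *\<^sub>R fst p, a + c *\<^sub>R snd p) \<partial>lborel2) = c powr (- 2 * ?n) * (\<integral>p. F p \<partial>lborel2)"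
  if F: "F \<in> borel_measurable lborel2" for F :: "'a \<times> 'a \<Rightarrow> real"
 proof -
  have F': "F \<in> borel_measurable borel" using F by (simp add: lborel_prod)
  have "(\<integral>p. F ((a, a) + c *\<^sub>R p)) = 1 / \<bar>c\<bar> ^ DIM('a \<times> 'a) * (\<integral>p. F p)"
   using c by (intro integral_lborel_affine F') auto
  moreover have e: "1 / \<bar>c\<bar> ^ DIM('a \<times> 'a) = c powr (- 2 * ?n)"
  proof -
   have "c ^ DIM('a \<times> 'a) = c powr (2 * ?n)" using c by (simp add: powr_realpow[symmetric])
   then show ?thesis using c powr_minus_divide[of c "2 * ?n"] by simp
  qed
  ultimately have "(\<integral>p. F ((a, a) + c *\<^sub>R p)) = c powr (- 2 * ?n) * (\<integral>p. F p)" by (simp only:)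
  then show ?thesis unfolding lborel_prod by (simp add: plus_prod_def scaleR_prod_def)
 qed
 show "Hsb s (\<lambda>x. w (a + c *\<^sub>R x))"
  unfolding Hsb_iff
 proof
  show "sqint (\<lambda>x. w (a + c *\<^sub>R x))" using Hsb_sqint[OF w] c by (intro sqint_affine) auto
  have "integrable lborel2 (\<lambda>p. c powr (?n + 2 * s) * ((?w p)\<^sup>2 * kr (2 * s) ((a + c *\<^sub>R fst p) - (a + c *\<^sub>R snd p))))"
   using int[OF Hsb_integrable_sq[OF w]] by (intro integrable_mult_right) simp
  moreover have "(\<lambda>p. (?w p)\<^sup>2 * kr (2 * s) (fst p - snd p)) = (\<lambda>p. c powr (?n + 2 * s) * ((?w p)\<^sup>2 * kr (2 * s) ((a + c *\<^sub>R fst p) - (a + c *\<^sub>R snd p))))"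
   by (rule ext, subst k, rule mult.left_commute)
  ultimately show "integrable lborel2 (\<lambda>p. (?w p)\<^sup>2 * kr (2 * s) (fst p - snd p))"
   by (simp only:)
 qed
 assume v: "Hsb s v"
 note [measurable] = Hsb_measurable[OF v]
 have "Eb s (\<lambda>x. w (a + c *\<^sub>R x)) (\<lambda>x. v (a + c *\<^sub>R x)) = (\<integral>p. c powr (?n + 2 * s) * (?w p * (v (a + c *\<^sub>R fst p) - v (a + c *\<^sub>R snd p)) * kr (2 * s) ((a + c *\<^sub>R fst p) - (a + c *\<^sub>R snd p))) \<partial>lborel2)"
  unfolding Eb_def by (rule Bochner_Integration.integral_cong[OF refl], subst k, rule mult.left_commute)
 also have "... = c powr (?n + 2 * s) * (\<integral>p. ?w p * (v (a + c *\<^sub>R fst p) - v (a + c *\<^sub>R snd p)) * kr (2 * s) ((a + c *\<^sub>R fst p) - (a + c *\<^sub>R snd p)) \<partial>lborel2)"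
  by (rule integral_mult_right_zero)
 also have "(\<integral>p. ?w p * (v (a + c *\<^sub>R fst p) - v (a + c *\<^sub>R snd p)) * kr (2 * s) ((a + c *\<^sub>R fst p) - (a + c *\<^sub>R snd p)) \<partial>lborel2) = c powr (- 2 * ?n) * Eb s w v"
 proof -
  have "(\<lambda>p. (w (fst p) - w (snd p)) * (v (fst p) - v (snd p)) * kr (2 * s) (fst p - snd p)) \<in> borel_measurable lborel2" by measurable
  from intg[OF this] show ?thesis by (simp add: Eb_def)
 qed
 also have "c powr (?n + 2 * s) * (c powr (- 2 * ?n) * Eb s w v) = c powr ((?n + 2 * s) + (- 2 * ?n)) * Eb s w v"
  by (simp only: powr_add mult.assoc)
 also have "(?n + 2 * s) + (- 2 * ?n) = 2 * s - ?n" by simp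
 finally show "Eb s (\<lambda>x. w (a + c *\<^sub>R x)) (\<lambda>x. v (a + c *\<^sub>R x)) = c powr (2 * s - ?n) * Eb s w v" .
qed

text \<open>The scaling exponent for which dilations preserve \<open>Eb\<close>; at the same time
  \<open>n\<close> times the coefficient in the hypothesis on \<open>f\<close>. This coincidence is
  why dilations produce exactly the Pohozaev integrand.\<close>

definition dex :: "'a::euclidean_space itself \<Rightarrow> real \<Rightarrow> real" where
 "dex _ s = (real DIM('a) - 2 * s) / 2"

text \<open>Dilation, normalised to be an isometry of the energy.\<close>

definition dil :: "real \<Rightarrow> real \<Rightarrow> ('a::euclidean_space \<Rightarrow> real) \<Rightarrow> 'a \<Rightarrow> real" where
 "dil s h w x = exp (dex TYPE('a) s * h) * w (exp h *\<^sub>R x)"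

lemma dil_add: "dil s h (dil s k w) = dil s (h + k) w"
 by (simp add: fun_eq_iff dil_def exp_add[symmetric] algebra_simps)

lemma Hsb_dil: "Hsb s w \<Longrightarrow> Hsb s (dil s h w)"
 using Hsb_cmult[OF Hsb_affine(1)[of s w "exp h" 0]] by (simp add: dil_def[abs_def])

lemma Eb_cmult: "Hsb s w \<Longrightarrow> Hsb s v \<Longrightarrow> Eb s (\<lambda>x. a * w x) v = a * Eb s w v"
 using Eb_lin[of s w w v a 0] by simp

lemma Eb_dil:
 fixes w :: "'a::euclidean_space \<Rightarrow> real"
 assumes w: "Hsb s w" and v: "Hsb s v"
 shows "Eb s (dil s h w) (dil s h v) = Eb s w v"
proof -
 let ?b = "dex TYPE('a) s"
 have w': "Hsb s (\<lambda>x. w (exp h *\<^sub>R x))" and v': "Hsb s (\<lambda>x. v (exp h *\<^sub>R x))"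
  using Hsb_affine(1)[OF w, of "exp h" 0] Hsb_affine(1)[OF v, of "exp h" 0] by simp_all
 have dw: "dil s h w = (\<lambda>x. exp (?b * h) * w (exp h *\<^sub>R x))" and dv: "dil s h v = (\<lambda>x. exp (?b * h) * v (exp h *\<^sub>R x))"
  by (simp_all add: fun_eq_iff dil_def)
 have "Eb s (dil s h w) (dil s h v) = exp (?b * h) * Eb s (\<lambda>x. w (exp h *\<^sub>R x)) (dil s h v)"
  unfolding dw by (rule Eb_cmult[OF w' Hsb_dil[OF v]])
 also have "Eb s (\<lambda>x. w (exp h *\<^sub>R x)) (dil s h v) = exp (?b * h) * Eb s (\<lambda>x. v (exp h *\<^sub>R x)) (\<lambda>x. w (exp h *\<^sub>R x))"
  unfolding dv Eb_commute[of s "\<lambda>x. w (exp h *\<^sub>R x)"] by (rule Eb_cmult[OF v' w'])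
 also have "Eb s (\<lambda>x. v (exp h *\<^sub>R x)) (\<lambda>x. w (exp h *\<^sub>R x)) = exp h powr (2 * s - real DIM('a)) * Eb s w v"
  using Hsb_affine(2)[OF v _ w, of "exp h" 0] by (simp add: Eb_commute[of s v w])
 also have "exp h powr (2 * s - real DIM('a)) = exp (- (2 * (?b * h)))" by (simp add: powr_def dex_def field_simps)
 finally have "Eb s (dil s h w) (dil s h v) = (exp (?b * h) * exp (?b * h) * exp (- (2 * (?b * h)))) * Eb s w v"
  by (simp only: mult.assoc)
 also have "exp (?b * h) * exp (?b * h) * exp (- (2 * (?b * h))) = 1" by (simp only: exp_add[symmetric]) simp
 finally show ?thesis by simp
qed

section \<open>Continuity modulus under dilations\<close>

lemma exp_taylor: "\<bar>exp x - 1 - x\<bar> \<le> x\<^sup>2 * exp \<bar>x\<bar>" for x :: real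
proof -
 have lower: "0 \<le> exp x - 1 - x" using exp_ge_add_one_self[of x] by linarith
 show ?thesis
 proof (cases "0 \<le> x")
  case True
  have "1 - x \<le> exp (- x)" using exp_ge_add_one_self[of "- x"] by simp
  then have "(1 - x) * exp x \<le> exp (- x) * exp x" by (intro mult_right_mono) auto
  also have "exp (- x) * exp x = 1" by (simp add: exp_minus)
  finally have 1: "exp x - 1 \<le> x * exp x" by (simp add: left_diff_distrib)
  have "exp x - 1 - x \<le> x * exp x - x" using 1 by simp
  also have "... = x * (exp x - 1)" by (simp add: right_diff_distrib)
  also have "... \<le> x * (x * exp x)" using True 1 by (intro mult_left_mono)
  finally show ?thesis using lower True by (simp add: power2_eq_square mult.assoc)
 next
  case False
  define y where "y = - x"
  have y: "0 < y" using False by (simp add: y_def)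
  have "1 + y \<le> exp y" by (rule exp_ge_add_one_self)
  then have "exp (- y) \<le> 1 / (1 + y)" using y by (simp add: exp_minus divide_simps)
  also have "... \<le> 1 - y + y\<^sup>2"
  proof -
   have "1 \<le> (1 - y + y\<^sup>2) * (1 + y)" using y by (simp add: power2_eq_square algebra_simps)
   then show ?thesis using y by (simp add: pos_divide_le_eq)
  qed
  finally have "exp x - 1 - x \<le> x\<^sup>2 * 1" by (simp add: y_def)
  also have "... \<le> x\<^sup>2 * exp \<bar>x\<bar>" by (intro mult_left_mono) auto
  finally show ?thesis using lower by simp
 qed
qed

lemma exp_minus_one_bound:
 fixes b h :: real
 assumes h: "0 \<le> h" "h \<le> 1"
 shows "\<bar>exp (b * h) - 1\<bar> \<le> (\<bar>b\<bar> + b\<^sup>2 * exp \<bar>b\<bar>) * h"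
proof -
 have "\<bar>exp (b * h) - 1\<bar> \<le> \<bar>exp (b * h) - 1 - b * h\<bar> + \<bar>b * h\<bar>"
  using abs_triangle_ineq[of "exp (b * h) - 1 - b * h" "b * h"] by simp
 also have "... \<le> (b * h)\<^sup>2 * exp \<bar>b * h\<bar> + \<bar>b * h\<bar>" using exp_taylor[of "b * h"] by simp
 also have "(b * h)\<^sup>2 * exp \<bar>b * h\<bar> \<le> (b\<^sup>2 * h) * exp \<bar>b\<bar>"
 proof (intro mult_mono)
  have "(b * h)\<^sup>2 = b\<^sup>2 * (h * h)" by (simp add: power2_eq_square mult_ac)
  also have "... \<le> b\<^sup>2 * (h * 1)" using h by (intro mult_left_mono) auto
  finally show "(b * h)\<^sup>2 \<le> b\<^sup>2 * h" by simp
  show "exp \<bar>b * h\<bar> \<le> exp \<bar>b\<bar>" using h by (simp add: abs_mult mult_left_le)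
 qed (use h in auto)
 also have "(b\<^sup>2 * h) * exp \<bar>b\<bar> + \<bar>b * h\<bar> = (\<bar>b\<bar> + b\<^sup>2 * exp \<bar>b\<bar>) * h" using h by (simp add: abs_mult algebra_simps)
 finally show ?thesis by simp
qed

text \<open>A dilation moves points of the support by \<open>O(h)\<close>. Averaging over
  \<open>y\<close> in the ball of radius \<open>h\<close> about \<open>x\<close> and comparing both
  values of \<open>w\<close> with \<open>w y\<close> keeps each pair within distance
  \<open>(2 * R + 1) * h\<close>, so the energy controls the difference with the factor
  \<open>h powr (2 * s)\<close>.\<close>

lemma dilation_modulus:
 fixes w :: "'a::euclidean_space \<Rightarrow> real"
 assumes w: "Hsb s w" and s: "0 < s" and R: "0 < R" "\<And>x. R < norm x \<Longrightarrow> w x = 0" and h: "0 < h" "h \<le> 1"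
 defines "V \<equiv> measure lborel (ball (0::'a) 1)"
 shows "(\<integral>x. (w (exp h *\<^sub>R x) - w x)\<^sup>2) \<le> 2 * (1 + (2 * R + 1) powr (real DIM('a) + 2 * s)) / V * h powr (2 * s) * Eb s w w"
proof -
 note [measurable] = Hsb_measurable[OF w]
 let ?n = "real DIM('a)" let ?l = "exp h" let ?K = "2 * R + 1"
 have V: "0 < V" unfolding V_def using content_ball_gt_0_iff[of "0::'a" 1] by simp
 have lam: "?l - 1 \<le> 2 * h"
 proof -
  have "exp h \<le> 1 + h + h\<^sup>2" using h by (intro exp_bound) auto
  also have "h\<^sup>2 \<le> h * 1" unfolding power2_eq_square using h by (intro mult_left_mono) auto
  finally show ?thesis by simp
 qed
 have p: "0 < ?n + 2 * s" using s by (simp add: add_nonneg_pos)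
 define \<Phi> where "\<Phi> x = (\<integral>\<^sup>+y. ennreal ((w x - w y)\<^sup>2 * kr (2 * s) (x - y)))" for x
 have [measurable]: "\<Phi> \<in> borel_measurable borel" unfolding \<Phi>_def by measurable
 have \<Phi>: "(\<integral>\<^sup>+x. \<Phi> x) = ennreal (Eb s w w)"
  unfolding \<Phi>_def Eb_self[OF w] by (rule gag_eq[OF Hsb_sqint[OF w]])
 have pw: "(w x - w y)\<^sup>2 \<le> r powr (?n + 2 * s) * ((w x - w y)\<^sup>2 * kr (2 * s) (x - y))" if "norm (x - y) \<le> r" for x y r
 proof (cases "x = y")
  case False
  have "norm (x - y) powr (?n + 2 * s) \<le> r powr (?n + 2 * s)" using that p by (intro powr_mono2) auto
  then have "1 \<le> r powr (?n + 2 * s) * kr (2 * s) (x - y)" using False by (simp add: kr_def)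
  then have "(w x - w y)\<^sup>2 * 1 \<le> (w x - w y)\<^sup>2 * (r powr (?n + 2 * s) * kr (2 * s) (x - y))" by (intro mult_left_mono) auto
  then show ?thesis by (simp add: mult_ac)
 qed simp
 have hn: "h powr (?n + 2 * s) = h powr ?n * h powr (2 * s)" by (rule powr_add)
 have hn': "h powr ?n = h ^ DIM('a)" using h by (simp add: powr_realpow)
 define A where "A = 2 * h powr (?n + 2 * s)"
 define B where "B = 2 * (?K * h) powr (?n + 2 * s)"
 have AB: "0 \<le> A" "0 \<le> B" by (auto simp: A_def B_def)
 have key: "ennreal (V * h ^ DIM('a) * (w (?l *\<^sub>R x) - w x)\<^sup>2) \<le> ennreal A * \<Phi> x + ennreal B * \<Phi> (?l *\<^sub>R x)" for x
 proof (cases "R < norm x")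
  case True
  have "norm x \<le> ?l * norm x" using h by (intro mult_right_le_one_le[THEN order_trans] order_trans[OF _ mult_right_mono[of 1 ?l]]) auto
  then have "R < norm (?l *\<^sub>R x)" using True by simp
  then show ?thesis using True R(2) by simp
 next
  case False
  have [measurable]: "ball x h \<in> sets borel" by simp
  have "ennreal (V * h ^ DIM('a) * (w (?l *\<^sub>R x) - w x)\<^sup>2) = ennreal ((w (?l *\<^sub>R x) - w x)\<^sup>2) * ennreal (h ^ DIM('a) * V)"
   using V h by (simp add: ennreal_mult[symmetric] mult_ac)
  also have "ennreal (h ^ DIM('a) * V) = emeasure lborel (ball x h)"
   using h by (simp add: V_def emeasure_ball content_ball mult.commute)
  also have "ennreal ((w (?l *\<^sub>R x) - w x)\<^sup>2) * emeasure lborel (ball x h) = (\<integral>\<^sup>+y. ennreal ((w (?l *\<^sub>R x) - w x)\<^sup>2) * indicator (ball x h) y)"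
   by (rule nn_integral_cmult_indicator[symmetric]) simp
  also have "... \<le> (\<integral>\<^sup>+y. ennreal A * ennreal ((w x - w y)\<^sup>2 * kr (2 * s) (x - y)) + ennreal B * ennreal ((w (?l *\<^sub>R x) - w y)\<^sup>2 * kr (2 * s) (?l *\<^sub>R x - y)))"
  proof (rule nn_integral_mono, goal_cases)
   case (1 y)
   show ?case
   proof (cases "y \<in> ball x h")
    case True
    then have d1: "norm (x - y) \<le> h" by (simp add: dist_norm)
    have "norm (?l *\<^sub>R x - y) \<le> norm (?l *\<^sub>R x - x) + norm (x - y)" by (metis norm_triangle_sub norm_triangle_ineq diff_add_cancel add_diff_eq)
    also have "norm (?l *\<^sub>R x - x) = (?l - 1) * norm x"
    proof -
     have "?l *\<^sub>R x - x = (?l - 1) *\<^sub>R x" by (simp add: scaleR_left_diff_distrib)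
     then show ?thesis using h by simp
    qed
    also have "(?l - 1) * norm x \<le> (2 * h) * R" using lam False h R by (intro mult_mono) auto
    finally have d2: "norm (?l *\<^sub>R x - y) \<le> ?K * h" using d1 by (simp add: algebra_simps)
    have "0 \<le> ((w (?l *\<^sub>R x) - w y) + (w x - w y))\<^sup>2" by simp
    then have "(w (?l *\<^sub>R x) - w x)\<^sup>2 \<le> 2 * (w x - w y)\<^sup>2 + 2 * (w (?l *\<^sub>R x) - w y)\<^sup>2"
     by (simp add: power2_eq_square algebra_simps)
    also have "... \<le> A * ((w x - w y)\<^sup>2 * kr (2 * s) (x - y)) + B * ((w (?l *\<^sub>R x) - w y)\<^sup>2 * kr (2 * s) (?l *\<^sub>R x - y))"
     using pw[OF d1] pw[OF d2] by (simp add: A_def B_def)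
    finally show ?thesis using True AB by (simp add: ennreal_mult[symmetric] ennreal_plus[symmetric] ennreal_leI del: ennreal_plus)
   qed simp
  qed
  also have "... = ennreal A * \<Phi> x + ennreal B * \<Phi> (?l *\<^sub>R x)"
   unfolding \<Phi>_def by (subst nn_integral_add) (auto simp: nn_integral_cmult)
  finally show ?thesis .
 qed
 have sq: "sqint (\<lambda>x. w (?l *\<^sub>R x) - w x)"
  using sqint_diff[OF sqint_affine[OF Hsb_sqint[OF w], of ?l 0] Hsb_sqint[OF w]] by simp
 let ?I = "\<integral>x. (w (?l *\<^sub>R x) - w x)\<^sup>2"
 have "ennreal (V * h ^ DIM('a) * ?I) = (\<integral>\<^sup>+x. ennreal (V * h ^ DIM('a) * (w (?l *\<^sub>R x) - w x)\<^sup>2))"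
  using V h sqint_integrable[OF sq] by (subst nn_integral_eq_integral) auto
 also have "... \<le> (\<integral>\<^sup>+x. ennreal A * \<Phi> x + ennreal B * \<Phi> (?l *\<^sub>R x))" by (intro nn_integral_mono key)
 also have "... = ennreal A * (\<integral>\<^sup>+x. \<Phi> x) + ennreal B * (\<integral>\<^sup>+x. \<Phi> (?l *\<^sub>R x))"
  by (subst nn_integral_add) (auto simp: nn_integral_cmult)
 also have "(\<integral>\<^sup>+x. \<Phi> (?l *\<^sub>R x)) = ennreal (1 / ?l ^ DIM('a)) * (\<integral>\<^sup>+x. \<Phi> x)"
  by (rule nn_integral_lborel_scale) auto
 also have "... \<le> 1 * (\<integral>\<^sup>+x. \<Phi> x)"
  using h by (intro mult_right_mono) (auto simp: ennreal_le_1 one_le_power)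
 finally have "ennreal (V * h ^ DIM('a) * ?I) \<le> ennreal A * ennreal (Eb s w w) + ennreal B * ennreal (Eb s w w)"
  unfolding \<Phi> by (simp add: mult_left_mono)
 also have "... = ennreal ((A + B) * Eb s w w)" using AB by (simp add: ennreal_mult[symmetric] ennreal_plus[symmetric] distrib_right del: ennreal_plus)
 finally have "V * h ^ DIM('a) * ?I \<le> (A + B) * Eb s w w" using AB by (subst (asm) ennreal_le_iff) auto
 also have "A + B = h ^ DIM('a) * (2 * (1 + ?K powr (?n + 2 * s)) * h powr (2 * s))"
 proof -
  have "(?K * h) powr (?n + 2 * s) = ?K powr (?n + 2 * s) * (h ^ DIM('a) * h powr (2 * s))"
   unfolding hn[unfolded hn', symmetric] by (rule powr_mult)
  then show ?thesis unfolding A_def B_def hn hn' by (simp only: mult_ac distrib_left distrib_right mult_1_left mult_1_right)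
 qed
 finally have "h ^ DIM('a) * (V * ?I) \<le> h ^ DIM('a) * (2 * (1 + ?K powr (?n + 2 * s)) * h powr (2 * s) * Eb s w w)" by (simp add: mult_ac)
 then have "V * ?I \<le> 2 * (1 + ?K powr (?n + 2 * s)) * h powr (2 * s) * Eb s w w" using h by (subst (asm) mult_le_cancel_left_pos) auto
 then show ?thesis using V by (simp add: field_simps)
qed

lemma dil_modulus:
 fixes s :: real
 assumes s: "0 < s" "s < 1" and R: "0 < R"
 obtains C where "0 < C" "\<And>(w :: 'a::euclidean_space \<Rightarrow> real) h. Hsb s w \<Longrightarrow> (\<And>x. R < norm x \<Longrightarrow> w x = 0) \<Longrightarrow> 0 < h \<Longrightarrow> h \<le> 1 \<Longrightarrow>
   (\<integral>x. (dil s h w x - w x)\<^sup>2) \<le> C * (h powr (2 * s) * Eb s w w + h\<^sup>2 * (\<integral>x. (w x)\<^sup>2))"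
proof -
 let ?b = "dex TYPE('a) s"
 define D where "D = 2 * (1 + (2 * R + 1) powr (real DIM('a) + 2 * s)) / measure lborel (ball (0::'a) 1)"
 define B where "B = \<bar>?b\<bar> + ?b\<^sup>2 * exp \<bar>?b\<bar>"
 have D: "0 \<le> D" by (simp add: D_def)
 have B: "0 \<le> B" by (simp add: B_def)
 define C where "C = 2 * exp (2 * \<bar>?b\<bar>) * D + 2 * B\<^sup>2 + 1"
 show ?thesis
 proof (rule that)
  show "0 < C" using D B unfolding C_def by (intro add_nonneg_pos add_nonneg_nonneg) auto
  fix w :: "'a \<Rightarrow> real" and h :: real
  assume w: "Hsb s w" and supp: "\<And>x. R < norm x \<Longrightarrow> w x = 0" and h: "0 < h" "h \<le> 1"
  have i1: "integrable lborel (\<lambda>x. (w (exp h *\<^sub>R x) - w x)\<^sup>2)"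
   using sqint_integrable[OF sqint_diff[OF sqint_affine[OF Hsb_sqint[OF w], of "exp h" 0] Hsb_sqint[OF w]]] by simp
  have i2: "integrable lborel (\<lambda>x. (w x)\<^sup>2)" by (rule sqint_integrable[OF Hsb_sqint[OF w]])
  have e1: "(exp (?b * h))\<^sup>2 \<le> exp (2 * \<bar>?b\<bar>)"
  proof -
   have "?b * h \<le> \<bar>?b\<bar> * 1" using h by (intro mult_mono) auto
   moreover have "(exp (?b * h))\<^sup>2 = exp (2 * (?b * h))" by (rule exp_double[symmetric])
   ultimately show ?thesis by simp
  qed
  have e2: "(exp (?b * h) - 1)\<^sup>2 \<le> B\<^sup>2 * h\<^sup>2"
  proof -
   have "\<bar>exp (?b * h) - 1\<bar> \<le> B * h" using exp_minus_one_bound[of h ?b] h by (simp add: B_def)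
   then have "\<bar>exp (?b * h) - 1\<bar>\<^sup>2 \<le> (B * h)\<^sup>2" by (intro power_mono) auto
   then show ?thesis by (simp add: power_mult_distrib)
  qed
  have "(\<integral>x. (dil s h w x - w x)\<^sup>2) \<le> (\<integral>x. 2 * exp (2 * \<bar>?b\<bar>) * (w (exp h *\<^sub>R x) - w x)\<^sup>2 + 2 * (B\<^sup>2 * h\<^sup>2) * (w x)\<^sup>2)"
  proof (rule integral_mono)
   show "integrable lborel (\<lambda>x. (dil s h w x - w x)\<^sup>2)"
    by (intro sqint_integrable sqint_diff Hsb_sqint[OF w] Hsb_sqint[OF Hsb_dil[OF w]])
   show "integrable lborel (\<lambda>x. 2 * exp (2 * \<bar>?b\<bar>) * (w (exp h *\<^sub>R x) - w x)\<^sup>2 + 2 * (B\<^sup>2 * h\<^sup>2) * (w x)\<^sup>2)"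
    using i1 i2 by (intro Bochner_Integration.integrable_add integrable_mult_right)
   fix x
   define p where "p = exp (?b * h) * (w (exp h *\<^sub>R x) - w x)"
   define q where "q = (exp (?b * h) - 1) * w x"
   have "dil s h w x - w x = p + q" by (simp add: dil_def p_def q_def algebra_simps)
   moreover have "(p + q)\<^sup>2 \<le> 2 * p\<^sup>2 + 2 * q\<^sup>2"
   proof -
    have "0 \<le> (p - q)\<^sup>2" by simp
    then show ?thesis by (simp add: power2_eq_square algebra_simps)
   qed
   moreover have "p\<^sup>2 \<le> exp (2 * \<bar>?b\<bar>) * (w (exp h *\<^sub>R x) - w x)\<^sup>2"
    unfolding p_def power_mult_distrib by (intro mult_right_mono e1) auto
   moreover have "q\<^sup>2 \<le> (B\<^sup>2 * h\<^sup>2) * (w x)\<^sup>2"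
    unfolding q_def power_mult_distrib by (intro mult_right_mono e2) auto
   ultimately show "(dil s h w x - w x)\<^sup>2 \<le> 2 * exp (2 * \<bar>?b\<bar>) * (w (exp h *\<^sub>R x) - w x)\<^sup>2 + 2 * (B\<^sup>2 * h\<^sup>2) * (w x)\<^sup>2"
    by simp
  qed
  also have "... = 2 * exp (2 * \<bar>?b\<bar>) * (\<integral>x. (w (exp h *\<^sub>R x) - w x)\<^sup>2) + 2 * (B\<^sup>2 * h\<^sup>2) * (\<integral>x. (w x)\<^sup>2)"
   using i1 i2 by simp
  also have "... \<le> 2 * exp (2 * \<bar>?b\<bar>) * (D * h powr (2 * s) * Eb s w w) + 2 * (B\<^sup>2 * h\<^sup>2) * (\<integral>x. (w x)\<^sup>2)"
   unfolding D_def by (intro add_mono mult_left_mono dilation_modulus w s R supp h) auto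
  also have "... = (2 * exp (2 * \<bar>?b\<bar>) * D) * (h powr (2 * s) * Eb s w w) + (2 * B\<^sup>2) * (h\<^sup>2 * (\<integral>x. (w x)\<^sup>2))"
   by (simp add: mult_ac)
  also have "... \<le> C * (h powr (2 * s) * Eb s w w) + C * (h\<^sup>2 * (\<integral>x. (w x)\<^sup>2))"
   using D B by (intro add_mono mult_right_mono mult_nonneg_nonneg) (auto simp: C_def)
  finally show "(\<integral>x. (dil s h w x - w x)\<^sup>2) \<le> C * (h powr (2 * s) * Eb s w w + h\<^sup>2 * (\<integral>x. (w x)\<^sup>2))"
   by (simp add: distrib_left)
 qed
qed

text \<open>Once the implicit term is absorbed, the growth factors are
  \<open>(1 + q ^ k) / (1 - C * q ^ k)\<close>, and their product converges because
  \<open>q ^ k\<close> is summable.\<close>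

lemma almost_contracting_bounded:
 fixes e :: "nat \<Rightarrow> real"
 assumes e: "\<And>k. 0 \<le> e k" and q: "0 < q" "q < 1" and C: "0 \<le> C"
  and rec: "\<And>k. e (Suc k) \<le> (1 + q ^ k) * e k + C * q ^ k * e (Suc k)"
 shows "\<exists>B. \<forall>k. e k \<le> B"
proof -
 have "(\<lambda>k. C * q ^ k) \<longlonglongrightarrow> C * 0" using q by (intro tendsto_intros LIMSEQ_realpow_zero) auto
 \<comment> \<open>Below \<open>1/2\<close> the implicit term can be absorbed, by means of
   \<open>1 \<le> (1 + 2 * c) * (1 - c)\<close>.\<close>
 then have "eventually (\<lambda>k. C * q ^ k < 1/2) sequentially" by (intro order_tendstoD) auto
 then obtain m where m: "\<And>k. m \<le> k \<Longrightarrow> C * q ^ k < 1/2" by (auto simp: eventually_sequentially)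
 have step: "e (Suc k) \<le> exp ((1 + 2 * C) * q ^ k) * e k" if "m \<le> k" for k
 proof -
  let ?c = "C * q ^ k"
  have "0 \<le> q ^ k" using q by simp
  with C have "0 \<le> ?c" by (rule mult_nonneg_nonneg)
  then have c: "0 \<le> ?c" "?c < 1/2" using m[OF that] .
  have "(1 - ?c) * e (Suc k) \<le> (1 + q ^ k) * e k" using rec[of k] by (simp add: algebra_simps)
  then have "(1 + 2 * ?c) * ((1 - ?c) * e (Suc k)) \<le> (1 + 2 * ?c) * ((1 + q ^ k) * e k)" using c by (intro mult_left_mono) auto
  moreover have "1 * e (Suc k) \<le> ((1 + 2 * ?c) * (1 - ?c)) * e (Suc k)"
  proof (rule mult_right_mono[OF _ e])
   have "0 \<le> ?c * (1 - 2 * ?c)" by (rule mult_nonneg_nonneg) (use c in linarith)+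
   then show "1 \<le> (1 + 2 * ?c) * (1 - ?c)" by (simp add: algebra_simps)
  qed
  ultimately have "e (Suc k) \<le> ((1 + 2 * ?c) * (1 + q ^ k)) * e k" by (simp only: mult.assoc)
  also have "... \<le> (exp (2 * ?c) * exp (q ^ k)) * e k"
   by (rule mult_right_mono[OF mult_mono[OF exp_ge_add_one_self exp_ge_add_one_self]]) (use q e in auto)
  also have "exp (2 * ?c) * exp (q ^ k) = exp ((1 + 2 * C) * q ^ k)" by (simp add: exp_add[symmetric] algebra_simps)
  finally show ?thesis .
 qed
 have bound: "e (m + j) \<le> exp ((1 + 2 * C) * (\<Sum>i<j. q ^ (m + i))) * e m" for j
 proof (induction j)
  case (Suc j)
  have "e (m + Suc j) \<le> exp ((1 + 2 * C) * q ^ (m + j)) * e (m + j)" using step[of "m + j"] by simp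
  also have "... \<le> exp ((1 + 2 * C) * q ^ (m + j)) * (exp ((1 + 2 * C) * (\<Sum>i<j. q ^ (m + i))) * e m)"
   by (intro mult_left_mono Suc) auto
  also have "... = exp ((1 + 2 * C) * (\<Sum>i<Suc j. q ^ (m + i))) * e m"
   by (simp add: exp_add[symmetric] distrib_left mult.assoc[symmetric] add.commute)
  finally show ?case .
 qed simp
 have geo: "(\<Sum>i<j. q ^ (m + i)) \<le> 1 / (1 - q)" for j
 proof -
  have "(\<Sum>i<j. q ^ (m + i)) \<le> (\<Sum>i<j. q ^ i)" using q by (intro sum_mono power_decreasing) auto
  also have "... \<le> (\<Sum>i. q ^ i)" using q by (intro sum_le_suminf) auto
  also have "... = 1 / (1 - q)" using q by (intro suminf_geometric) auto
  finally show ?thesis .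
 qed
 define B where "B = exp ((1 + 2 * C) * (1 / (1 - q))) * e m + (\<Sum>i<m. e i)"
 have "e k \<le> B" for k
 proof (cases "k < m")
  case True
  have "e k \<le> (\<Sum>i<m. e i)" using True e by (intro member_le_sum) auto
  also have "... \<le> B" using e unfolding B_def by simp
  finally show ?thesis .
 next
  case False
  then obtain j where k: "k = m + j" using le_Suc_ex not_less by blast
  have "e k \<le> exp ((1 + 2 * C) * (\<Sum>i<j. q ^ (m + i))) * e m" unfolding k by (rule bound)
  also have "... \<le> exp ((1 + 2 * C) * (1 / (1 - q))) * e m"
  proof (intro mult_right_mono e)
   have "(1 + 2 * C) * (\<Sum>i<j. q ^ (m + i)) \<le> (1 + 2 * C) * (1 / (1 - q))" using C by (intro mult_left_mono geo) auto
   then show "exp ((1 + 2 * C) * (\<Sum>i<j. q ^ (m + i))) \<le> exp ((1 + 2 * C) * (1 / (1 - q)))" unfolding exp_le_cancel_iff .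
  qed
  also have "... \<le> B" using e unfolding B_def by (simp add: sum_nonneg)
  finally show ?thesis .
 qed
 then show ?thesis by blast
qed

text \<open>Normal form of the problem: star centre at the origin, \<open>f\<close> and
  \<open>F\<close> already divided by the constant of \<open>weak_solution_energy\<close>, and a
  Borel representative that is bounded and vanishes outside \<open>\<Omega>\<close> everywhere, not
  only almost everywhere.\<close>

locale energy_solution =
 fixes s :: real and \<Omega> :: "'a::euclidean_space set" and f F :: "real \<Rightarrow> real" and u :: "'a \<Rightarrow> real" and M R :: real
 assumes s: "0 < s" "s < 1"
  and \<Omega>: "open \<Omega>" "0 < R" "\<And>x. x \<in> \<Omega> \<Longrightarrow> norm x \<le> R" "\<And>x t. x \<in> \<Omega> \<Longrightarrow> 0 \<le> t \<Longrightarrow> t \<le> 1 \<Longrightarrow> t *\<^sub>R x \<in> \<Omega>"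
  and u: "Hsb s u" "\<And>x. x \<notin> \<Omega> \<Longrightarrow> u x = 0" "\<And>x. \<bar>u x\<bar> \<le> M"
  and f: "continuous_on UNIV f" "\<And>B. \<exists>L\<ge>0. \<forall>x y. \<bar>x\<bar> \<le> B \<longrightarrow> \<bar>y\<bar> \<le> B \<longrightarrow> \<bar>f x - f y\<bar> \<le> L * \<bar>x - y\<bar>"
  and F: "F 0 = 0" "\<And>t. (F has_real_derivative f t) (at t)"
  and eq: "\<And>\<phi>. Hsb s \<phi> \<Longrightarrow> (\<And>x. x \<notin> \<Omega> \<Longrightarrow> \<phi> x = 0) \<Longrightarrow> Eb s u \<phi> = (\<integral>x. f (u x) * \<phi> x)"
  and poh: "\<And>t. 0 \<le> dex TYPE('a) s * (t * f t) - real DIM('a) * F t"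
begin

definition b :: real where "b = dex TYPE('a) s"

lemma dil_b: "dil s h w (x::'a) = exp (b * h) * w (exp h *\<^sub>R x)"
 by (simp add: dil_def b_def)

lemma u_measurable [measurable]: "u \<in> borel_measurable borel"
 by (rule Hsb_measurable[OF u(1)])

lemma f_measurable [measurable]: "f \<in> borel_measurable borel"
 using f(1) by (rule borel_measurable_continuous_onI)

lemma F_continuous: "continuous_on UNIV F"
 by (intro continuous_at_imp_continuous_on ballI DERIV_isCont[OF F(2)])

lemma F_measurable [measurable]: "F \<in> borel_measurable borel"
 using F_continuous by (rule borel_measurable_continuous_onI)

lemma M_nonneg: "0 \<le> M"
 using u(3)[of 0] by linarith

lemma \<Omega>_sets [measurable]: "\<Omega> \<in> sets borel"
 using \<Omega>(1) by simp

lemma \<Omega>_finite: "emeasure lborel \<Omega> < \<infinity>"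
proof -
 have "emeasure lborel \<Omega> \<le> emeasure lborel (ball (0::'a) (R + 1))"
  by (intro emeasure_mono) (use \<Omega>(3) in fastforce)+
 then show ?thesis using emeasure_lborel_ball_finite[of "0::'a" "R + 1"] by (rule le_less_trans)
qed

lemma bounded_integrable:
 fixes g :: "'a \<Rightarrow> real"
 assumes [measurable]: "g \<in> borel_measurable borel" and B: "\<And>x. \<bar>g x\<bar> \<le> B" and z: "\<And>x. x \<notin> \<Omega> \<Longrightarrow> g x = 0"
 shows "integrable lborel g"
proof (rule Bochner_Integration.integrable_bound)
 show "integrable lborel (\<lambda>x. B * indicator \<Omega> x)"
  using \<Omega>_finite by (intro integrable_mult_right integrable_real_indicator) auto
 show "AE x in lborel. norm (g x) \<le> norm (B * indicator \<Omega> x)"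
 proof (rule AE_I2, goal_cases)
  case (1 x)
  show ?case
   using B[of x] z[of x] by (cases "x \<in> \<Omega>") auto
 qed
qed measurable

lemma comp_bounded:
 assumes g: "continuous_on UNIV (g :: real \<Rightarrow> real)"
 shows "\<exists>B. \<forall>t. \<bar>t\<bar> \<le> A \<longrightarrow> \<bar>g t\<bar> \<le> B"
proof -
 have "compact (g ` {-A..A})" using g by (intro compact_continuous_image continuous_on_subset[OF g]) auto
 then obtain B where "\<And>y. y \<in> g ` {-A..A} \<Longrightarrow> norm y \<le> B" using compact_imp_bounded bounded_iff by metis
 then show ?thesis by (intro exI[of _ B]) (auto simp: abs_le_iff)
qed

lemma F_taylor:
 assumes L: "\<forall>x y. \<bar>x\<bar> \<le> B \<longrightarrow> \<bar>y\<bar> \<le> B \<longrightarrow> \<bar>f x - f y\<bar> \<le> L * \<bar>x - y\<bar>" "0 \<le> L" and x: "\<bar>x\<bar> \<le> B" and y: "\<bar>y\<bar> \<le> B"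
 shows "\<bar>F y - F x - f x * (y - x)\<bar> \<le> L * (y - x)\<^sup>2"
proof -
 have "\<exists>z. \<bar>z\<bar> \<le> B \<and> \<bar>x - z\<bar> \<le> \<bar>y - x\<bar> \<and> F y - F x = (y - x) * f z"
 proof (cases x y rule: linorder_cases)
  case less
  then obtain z where "x < z" "z < y" "F y - F x = (y - x) * f z" using MVT2[of x y F f] F(2) by auto
  then show ?thesis using x y by (intro exI[of _ z]) auto
 next
  case greater
  then obtain z where z: "y < z" "z < x" "F x - F y = (x - y) * f z" using MVT2[of y x F f] F(2) by auto
  have "F y - F x = (y - x) * f z" using z(3) by (simp add: algebra_simps)
  then show ?thesis using z x y by (intro exI[of _ z]) auto
 qed (use x in auto)
 then obtain z where z: "\<bar>z\<bar> \<le> B" "\<bar>x - z\<bar> \<le> \<bar>y - x\<bar>" "F y - F x = (y - x) * f z" by blast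
 have "\<bar>f x - f z\<bar> \<le> L * \<bar>x - z\<bar>" using L(1) x z(1) by blast
 also have "... \<le> L * \<bar>y - x\<bar>" using z(2) L(2) by (intro mult_left_mono)
 finally have le: "\<bar>f x - f z\<bar> \<le> L * \<bar>y - x\<bar>" .
 have "F y - F x - f x * (y - x) = - ((f x - f z) * (y - x))" unfolding z(3) by (simp add: algebra_simps)
 then have "\<bar>F y - F x - f x * (y - x)\<bar> = \<bar>f x - f z\<bar> * \<bar>y - x\<bar>" by (simp add: abs_mult)
 also have "... \<le> (L * \<bar>y - x\<bar>) * \<bar>y - x\<bar>" using le by (intro mult_right_mono) auto
 also have "... = L * (y - x)\<^sup>2" by (simp add: power2_eq_square abs_mult_self_eq[of "y - x", symmetric] mult.assoc del: abs_mult_self_eq)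
 finally show ?thesis .
qed

section \<open>The Pohozaev functional and the energy of dilation differences\<close>

definition PF :: real where "PF = (\<integral>x. F (u x))"
definition Pf :: real where "Pf = (\<integral>x. f (u x) * u x)"

definition wh :: "real \<Rightarrow> 'a \<Rightarrow> real" where "wh h x = dil s h u x - u x"
definition W :: "real \<Rightarrow> real" where "W h = (\<integral>x. (wh h x)\<^sup>2)"

lemma F_u_integrable: "integrable lborel (\<lambda>x. F (u x))"
proof -
 obtain B where B: "\<forall>t. \<bar>t\<bar> \<le> M \<longrightarrow> \<bar>F t\<bar> \<le> B" using comp_bounded[OF F_continuous] by blast
 show ?thesis by (rule bounded_integrable[where B=B]) (use B u F in auto)
qed

lemma f_u_integrable: "integrable lborel (\<lambda>x. f (u x) * u x)"
proof -
 obtain B where B: "\<forall>t. \<bar>t\<bar> \<le> M \<longrightarrow> \<bar>f t\<bar> \<le> B" using comp_bounded[OF f(1)] by blast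
 show ?thesis
 proof (rule bounded_integrable[where B="B * M"])
  fix x
  have "0 \<le> B" using B u(3)[of x] by (metis abs_ge_zero order_trans)
  then show "\<bar>f (u x) * u x\<bar> \<le> B * M" unfolding abs_mult using B u(3) by (intro mult_mono) auto
 qed (use u in auto)
qed

lemma poh_integrable: "integrable lborel (\<lambda>x. b * (u x * f (u x)) - real DIM('a) * F (u x))"
 using F_u_integrable f_u_integrable by (simp add: mult.commute)

lemma poh_integral: "(\<integral>x. b * (u x * f (u x)) - real DIM('a) * F (u x)) = b * Pf - real DIM('a) * PF"
 using F_u_integrable f_u_integrable by (simp add: PF_def Pf_def mult.commute)

lemma P_nonneg: "0 \<le> b * Pf - real DIM('a) * PF"
 unfolding poh_integral[symmetric] using poh by (intro Bochner_Integration.integral_nonneg) (auto simp: b_def)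

text \<open>Star-shapedness enters the energy argument here, and it is the reason why only
  \<open>h \<ge> 0\<close> is available: \<open>dil s h u\<close> lives on a smaller copy of
  \<open>\<Omega>\<close>.\<close>

lemma dil_support: "0 \<le> h \<Longrightarrow> x \<notin> \<Omega> \<Longrightarrow> dil s h u x = 0"
proof -
 assume h: "0 \<le> h" and x: "x \<notin> \<Omega>"
 have "exp h *\<^sub>R x \<notin> \<Omega>"
 proof
  assume "exp h *\<^sub>R x \<in> \<Omega>"
  then have "exp (- h) *\<^sub>R (exp h *\<^sub>R x) \<in> \<Omega>" by (rule \<Omega>(4)) (use h in auto)
  then show False using x by (simp add: exp_minus)
 qed
 then show ?thesis by (simp add: dil_def u)
qed

lemma dil_bound: "0 \<le> h \<Longrightarrow> h \<le> 1 \<Longrightarrow> \<bar>dil s h u x\<bar> \<le> exp \<bar>b\<bar> * M"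
proof -
 assume h: "0 \<le> h" "h \<le> 1"
 have "b * h \<le> \<bar>b\<bar> * 1" using h by (intro mult_mono) auto
 then show ?thesis unfolding dil_b abs_mult using u(3) by (intro mult_mono) auto
qed

lemma wh_Hsb: "Hsb s (wh h)"
 unfolding wh_def[abs_def] by (intro Hsb_diff Hsb_dil u)

lemma wh_sqint: "sqint (wh h)"
 by (rule Hsb_sqint[OF wh_Hsb])

lemma wh_measurable [measurable]: "wh h \<in> borel_measurable borel"
 by (rule Hsb_measurable[OF wh_Hsb])

lemma wh_support: "0 \<le> h \<Longrightarrow> x \<notin> \<Omega> \<Longrightarrow> wh h x = 0"
 by (simp add: wh_def dil_support u)

lemma W_nonneg [simp]: "0 \<le> W h"
 by (simp add: W_def)

lemma Eb_wh: 
 assumes h: "0 \<le> h"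
 shows "Eb s (wh h) (wh h) = - 2 * (\<integral>x. f (u x) * wh h x)"
proof -
 have V: "Hsb s (dil s h u)" by (rule Hsb_dil[OF u(1)])
 have "Eb s (wh h) (wh h) = Eb s (dil s h u) (dil s h u) - 2 * Eb s (dil s h u) u + Eb s u u"
  unfolding wh_def[abs_def] using Eb_sq_lin[OF V u(1), of 1 "-1"] by simp
 also have "Eb s (dil s h u) (dil s h u) = Eb s u u" by (rule Eb_dil[OF u(1) u(1)])
 finally have "Eb s (wh h) (wh h) = - 2 * (Eb s (dil s h u) u - Eb s u u)" by simp
 also have "Eb s (dil s h u) u - Eb s u u = Eb s (wh h) u"
  unfolding wh_def[abs_def] by (rule Eb_diff[OF V u(1) u(1), symmetric])
 also have "Eb s (wh h) u = Eb s u (wh h)" by (rule Eb_commute)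
 also have "... = (\<integral>x. f (u x) * wh h x)" by (rule eq[OF wh_Hsb wh_support[OF h]])
 finally show ?thesis .
qed

text \<open>After \<open>Eb_wh\<close>, a lower bound for the integral of
  \<open>f (u x) * wh h x\<close> is needed. As \<open>f\<close> is Lipschitz on bounded sets, that
  integral is at least the increment of the integral of \<open>F\<close> minus
  \<open>L * W h\<close>. A change of variables turns the dilated integral into
  \<open>exp (- n * h)\<close> times the integral of \<open>F (exp (b * h) * u x)\<close>, whose
  derivative at \<open>h = 0\<close> is \<open>b * Pf - n * PF\<close>.\<close>

lemma energy_estimate:
 obtains C where "0 \<le> C" "\<And>h. 0 < h \<Longrightarrow> h \<le> 1 \<Longrightarrow> Eb s (wh h) (wh h) \<le> - 2 * h * (b * Pf - real DIM('a) * PF) + C * (h\<^sup>2 + W h)"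
proof -
 let ?n = "real DIM('a)"
 define M1 where "M1 = exp \<bar>b\<bar> * M"
 have M1: "M \<le> M1" unfolding M1_def using M_nonneg mult_right_mono[of 1 "exp \<bar>b\<bar>" M] by simp
 obtain L where L: "0 \<le> L" "\<forall>x y. \<bar>x\<bar> \<le> M1 \<longrightarrow> \<bar>y\<bar> \<le> M1 \<longrightarrow> \<bar>f x - f y\<bar> \<le> L * \<bar>x - y\<bar>" using f(2) by blast
 note taylor = F_taylor[OF L(2) L(1)]
 obtain Bf where Bf: "\<forall>t. \<bar>t\<bar> \<le> M1 \<longrightarrow> \<bar>f t\<bar> \<le> Bf" using comp_bounded[OF f(1)] by blast
 obtain BF where BF: "\<forall>t. \<bar>t\<bar> \<le> M1 \<longrightarrow> \<bar>F t\<bar> \<le> BF" using comp_bounded[OF F_continuous] by blast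
 have Bf0: "0 \<le> Bf" using Bf M1 M_nonneg by (metis abs_ge_zero abs_of_nonneg order_trans order_refl)
 have u1: "\<bar>u x\<bar> \<le> M1" for x using u(3)[of x] M1 by linarith
 define U2 where "U2 = (\<integral>x. (u x)\<^sup>2)"
 have U2: "0 \<le> U2" by (simp add: U2_def)
 define A1 where "A1 = \<bar>b\<bar> + b\<^sup>2 * exp \<bar>b\<bar>"
 \<comment> \<open>\<open>C1\<close> and \<open>C2\<close> bound the second order remainders of
   \<open>exp (- n * h)\<close> and of \<open>exp (- n * h) * a\<close> with
   \<open>a = exp (b * h) - 1\<close>; the latter is a difference of two exponentials.\<close>
 define C1 where "C1 = ?n\<^sup>2 * exp ?n"
 define C2 where "C2 = (b - ?n)\<^sup>2 * exp \<bar>b - ?n\<bar> + C1"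
 define C3 where "C3 = C1 * \<bar>PF\<bar> + C2 * \<bar>Pf\<bar> + L * A1\<^sup>2 * U2"
 have C3: "0 \<le> C3" unfolding C3_def C2_def C1_def using L U2 by (intro add_nonneg_nonneg mult_nonneg_nonneg) auto
 show ?thesis
 proof (rule that)
  show "0 \<le> 2 * C3 + 2 * L" using C3 L by simp
  fix h :: real assume h: "0 < h" "h \<le> 1"
  let ?V = "dil s h u"
  define a where "a = exp (b * h) - 1"
  have V1: "\<bar>?V x\<bar> \<le> M1" for x unfolding M1_def using h by (intro dil_bound) auto
  have [measurable]: "?V \<in> borel_measurable borel" by (rule Hsb_measurable[OF Hsb_dil[OF u(1)]])
  have bu: "\<bar>exp (b * h) * u x\<bar> \<le> M1" for x
  proof -
   have "b * h \<le> \<bar>b\<bar> * 1" using h by (intro mult_mono) auto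
   then show ?thesis unfolding M1_def abs_mult using u(3) by (intro mult_mono) auto
  qed
  have iW: "integrable lborel (\<lambda>x. (wh h x)\<^sup>2)" by (rule sqint_integrable[OF wh_sqint])
  have iV: "integrable lborel (\<lambda>x. F (?V x))"
   by (rule bounded_integrable[where B=BF]) (use BF V1 h F dil_support in auto)
  have ifw: "integrable lborel (\<lambda>x. f (u x) * wh h x)"
  proof (rule bounded_integrable[where B="Bf * (2 * M1)"])
   fix x
   have "\<bar>wh h x\<bar> \<le> 2 * M1" unfolding wh_def using V1[of x] u1[of x] by linarith
   then show "\<bar>f (u x) * wh h x\<bar> \<le> Bf * (2 * M1)" unfolding abs_mult using Bf u1 Bf0 by (intro mult_mono) auto
  qed (use wh_support h in auto)
  have "(\<integral>x. F (?V x) - F (u x) - L * (wh h x)\<^sup>2) \<le> (\<integral>x. f (u x) * wh h x)"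
  proof (rule integral_mono)
   fix x
   show "F (?V x) - F (u x) - L * (wh h x)\<^sup>2 \<le> f (u x) * wh h x"
    using taylor[OF u1 V1, of x x] unfolding wh_def by (simp add: abs_le_iff)
  qed (use iV F_u_integrable iW ifw in auto)
  then have step1: "(\<integral>x. F (?V x)) - PF - L * W h \<le> (\<integral>x. f (u x) * wh h x)"
   using iV F_u_integrable iW by (simp add: PF_def W_def)
  define G where "G y = F (exp (b * h) * u y)" for y
  have [measurable]: "G \<in> borel_measurable borel" unfolding G_def by measurable
  have iG: "integrable lborel G"
   by (rule bounded_integrable[where B=BF]) (use BF bu F u in \<open>auto simp: G_def\<close>)
  have "(\<integral>x. F (?V x)) = (\<integral>x. G (0 + exp h *\<^sub>R x))" by (simp add: G_def dil_b)
  also have "... = 1 / \<bar>exp h\<bar> ^ DIM('a) * (\<integral>x. G x)" by (rule integral_lborel_affine) auto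
  also have "1 / \<bar>exp h\<bar> ^ DIM('a) = exp (- (?n * h))" by (simp add: exp_of_nat_mult[symmetric] exp_minus divide_inverse)
  finally have step2: "(\<integral>x. F (?V x)) = exp (- (?n * h)) * (\<integral>x. G x)" .
  have step3: "PF + a * Pf - L * a\<^sup>2 * U2 \<le> (\<integral>x. G x)"
  proof -
   have i2: "integrable lborel (\<lambda>x. (u x)\<^sup>2)" by (rule sqint_integrable[OF Hsb_sqint[OF u(1)]])
   have "(\<integral>x. F (u x) + a * (f (u x) * u x) - (L * a\<^sup>2) * (u x)\<^sup>2) \<le> (\<integral>x. G x)"
   proof (rule integral_mono)
    fix x
    have "exp (b * h) * u x - u x = a * u x" by (simp add: a_def algebra_simps)
    then show "F (u x) + a * (f (u x) * u x) - (L * a\<^sup>2) * (u x)\<^sup>2 \<le> G x"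
     using taylor[OF u1 bu, of x x] unfolding G_def by (simp add: abs_le_iff power_mult_distrib mult_ac)
   qed (use iG i2 F_u_integrable f_u_integrable in auto)
   then show ?thesis using i2 F_u_integrable f_u_integrable by (simp add: PF_def Pf_def U2_def)
  qed
  have hh: "h * h \<le> h" using h mult_left_mono[of h 1 h] by simp
  have t1: "\<bar>exp (- (?n * h)) - 1 + ?n * h\<bar> \<le> C1 * h\<^sup>2"
  proof -
   have "\<bar>exp (- (?n * h)) - 1 - (- (?n * h))\<bar> \<le> (- (?n * h))\<^sup>2 * exp \<bar>- (?n * h)\<bar>" by (rule exp_taylor)
   also have "... \<le> (- (?n * h))\<^sup>2 * exp ?n" using h by (intro mult_left_mono) (auto simp: abs_mult mult_left_le)
   also have "... = C1 * h\<^sup>2" by (simp add: C1_def power_mult_distrib mult_ac)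
   finally show ?thesis by simp
  qed
  have t2: "\<bar>exp (- (?n * h)) * a - b * h\<bar> \<le> C2 * h\<^sup>2"
  proof -
   have "exp (- (?n * h)) * a - b * h = (exp ((b - ?n) * h) - 1 - (b - ?n) * h) - (exp (- (?n * h)) - 1 + ?n * h)"
    by (simp add: a_def algebra_simps exp_add[symmetric])
   moreover have "\<bar>exp ((b - ?n) * h) - 1 - (b - ?n) * h\<bar> \<le> (b - ?n)\<^sup>2 * exp \<bar>b - ?n\<bar> * h\<^sup>2"
   proof -
    have "\<bar>exp ((b - ?n) * h) - 1 - (b - ?n) * h\<bar> \<le> ((b - ?n) * h)\<^sup>2 * exp \<bar>(b - ?n) * h\<bar>" by (rule exp_taylor)
    also have "... \<le> ((b - ?n) * h)\<^sup>2 * exp \<bar>b - ?n\<bar>" using h by (intro mult_left_mono) (auto simp: abs_mult mult_left_le)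
    finally show ?thesis by (simp add: power_mult_distrib mult_ac)
   qed
   ultimately show ?thesis using t1 unfolding C2_def distrib_right by linarith
  qed
  have t3: "exp (- (?n * h)) * (L * a\<^sup>2 * U2) \<le> L * A1\<^sup>2 * U2 * h\<^sup>2"
  proof -
   have "\<bar>a\<bar> \<le> A1 * h" unfolding a_def A1_def using h by (intro exp_minus_one_bound) auto
   then have "\<bar>a\<bar>\<^sup>2 \<le> (A1 * h)\<^sup>2" by (intro power_mono) auto
   then have "a\<^sup>2 \<le> A1\<^sup>2 * h\<^sup>2" by (simp add: power_mult_distrib)
   then have "L * a\<^sup>2 * U2 \<le> L * (A1\<^sup>2 * h\<^sup>2) * U2" using L U2 by (intro mult_right_mono mult_left_mono)
   moreover have "exp (- (?n * h)) * (L * a\<^sup>2 * U2) \<le> 1 * (L * a\<^sup>2 * U2)" using h L U2 by (intro mult_right_mono) auto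
   ultimately show ?thesis by (simp add: mult_ac)
  qed
  have "exp (- (?n * h)) * (PF + a * Pf - L * a\<^sup>2 * U2) \<le> (\<integral>x. F (?V x))"
   unfolding step2 by (intro mult_left_mono step3) auto
  moreover have "exp (- (?n * h)) * (PF + a * Pf - L * a\<^sup>2 * U2) =
    PF + h * (b * Pf - ?n * PF) + (exp (- (?n * h)) - 1 + ?n * h) * PF + (exp (- (?n * h)) * a - b * h) * Pf - exp (- (?n * h)) * (L * a\<^sup>2 * U2)"
   by (simp add: algebra_simps)
  moreover have "- (C1 * \<bar>PF\<bar> * h\<^sup>2) \<le> (exp (- (?n * h)) - 1 + ?n * h) * PF"
  proof -
   have "\<bar>(exp (- (?n * h)) - 1 + ?n * h) * PF\<bar> \<le> (C1 * h\<^sup>2) * \<bar>PF\<bar>" unfolding abs_mult by (intro mult_right_mono t1) auto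
   then show ?thesis by (simp add: abs_le_iff mult_ac)
  qed
  moreover have "- (C2 * \<bar>Pf\<bar> * h\<^sup>2) \<le> (exp (- (?n * h)) * a - b * h) * Pf"
  proof -
   have "\<bar>(exp (- (?n * h)) * a - b * h) * Pf\<bar> \<le> (C2 * h\<^sup>2) * \<bar>Pf\<bar>" unfolding abs_mult by (intro mult_right_mono t2) auto
   then show ?thesis by (simp add: abs_le_iff mult_ac)
  qed
  moreover have "C3 * h\<^sup>2 = C1 * \<bar>PF\<bar> * h\<^sup>2 + C2 * \<bar>Pf\<bar> * h\<^sup>2 + L * A1\<^sup>2 * U2 * h\<^sup>2" by (simp add: C3_def distrib_right)
  ultimately have "h * (b * Pf - ?n * PF) - C3 * h\<^sup>2 \<le> (\<integral>x. F (?V x)) - PF" using t3 by linarith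
  then have "h * (b * Pf - ?n * PF) - C3 * h\<^sup>2 - L * W h \<le> (\<integral>x. f (u x) * wh h x)" using step1 by linarith
  moreover have "Eb s (wh h) (wh h) = - 2 * (\<integral>x. f (u x) * wh h x)" using h by (intro Eb_wh) auto
  moreover have "C3 * h\<^sup>2 + L * W h \<le> (C3 + L) * (h\<^sup>2 + W h)" using C3 L by (simp add: distrib_right distrib_left)
  moreover have "- 2 * h * (b * Pf - ?n * PF) = - 2 * (h * (b * Pf - ?n * PF))" by simp
  moreover have "(2 * C3 + 2 * L) * (h\<^sup>2 + W h) = 2 * ((C3 + L) * (h\<^sup>2 + W h))" by (simp add: algebra_simps)
  ultimately show "Eb s (wh h) (wh h) \<le> - 2 * h * (b * Pf - ?n * PF) + (2 * C3 + 2 * L) * (h\<^sup>2 + W h)" by linarith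
 qed
qed

text \<open>A Savare type bootstrap: the energy of \<open>wh h\<close> controls its own modulus of continuity under dilations,
 which improves \<open>W h = o(1)\<close> to \<open>W h = O(h\<^sup>2)\<close> in a single step along \<open>h = 2\<^bsup>-k\<^esup>\<close>.\<close>

lemma W_bound: "\<exists>B. \<forall>k::nat. W ((1/2)^k) \<le> B * (1/4)^k"
proof -
 obtain C where C: "0 \<le> C" "\<And>h. 0 < h \<Longrightarrow> h \<le> 1 \<Longrightarrow> Eb s (wh h) (wh h) \<le> - 2 * h * (b * Pf - real DIM('a) * PF) + C * (h\<^sup>2 + W h)"
  using energy_estimate by blast
 obtain D where D: "0 < D" "\<And>(w :: 'a \<Rightarrow> real) h. Hsb s w \<Longrightarrow> (\<And>x. R < norm x \<Longrightarrow> w x = 0) \<Longrightarrow> 0 < h \<Longrightarrow> h \<le> 1 \<Longrightarrow>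
   (\<integral>x. (dil s h w x - w x)\<^sup>2) \<le> D * (h powr (2 * s) * Eb s w w + h\<^sup>2 * (\<integral>x. (w x)\<^sup>2))"
  using dil_modulus[OF s \<Omega>(2), where 'a='a] by blast
 define E where "E = D * (C + 1)"
 have E: "0 \<le> E" using D C by (simp add: E_def)
 \<comment> \<open>\<open>wh (2 * h) = 2 * wh h + r\<close>, where \<open>r\<close> is the dilation
   increment of \<open>wh h\<close> itself. \<open>dil_modulus\<close> bounds the norm of
   \<open>r\<close> through the energy of \<open>wh h\<close>, which by
   \<open>energy_estimate\<close> and \<open>P_nonneg\<close> is in turn bounded by a multiple of
   \<open>h\<^sup>2 + W h\<close>; the gain \<open>h powr (2 * s)\<close> survives.\<close>
 have rec: "4 * W h \<le> (1 + h powr s) * W (2 * h) + 2 * E * h powr s * (h\<^sup>2 + W h)" if h: "0 < h" "h \<le> 1/2" for h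
 proof -
  define r where "r x = dil s h (wh h) x - wh h x" for x
  have rs: "sqint r" unfolding r_def[abs_def] by (intro sqint_diff Hsb_sqint[OF Hsb_dil[OF wh_Hsb]] wh_sqint)
  have hs: "0 < h powr s" "h powr s \<le> 1" using h s by (auto intro: powr_le1)
  have h2: "h\<^sup>2 \<le> h powr (2 * s)"
  proof -
   have "h powr 2 \<le> h powr (2 * s)" using h s by (intro powr_mono') auto
   then show ?thesis using h by simp
  qed
  have Ew: "Eb s (wh h) (wh h) \<le> C * (h\<^sup>2 + W h)"
  proof -
   have "0 \<le> h * (b * Pf - real DIM('a) * PF)" using h P_nonneg by (intro mult_nonneg_nonneg) auto
   then show ?thesis using C(2)[of h] h by simp
  qed
  have supp: "wh h x = 0" if "R < norm x" for x
  proof -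
   have "x \<notin> \<Omega>" using \<Omega>(3)[of x] that by auto
   then show ?thesis using h by (intro wh_support) auto
  qed
  have "(\<integral>x. (r x)\<^sup>2) \<le> D * (h powr (2 * s) * Eb s (wh h) (wh h) + h\<^sup>2 * W h)"
   unfolding r_def W_def using h by (intro D(2) wh_Hsb supp) auto
  also have "... \<le> D * (h powr (2 * s) * (C * (h\<^sup>2 + W h)) + h powr (2 * s) * (h\<^sup>2 + W h))"
   using D Ew h2 by (intro mult_left_mono add_mono mult_mono) auto
  also have "... = E * h powr (2 * s) * (h\<^sup>2 + W h)" by (simp add: E_def algebra_simps)
  also have "h powr (2 * s) = h powr s * h powr s" by (simp add: powr_add[symmetric])
  finally have r: "(\<integral>x. (r x)\<^sup>2) \<le> E * (h powr s * h powr s) * (h\<^sup>2 + W h)" .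
  have dec: "wh (2 * h) x = 2 * wh h x + r x" for x
  proof -
   have "dil s h (wh h) x = dil s h (dil s h u) x - dil s h u x" by (simp add: dil_def wh_def algebra_simps)
   also have "dil s h (dil s h u) x = dil s (2 * h) u x" by (simp add: dil_add)
   finally have "dil s h (wh h) x = dil s (2 * h) u x - dil s h u x" .
   then show ?thesis unfolding r_def wh_def[of "2 * h" x] using wh_def[of h x] by linarith
  qed
  \<comment> \<open>Weight in Young's inequality: half of the gain \<open>h powr (2 * s)\<close> is
    spent on reducing the loss to \<open>1 + h powr s\<close>, which is summable along dyadic
    \<open>h\<close>.\<close>
  let ?t = "h powr s"
  have "4 * W h = (\<integral>x. 4 * (wh h x)\<^sup>2)" by (simp add: W_def)
  also have "... \<le> (\<integral>x. (1 + ?t) * (wh (2 * h) x)\<^sup>2 + (1 + 1 / ?t) * (r x)\<^sup>2)"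
  proof (rule integral_mono)
   show "integrable lborel (\<lambda>x. 4 * (wh h x)\<^sup>2)" using sqint_integrable[OF wh_sqint] by simp
   show "integrable lborel (\<lambda>x. (1 + ?t) * (wh (2 * h) x)\<^sup>2 + (1 + 1 / ?t) * (r x)\<^sup>2)"
    by (intro Bochner_Integration.integrable_add integrable_mult_right sqint_integrable wh_sqint rs)
   fix x
   define p where "p = wh (2 * h) x"
   define q where "q = r x"
   have "0 \<le> (1 / ?t) * (?t * p + q)\<^sup>2" using hs by simp
   also have "... = ?t * p\<^sup>2 + 2 * (p * q) + (1 / ?t) * q\<^sup>2"
    using hs by (simp add: power2_eq_square field_simps)
   finally have "- (2 * (p * q)) \<le> ?t * p\<^sup>2 + (1 / ?t) * q\<^sup>2" by linarith
   moreover have "4 * (wh h x)\<^sup>2 = (p - q)\<^sup>2" using dec[of x] by (simp add: p_def q_def power2_eq_square)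
   moreover have "(p - q)\<^sup>2 = p\<^sup>2 - 2 * (p * q) + q\<^sup>2" by (simp add: power2_eq_square algebra_simps)
   moreover have "(1 + ?t) * p\<^sup>2 = p\<^sup>2 + ?t * p\<^sup>2" "(1 + 1 / ?t) * q\<^sup>2 = q\<^sup>2 + (1 / ?t) * q\<^sup>2" by (simp_all add: distrib_right)
   ultimately show "4 * (wh h x)\<^sup>2 \<le> (1 + ?t) * (wh (2 * h) x)\<^sup>2 + (1 + 1 / ?t) * (r x)\<^sup>2"
    unfolding p_def q_def by linarith
  qed
  also have "... = (1 + ?t) * W (2 * h) + (1 + 1 / ?t) * (\<integral>x. (r x)\<^sup>2)"
   using sqint_integrable[OF wh_sqint] sqint_integrable[OF rs] by (simp add: W_def)
  also have "... \<le> (1 + ?t) * W (2 * h) + (1 + 1 / ?t) * (E * (?t * ?t) * (h\<^sup>2 + W h))"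
   using r hs by (intro add_left_mono mult_left_mono) auto
  also have "(1 + 1 / ?t) * (E * (?t * ?t) * (h\<^sup>2 + W h)) = (?t + 1) * (E * ?t * (h\<^sup>2 + W h))"
   using hs by (simp add: distrib_right)
  also have "... \<le> 2 * (E * ?t * (h\<^sup>2 + W h))" using hs E by (intro mult_right_mono mult_nonneg_nonneg add_nonneg_nonneg) auto
  finally show ?thesis by (simp add: mult_ac)
 qed
 define q where "q = (1/2::real) powr s"
 have q: "0 < q" "q < 1" using s powr_less_mono2[of s "1/2" 1] by (auto simp: q_def)
 \<comment> \<open>The summand \<open>1\<close> absorbs the term \<open>h\<^sup>2\<close>, since
   \<open>4^k * h\<^sup>2 = 1\<close> for \<open>h = (1/2)^k\<close>, so that the recursion closes
   in \<open>e\<close> alone.\<close>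
 define e where "e k = 1 + 4^k * W ((1/2)^k)" for k :: nat
 have "\<exists>B. \<forall>k. e k \<le> B"
 proof (rule almost_contracting_bounded[OF _ q])
  show "0 \<le> e k" for k by (simp add: e_def)
  show "0 \<le> E" by (rule E)
  fix k
  let ?h = "(1/2::real)^(Suc k)"
  have h: "0 < ?h" "?h \<le> 1/2" by (auto simp: power_le_one)
  have hq: "?h powr s \<le> q ^ k"
  proof -
   have "?h powr s = q ^ Suc k" unfolding q_def by (simp only: powr_realpow[symmetric] powr_powr powr_gt_zero) (simp add: powr_powr powr_realpow[symmetric] mult.commute del: powr_realpow)
   also have "... \<le> q ^ k" using q by simp
   finally show ?thesis .
  qed
  have hs: "0 \<le> ?h powr s" by simp
  have W2: "W (2 * ?h) = W ((1/2)^k)" by simp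
  have h24: "4^(Suc k) * ?h\<^sup>2 = 1" by (simp add: power2_eq_square power_mult_distrib[symmetric])
  have "4 * W ?h \<le> (1 + ?h powr s) * W ((1/2)^k) + 2 * E * ?h powr s * (?h\<^sup>2 + W ?h)"
   using rec[OF h] unfolding W2 .
  then have "4^k * (4 * W ?h) \<le> 4^k * ((1 + ?h powr s) * W ((1/2)^k) + 2 * E * ?h powr s * (?h\<^sup>2 + W ?h))"
   by (intro mult_left_mono) auto
  also have "... = (1 + ?h powr s) * (4^k * W ((1/2)^k)) + (E * ?h powr s / 2) * (4^(Suc k) * ?h\<^sup>2 + 4^(Suc k) * W ?h)"
   by (simp add: algebra_simps)
  also have "... = (1 + ?h powr s) * (e k - 1) + (E * ?h powr s / 2) * e (Suc k)" unfolding h24 by (simp only: e_def) simp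
  finally have "e (Suc k) - 1 \<le> (1 + ?h powr s) * (e k - 1) + (E * ?h powr s / 2) * e (Suc k)" by (simp add: e_def)
  also have "... \<le> (1 + q ^ k) * e k - 1 + E * q ^ k * e (Suc k)"
  proof (rule add_mono)
   have "?h powr s * (e k - 1) \<le> q ^ k * e k" using hq hs q by (intro mult_mono) (auto simp: e_def)
   then show "(1 + ?h powr s) * (e k - 1) \<le> (1 + q ^ k) * e k - 1" by (simp add: distrib_right)
   have "E * ?h powr s / 2 \<le> E * ?h powr s" using E by simp
   also have "... \<le> E * q ^ k" using hq E by (intro mult_left_mono)
   finally show "(E * ?h powr s / 2) * e (Suc k) \<le> E * q ^ k * e (Suc k)" by (intro mult_right_mono) (auto simp: e_def)
  qed
  finally show "e (Suc k) \<le> (1 + q ^ k) * e k + E * q ^ k * e (Suc k)" by simp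
 qed
 then obtain B where B: "\<And>k. e k \<le> B" by blast
 have "W ((1/2)^k) \<le> B * (1/4)^k" for k
 proof -
  have "4^k * W ((1/2)^k) \<le> B" using B[of k] by (simp add: e_def)
  then have "(1/4)^k * (4^k * W ((1/2)^k)) \<le> (1/4)^k * B" by (intro mult_left_mono) auto
  moreover have "(1/4)^k * (4^k * W ((1/2)^k)) = W ((1/2)^k)" by (simp add: mult.assoc[symmetric] power_mult_distrib[symmetric])
  ultimately show ?thesis by (simp add: mult.commute)
 qed
 then show ?thesis by blast
qed

lemma P_zero_energy:
 shows "b * Pf - real DIM('a) * PF = 0" and "\<exists>B. \<forall>k::nat. Eb s (wh ((1/2)^k)) (wh ((1/2)^k)) \<le> B * (1/4)^k"
proof -
 let ?P = "b * Pf - real DIM('a) * PF"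
 obtain C where C: "0 \<le> C" "\<And>h. 0 < h \<Longrightarrow> h \<le> 1 \<Longrightarrow> Eb s (wh h) (wh h) \<le> - 2 * h * ?P + C * (h\<^sup>2 + W h)"
  using energy_estimate by blast
 obtain B where B: "\<And>k::nat. W ((1/2)^k) \<le> B * (1/4)^k" using W_bound by blast
 have E: "Eb s (wh ((1/2)^k)) (wh ((1/2)^k)) \<le> - 2 * (1/2)^k * ?P + C * (1 + B) * (1/4)^k" for k :: nat
 proof -
  have "((1/2::real)^k)\<^sup>2 = (1/4)^k" by (simp add: power2_eq_square power_mult_distrib[symmetric])
  then have "((1/2::real)^k)\<^sup>2 + W ((1/2)^k) \<le> (1 + B) * (1/4)^k" using B[of k] by (simp add: distrib_right)
  then have "C * (((1/2::real)^k)\<^sup>2 + W ((1/2)^k)) \<le> C * ((1 + B) * (1/4)^k)" using C(1) by (intro mult_left_mono)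
  then show ?thesis using C(2)[of "(1/2)^k"] by (simp add: power_le_one mult.assoc)
 qed
 \<comment> \<open>Nonnegativity of the energy, divided by \<open>h = (1/2)^k\<close>, leaves an
   upper bound for \<open>P\<close> that tends to zero.\<close>
 have "2 * ?P \<le> C * (1 + B) * (1/2)^k" for k :: nat
 proof -
  have "0 \<le> - 2 * (1/2)^k * ?P + C * (1 + B) * (1/4)^k" using E[of k] Eb_nonneg[of s "wh ((1/2)^k)"] by linarith
  then have "(1/2)^k * (2 * ?P) \<le> (1/2)^k * (C * (1 + B) * (1/2)^k)"
  proof -
   have "(1/4::real)^k = (1/2)^k * (1/2)^k" by (simp add: power_mult_distrib[symmetric])
   then show ?thesis using \<open>0 \<le> - 2 * (1/2)^k * ?P + C * (1 + B) * (1/4)^k\<close> by (simp add: mult_ac)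
  qed
  then show ?thesis by (subst (asm) mult_le_cancel_left_pos) auto
 qed
 moreover have "(\<lambda>k. C * (1 + B) * (1/2)^k) \<longlonglongrightarrow> C * (1 + B) * 0" by (intro tendsto_intros LIMSEQ_realpow_zero) auto
 ultimately have "2 * ?P \<le> 0" by (intro LIMSEQ_le_const) auto
 then have "?P \<le> 0" by simp
 then show P: "?P = 0" using P_nonneg by (rule order.antisym)
 show "\<exists>B. \<forall>k::nat. Eb s (wh ((1/2)^k)) (wh ((1/2)^k)) \<le> B * (1/4)^k"
  using E unfolding P by (intro exI[of _ "C * (1 + B)"]) simp
qed

end

subsection \<open>Energy estimates\<close>

lemma disjoint_product: "a * c = 0 \<Longrightarrow> b * d = 0 \<Longrightarrow> (a - b) * (c - d) * k = - (a * d * k) - b * c * k" for a b c d k :: real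
 by (auto simp: algebra_simps)

text \<open>The Lipschitz and the semiconvexity estimates both lead to this integral: quadratic
  vanishing tames the singularity because \<open>s < 1\<close>, and the cut-off tames the tail
  because \<open>s > 0\<close>.\<close>

lemma min_kernel:
 fixes s T :: real
 assumes s: "0 < s" "s < 1" and T: "0 < T"
 defines "D \<equiv> kr_const TYPE('a::euclidean_space) (2 * s - 2) + kr_const TYPE('a) (2 * s)"
 shows "(\<integral>\<^sup>+(z::'a). ennreal ((min (norm z) T)\<^sup>2 * kr (2 * s) z)) \<le> ennreal (D * T powr (2 - 2 * s))"
proof -
 let ?c = "kr_const TYPE('a) (2 * s - 2)" let ?d = "kr_const TYPE('a) (2 * s)"
 have c: "0 \<le> ?c" "0 \<le> ?d" by simp_all
 have T2: "T\<^sup>2 * T powr - (2 * s) = T powr (2 - 2 * s)"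
  using T by (simp add: powr_diff powr_minus divide_inverse powr_numeral)
 have pt: "ennreal ((min (norm z) T)\<^sup>2 * kr (2 * s) z) \<le> ennreal (kr (2 * s - 2) z) * indicator {z. norm z < T} z
   + ennreal (T\<^sup>2) * (ennreal (kr (2 * s) z) * indicator {z. T \<le> norm z} z)" for z :: 'a
 proof (cases "norm z < T")
  case True
  have "(norm z)\<^sup>2 * kr (2 * s) z = kr (2 * s - 2) z"
   using kr_mult_norm[of z 2 "2 * s"] by (cases "z = 0") (auto simp: powr_numeral)
  then show ?thesis using True by (simp add: min_def)
 qed (auto simp: ennreal_mult min_def)
 have "(\<integral>\<^sup>+(z::'a). ennreal ((min (norm z) T)\<^sup>2 * kr (2 * s) z))
  \<le> (\<integral>\<^sup>+(z::'a). ennreal (kr (2 * s - 2) z) * indicator {z. norm z < T} z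
   + ennreal (T\<^sup>2) * (ennreal (kr (2 * s) z) * indicator {z. T \<le> norm z} z))"
  by (intro nn_integral_mono pt)
 also have "... = (\<integral>\<^sup>+(z::'a)\<in>{z. norm z < T}. ennreal (kr (2 * s - 2) z) \<partial>lborel)
   + ennreal (T\<^sup>2) * (\<integral>\<^sup>+(z::'a)\<in>{z. T \<le> norm z}. ennreal (kr (2 * s) z) \<partial>lborel)"
  by (subst nn_integral_add) (auto simp: nn_integral_cmult)
 also have "... \<le> ennreal (?c * T powr (2 - 2 * s)) + ennreal (T\<^sup>2) * ennreal (?d * T powr - (2 * s))"
  using kr_core[OF T, where 'a='a and b="2 - 2 * s"] kr_tail[OF T, where 'a='a and a="2 * s"] s
  by (intro add_mono mult_left_mono) auto
 also have "... = ennreal (D * T powr (2 - 2 * s))"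
  using c by (simp add: D_def ennreal_mult[symmetric] ennreal_plus[symmetric] distrib_right mult.left_commute[of "T\<^sup>2"] T2 del: ennreal_plus)
 finally show ?thesis .
qed

lemma Hsb_contraction:
 assumes w: "Hsb s w" and [measurable]: "v \<in> borel_measurable borel"
  and le: "\<And>x. \<bar>v x\<bar> \<le> \<bar>w x\<bar>" "\<And>x y. \<bar>v x - v y\<bar> \<le> \<bar>w x - w y\<bar>"
 shows "Hsb s v"
proof -
 have v: "sqint v" by (rule sqint_bound[OF Hsb_sqint[OF w]]) (use le in auto)
 have "gag s v \<le> gag s w"
  unfolding gag_pair[OF v, symmetric] gag_pair[OF Hsb_sqint[OF w], symmetric]
  using le by (intro nn_integral_mono ennreal_leI mult_right_mono) (auto simp: abs_le_square_iff)
 then show ?thesis using w v unfolding Hsb_def by (auto intro: le_less_trans)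
qed

text \<open>The increment by \<open>z\<close> vanishes unless \<open>x\<close> or
  \<open>x + z\<close> lies in \<open>S\<close>, which gives the factor \<open>2 * A\<close>; the
  rest is \<open>min_kernel\<close>. Keeping \<open>T\<close> as a parameter yields the correct
  power of the thickness for thin shells.\<close>

lemma lipschitz_energy:
 fixes w :: "'a::euclidean_space \<Rightarrow> real" and s \<Lambda> T :: real
 assumes s: "0 < s" "s < 1" and T: "0 < T" and \<Lambda>: "0 \<le> \<Lambda>" and [measurable]: "w \<in> borel_measurable borel" "S \<in> sets borel"
  and S: "emeasure lborel S \<le> ennreal A" "0 \<le> A" "\<And>x. x \<notin> S \<Longrightarrow> w x = 0" and B: "\<And>x. \<bar>w x\<bar> \<le> B"
  and lip: "\<And>x y. \<bar>w x - w y\<bar> \<le> \<Lambda> * min (norm (x - y)) T"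
 defines "D \<equiv> kr_const TYPE('a) (2 * s - 2) + kr_const TYPE('a) (2 * s)"
 shows "Hsb s w" and "Eb s w w \<le> 2 * A * \<Lambda>\<^sup>2 * D * T powr (2 - 2 * s)"
proof -
 have D: "0 \<le> D" by (simp add: D_def)
 have Sfin: "emeasure lborel S < \<infinity>" using S(1) by (rule le_less_trans) simp
 have mS: "measure lborel S \<le> A" using S(1,2) by (simp add: measure_def enn2real_leI)
 have iS: "integrable lborel (\<lambda>x. c * indicator S x :: real)" for c
  using Sfin by (intro integrable_mult_right integrable_real_indicator) auto
 have w: "sqint w"
 proof (rule sqintI)
  show "integrable lborel (\<lambda>x. (w x)\<^sup>2)"
  proof (rule Bochner_Integration.integrable_bound[OF iS[of "B\<^sup>2"]])
   have "(w x)\<^sup>2 \<le> B\<^sup>2" for x using B[of x] by (rule abs_le_square_iff[THEN iffD1, OF order_trans[OF _ abs_ge_self]])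
   then show "AE x in lborel. norm ((w x)\<^sup>2) \<le> norm (B\<^sup>2 * indicator S x)"
    using S(3) by (intro AE_I2) (auto simp: indicator_def)
  qed measurable
 qed fact
 have N: "Nw w z \<le> 2 * A * \<Lambda>\<^sup>2 * (min (norm z) T)\<^sup>2" for z
 proof -
  let ?c = "(\<Lambda> * min (norm z) T)\<^sup>2"
  have i2: "integrable lborel (\<lambda>x. ?c * indicator S (x + z))" "(\<integral>x. ?c * indicator S (x + z)) = ?c * measure lborel S"
   using integrable_lborel_shift[OF iS[of ?c], of z] integral_lborel_shift[of "\<lambda>x. ?c * indicator S x" z] by (simp_all add: add.commute)
  have "Nw w z \<le> (\<integral>x. ?c * indicator S (x + z) + ?c * indicator S x)"
   unfolding Nw_def
  proof (rule integral_mono)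
   show "integrable lborel (\<lambda>x. (w (x + z) - w x)\<^sup>2)" using Nw_integrable[OF w, of z 0] by simp
   fix x
   have "\<bar>w (x + z) - w x\<bar> \<le> \<Lambda> * min (norm z) T" using lip[of "x + z" x] by simp
   then have "(w (x + z) - w x)\<^sup>2 \<le> ?c" by (rule abs_le_square_iff[THEN iffD1, OF order_trans[OF _ abs_ge_self]])
   moreover obtain c where c: "?c = c" and "0 \<le> c" by simp
   ultimately show "(w (x + z) - w x)\<^sup>2 \<le> ?c * indicator S (x + z) + ?c * indicator S x"
    using S(3)[of x] S(3)[of "x + z"] unfolding c by (cases "x \<in> S"; cases "x + z \<in> S") auto
  qed (use i2 iS in simp)
  also have "... = 2 * measure lborel S * ?c" using i2 iS[of ?c] by simp
  also have "... \<le> 2 * A * ?c" using mS by (intro mult_right_mono) auto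
  finally show ?thesis by (simp add: power_mult_distrib mult_ac)
 qed
 have "gag s w \<le> (\<integral>\<^sup>+(z::'a). ennreal (2 * A * \<Lambda>\<^sup>2) * ennreal ((min (norm z) T)\<^sup>2 * kr (2 * s) z))"
  unfolding gag_def using N S by (intro nn_integral_mono) (simp add: ennreal_mult[symmetric] mult.assoc[symmetric] mult_right_mono)
 also have "... = ennreal (2 * A * \<Lambda>\<^sup>2) * (\<integral>\<^sup>+z. ennreal ((min (norm z) T)\<^sup>2 * kr (2 * s) (z::'a)))"
  by (rule nn_integral_cmult) measurable
 also have "... \<le> ennreal (2 * A * \<Lambda>\<^sup>2) * ennreal (D * T powr (2 - 2 * s))"
  unfolding D_def by (intro mult_left_mono min_kernel s T) simp
 also have "... = ennreal (2 * A * \<Lambda>\<^sup>2 * D * T powr (2 - 2 * s))" using D S by (simp add: ennreal_mult[symmetric] mult.assoc)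
 finally have g: "gag s w \<le> ennreal (2 * A * \<Lambda>\<^sup>2 * D * T powr (2 - 2 * s))" .
 then show H: "Hsb s w" using w unfolding Hsb_def by (auto intro: le_less_trans)
 show "Eb s w w \<le> 2 * A * \<Lambda>\<^sup>2 * D * T powr (2 - 2 * s)"
  using g D S unfolding Eb_self[OF H, symmetric] by (subst (asm) ennreal_le_iff) auto
qed

text \<open>With disjoint supports the products taken at a single point drop out, and
  \<open>- Eb\<close> is the interaction counted twice, once for each order of the arguments; one
  copy is kept.\<close>

lemma Eb_disjoint:
 assumes V: "Hsb s V" and \<phi>: "Hsb s \<phi>" and pos: "\<And>x. 0 \<le> V x" "\<And>x. 0 \<le> \<phi> x" and disj: "\<And>x. V x * \<phi> x = 0"
 shows "(\<integral>\<^sup>+y. (\<integral>\<^sup>+x. ennreal (V x * \<phi> y * kr (2 * s) (x - y)))) \<le> ennreal (- Eb s V \<phi>)"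
proof -
 note [measurable] = Hsb_measurable[OF V] Hsb_measurable[OF \<phi>]
 let ?g = "\<lambda>p. - ((V (fst p) - V (snd p)) * (\<phi> (fst p) - \<phi> (snd p)) * kr (2 * s) (fst p - snd p))"
 have g: "?g p = (V (fst p) * \<phi> (snd p) + V (snd p) * \<phi> (fst p)) * kr (2 * s) (fst p - snd p)" for p
  unfolding disjoint_product[OF disj disj] by (simp add: algebra_simps)
 have "(\<integral>\<^sup>+y. (\<integral>\<^sup>+x. ennreal (V x * \<phi> y * kr (2 * s) (x - y))))
  \<le> (\<integral>\<^sup>+y. (\<integral>\<^sup>+x. ennreal (?g (y, x))))"
 proof (intro nn_integral_mono ennreal_leI)
  fix y x
  show "V x * \<phi> y * kr (2 * s) (x - y) \<le> ?g (y, x)"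
   unfolding g using pos by (simp add: kr_minus_commute[of _ x y] distrib_right)
 qed
 also have "... = (\<integral>\<^sup>+p. ennreal (?g p) \<partial>lborel2)"
  by (rule lborel.nn_integral_fst) measurable
 also have "... = ennreal (\<integral>p. ?g p \<partial>lborel2)"
 proof (rule nn_integral_eq_integral)
  show "integrable lborel2 ?g" using Hsb_integrable[OF V \<phi>] by simp
  show "AE p in lborel2. 0 \<le> ?g p" unfolding g using pos by (intro AE_I2) simp
 qed
 also have "(\<integral>p. ?g p \<partial>lborel2) = - Eb s V \<phi>" by (simp add: Eb_def)
 finally show ?thesis .
qed

text \<open>Weak form of an upper bound for the fractional Laplacian of \<open>\<psi>\<close> on the
  support of \<open>\<phi>\<close>. Polarising through \<open>Nw\<close> makes the symmetric second
  difference of \<open>\<psi>\<close> appear under the integral, so no principal value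
  occurs.\<close>

lemma Eb_semiconvex:
 fixes \<psi> \<phi> :: "'a::euclidean_space \<Rightarrow> real" and s C :: real
 assumes s: "0 < s" "s < 1" and \<psi>: "Hsb s \<psi>" and \<phi>: "Hsb s \<phi>" "\<And>x. 0 \<le> \<phi> x" "integrable lborel \<phi>" and C: "0 \<le> C"
  and sc: "\<And>x z. \<phi> x \<noteq> 0 \<Longrightarrow> 2 * \<psi> x - \<psi> (x + z) - \<psi> (x - z) \<le> C * (min (norm z) 1)\<^sup>2"
 defines "D \<equiv> kr_const TYPE('a) (2 * s - 2) + kr_const TYPE('a) (2 * s)"
 shows "Eb s \<psi> \<phi> \<le> C * D * (\<integral>x. \<phi> x)"
proof -
 note sp = Hsb_sqint[OF \<psi>] and sf = Hsb_sqint[OF \<phi>(1)]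
 note [measurable] = Hsb_measurable[OF \<psi>] Hsb_measurable[OF \<phi>(1)]
 define I where "I = (\<integral>x. \<phi> x)"
 have I: "0 \<le> I" using \<phi> by (simp add: I_def)
 have D: "0 \<le> D" by (simp add: D_def)
 have a: "Hsb s (\<lambda>x. \<psi> x + \<phi> x)" and d: "Hsb s (\<lambda>x. \<psi> x - \<phi> x)" using \<psi> \<phi> by (auto intro: Hsb_add Hsb_diff)
 have N: "Nw (\<lambda>x. \<psi> x + \<phi> x) z \<le> Nw (\<lambda>x. \<psi> x - \<phi> x) z + 4 * C * I * (min (norm z) 1)\<^sup>2" for z :: 'a
 proof -
  have sh: "sqint (\<lambda>x. w (x + z))" if "sqint w" for w :: "'a \<Rightarrow> real" and z using that by (rule sqint_shift)
  note ii = sqint_prod_integrable[OF sp sf] sqint_prod_integrable[OF sh[OF sp, of z] sf] sqint_prod_integrable[OF sh[OF sp, of "-z"] sf]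
   sqint_prod_integrable[OF sp sh[OF sf, of z]] sqint_prod_integrable[OF sh[OF sp, of z] sh[OF sf, of z]]
  have e1: "(\<integral>x. \<psi> (x + z) * \<phi> (x + z)) = (\<integral>x. \<psi> x * \<phi> x)"
   using integral_lborel_shift[of "\<lambda>x. \<psi> x * \<phi> x" z] by (simp add: add.commute)
  have e2: "(\<integral>x. \<psi> x * \<phi> (x + z)) = (\<integral>x. \<psi> (x + - z) * \<phi> x)"
   using integral_lborel_shift[of "\<lambda>x. \<psi> (x + - z) * \<phi> x" z] by (simp add: add.commute)
  have "Nw (\<lambda>x. \<psi> x + \<phi> x) z - Nw (\<lambda>x. \<psi> x - \<phi> x) z
   = (\<integral>x. (\<psi> (x + z) + \<phi> (x + z) - (\<psi> x + \<phi> x))\<^sup>2 - (\<psi> (x + z) - \<phi> (x + z) - (\<psi> x - \<phi> x))\<^sup>2)"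
   unfolding Nw_def using Nw_integrable[OF Hsb_sqint[OF a], of z 0] Nw_integrable[OF Hsb_sqint[OF d], of z 0] by simp
  also have "... = (\<integral>x. 4 * (\<psi> (x + z) * \<phi> (x + z)) - 4 * (\<psi> (x + z) * \<phi> x) - 4 * (\<psi> x * \<phi> (x + z)) + 4 * (\<psi> x * \<phi> x))"
   by (intro Bochner_Integration.integral_cong) (auto simp: power2_eq_square algebra_simps)
  also have "... = 4 * (\<integral>x. \<psi> x * \<phi> x) - 4 * (\<integral>x. \<psi> (x + z) * \<phi> x) - 4 * (\<integral>x. \<psi> (x + - z) * \<phi> x) + 4 * (\<integral>x. \<psi> x * \<phi> x)"
   using ii by (simp add: e1 e2)
  also have "... = (\<integral>x. 8 * (\<psi> x * \<phi> x) - 4 * (\<psi> (x + z) * \<phi> x) - 4 * (\<psi> (x + - z) * \<phi> x))"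
   using ii by simp
  also have "... \<le> (\<integral>x. 4 * (C * (min (norm z) 1)\<^sup>2) * \<phi> x)"
  proof (rule integral_mono)
   fix x
   have "(2 * \<psi> x - \<psi> (x + z) - \<psi> (x - z)) * \<phi> x \<le> (C * (min (norm z) 1)\<^sup>2) * \<phi> x"
    using sc[of x z] \<phi>(2)[of x] by (cases "\<phi> x = 0") (auto intro: mult_right_mono)
   then show "8 * (\<psi> x * \<phi> x) - 4 * (\<psi> (x + z) * \<phi> x) - 4 * (\<psi> (x + - z) * \<phi> x) \<le> 4 * (C * (min (norm z) 1)\<^sup>2) * \<phi> x"
    by (simp add: left_diff_distrib)
  qed (use ii \<phi> in auto)
  finally show ?thesis by (simp add: I_def mult_ac)
 qed
 have "gag s (\<lambda>x. \<psi> x + \<phi> x) \<le> (\<integral>\<^sup>+z. ennreal (Nw (\<lambda>x. \<psi> x - \<phi> x) z * kr (2 * s) z) + ennreal (4 * C * I) * ennreal ((min (norm z) 1)\<^sup>2 * kr (2 * s) z))"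
  unfolding gag_def
 proof (rule nn_integral_mono, goal_cases)
  case (1 z)
  have "Nw (\<lambda>x. \<psi> x + \<phi> x) z * kr (2 * s) z \<le> (Nw (\<lambda>x. \<psi> x - \<phi> x) z + 4 * C * I * (min (norm z) 1)\<^sup>2) * kr (2 * s) z"
   using N by (intro mult_right_mono) auto
  then show ?case
   using C I by (simp add: ennreal_mult[symmetric] ennreal_plus[symmetric] distrib_right mult.assoc del: ennreal_plus)
 qed
 also have "... = gag s (\<lambda>x. \<psi> x - \<phi> x) + ennreal (4 * C * I) * (\<integral>\<^sup>+z. ennreal ((min (norm z) 1)\<^sup>2 * kr (2 * s) (z::'a)))"
  unfolding gag_def by (subst nn_integral_add) (auto simp: nn_integral_cmult)
 also have "... \<le> gag s (\<lambda>x. \<psi> x - \<phi> x) + ennreal (4 * C * I) * ennreal D"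
  using min_kernel[OF s, of 1, where 'a='a] by (intro add_mono mult_left_mono) (auto simp: D_def)
 finally have "ennreal (Eb s (\<lambda>x. \<psi> x + \<phi> x) (\<lambda>x. \<psi> x + \<phi> x)) \<le> ennreal (Eb s (\<lambda>x. \<psi> x - \<phi> x) (\<lambda>x. \<psi> x - \<phi> x) + 4 * C * I * D)"
  using C I D unfolding Eb_self[OF a, symmetric] Eb_self[OF d, symmetric] by (simp add: ennreal_mult[symmetric] ennreal_plus[symmetric] del: ennreal_plus)
 then have "Eb s (\<lambda>x. \<psi> x + \<phi> x) (\<lambda>x. \<psi> x + \<phi> x) \<le> Eb s (\<lambda>x. \<psi> x - \<phi> x) (\<lambda>x. \<psi> x - \<phi> x) + 4 * C * I * D"
  using C I D by (subst (asm) ennreal_le_iff) auto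
 then show ?thesis using Eb_sq_lin[OF \<psi> \<phi>(1), of 1 1] Eb_sq_lin[OF \<psi> \<phi>(1), of 1 "-1"] by (simp add: I_def mult_ac)
qed

text \<open>Supplies the negative term in the barrier: a distant bump contributes to the test the
  product of both masses times a lower bound for the kernel, with a minus sign.\<close>

lemma Eb_below_disjoint:
 fixes g \<phi> :: "'a::euclidean_space \<Rightarrow> real"
 assumes g: "Hsb s g" "\<And>x. 0 \<le> g x" "integrable lborel g" and \<phi>: "Hsb s \<phi>" "\<And>x. 0 \<le> \<phi> x" "integrable lborel \<phi>"
  and disj: "\<And>x. g x * \<phi> x = 0" and \<kappa>: "\<And>x y. g x \<noteq> 0 \<Longrightarrow> \<phi> y \<noteq> 0 \<Longrightarrow> \<kappa> \<le> kr (2 * s) (x - y)"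
 shows "Eb s g \<phi> \<le> - \<kappa> * (\<integral>x. g x) * (\<integral>x. \<phi> x)"
proof -
 have "Eb s g \<phi> \<le> (\<integral>p. - \<kappa> * (g (fst p) * \<phi> (snd p)) \<partial>lborel2)"
  unfolding Eb_def
 proof (rule integral_mono)
  show "integrable lborel2 (\<lambda>p. - \<kappa> * (g (fst p) * \<phi> (snd p)))"
   using integrable_lborel_pair_mult[OF g(3) \<phi>(3)] by (intro integrable_mult_right)
  fix p :: "'a \<times> 'a"
  let ?k = "kr (2 * s) (fst p - snd p)"
  have "(g (fst p) - g (snd p)) * (\<phi> (fst p) - \<phi> (snd p)) * ?k = - (g (fst p) * \<phi> (snd p) * ?k) - g (snd p) * \<phi> (fst p) * ?k"
   by (rule disjoint_product) (rule disj)+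
  moreover have "0 \<le> g (snd p) * \<phi> (fst p) * ?k" using g \<phi> by simp
  moreover have "g (fst p) * \<phi> (snd p) * \<kappa> \<le> g (fst p) * \<phi> (snd p) * ?k"
  proof (cases "g (fst p) = 0 \<or> \<phi> (snd p) = 0")
   case False
   then show ?thesis using g \<phi> \<kappa> by (intro mult_left_mono) auto
  qed auto
  ultimately show "(g (fst p) - g (snd p)) * (\<phi> (fst p) - \<phi> (snd p)) * ?k \<le> - \<kappa> * (g (fst p) * \<phi> (snd p))"
   by (simp add: mult_ac)
 qed (rule Hsb_integrable[OF g(1) \<phi>(1)])
 also have "... = - \<kappa> * ((\<integral>x. g x) * (\<integral>x. \<phi> x))"
  using lborel_pair.integral_fst'[OF integrable_lborel_pair_mult[OF g(3) \<phi>(3)]] by (simp add: mult_ac)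
 finally show ?thesis by (simp add: mult.assoc)
qed

subsection \<open>Interior barriers\<close>

lemma Eb_positive_part: "0 \<le> Eb s (w :: 'a::euclidean_space \<Rightarrow> real) (\<lambda>x. max 0 (w x))"
 unfolding Eb_def
proof (rule Bochner_Integration.integral_nonneg)
 fix p :: "'a \<times> 'a"
 have "0 \<le> (a - b) * (max 0 a - max 0 b)" for a b :: real
  by (cases "a \<le> b") (auto simp: max_def mult_nonneg_nonneg mult_nonpos_nonpos)
 then show "0 \<le> (w (fst p) - w (snd p)) * (max 0 (w (fst p)) - max 0 (w (snd p))) * kr (2 * s) (fst p - snd p)"
  by (rule mult_nonneg_nonneg) simp
qed

definition bump :: "'a::euclidean_space \<Rightarrow> real \<Rightarrow> 'a \<Rightarrow> real" where
 "bump p r x = max 0 (r\<^sup>2 - (norm (x - p))\<^sup>2)"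

lemma bump_nonneg [simp]: "0 \<le> bump p r x"
 by (simp add: bump_def)

lemma bump_le: "bump p r x \<le> r\<^sup>2"
 by (simp add: bump_def)

lemma bump_zero: "0 \<le> r \<Longrightarrow> x \<notin> ball p r \<Longrightarrow> bump p r x = 0"
 using power_mono[of r "norm (x - p)" 2] by (simp add: bump_def dist_norm norm_minus_commute)

lemma bump_measurable [measurable]: "bump p r \<in> borel_measurable borel"
 unfolding bump_def[abs_def] by measurable

lemma bump_lipschitz:
 assumes "0 \<le> r"
 shows "\<bar>bump p r x - bump p r y\<bar> \<le> 2 * r * min (norm (x - y)) r"
proof -
 have m: "bump p r x = r\<^sup>2 - (min (norm (x - p)) r)\<^sup>2" for x
  using assms power_mono[of r "norm (x - p)" 2] power_mono[of "norm (x - p)" r 2] by (auto simp: bump_def min_def max_def)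
 define a where "a = min (norm (x - p)) r"
 define b where "b = min (norm (y - p)) r"
 have ab: "0 \<le> a" "a \<le> r" "0 \<le> b" "b \<le> r" using assms by (auto simp: a_def b_def)
 have "\<bar>norm (x - p) - norm (y - p)\<bar> \<le> norm (x - y)" using norm_triangle_ineq3[of "x - p" "y - p"] by simp
 then have "\<bar>a - b\<bar> \<le> min (norm (x - y)) r" using ab unfolding a_def b_def by (auto simp: min_def abs_le_iff)
 moreover have "bump p r x - bump p r y = (b + a) * (b - a)" by (simp add: m a_def b_def power2_eq_square algebra_simps)
 then have "\<bar>bump p r x - bump p r y\<bar> = (b + a) * \<bar>a - b\<bar>" using ab by (simp add: abs_mult abs_minus_commute)
 ultimately show ?thesis using ab by (auto intro!: mult_mono)
qed

lemma Hsb_bump: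
 fixes p :: "'a::euclidean_space"
 assumes s: "0 < s" "s < 1" and r: "0 < r"
 shows "Hsb s (bump p r)"
proof -
 have e: "emeasure lborel (ball p r) \<le> ennreal (measure lborel (ball p r))"
  using emeasure_lborel_ball_finite[of p r] by (simp add: emeasure_eq_ennreal_measure)
 show ?thesis
  by (rule lipschitz_energy(1)[OF s r _ _ _ e _ _ _ bump_lipschitz, where B="r\<^sup>2"]) (use r bump_le bump_zero[of r _ p] in auto)
qed

lemma bump_integrable: "0 \<le> r \<Longrightarrow> integrable lborel (bump p r)"
proof (rule Bochner_Integration.integrable_bound)
 assume r: "0 \<le> r"
 show "integrable lborel (\<lambda>x. r\<^sup>2 * indicator (ball p r) x)"
  using emeasure_lborel_ball_finite[of p r] by (intro integrable_mult_right integrable_real_indicator) auto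
 show "AE x in lborel. norm (bump p r x) \<le> norm (r\<^sup>2 * indicator (ball p r) x)"
 proof (rule AE_I2)
  fix x show "norm (bump p r x) \<le> norm (r\<^sup>2 * indicator (ball p r) x)"
   using bump_zero[OF r, of x p] bump_le[of p r x] by (cases "x \<in> ball p r") auto
 qed
qed measurable

lemma bump_integral_pos:
 assumes r: "0 < r"
 shows "0 < (\<integral>x. bump p r x)"
proof -
 have b: "(3/4) * r\<^sup>2 \<le> bump p r x" if "x \<in> ball p (r/2)" for x
 proof -
  have "(norm (x - p))\<^sup>2 \<le> (r/2)\<^sup>2" using that by (intro power_mono) (auto simp: dist_norm norm_minus_commute)
  then have "(norm (x - p))\<^sup>2 \<le> r\<^sup>2 / 4" by (simp add: power_divide)
  moreover have "r\<^sup>2 - (norm (x - p))\<^sup>2 \<le> bump p r x" by (simp add: bump_def)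
  ultimately show ?thesis by linarith
 qed
 have "0 < (3/4) * r\<^sup>2 * measure lborel (ball p (r/2))" using r content_ball_gt_0_iff[of p "r/2"] by simp
 also have "... = (\<integral>x. (3/4) * r\<^sup>2 * indicator (ball p (r/2)) x)" by simp
 also have "... \<le> (\<integral>x. bump p r x)"
 proof (rule integral_mono)
  show "integrable lborel (\<lambda>x. (3/4) * r\<^sup>2 * indicator (ball p (r/2)) x)"
   using emeasure_lborel_ball_finite[of p "r/2"] by (intro integrable_mult_right integrable_real_indicator) auto
  show "integrable lborel (bump p r)" using r by (intro bump_integrable) simp
  fix x show "(3/4) * r\<^sup>2 * indicator (ball p (r/2)) x \<le> bump p r x"
   using b[of x] by (cases "x \<in> ball p (r/2)") auto
 qed
 finally show ?thesis .
qed

text \<open>The bump lies above its paraboloid everywhere and equals it at \<open>x\<close>, so its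
  second difference there is at most that of the paraboloid. The bound depends on \<open>r1\<close>
  and not on \<open>r\<close>, which makes the barrier uniform in the ball.\<close>

lemma bump_semiconvex:
 assumes r: "0 \<le> r" "r \<le> r1" and x: "x \<in> ball p r"
 shows "2 * bump p r x - bump p r (x + z) - bump p r (x - z) \<le> (2 + 2 * r1\<^sup>2) * (min (norm z) 1)\<^sup>2"
proof -
 let ?g = "\<lambda>y. r\<^sup>2 - (norm (y - p))\<^sup>2"
 have "(norm (x - p))\<^sup>2 \<le> r\<^sup>2" using x by (intro power_mono) (auto simp: dist_norm norm_minus_commute)
 then have gx: "bump p r x = ?g x" by (simp add: bump_def max_def)
 have "(norm (x + z - p))\<^sup>2 + (norm (x - z - p))\<^sup>2 = 2 * (norm (x - p))\<^sup>2 + 2 * (norm z)\<^sup>2"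
  unfolding power2_norm_eq_inner by (simp add: inner_simps inner_commute)
 moreover have "?g (x + z) \<le> bump p r (x + z)" "?g (x - z) \<le> bump p r (x - z)" by (simp_all add: bump_def)
 ultimately have 1: "2 * bump p r x - bump p r (x + z) - bump p r (x - z) \<le> 2 * (norm z)\<^sup>2" unfolding gx by argo
 have r2: "r\<^sup>2 \<le> r1\<^sup>2" using r by (intro power_mono)
 have 2: "2 * bump p r x - bump p r (x + z) - bump p r (x - z) \<le> 2 * r1\<^sup>2"
  using bump_le[of p r x] bump_nonneg[of p r "x + z"] bump_nonneg[of p r "x - z"] r2 by linarith
 show ?thesis
 proof (cases "norm z \<le> 1")
  case True
  have "0 \<le> (2 * r1\<^sup>2) * (norm z)\<^sup>2" by simp
  then have "2 * (norm z)\<^sup>2 \<le> (2 + 2 * r1\<^sup>2) * (norm z)\<^sup>2" by (simp only: distrib_right)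
  then show ?thesis using True order_trans[OF 1] by (simp add: min_def)
 next
  case False
  then show ?thesis using 2 by (simp add: min_def)
 qed
qed

context energy_solution
begin

text \<open>The function \<open>\<tau> * (bump p r + K * bump q \<rho>)\<close> is compared with
  \<open>u\<close> by testing with the positive part of the difference. The distant bump supplies a
  negative term that outweighs both the second order part of the paraboloid and the reaction term.
  Since no constant depends on \<open>p\<close> or \<open>r\<close>, one \<open>\<tau>\<close>
  serves all balls.\<close>

lemma barrier:
 fixes q :: 'a and \<rho> c0 r1 :: real
 assumes upos: "\<And>x. 0 \<le> u x" and f0: "f 0 = 0" and q: "0 < \<rho>" "ball q \<rho> \<subseteq> \<Omega>" and c0: "0 < c0" "\<And>x. x \<in> ball q \<rho> \<Longrightarrow> c0 \<le> u x"
 obtains \<tau> where "0 < \<tau>" "\<And>p r. 0 < r \<Longrightarrow> r \<le> r1 \<Longrightarrow> ball p r \<subseteq> \<Omega> \<Longrightarrow> ball p r \<inter> ball q \<rho> = {} \<Longrightarrow>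
   AE x in lborel. x \<in> ball p r \<longrightarrow> \<tau> * (r\<^sup>2 - (norm (x - p))\<^sup>2) \<le> u x"
proof -
 obtain L where L: "0 \<le> L" "\<forall>x y. \<bar>x\<bar> \<le> M \<longrightarrow> \<bar>y\<bar> \<le> M \<longrightarrow> \<bar>f x - f y\<bar> \<le> L * \<bar>x - y\<bar>" using f(2) by blast
 have fL: "- L * u x \<le> f (u x)" for x
  using L(2)[rule_format, of "u x" 0] u(3)[of x] upos[of x] f0 by (simp add: abs_le_iff)
 define C where "C = 2 + 2 * r1\<^sup>2"
 define D where "D = kr_const TYPE('a) (2 * s - 2) + kr_const TYPE('a) (2 * s)"
 \<comment> \<open>Lower bound for the kernel over distinct points of \<open>\<Omega>\<close>, whose
   distance is at most \<open>2 * R\<close>.\<close>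
 define \<kappa> where "\<kappa> = 1 / (2 * R) powr (real DIM('a) + 2 * s)"
 define G where "G = (\<integral>x. bump q \<rho> x)"
 \<comment> \<open>Chosen so that the distant bump outweighs the other two terms with one to spare;
   this margin forces the integral of the positive part to vanish.\<close>
 define K where "K = (C * D + L * r1\<^sup>2 + 1) / (\<kappa> * G)"
 have C: "0 \<le> C" by (simp add: C_def)
 have D: "0 \<le> D" by (simp add: D_def)
 have \<kappa>: "0 < \<kappa>" using \<Omega>(2) by (simp add: \<kappa>_def)
 have G: "0 < G" unfolding G_def using q(1) by (rule bump_integral_pos)
 have num: "0 < C * D + L * r1\<^sup>2 + 1" using C D L(1) by (intro add_nonneg_pos add_nonneg_nonneg mult_nonneg_nonneg) auto
 have K: "0 < K" unfolding K_def using num \<kappa> G by simp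
 have K': "K * (\<kappa> * G) = C * D + L * r1\<^sup>2 + 1" unfolding K_def using \<kappa> G by simp
 \<comment> \<open>Makes the barrier at most \<open>c0\<close> on the distant ball, so that the
   positive part of \<open>w\<close> lives in \<open>ball p r\<close> only.\<close>
 define \<tau> where "\<tau> = c0 / (K * \<rho>\<^sup>2)"
 have \<tau>: "0 < \<tau>" unfolding \<tau>_def using K c0 q by simp
 have \<tau>K: "\<tau> * K * \<rho>\<^sup>2 = c0" unfolding \<tau>_def using K q by simp
 show ?thesis
 proof (rule that[OF \<tau>])
  fix p :: 'a and r :: real
  assume r: "0 < r" "r \<le> r1" and pr: "ball p r \<subseteq> \<Omega>" and disj: "ball p r \<inter> ball q \<rho> = {}"
  define w where "w x = \<tau> * bump p r x + (\<tau> * K) * bump q \<rho> x - u x" for x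
  define \<phi> where "\<phi> x = max 0 (w x)" for x
  note Hp = Hsb_bump[OF s r(1), of p] and Hq = Hsb_bump[OF s q(1), of q]
  have Hpq: "Hsb s (\<lambda>x. \<tau> * bump p r x + (\<tau> * K) * bump q \<rho> x)" by (rule Hsb_lin[OF Hp Hq])
  have Hw: "Hsb s w" unfolding w_def[abs_def] by (rule Hsb_diff[OF Hpq u(1)])
  have [measurable]: "w \<in> borel_measurable borel" by (rule Hsb_measurable[OF Hw])
  have H\<phi>: "Hsb s \<phi>"
   by (rule Hsb_contraction[OF Hw]) (auto simp: \<phi>_def[abs_def] max_def)
  note [measurable] = Hsb_measurable[OF H\<phi>]
  have supp: "x \<in> ball p r \<and> \<phi> x = \<tau> * bump p r x - u x" if "\<phi> x \<noteq> 0" for x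
  proof -
   have w: "0 < w x" "\<phi> x = w x" using that by (auto simp: \<phi>_def max_def split: if_splits)
   have "x \<notin> ball q \<rho>"
   proof
    assume x: "x \<in> ball q \<rho>"
    then have "bump p r x = 0" using disj r by (intro bump_zero) auto
    moreover have "(\<tau> * K) * bump q \<rho> x \<le> (\<tau> * K) * \<rho>\<^sup>2" using \<tau> K by (intro mult_left_mono bump_le) auto
    ultimately show False using w(1) c0(2)[OF x] \<tau>K by (simp add: w_def)
   qed
   then have bq: "bump q \<rho> x = 0" using q by (intro bump_zero) auto
   moreover have "x \<in> ball p r"
   proof (rule ccontr)
    assume "x \<notin> ball p r"
    then have "bump p r x = 0" using r by (intro bump_zero) auto
    then show False using w(1) bq upos[of x] by (simp add: w_def)
   qed
   ultimately show ?thesis using w by (simp add: w_def)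
  qed
  have \<phi>0: "0 \<le> \<phi> x" for x by (simp add: \<phi>_def)
  have \<phi>\<Omega>: "\<phi> x = 0" if "x \<notin> \<Omega>" for x using supp[of x] that pr by blast
  have \<phi>B: "\<phi> x \<le> \<tau> * r\<^sup>2" for x
  proof (cases "\<phi> x = 0")
   case False
   have "\<tau> * bump p r x \<le> \<tau> * r\<^sup>2" using \<tau> by (intro mult_left_mono bump_le) auto
   then show ?thesis using supp[OF False] upos[of x] by linarith
  qed (use \<tau> in simp)
  have i\<phi>: "integrable lborel \<phi>"
   by (rule bounded_integrable[where B="\<tau> * r\<^sup>2"]) (use \<phi>B \<phi>0 \<phi>\<Omega> in auto)
  define I where "I = (\<integral>x. \<phi> x)"
  have I: "0 \<le> I" using \<phi>0 by (simp add: I_def)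
  have Ep: "Eb s (bump p r) \<phi> \<le> C * D * I"
   unfolding I_def D_def using r supp C_def
   by (intro Eb_semiconvex[OF s Hp H\<phi> \<phi>0 i\<phi>]) (auto intro!: bump_semiconvex simp: C_def simp del: mem_ball)
  have Eq: "Eb s (bump q \<rho>) \<phi> \<le> - \<kappa> * G * I"
   unfolding I_def G_def
  proof (rule Eb_below_disjoint[OF Hq bump_nonneg bump_integrable H\<phi> \<phi>0 i\<phi>])
   have z: "bump q \<rho> x = 0" if "\<phi> x \<noteq> 0" for x
    using supp[OF that] disj q by (intro bump_zero) auto
   then show "bump q \<rho> x * \<phi> x = 0" for x by (cases "\<phi> x = 0") auto
   fix x y assume x: "bump q \<rho> x \<noteq> 0" and y: "\<phi> y \<noteq> 0"
   have "x \<noteq> y" using x z[OF y] by auto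
   have "x \<in> \<Omega>" using x bump_zero[of \<rho> x q] q by (meson less_imp_le subsetD)
   moreover have "y \<in> \<Omega>" using supp[OF y] pr by blast
   ultimately have "norm (x - y) \<le> 2 * R" using norm_triangle_ineq4[of x y] \<Omega>(3)[of x] \<Omega>(3)[of y] by linarith
   then show "\<kappa> \<le> kr (2 * s) (x - y)"
    unfolding \<kappa>_def kr_def using \<open>x \<noteq> y\<close> s \<Omega>(2) by (intro divide_left_mono powr_mono2 mult_pos_pos) auto
  qed (use q in simp)
  have Eu': "Eb s u \<phi> = (\<integral>x. f (u x) * \<phi> x)" by (rule eq[OF H\<phi> \<phi>\<Omega>])
  have Eu: "- (L * \<tau> * r\<^sup>2) * I \<le> Eb s u \<phi>"
   unfolding Eu' I_def integral_mult_right_zero[symmetric]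
  proof (rule integral_mono)
   obtain Bf where Bf: "\<forall>t. \<bar>t\<bar> \<le> M \<longrightarrow> \<bar>f t\<bar> \<le> Bf" using comp_bounded[OF f(1)] by blast
   have Bf0: "0 \<le> Bf" using Bf u(3)[of 0] by (metis abs_ge_zero order_trans)
   have \<phi>B': "\<bar>\<phi> x\<bar> \<le> \<tau> * r\<^sup>2" for x using \<phi>B[of x] \<phi>0[of x] by simp
   show "integrable lborel (\<lambda>x. f (u x) * \<phi> x)"
    by (rule bounded_integrable[where B="Bf * (\<tau> * r\<^sup>2)"]) (use Bf Bf0 \<phi>B' u(3) \<phi>\<Omega> in \<open>auto simp: abs_mult intro!: mult_mono\<close>)
   fix x
   show "- (L * \<tau> * r\<^sup>2) * \<phi> x \<le> f (u x) * \<phi> x"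
   proof (cases "\<phi> x = 0")
    case False
    have "\<tau> * bump p r x \<le> \<tau> * r\<^sup>2" using \<tau> by (intro mult_left_mono bump_le) auto
    then have "u x \<le> \<tau> * r\<^sup>2" using supp[OF False] \<phi>0[of x] by linarith
    then have "L * u x \<le> L * (\<tau> * r\<^sup>2)" using L by (intro mult_left_mono)
    then show ?thesis using fL[of x] \<phi>0 by (intro mult_right_mono) (auto simp: mult.assoc)
   qed simp
  qed (use i\<phi> in simp)
  have "0 \<le> Eb s w \<phi>" unfolding \<phi>_def[abs_def] by (rule Eb_positive_part)
  also have "... = \<tau> * Eb s (bump p r) \<phi> + (\<tau> * K) * Eb s (bump q \<rho>) \<phi> - Eb s u \<phi>"
   unfolding w_def[abs_def] Eb_diff[OF Hpq u(1) H\<phi>] Eb_lin[OF Hp Hq H\<phi>] ..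
  also have "... \<le> \<tau> * (C * D * I) + (\<tau> * K) * (- \<kappa> * G * I) + L * \<tau> * r\<^sup>2 * I"
  proof -
   have "\<tau> * Eb s (bump p r) \<phi> \<le> \<tau> * (C * D * I)" using \<tau> by (intro mult_left_mono Ep) simp
   moreover have "(\<tau> * K) * Eb s (bump q \<rho>) \<phi> \<le> (\<tau> * K) * (- \<kappa> * G * I)" using \<tau> K by (intro mult_left_mono Eq) simp
   ultimately show ?thesis using Eu by simp
  qed
  also have "... = \<tau> * I * (C * D - K * (\<kappa> * G) + L * r\<^sup>2)" by (simp add: algebra_simps)
  also have "... \<le> \<tau> * I * (- 1)"
  proof (rule mult_left_mono)
   have "L * r\<^sup>2 \<le> L * r1\<^sup>2" using r L by (intro mult_left_mono power_mono) auto
   then show "C * D - K * (\<kappa> * G) + L * r\<^sup>2 \<le> - 1" unfolding K' by simp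
  qed (use \<tau> I in simp)
  finally have "I = 0" using \<tau> I by (simp add: mult_le_0_iff)
  then have "AE x in lborel. \<phi> x = 0"
   using integral_nonneg_eq_0_iff_AE[OF i\<phi>] \<phi>0 by (simp add: I_def)
  then show "AE x in lborel. x \<in> ball p r \<longrightarrow> \<tau> * (r\<^sup>2 - (norm (x - p))\<^sup>2) \<le> u x"
  proof (rule AE_mp[OF _ AE_I2], intro impI)
   fix x assume "\<phi> x = 0" "x \<in> ball p r"
   have "0 \<le> \<tau> * K * bump q \<rho> x" using \<tau> K by simp
   then have "\<tau> * bump p r x \<le> u x" using \<open>\<phi> x = 0\<close> by (simp add: \<phi>_def w_def max_def split: if_splits)
   moreover have "\<tau> * (r\<^sup>2 - (norm (x - p))\<^sup>2) \<le> \<tau> * bump p r x" using \<tau> by (intro mult_left_mono) (auto simp: bump_def)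
   ultimately show "\<tau> * (r\<^sup>2 - (norm (x - p))\<^sup>2) \<le> u x" by simp
  qed
 qed
qed

end

subsection \<open>Boundary charts\<close>

lemma AE_le_imp_le:
 fixes g h :: "'a::euclidean_space \<Rightarrow> real"
 assumes S: "open S" and ae: "AE x in lborel. x \<in> S \<longrightarrow> g x \<le> h x" and c: "continuous_on S g" "continuous_on S h" and x: "x \<in> S"
 shows "g x \<le> h x"
proof (rule ccontr)
 assume "\<not> g x \<le> h x"
 define T where "T = {y \<in> S. g y - h y \<in> {0<..}}"
 have "continuous_on S (\<lambda>y. g y - h y)" using c by (intro continuous_intros)
 then have "open T" using S unfolding T_def by (intro continuous_open_preimage[unfolded vimage_def Int_def, simplified]) auto
 moreover have "x \<in> T" using x \<open>\<not> g x \<le> h x\<close> by (simp add: T_def)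
 ultimately obtain \<epsilon> where \<epsilon>: "0 < \<epsilon>" "ball x \<epsilon> \<subseteq> T" using openE by metis
 have "AE y in lborel. y \<notin> T" using ae by eventually_elim (auto simp: T_def)
 then have "T \<in> null_sets lborel" using AE_iff_null_sets[of T lborel] \<open>open T\<close> by simp
 then have "emeasure lborel (ball x \<epsilon>) = 0" using emeasure_mono[OF \<epsilon>(2), of lborel] \<open>open T\<close> by (auto simp: null_sets_def)
 then show False using content_ball_gt_0_iff[of x \<epsilon>] \<epsilon>(1) by (simp add: measure_def)
qed

text \<open>\<open>l\<close> is a defining function of \<open>\<Omega>\<close> near
  \<open>z0\<close> and \<open>N\<close> its gradient, normalised by
  \<open>N x \<bullet> e = 1\<close> rather than to unit length, in accordance with \<open>l\<close>
  measuring height along \<open>e\<close> exactly.\<close>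

locale boundary_chart =
 fixes \<Omega> :: "'a::euclidean_space set" and z0 e :: 'a and r0 \<Lambda> :: real and l :: "'a \<Rightarrow> real" and N :: "'a \<Rightarrow> 'a"
 assumes r0: "0 < r0" and e: "norm e = 1" and \<Lambda>: "0 < \<Lambda>"
  and shift: "\<And>x t. l (x + t *\<^sub>R e) = l x + t"
  and N_lip: "\<And>x y. norm (N x - N y) \<le> \<Lambda> * norm (x - y)"
  and taylor: "\<And>x y. \<bar>l y - l x - N x \<bullet> (y - x)\<bar> \<le> \<Lambda> * (norm (y - x))\<^sup>2"
  and N_e: "\<And>x. N x \<bullet> e = 1"
  and chart: "\<Omega> \<inter> ball z0 r0 = {x \<in> ball z0 r0. 0 < l x}"
  and l_z0: "l z0 = 0" and l_cont: "continuous_on UNIV l"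

lemma C11_boundary_chart:
 assumes D: "C11_domain \<Omega>" and z0: "z0 \<in> frontier \<Omega>"
 obtains e r0 \<Lambda> l N where "boundary_chart \<Omega> z0 e r0 \<Lambda> l N"
proof -
 obtain r e \<gamma> where r: "r > 0" and e: "norm e = 1" and \<gamma>: "C11_function \<gamma>"
  and ch: "\<Omega> \<inter> ball z0 r = {x \<in> ball z0 r. \<gamma> (x - (x \<bullet> e) *\<^sub>R e) < x \<bullet> e}"
  using D z0 unfolding C11_domain_def by blast
 obtain G L where G: "\<And>x. (\<gamma> has_derivative (\<lambda>h. G x \<bullet> h)) (at x)" and L: "L-lipschitz_on UNIV G"
  using \<gamma> unfolding C11_function_def by blast
 have L0: "0 \<le> L" using L by (rule lipschitz_on_nonneg)
 define P where "P x = x - (x \<bullet> e) *\<^sub>R e" for x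
 have ee: "e \<bullet> e = 1" using e by (simp add: norm_eq_1)
 have Psym: "P v \<bullet> w = v \<bullet> P w" for v w by (simp add: P_def inner_simps inner_commute)
 have Pn: "norm (P v) \<le> norm v" for v
 proof -
  have "(norm (P v))\<^sup>2 = (norm v)\<^sup>2 - (v \<bullet> e)\<^sup>2" unfolding power2_norm_eq_inner P_def using ee
   by (simp add: inner_simps inner_commute power2_eq_square)
  then have "(norm (P v))\<^sup>2 \<le> (norm v)\<^sup>2" by simp
  then show ?thesis by (rule power2_le_imp_le) simp
 qed
 have Pd: "P x - P y = P (x - y)" for x y by (simp add: P_def inner_simps algebra_simps)
 have Pe: "P (x + t *\<^sub>R e) = P x" for x t using ee by (simp add: P_def inner_simps algebra_simps)
 have Pder: "(P has_derivative P) (at x)" for x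
  unfolding P_def[abs_def] by (auto intro!: derivative_eq_intros)
 define l where "l x = x \<bullet> e - \<gamma> (P x)" for x
 define N where "N x = e - P (G (P x))" for x
 have der: "(l has_derivative (\<lambda>h. N x \<bullet> h)) (at x)" for x
 proof -
  have "((\<lambda>x. \<gamma> (P x)) has_derivative (\<lambda>h. G (P x) \<bullet> P h)) (at x)" by (rule has_derivative_compose[OF Pder G])
  then have "(l has_derivative (\<lambda>h. h \<bullet> e - G (P x) \<bullet> P h)) (at x)" unfolding l_def[abs_def] by (auto intro!: derivative_eq_intros)
  then show ?thesis by (simp add: N_def inner_diff_left Psym) (simp add: inner_commute)
 qed
 have Nl: "norm (N x - N y) \<le> L * norm (x - y)" for x y
 proof -
  have "N x - N y = P (G (P y) - G (P x))" by (simp add: N_def Pd[symmetric])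
  then have "norm (N x - N y) \<le> norm (G (P y) - G (P x))" using Pn by simp
  also have "... \<le> L * norm (P y - P x)" using lipschitz_onD[OF L, of "P y" "P x"] by (simp add: dist_norm)
  also have "... \<le> L * norm (x - y)" unfolding Pd using Pn[of "y - x"] L0 by (intro mult_left_mono) (auto simp: norm_minus_commute)
  finally show ?thesis .
 qed
 have cont: "continuous_on UNIV l" using der by (intro continuous_at_imp_continuous_on ballI has_derivative_continuous) auto
 have ch': "\<Omega> \<inter> ball z0 r = {x \<in> ball z0 r. 0 < l x}" unfolding ch l_def P_def by auto
 \<comment> \<open>\<open>L + 1\<close> instead of \<open>L\<close>, because the Lipschitz constant
   may be zero while the locale asks for a positive \<open>\<Lambda>\<close>.\<close>
 have "boundary_chart \<Omega> z0 e r (L + 1) l N"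
 proof
  show "l (x + t *\<^sub>R e) = l x + t" for x t using ee by (simp add: l_def Pe inner_simps)
  show "norm (N x - N y) \<le> (L + 1) * norm (x - y)" for x y using Nl[of x y] by (simp add: distrib_right add_increasing2)
  show "N x \<bullet> e = 1" for x using ee by (simp add: N_def inner_diff_left Psym) (simp add: P_def)
  show "\<bar>l y - l x - N x \<bullet> (y - x)\<bar> \<le> (L + 1) * (norm (y - x))\<^sup>2" for x y
  proof -
   let ?d = "y - x"
   have g: "((\<lambda>t. l (x + t *\<^sub>R ?d)) has_real_derivative N (x + t *\<^sub>R ?d) \<bullet> ?d) (at t)" for t
   proof -
    have "((\<lambda>t. x + t *\<^sub>R ?d) has_derivative (\<lambda>h. h *\<^sub>R ?d)) (at t)" by (auto intro!: derivative_eq_intros)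
    from has_derivative_compose[OF this der] show ?thesis by (simp add: has_field_derivative_def mult_commute_abs)
   qed
   obtain t where t: "0 < t" "t < 1" "l (x + 1 *\<^sub>R ?d) - l (x + 0 *\<^sub>R ?d) = (1 - 0) * (N (x + t *\<^sub>R ?d) \<bullet> ?d)"
    using MVT2[of 0 1 "\<lambda>t. l (x + t *\<^sub>R ?d)" "\<lambda>t. N (x + t *\<^sub>R ?d) \<bullet> ?d"] g by auto
   have "l y - l x - N x \<bullet> ?d = (N (x + t *\<^sub>R ?d) - N x) \<bullet> ?d" using t(3) by (simp add: inner_diff_left)
   then have "\<bar>l y - l x - N x \<bullet> ?d\<bar> \<le> norm (N (x + t *\<^sub>R ?d) - N x) * norm ?d" using Cauchy_Schwarz_ineq2 by simp
   also have "... \<le> (L * (t * norm ?d)) * norm ?d" using Nl[of "x + t *\<^sub>R ?d" x] t by (intro mult_right_mono) auto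
   also have "... = (L * t) * (norm ?d)\<^sup>2" by (simp add: power2_eq_square)
   also have "... \<le> (L + 1) * (norm ?d)\<^sup>2" using t L0 mult_left_le[of t L] by (intro mult_right_mono) auto
   finally show ?thesis .
  qed
  show "l z0 = 0"
  proof -
   have "open \<Omega>" using D by (simp add: C11_domain_def)
   then have "z0 \<notin> \<Omega>" "z0 \<in> closure \<Omega>" using z0 by (auto simp: frontier_def interior_open)
   then have "l z0 \<le> 0" using ch' r centre_in_ball[of z0 r] by (metis (no_types, lifting) IntE not_le mem_Collect_eq)
   moreover have "\<not> l z0 < 0"
   proof
    assume neg: "l z0 < 0"
    have "open {x. l x < 0}" using cont by (intro open_Collect_less) auto
    then have "open ({x. l x < 0} \<inter> ball z0 r)" by auto
    moreover have "z0 \<in> {x. l x < 0} \<inter> ball z0 r" using neg r by simp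
    ultimately have "({x. l x < 0} \<inter> ball z0 r) \<inter> \<Omega> \<noteq> {}" using \<open>z0 \<in> closure \<Omega>\<close> open_Int_closure_eq_empty by (metis disjoint_iff)
    then obtain x where x: "l x < 0" "x \<in> \<Omega> \<inter> ball z0 r" by blast
    then show False unfolding ch' by simp
   qed
   ultimately show ?thesis by simp
  qed
 qed (use r e L0 ch' cont in auto)
 then show ?thesis by (rule that)
qed

context boundary_chart
begin

lemma N_bound: "x \<in> ball z0 r0 \<Longrightarrow> norm (N x) \<le> norm (N z0) + \<Lambda> * r0"
proof -
 assume "x \<in> ball z0 r0"
 then have "\<Lambda> * norm (x - z0) \<le> \<Lambda> * r0" using \<Lambda> by (intro mult_left_mono) (auto simp: dist_norm norm_minus_commute)
 then show ?thesis using N_lip[of x z0] norm_triangle_ineq2[of "N x" "N z0"] by linarith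
qed

lemma N_ge_1: "1 \<le> norm (N x)"
 using N_e[of x] norm_cauchy_schwarz[of "N x" e] e by simp

text \<open>In the ball, \<open>d = x - z\<close> satisfies
  \<open>norm d ^ 2 < 2 * r * (N z \<bullet> d)\<close>; the condition
  \<open>2 * \<Lambda> * r \<le> 1\<close> then makes the first order term of \<open>taylor\<close>
  win over the quadratic error.\<close>

lemma interior_ball:
 assumes z: "l z = 0" "norm (z - z0) + 2 * r * norm (N z) \<le> r0" and r: "0 < r" "2 * \<Lambda> * r \<le> 1"
 shows "ball (z + r *\<^sub>R N z) (r * norm (N z)) \<subseteq> \<Omega>"
proof
 fix x assume x: "x \<in> ball (z + r *\<^sub>R N z) (r * norm (N z))"
 let ?d = "x - z"
 have n: "norm (?d - r *\<^sub>R N z) < r * norm (N z)" using x by (simp add: dist_norm norm_minus_commute algebra_simps)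
 have "norm ?d < 2 * r * norm (N z)" using n r norm_triangle_ineq[of "?d - r *\<^sub>R N z" "r *\<^sub>R N z"] by simp
 then have "norm (x - z0) < r0" using z(2) norm_triangle_ineq[of ?d "z - z0"] by simp
 moreover have "0 < l x"
 proof -
  have "(norm (?d - r *\<^sub>R N z))\<^sup>2 < (r * norm (N z))\<^sup>2" using n by (intro power_strict_mono) auto
  moreover have "(norm (?d - r *\<^sub>R N z))\<^sup>2 = (norm ?d)\<^sup>2 - 2 * r * (N z \<bullet> ?d) + (r * norm (N z))\<^sup>2"
   unfolding power_mult_distrib power2_norm_eq_inner by (simp add: inner_simps inner_commute power2_eq_square algebra_simps)
  ultimately have "(norm ?d)\<^sup>2 < 2 * r * (N z \<bullet> ?d)" by linarith
  moreover have "2 * r * (\<Lambda> * (norm ?d)\<^sup>2) \<le> (norm ?d)\<^sup>2" using mult_right_mono[OF r(2), of "(norm ?d)\<^sup>2"] by (simp add: mult_ac)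
  ultimately have "2 * r * (\<Lambda> * (norm ?d)\<^sup>2) < 2 * r * (N z \<bullet> ?d)" by simp
  then have "\<Lambda> * (norm ?d)\<^sup>2 < N z \<bullet> ?d" using r by simp
  then show ?thesis using taylor[of x z] z(1) by (simp add: abs_le_iff)
 qed
 ultimately have "x \<in> {x \<in> ball z0 r0. 0 < l x}" by (simp add: dist_norm norm_minus_commute)
 then show "x \<in> \<Omega>" unfolding chart[symmetric] by blast
qed

text \<open>The interior ball at a farthest point must stay within distance \<open>norm z0\<close>
  of the origin, which forces the inward gradient to point towards the origin. Star-shapedness by
  itself would only give the sign, without a positive amount.\<close>

lemma transversal:
 assumes far: "\<And>x. x \<in> \<Omega> \<Longrightarrow> norm x \<le> norm z0" and z0: "z0 \<noteq> 0"
 shows "N z0 \<bullet> z0 \<le> - norm z0"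
proof -
 define r where "r = min (1 / (2 * \<Lambda>)) (r0 / (2 * norm (N z0)))"
 have N1: "1 \<le> norm (N z0)" by (rule N_ge_1)
 have r: "0 < r" "2 * \<Lambda> * r \<le> 1" "2 * r * norm (N z0) \<le> r0"
  unfolding r_def
 proof -
  let ?n = "norm (N z0)" and ?m = "min (1 / (2 * \<Lambda>)) (r0 / (2 * norm (N z0)))"
  have n: "0 < ?n" using N1 by linarith
  then show "0 < ?m" using \<Lambda> r0 by simp
  have "2 * \<Lambda> * ?m \<le> 2 * \<Lambda> * (1 / (2 * \<Lambda>))" using \<Lambda> by (intro mult_left_mono) auto
  then show "2 * \<Lambda> * ?m \<le> 1" using \<Lambda> by simp
  have "2 * ?n * ?m \<le> 2 * ?n * (r0 / (2 * ?n))" using n by (intro mult_left_mono) auto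
  then show "2 * ?m * ?n \<le> r0" using n by (simp add: mult_ac)
 qed
 have ball: "ball (z0 + r *\<^sub>R N z0) (r * norm (N z0)) \<subseteq> \<Omega>" using r l_z0 by (intro interior_ball) auto
 define \<nu> where "\<nu> = z0 /\<^sub>R norm z0"
 have \<nu>: "norm \<nu> = 1" "z0 = norm z0 *\<^sub>R \<nu>" using z0 by (auto simp: \<nu>_def)
 \<comment> \<open>Move from the centre of the interior ball outwards in direction
   \<open>\<nu>\<close>; any length below the radius stays in \<open>\<Omega>\<close>, and
   \<open>norm (N z0) \<ge> 1\<close> permits every \<open>t < r\<close>.\<close>
 have "t \<le> - r * (N z0 \<bullet> \<nu>)" if t: "0 < t" "t < r" for t
 proof -
  have "t < r * norm (N z0)" using t mult_left_mono[OF N1, of r] by linarith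
  then have "z0 + r *\<^sub>R N z0 + t *\<^sub>R \<nu> \<in> \<Omega>" using ball \<nu> t by (intro subsetD[OF ball]) (simp add: dist_norm)
  then have "norm (z0 + r *\<^sub>R N z0 + t *\<^sub>R \<nu>) \<le> norm z0" by (rule far)
  then have "(z0 + r *\<^sub>R N z0 + t *\<^sub>R \<nu>) \<bullet> \<nu> \<le> norm z0" using norm_cauchy_schwarz[of "z0 + r *\<^sub>R N z0 + t *\<^sub>R \<nu>" \<nu>] \<nu>(1) by simp
  moreover have "z0 \<bullet> \<nu> = norm z0" "\<nu> \<bullet> \<nu> = 1" using \<nu>(1) z0 by (auto simp: \<nu>_def norm_eq_1 power2_norm_eq_inner[symmetric] power2_eq_square)
  ultimately show ?thesis by (simp add: inner_add_left)
 qed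
 then have "r \<le> - r * (N z0 \<bullet> \<nu>)" using r(1) by (intro dense_le_bounded[of 0 r]) auto
 then have "r * (1 + N z0 \<bullet> \<nu>) \<le> 0" by (simp add: algebra_simps)
 then have "1 + N z0 \<bullet> \<nu> \<le> 0" using r(1) by (simp add: mult_le_0_iff)
 then have "norm z0 * (N z0 \<bullet> \<nu>) \<le> norm z0 * (- 1)" by (intro mult_left_mono) auto
 then show ?thesis using \<nu>(2) by (metis inner_scaleR_right mult_minus1_right)
qed

end

subsection \<open>Interaction with a boundary shell\<close>

locale positive_solution = energy_solution s \<Omega> f F u M R + boundary_chart \<Omega> z0 e r0 \<Lambda> l N
 for s :: real and \<Omega> :: "'a::euclidean_space set" and f F :: "real \<Rightarrow> real" and u :: "'a \<Rightarrow> real" and M R :: real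
  and z0 e :: 'a and r0 \<Lambda> :: real and l :: "'a \<Rightarrow> real" and N :: "'a \<Rightarrow> 'a" +
 assumes u_pos: "\<And>x. x \<in> \<Omega> \<Longrightarrow> 0 < u x" and u_cont: "continuous_on \<Omega> u" and f_0: "f 0 = 0"
  and far: "\<And>x. x \<in> \<Omega> \<Longrightarrow> norm x \<le> norm z0" and z0: "z0 \<noteq> 0" and origin: "0 \<in> \<Omega>"
begin

lemma u_nonneg: "0 \<le> u x"
 using u_pos[of x] u(2)[of x] by (cases "x \<in> \<Omega>") auto

text \<open>Slide from \<open>x\<close> along \<open>- e\<close> to the boundary point
  \<open>z\<close> and use the barrier on the interior ball at \<open>z\<close>. Since
  \<open>N z \<bullet> e = 1\<close>, the paraboloid at height \<open>t\<close> equals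
  \<open>2 * r * t - t\<^sup>2\<close>, which is at least \<open>r * t\<close> for
  \<open>t \<le> r\<close>.\<close>

lemma linear_lower:
 obtains c r2 where "0 < c" "0 < r2" "\<And>x. norm (x - z0) < r2 \<Longrightarrow> 0 < l x \<Longrightarrow> l x < r2 \<Longrightarrow> c * l x \<le> u x"
proof -
 define m where "m = min r0 (norm z0)"
 have m: "0 < m" "m \<le> r0" "m \<le> norm z0" using r0 z0 by (auto simp: m_def)
 obtain \<epsilon> where \<epsilon>: "0 < \<epsilon>" "cball 0 \<epsilon> \<subseteq> \<Omega>" using \<Omega>(1) origin open_contains_cball by blast
 \<comment> \<open>By compactness \<open>u\<close> has a positive lower bound on a closed ball about
   the origin; a radius of at most \<open>m / 4\<close> keeps that ball away from the interior balls
   used near \<open>z0\<close>.\<close>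
 define \<rho> where "\<rho> = min \<epsilon> (m / 4)"
 have \<rho>: "0 < \<rho>" "\<rho> \<le> m / 4" "cball (0::'a) \<rho> \<subseteq> \<Omega>" using \<epsilon> m by (auto simp: \<rho>_def subset_iff)
 obtain x0 where x0: "x0 \<in> cball 0 \<rho>" "\<And>y. y \<in> cball 0 \<rho> \<Longrightarrow> u x0 \<le> u y"
  using continuous_attains_inf[of "cball 0 \<rho>" u] \<rho> continuous_on_subset[OF u_cont \<rho>(3)] by auto
 have "0 < u x0" using x0 \<rho> u_pos by blast
 define Gm where "Gm = norm (N z0) + \<Lambda> * r0"
 have Gm: "1 \<le> Gm" using N_ge_1[of z0] \<Lambda> r0 by (simp add: Gm_def add_increasing2)
 \<comment> \<open>The first entry is the condition of \<open>interior_ball\<close>; the second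
   keeps the interior balls small enough to fit into the chart and to miss the ball about the
   origin.\<close>
 define r where "r = min (1 / (2 * \<Lambda>)) (m / (8 * Gm))"
 have r: "0 < r" using \<Lambda> m Gm by (simp add: r_def)
 have r\<Lambda>: "2 * \<Lambda> * r \<le> 1"
  using mult_left_mono[of r "1 / (2 * \<Lambda>)" "2 * \<Lambda>"] \<Lambda> by (simp add: r_def)
 have rm: "r * Gm \<le> m / 8"
  using mult_right_mono[of r "m / (8 * Gm)" Gm] Gm by (simp add: r_def)
 obtain \<tau> where \<tau>: "0 < \<tau>" "\<And>p r'. 0 < r' \<Longrightarrow> r' \<le> r * Gm \<Longrightarrow> ball p r' \<subseteq> \<Omega> \<Longrightarrow> ball p r' \<inter> ball 0 \<rho> = {} \<Longrightarrow>
   AE x in lborel. x \<in> ball p r' \<longrightarrow> \<tau> * (r'\<^sup>2 - (norm (x - p))\<^sup>2) \<le> u x"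
 proof (rule barrier[of \<rho> 0 "u x0" "r * Gm"])
  show "ball 0 \<rho> \<subseteq> \<Omega>" using \<rho>(3) by auto
 qed (use u_nonneg f_0 \<rho>(1) \<open>0 < u x0\<close> x0(2) in auto)
 define r2 where "r2 = min r (m / 4)"
 show ?thesis
 proof (rule that[of "\<tau> * r" r2])
  show "0 < \<tau> * r" "0 < r2" using \<tau> r m by (auto simp: r2_def)
  fix x assume x: "norm (x - z0) < r2" "0 < l x" "l x < r2"
  let ?t = "l x"
  define z where "z = x - ?t *\<^sub>R e"
  define p where "p = z + r *\<^sub>R N z"
  have lz: "l z = 0" using shift[of x "- ?t"] by (simp add: z_def)
  have "norm (z - z0) \<le> norm (x - z0) + norm (?t *\<^sub>R e)" 
   using norm_triangle_ineq4[of "x - z0" "?t *\<^sub>R e"] by (simp add: z_def algebra_simps)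
  then have zz: "norm (z - z0) < m / 2" using x e by (simp add: r2_def)
  then have Nz: "norm (N z) \<le> Gm" unfolding Gm_def using m by (intro N_bound) (simp add: dist_norm norm_minus_commute)
  have rN: "r * norm (N z) \<le> r * Gm" using Nz r by (intro mult_left_mono) auto
  have rN0: "0 < r * norm (N z)" using r N_ge_1[of z] by (intro mult_pos_pos) auto
  have sub: "ball p (r * norm (N z)) \<subseteq> \<Omega>" unfolding p_def
  proof (rule interior_ball[OF lz _ r r\<Lambda>])
   have "2 * r * norm (N z) = 2 * (r * norm (N z))" by simp
   then show "norm (z - z0) + 2 * r * norm (N z) \<le> r0" using zz rN rm m by linarith
  qed
  have disj: "ball p (r * norm (N z)) \<inter> ball 0 \<rho> = {}"
  proof (rule ccontr)
   assume "\<not> ?thesis"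
   then obtain y where y: "norm (y - p) < r * norm (N z)" "norm y < \<rho>" by (auto simp: dist_norm norm_minus_commute)
   have "norm (p - z) = r * norm (N z)" using r by (simp add: p_def)
   then have "norm z0 \<le> norm (z - z0) + r * norm (N z) + norm (y - p) + norm y"
    using norm_triangle_ineq4[of z "z - z0"] norm_triangle_ineq4[of p "p - z"] norm_triangle_ineq4[of y "y - p"] by simp
   then show False using y zz rN rm m \<rho> by linarith
  qed
  have id: "(r * norm (N z))\<^sup>2 - (norm (x - p))\<^sup>2 = 2 * r * ?t - ?t\<^sup>2"
  proof -
   have xp: "x - p = ?t *\<^sub>R e - r *\<^sub>R N z" by (simp add: p_def z_def)
   have "e \<bullet> e = 1" using e by (simp add: norm_eq_1)
   then show ?thesis using N_e[of z]
    unfolding xp power_mult_distrib power2_norm_eq_inner by (simp add: inner_simps inner_commute power2_eq_square algebra_simps)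
  qed
  have "?t * ?t \<le> r * ?t" using x by (intro mult_right_mono) (auto simp: r2_def)
  then have id': "r * ?t \<le> (r * norm (N z))\<^sup>2 - (norm (x - p))\<^sup>2" unfolding id by (simp add: power2_eq_square)
  moreover have "0 < r * ?t" using r x by simp
  ultimately have "(norm (x - p))\<^sup>2 < (r * norm (N z))\<^sup>2" by linarith
  then have "norm (x - p) < r * norm (N z)" using rN0 by (auto intro: power2_less_imp_less)
  then have xb: "x \<in> ball p (r * norm (N z))" by (simp add: dist_norm norm_minus_commute)
  have "\<tau> * ((r * norm (N z))\<^sup>2 - (norm (x - p))\<^sup>2) \<le> u x"
  proof (rule AE_le_imp_le[OF open_ball \<tau>(2)[OF rN0 rN sub disj] _ _ xb])
   show "continuous_on (ball p (r * norm (N z))) (\<lambda>x. \<tau> * ((r * norm (N z))\<^sup>2 - (norm (x - p))\<^sup>2))" by (intro continuous_intros)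
   show "continuous_on (ball p (r * norm (N z))) u" by (rule continuous_on_subset[OF u_cont sub])
  qed
  moreover have "\<tau> * (r * ?t) \<le> \<tau> * ((r * norm (N z))\<^sup>2 - (norm (x - p))\<^sup>2)" using id' \<tau>(1) by (intro mult_left_mono) auto
  ultimately show "\<tau> * r * ?t \<le> u x" by simp
 qed
qed

section \<open>The boundary shell\<close>

definition shrunk :: "real \<Rightarrow> 'a set" where "shrunk h = {x. exp h *\<^sub>R x \<in> \<Omega>}"

text \<open>Off the shell one of the two distances vanishes, and on it the first is at most
  \<open>2 * R * h\<close>. Division by \<open>h\<close> thus gives height of order one at Lipschitz
  constant \<open>1 / h\<close>.\<close>

definition shell_test :: "real \<Rightarrow> 'a \<Rightarrow> real" where
 "shell_test h y = (1 / h) * min (infdist y (- \<Omega>)) (infdist y (shrunk h))"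

lemma shrunk_subset: "0 \<le> h \<Longrightarrow> shrunk h \<subseteq> \<Omega>"
proof
 fix x assume h: "0 \<le> h" and "x \<in> shrunk h"
 then have "exp (- h) *\<^sub>R (exp h *\<^sub>R x) \<in> \<Omega>" by (intro \<Omega>(4)[of "exp h *\<^sub>R x"]) (auto simp: shrunk_def)
 then show "x \<in> \<Omega>" by (simp add: exp_minus)
qed

lemma shrunk_sets [measurable]: "shrunk h \<in> sets borel"
 unfolding shrunk_def by measurable

lemma exp_le_twice: "0 \<le> h \<Longrightarrow> h \<le> 1 \<Longrightarrow> exp h - 1 \<le> 2 * h" for h :: real
proof -
 assume h: "0 \<le> h" "h \<le> 1"
 have "exp h \<le> 1 + h + h\<^sup>2" using h by (intro exp_bound) auto
 also have "h\<^sup>2 \<le> h * 1" unfolding power2_eq_square using h by (intro mult_left_mono) auto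
 finally show ?thesis by simp
qed

lemma shell_measure:
 assumes h: "0 < h"
 shows "emeasure lborel (\<Omega> - shrunk h) \<le> ennreal (real DIM('a) * measure lborel \<Omega> * h)"
proof -
 let ?n = "real DIM('a)"
 have fin: "emeasure lborel (shrunk h) < \<infinity>"
  using emeasure_mono[OF shrunk_subset[of h], of lborel] \<Omega>_finite h by (auto intro: le_less_trans)
 have "measure lborel (shrunk h) = (\<integral>x. indicator \<Omega> (0 + exp h *\<^sub>R x))"
  proof -
  have "indicator \<Omega> (0 + exp h *\<^sub>R x) = (indicator (shrunk h) x :: real)" for x by (simp add: shrunk_def indicator_def)
  then show ?thesis by simp
 qed
 also have "... = 1 / \<bar>exp h\<bar> ^ DIM('a) * (\<integral>x. indicator \<Omega> x)" by (rule integral_lborel_affine) auto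
 also have "... = exp (- (?n * h)) * measure lborel \<Omega>" by (simp add: exp_of_nat_mult[symmetric] exp_minus divide_inverse)
 finally have m: "measure lborel (shrunk h) = exp (- (?n * h)) * measure lborel \<Omega>" .
 have "emeasure lborel (\<Omega> - shrunk h) = ennreal (measure lborel (\<Omega> - shrunk h))"
  using \<Omega>_finite emeasure_mono[of "\<Omega> - shrunk h" \<Omega> lborel] by (intro emeasure_eq_ennreal_measure) (auto simp: top_unique)
 also have "measure lborel (\<Omega> - shrunk h) = measure lborel \<Omega> - measure lborel (shrunk h)"
  using \<Omega>_finite h shrunk_subset[of h] by (intro measure_Diff) auto
 also have "... = (1 - exp (- (?n * h))) * measure lborel \<Omega>" unfolding m by (simp add: left_diff_distrib)
 also have "ennreal ... \<le> ennreal ((?n * h) * measure lborel \<Omega>)"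
  using exp_ge_add_one_self[of "- (?n * h)"] by (intro ennreal_leI mult_right_mono) auto
 finally show ?thesis by (simp add: mult_ac)
qed

lemma shell_test_zero:
 assumes "0 < h" "y \<notin> \<Omega> - shrunk h" shows "shell_test h y = 0"
 using assms infdist_zero[of y "- \<Omega>"] infdist_zero[of y "shrunk h"] infdist_nonneg[of y "- \<Omega>"] infdist_nonneg[of y "shrunk h"]
 by (cases "y \<in> \<Omega>") (auto simp: shell_test_def min_def)

lemma shell_test_nonneg: "0 < h \<Longrightarrow> 0 \<le> shell_test h y"
 by (simp add: shell_test_def infdist_nonneg)

lemma shell_test_le:
 assumes h: "0 < h" "h \<le> 1"
 shows "shell_test h y \<le> 2 * R"
proof (cases "y \<in> \<Omega> - shrunk h")
 case True
 have "infdist y (- \<Omega>) \<le> dist y (exp h *\<^sub>R y)" using True by (intro infdist_le) (auto simp: shrunk_def)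
 also have "... = norm ((exp h - 1) *\<^sub>R y)" by (simp add: dist_norm norm_minus_commute algebra_simps)
 also have "... = (exp h - 1) * norm y" using h by simp
 also have "... \<le> (2 * h) * R" using h exp_le_twice[of h] True \<Omega>(3)[of y] by (intro mult_mono) auto
 finally have "(1 / h) * min (infdist y (- \<Omega>)) (infdist y (shrunk h)) \<le> (1 / h) * ((2 * h) * R)" using h by (intro mult_left_mono) auto
 then show ?thesis using h by (simp add: shell_test_def)
qed (use shell_test_zero[OF h(1)] \<Omega>(2) in simp)

lemma shell_test_lipschitz:
 assumes h: "0 < h" "h \<le> 1"
 shows "\<bar>shell_test h x - shell_test h y\<bar> \<le> (1 / h) * min (norm (x - y)) (2 * R * h)"
proof -
 have "\<bar>infdist x A - infdist y A\<bar> \<le> norm (x - y)" for A :: "'a set" using infdist_triangle_abs[of x A y] by (simp add: dist_norm)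
 from this[of "- \<Omega>"] this[of "shrunk h"]
 have "\<bar>min (infdist x (- \<Omega>)) (infdist x (shrunk h)) - min (infdist y (- \<Omega>)) (infdist y (shrunk h))\<bar> \<le> norm (x - y)" by (auto simp: min_def)
 then have "(1 / h) * \<bar>min (infdist x (- \<Omega>)) (infdist x (shrunk h)) - min (infdist y (- \<Omega>)) (infdist y (shrunk h))\<bar> \<le> (1 / h) * norm (x - y)" using h by (intro mult_left_mono) auto
 then have 1: "\<bar>shell_test h x - shell_test h y\<bar> \<le> (1 / h) * norm (x - y)" using h unfolding shell_test_def by (simp add: right_diff_distrib[symmetric] abs_mult del: times_divide_eq_left)
 have 2: "\<bar>shell_test h x - shell_test h y\<bar> \<le> 2 * R"
  using shell_test_nonneg[of h x] shell_test_nonneg[of h y] shell_test_le[OF h, of x] shell_test_le[OF h, of y] h by linarith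
 show ?thesis using 1 2 h by (simp add: min_def)
qed

lemma shell_test_measurable [measurable]: "shell_test h \<in> borel_measurable borel"
proof -
 have "continuous_on UNIV (\<lambda>y. infdist y A)" for A :: "'a set" by (intro continuous_intros)
 then have [measurable]: "(\<lambda>y. infdist y A) \<in> borel_measurable borel" for A :: "'a set" by (rule borel_measurable_continuous_onI)
 show ?thesis unfolding shell_test_def[abs_def] by measurable
qed

text \<open>\<open>lipschitz_energy\<close> with measure \<open>O(h)\<close>, slope
  \<open>1 / h\<close> and cut-off \<open>2 * R * h\<close>: the powers of \<open>h\<close> combine
  to \<open>1 - 2 + (2 - 2 * s) = 1 - 2 * s\<close>.\<close>

lemma shell_test_energy:
 obtains C where "0 \<le> C" "\<And>h. 0 < h \<Longrightarrow> h \<le> 1 \<Longrightarrow> Hsb s (shell_test h) \<and>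
  Eb s (shell_test h) (shell_test h) \<le> C * h powr (1 - 2 * s) \<and> (\<integral>x. (shell_test h x)\<^sup>2) \<le> C * h"
proof -
 define A where "A = real DIM('a) * measure lborel \<Omega>"
 have A: "0 \<le> A" by (simp add: A_def)
 define D where "D = kr_const TYPE('a) (2 * s - 2) + kr_const TYPE('a) (2 * s)"
 have D: "0 \<le> D" by (simp add: D_def)
 define C1 where "C1 = 2 * A * D * (2 * R) powr (2 - 2 * s)"
 define C2 where "C2 = (2 * R)\<^sup>2 * A"
 have C: "0 \<le> C1" "0 \<le> C2" using A D by (auto simp: C1_def C2_def)
 show ?thesis
 proof (rule that[of "C1 + C2"])
  fix h :: real assume h: "0 < h" "h \<le> 1"
  have S: "emeasure lborel (\<Omega> - shrunk h) \<le> ennreal (A * h)" using shell_measure[OF h(1)] by (simp add: A_def)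
  have B: "\<bar>shell_test h x\<bar> \<le> 2 * R" for x using shell_test_nonneg[OF h(1)] shell_test_le[OF h] by simp
  have z: "x \<notin> \<Omega> - shrunk h \<Longrightarrow> shell_test h x = 0" for x by (rule shell_test_zero[OF h(1)])
  have RT: "0 < 2 * R * h" "0 \<le> 1 / h" "0 \<le> A * h" using \<Omega>(2) h A by auto
  note le = lipschitz_energy[OF s RT(1,2) shell_test_measurable _ S RT(3) z B shell_test_lipschitz[OF h]]
  have H: "Hsb s (shell_test h)" by (rule le(1)) auto
  have "Eb s (shell_test h) (shell_test h) \<le> 2 * (A * h) * (1 / h)\<^sup>2 * D * (2 * R * h) powr (2 - 2 * s)"
   unfolding D_def by (rule le(2)) auto
  also have "... = C1 * (h * (1 / h)\<^sup>2 * h powr (2 - 2 * s))" using h \<Omega>(2) by (simp add: C1_def powr_mult mult_ac)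
  also have "h * (1 / h)\<^sup>2 * h powr (2 - 2 * s) = h powr 1 * h powr - 2 * h powr (2 - 2 * s)"
   using h by (simp add: powr_minus divide_inverse power_inverse powr_numeral)
  also have "... = h powr (1 - 2 * s)" by (simp only: powr_add[symmetric]) simp
  also have "C1 * ... \<le> (C1 + C2) * ..." using C by (intro mult_right_mono) auto
  finally have E: "Eb s (shell_test h) (shell_test h) \<le> (C1 + C2) * h powr (1 - 2 * s)" .
  have Sf: "emeasure lborel (\<Omega> - shrunk h) < \<infinity>" using S by (rule le_less_trans) simp
  have Sm: "measure lborel (\<Omega> - shrunk h) \<le> A * h" using S RT(3) by (simp add: measure_def enn2real_leI)
  have "(\<integral>x. (shell_test h x)\<^sup>2) \<le> (\<integral>x. (2 * R)\<^sup>2 * indicator (\<Omega> - shrunk h) x)"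
  proof (rule integral_mono)
   show "integrable lborel (\<lambda>x. (shell_test h x)\<^sup>2)" by (rule sqint_integrable[OF Hsb_sqint[OF H]])
   show "integrable lborel (\<lambda>x. (2 * R)\<^sup>2 * indicator (\<Omega> - shrunk h) x)" using Sf by (intro integrable_mult_right integrable_real_indicator) auto
   fix x
   have "(shell_test h x)\<^sup>2 \<le> (2 * R)\<^sup>2" using B[of x] by (rule abs_le_square_iff[THEN iffD1, OF order_trans[OF _ abs_ge_self]])
   then show "(shell_test h x)\<^sup>2 \<le> (2 * R)\<^sup>2 * indicator (\<Omega> - shrunk h) x" using z[of x] by (cases "x \<in> \<Omega> - shrunk h") auto
  qed
  also have "... \<le> (2 * R)\<^sup>2 * (A * h)" using Sm by (simp add: mult_left_mono)
  also have "... = C2 * h" by (simp add: C2_def)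
  also have "... \<le> (C1 + C2) * h" using C h by (intro mult_right_mono) auto
  finally show "Hsb s (shell_test h) \<and> Eb s (shell_test h) (shell_test h) \<le> (C1 + C2) * h powr (1 - 2 * s)
   \<and> (\<integral>x. (shell_test h x)\<^sup>2) \<le> (C1 + C2) * h" using H E by blast
 qed (use C in auto)
qed

definition interaction :: "real \<Rightarrow> ennreal" where
 "interaction h = (\<integral>\<^sup>+y. (\<integral>\<^sup>+x. ennreal (dil s h u x * shell_test h y * kr (2 * s) (x - y))))"

text \<open>The interaction is bounded by \<open>- Eb\<close> of the dilate and the shell function,
  which is split into the parts from \<open>wh h\<close> and from \<open>u\<close>. The first is
  controlled by the geometric mean of the energies \<open>h\<^sup>2\<close> and
  \<open>h powr (1 - 2 * s)\<close>; the second is of smaller order by the equation.\<close>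

lemma interaction_upper: "\<exists>C\<ge>0. \<forall>k. interaction ((1/2)^k) \<le> ennreal (C * ((1/2)^k) powr (3/2 - s))"
proof -
 obtain B1 where B1: "\<And>k::nat. W ((1/2)^k) \<le> B1 * (1/4)^k" using W_bound by blast
 obtain B2 where B2: "\<And>k::nat. Eb s (wh ((1/2)^k)) (wh ((1/2)^k)) \<le> B2 * (1/4)^k" using P_zero_energy(2) by blast
 obtain C where C: "0 \<le> C" "\<And>h. 0 < h \<Longrightarrow> h \<le> 1 \<Longrightarrow> Hsb s (shell_test h) \<and>
  Eb s (shell_test h) (shell_test h) \<le> C * h powr (1 - 2 * s) \<and> (\<integral>x. (shell_test h x)\<^sup>2) \<le> C * h"
  using shell_test_energy by blast
 obtain L where L: "0 \<le> L" "\<forall>x y. \<bar>x\<bar> \<le> M \<longrightarrow> \<bar>y\<bar> \<le> M \<longrightarrow> \<bar>f x - f y\<bar> \<le> L * \<bar>x - y\<bar>" using f(2) by blast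
 have fL: "- f (u x) \<le> L * u x" for x
  using L(2)[rule_format, of "u x" 0] u(3)[of x] u_nonneg[of x] f_0 by (simp add: abs_le_iff)
 define E where "E = (B2 + C) / 2 + L * ((B1 + C) / 2)"
 have "interaction ((1/2)^k) \<le> ennreal (E * ((1/2)^k) powr (3/2 - s))" for k :: nat
 proof -
  define h where "h = (1/2::real)^k"
  have h: "0 < h" "h \<le> 1" by (auto simp: h_def power_le_one)
  have h2: "(1/4::real)^k = h powr 2" using h by (simp add: h_def powr_numeral power2_eq_square power_mult_distrib[symmetric])
  let ?\<phi> = "shell_test h" let ?V = "dil s h u" let ?w = "wh h"
  have H\<phi>: "Hsb s ?\<phi>" and E\<phi>: "Eb s ?\<phi> ?\<phi> \<le> C * h powr (1 - 2 * s)" and I\<phi>: "(\<integral>x. (?\<phi> x)\<^sup>2) \<le> C * h" using C(2)[OF h] by auto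
  have HV: "Hsb s ?V" by (rule Hsb_dil[OF u(1)])
  have \<phi>0: "0 \<le> ?\<phi> x" for x by (rule shell_test_nonneg[OF h(1)])
  have V0: "0 \<le> ?V x" for x by (simp add: dil_b u_nonneg)
  have disj: "?V x * ?\<phi> x = 0" for x
  proof (cases "x \<in> shrunk h")
   case True
   then show ?thesis using shell_test_zero[OF h(1), of x] by simp
  qed (simp add: dil_b shrunk_def u)
  have Bw: "Eb s ?w ?w \<le> B2 * h powr 2" and Ww: "W h \<le> B1 * h powr 2" using B1[of k] B2[of k] by (simp_all add: h2 flip: h_def)
  \<comment> \<open>The ratio of the square roots of the two energy bounds; it balances both
    quadratic terms in the energy of \<open>\<theta> * w + \<phi>\<close> to
    \<open>\<theta> * h powr (3/2 - s)\<close>.\<close>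
  define \<theta> where "\<theta> = h powr (- 1/2 - s)"
  have \<theta>: "0 < \<theta>" using h by (simp add: \<theta>_def)
  have "0 \<le> \<theta>\<^sup>2 * Eb s ?w ?w + 2 * \<theta> * 1 * Eb s ?w ?\<phi> + 1\<^sup>2 * Eb s ?\<phi> ?\<phi>"
   unfolding Eb_sq_lin[OF wh_Hsb H\<phi>, symmetric] by simp
  also have "... \<le> \<theta>\<^sup>2 * (B2 * h powr 2) + 2 * \<theta> * Eb s ?w ?\<phi> + C * h powr (1 - 2 * s)"
   using mult_left_mono[OF Bw, of "\<theta>\<^sup>2"] E\<phi> by simp
  also have "\<theta>\<^sup>2 * (B2 * h powr 2) = \<theta> * (B2 * h powr (3/2 - s))"
   by (simp add: \<theta>_def power2_eq_square powr_add[symmetric] mult_ac)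
  also have "C * h powr (1 - 2 * s) = \<theta> * (C * h powr (3/2 - s))"
   by (simp add: \<theta>_def powr_add[symmetric] mult_ac)
  finally have "0 \<le> \<theta> * (B2 * h powr (3/2 - s) + 2 * Eb s ?w ?\<phi> + C * h powr (3/2 - s))" by (simp add: algebra_simps)
  then have "0 \<le> B2 * h powr (3/2 - s) + 2 * Eb s ?w ?\<phi> + C * h powr (3/2 - s)" using \<theta> by (metis not_less zero_le_mult_iff)
  then have e1: "- Eb s ?w ?\<phi> \<le> (B2 + C) / 2 * h powr (3/2 - s)" by (simp add: add_divide_distrib distrib_right)
  \<comment> \<open>Balances \<open>W h\<close>, of order \<open>h\<^sup>2\<close>, with the squared
    norm of the shell function, of order \<open>h\<close>, to \<open>h powr (3/2)\<close>.\<close>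
  let ?t = "h powr (1/2)"
  have t: "0 < ?t" using h by simp
  have "- Eb s u ?\<phi> = (\<integral>x. - (f (u x) * ?\<phi> x))"
   using shell_test_zero[OF h(1)] by (subst eq[OF H\<phi>]) auto
  also have "... \<le> (\<integral>x. L * ((1 / (2 * ?t)) * (?w x)\<^sup>2 + (?t / 2) * (?\<phi> x)\<^sup>2))"
  proof (rule integral_mono)
   have "sqint (\<lambda>x. f (u x))"
   proof (rule sqint_bound[OF sqint_cmult[OF Hsb_sqint[OF u(1)], of L]])
    show "\<bar>f (u x)\<bar> \<le> \<bar>L * u x\<bar>" for x using L(2)[rule_format, of "u x" 0] u(3)[of x] L(1) f_0 by (simp add: abs_mult)
   qed measurable
   then show "integrable lborel (\<lambda>x. - (f (u x) * ?\<phi> x))" using sqint_prod_integrable[OF _ Hsb_sqint[OF H\<phi>]] by simp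
   show "integrable lborel (\<lambda>x. L * ((1 / (2 * ?t)) * (?w x)\<^sup>2 + (?t / 2) * (?\<phi> x)\<^sup>2))"
    by (intro integrable_mult_right Bochner_Integration.integrable_add sqint_integrable wh_sqint Hsb_sqint[OF H\<phi>])
   fix x
   have "- (f (u x) * ?\<phi> x) \<le> (L * u x) * ?\<phi> x" using mult_right_mono[OF fL \<phi>0, of x x] by simp
   \<comment> \<open>Where the shell function is nonzero the dilate vanishes, so
     \<open>u = - wh h\<close> there, and the size of \<open>u\<close> on the shell is already
     controlled by \<open>W h\<close>.\<close>
   also have "... = L * (- (?w x * ?\<phi> x))" using disj[of x] by (simp add: wh_def left_diff_distrib)
   also have "... \<le> L * ((1 / (2 * ?t)) * (?w x)\<^sup>2 + (?t / 2) * (?\<phi> x)\<^sup>2)"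
   proof (rule mult_left_mono[OF _ L(1)])
    have "0 \<le> (1 / (2 * ?t)) * (?w x + ?t * ?\<phi> x)\<^sup>2" using t by simp
    also have "... = (1 / (2 * ?t)) * (?w x)\<^sup>2 + ?w x * ?\<phi> x + (?t / 2) * (?\<phi> x)\<^sup>2"
    proof -
     have "(1 / (2 * t)) * (w + t * p)\<^sup>2 = (1 / (2 * t)) * w\<^sup>2 + w * p + (t / 2) * p\<^sup>2" if "0 < t" for t w p :: real
      using that by (simp add: power2_eq_square field_simps)
     then show ?thesis using t .
    qed
    finally show "- (?w x * ?\<phi> x) \<le> (1 / (2 * ?t)) * (?w x)\<^sup>2 + (?t / 2) * (?\<phi> x)\<^sup>2" by linarith
   qed
   finally show "- (f (u x) * ?\<phi> x) \<le> L * ((1 / (2 * ?t)) * (?w x)\<^sup>2 + (?t / 2) * (?\<phi> x)\<^sup>2)" .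
  qed
  also have "... = L * ((1 / (2 * ?t)) * W h + (?t / 2) * (\<integral>x. (?\<phi> x)\<^sup>2))"
   using sqint_integrable[OF wh_sqint] sqint_integrable[OF Hsb_sqint[OF H\<phi>]] by (simp add: W_def del: times_divide_eq_left)
  also have "... \<le> L * ((1 / (2 * ?t)) * (B1 * h powr 2) + (?t / 2) * (C * h))"
   using t L(1) by (intro mult_left_mono add_mono Ww I\<phi>) auto
  also have "... = L * ((B1 + C) / 2) * h powr (3/2)"
  proof -
   have "h powr 2 / ?t = h powr (3/2)" by (simp add: powr_diff[symmetric])
   moreover have "?t * h = h powr (3/2)" using h powr_add[of h "1/2" 1] by simp
   ultimately have "(1 / (2 * ?t)) * (B1 * h powr 2) = B1 / 2 * h powr (3/2)" "(?t / 2) * (C * h) = C / 2 * h powr (3/2)"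
    by (simp_all add: mult_ac) (metis (no_types, lifting) times_divide_eq_right)
   then show ?thesis by (simp only:) (simp add: algebra_simps add_divide_distrib)
  qed
  also have "... \<le> L * ((B1 + C) / 2) * h powr (3/2 - s)"
  proof (rule mult_left_mono)
   show "h powr (3/2) \<le> h powr (3/2 - s)" using h s by (intro powr_mono') auto
   have "0 \<le> B1" using order_trans[OF W_nonneg B1[of 0]] by simp
   then show "0 \<le> L * ((B1 + C) / 2)" using L(1) C(1) by simp
  qed
  finally have e2: "- Eb s u ?\<phi> \<le> L * ((B1 + C) / 2) * h powr (3/2 - s)" .
  have "Eb s ?w ?\<phi> = Eb s ?V ?\<phi> - Eb s u ?\<phi>" unfolding wh_def[abs_def] by (rule Eb_diff[OF HV u(1) H\<phi>])
  have "- Eb s ?V ?\<phi> \<le> E * h powr (3/2 - s)"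
  proof -
   have "E * h powr (3/2 - s) = (B2 + C) / 2 * h powr (3/2 - s) + L * ((B1 + C) / 2) * h powr (3/2 - s)" by (simp only: E_def distrib_right)
   then show ?thesis using e1 e2 \<open>Eb s ?w ?\<phi> = Eb s ?V ?\<phi> - Eb s u ?\<phi>\<close> by linarith
  qed
  then have "ennreal (- Eb s ?V ?\<phi>) \<le> ennreal (E * h powr (3/2 - s))" by (rule ennreal_leI)
  then show ?thesis unfolding h_def[symmetric] interaction_def
   by (rule order_trans[OF Eb_disjoint[OF HV H\<phi> V0 \<phi>0 disj]])
 qed
 moreover have "0 \<le> E"
 proof -
  have "0 \<le> B1" using order_trans[OF W_nonneg B1[of 0]] by simp
  moreover have "0 \<le> B2" using order_trans[OF Eb_nonneg B2[of 0]] by simp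
  ultimately show ?thesis using C(1) L(1) by (simp add: E_def)
 qed
 ultimately show ?thesis by blast
qed

end

context positive_solution
begin

section \<open>Geometry near the farthest point\<close>

lemma l_measurable [measurable]: "l \<in> borel_measurable borel"
 using l_cont by (rule borel_measurable_continuous_onI)

lemma l_lipschitz:
 obtains G where "1 \<le> G" "\<And>x y. x \<in> ball z0 r0 \<Longrightarrow> y \<in> ball z0 r0 \<Longrightarrow> \<bar>l y - l x\<bar> \<le> G * norm (y - x)"
proof (rule that[of "norm (N z0) + \<Lambda> * r0 + \<Lambda> * (2 * r0)"])
 show "1 \<le> norm (N z0) + \<Lambda> * r0 + \<Lambda> * (2 * r0)" using N_ge_1[of z0] mult_pos_pos[OF \<Lambda> r0] by simp
 fix x y assume xy: "x \<in> ball z0 r0" "y \<in> ball z0 r0"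
 have "dist y x \<le> 2 * r0" using xy dist_triangle3[of y x z0] by (simp add: dist_commute)
 then have d: "norm (y - x) \<le> 2 * r0" by (simp add: dist_norm)
 have "\<bar>l y - l x\<bar> \<le> \<bar>N x \<bullet> (y - x)\<bar> + \<Lambda> * (norm (y - x))\<^sup>2" using taylor[of y x] by linarith
 also have "\<bar>N x \<bullet> (y - x)\<bar> \<le> norm (N x) * norm (y - x)" by (rule Cauchy_Schwarz_ineq2)
 also have "... \<le> (norm (N z0) + \<Lambda> * r0) * norm (y - x)" using N_bound[OF xy(1)] by (intro mult_right_mono) auto
 also have "\<Lambda> * (norm (y - x))\<^sup>2 \<le> \<Lambda> * (2 * r0) * norm (y - x)"
  unfolding power2_eq_square mult.assoc[of \<Lambda>] using mult_right_mono[OF d, of "norm (y - x)"] \<Lambda> by (intro mult_left_mono) auto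
 finally show "\<bar>l y - l x\<bar> \<le> (norm (N z0) + \<Lambda> * r0 + \<Lambda> * (2 * r0)) * norm (y - x)" by (simp add: distrib_right)
qed

lemma dilate_dist:
 assumes "0 \<le> h" "h \<le> 1" "norm x \<le> 2 * norm z0"
 shows "norm (exp h *\<^sub>R x - x) \<le> 4 * h * norm z0"
proof -
 have "norm (exp h *\<^sub>R x - x) = norm ((exp h - 1) *\<^sub>R x)" by (simp add: algebra_simps)
 also have "... = (exp h - 1) * norm x" using assms by simp
 also have "... \<le> (2 * h) * (2 * norm z0)" using assms exp_le_twice[of h] by (intro mult_mono) auto
 finally show ?thesis by simp
qed

text \<open>Dilation crosses the boundary at a definite rate near \<open>z0\<close>: by
  \<open>transversal\<close> and the Lipschitz bound on \<open>N\<close>,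
  \<open>N y \<bullet> y \<le> - (norm z0 / 2)\<close> close to \<open>z0\<close>, giving a drop of
  \<open>h * norm z0 / 2\<close>, half of which is given up to the quadratic error.\<close>

lemma dilate_drop:
 obtains r3 where "0 < r3" "\<And>y h. norm (y - z0) < r3 \<Longrightarrow> 0 < h \<Longrightarrow> h < r3 \<Longrightarrow> l (exp h *\<^sub>R y) \<le> l y - h * norm z0 / 4"
proof -
 let ?\<rho> = "norm z0"
 have \<rho>: "0 < ?\<rho>" using z0 by simp
 define K where "K = norm (N z0) + 2 * \<Lambda> * ?\<rho>"
 have K: "0 < K" using \<Lambda> \<rho> by (simp add: K_def add_nonneg_pos)
 \<comment> \<open>The second entry keeps the perturbation of \<open>N y \<bullet> y\<close> below
   \<open>norm z0 / 2\<close>, the fourth keeps the quadratic error below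
   \<open>h * norm z0 / 4\<close>.\<close>
 define r3 where "r3 = Min {?\<rho>, ?\<rho> / (2 * K), 1, 1 / (64 * \<Lambda> * ?\<rho>)}"
 have r3: "0 < r3" "r3 \<le> ?\<rho>" "r3 \<le> ?\<rho> / (2 * K)" "r3 \<le> 1" "r3 \<le> 1 / (64 * \<Lambda> * ?\<rho>)" using \<rho> K \<Lambda> by (auto simp: r3_def)
 show ?thesis
 proof (rule that[OF r3(1)])
  fix y h assume y: "norm (y - z0) < r3" and h: "0 < h" "h < r3"
  have y2: "norm y \<le> 2 * ?\<rho>" using y r3 norm_triangle_ineq2[of y z0] by linarith
  have "N y \<bullet> y = N z0 \<bullet> z0 + N z0 \<bullet> (y - z0) + (N y - N z0) \<bullet> y" by (simp add: inner_diff_left inner_diff_right)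
  also have "... \<le> - ?\<rho> + norm (N z0) * norm (y - z0) + norm (N y - N z0) * norm y"
   using transversal[OF far z0] norm_cauchy_schwarz[of "N z0" "y - z0"] norm_cauchy_schwarz[of "N y - N z0" y] by linarith
  also have "... \<le> - ?\<rho> + norm (N z0) * norm (y - z0) + (\<Lambda> * norm (y - z0)) * (2 * ?\<rho>)"
   using N_lip y2 \<Lambda> by (intro add_left_mono mult_mono) auto
  also have "... = - ?\<rho> + K * norm (y - z0)" by (simp add: K_def algebra_simps)
  also have "... \<le> - ?\<rho> + K * (?\<rho> / (2 * K))" using y r3 K by (intro add_left_mono mult_left_mono) auto
  also have "... = - (?\<rho> / 2)" using K by simp
  finally have Ny: "N y \<bullet> y \<le> - (?\<rho> / 2)" .
  let ?d = "exp h *\<^sub>R y - y"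
  have "l (exp h *\<^sub>R y) \<le> l y + N y \<bullet> ?d + \<Lambda> * (norm ?d)\<^sup>2" using taylor[where x=y and y="exp h *\<^sub>R y"] by linarith
  moreover have "N y \<bullet> ?d \<le> - (h * (?\<rho> / 2))"
  proof -
   have "N y \<bullet> ?d = (exp h - 1) * (N y \<bullet> y)" by (simp add: inner_diff_right algebra_simps)
   also have "... \<le> (exp h - 1) * - (?\<rho> / 2)" using Ny h by (intro mult_left_mono) auto
   also have "... \<le> h * - (?\<rho> / 2)" 
   proof (rule mult_right_mono_neg)
    show "h \<le> exp h - 1" using exp_ge_add_one_self[of h] by linarith
   qed simp
   finally show ?thesis by simp
  qed
  moreover have "\<Lambda> * (norm ?d)\<^sup>2 \<le> h * ?\<rho> / 4"
  proof -
   have "\<Lambda> * (norm ?d)\<^sup>2 \<le> \<Lambda> * (4 * h * ?\<rho>)\<^sup>2" using dilate_dist[OF _ _ y2, of h] h r3 \<Lambda> by (intro mult_left_mono power_mono) auto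
   also have "... = h * ?\<rho> * (16 * \<Lambda> * ?\<rho>) * h" by (simp add: power2_eq_square)
   also have "... \<le> h * ?\<rho> * (16 * \<Lambda> * ?\<rho>) * (1 / (64 * \<Lambda> * ?\<rho>))" using h r3 \<Lambda> by (intro mult_left_mono) auto
   also have "... = h * ?\<rho> / 4" using \<Lambda> \<rho> by (simp add: field_simps)
   finally show ?thesis .
  qed
  ultimately show "l (exp h *\<^sub>R y) \<le> l y - h * ?\<rho> / 4" by linarith
 qed
qed

lemma le_infdist: "A \<noteq> {} \<Longrightarrow> (\<And>x. x \<in> A \<Longrightarrow> d \<le> dist y x) \<Longrightarrow> d \<le> infdist y A"
 by (simp add: infdist_notempty cINF_greatest)

text \<open>In the middle layer of the shell both distances are comparable to \<open>h\<close>.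
  Within the chart, points outside \<open>\<Omega>\<close> have \<open>l \<le> 0\<close>, and points
  of \<open>shrunk h\<close> dilate into \<open>l > 0\<close>, whereas \<open>dilate_drop\<close>
  puts the dilate of \<open>y\<close> at \<open>l \<le> - (h * norm z0 / 8)\<close>.\<close>

lemma shell_test_lower:
 obtains c r3 where "0 < c" "0 < r3" "\<And>y h. norm (y - z0) < r3 \<Longrightarrow> 0 < h \<Longrightarrow> h < r3 \<Longrightarrow> h * norm z0 / 16 \<le> l y \<Longrightarrow> l y \<le> h * norm z0 / 8 \<Longrightarrow> c \<le> shell_test h y"
proof -
 let ?\<rho> = "norm z0"
 have \<rho>: "0 < ?\<rho>" using z0 by simp
 obtain G where G: "1 \<le> G" "\<And>x y. x \<in> ball z0 r0 \<Longrightarrow> y \<in> ball z0 r0 \<Longrightarrow> \<bar>l y - l x\<bar> \<le> G * norm (y - x)" using l_lipschitz by blast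
 obtain r3 where r3: "0 < r3" "\<And>y h. norm (y - z0) < r3 \<Longrightarrow> 0 < h \<Longrightarrow> h < r3 \<Longrightarrow> l (exp h *\<^sub>R y) \<le> l y - h * ?\<rho> / 4" using dilate_drop by blast
 define r4 where "r4 = Min {r3, r0 / 4, ?\<rho> / 4, 1, r0 / (16 * ?\<rho>), 1/4}"
 have r4: "0 < r4" "r4 \<le> r3" "r4 \<le> r0 / 4" "r4 \<le> ?\<rho> / 4" "r4 \<le> 1" "r4 \<le> r0 / (16 * ?\<rho>)" using \<rho> r0 r3 by (auto simp: r4_def)
 have in_ball: "x \<in> ball z0 r0 \<longleftrightarrow> norm (x - z0) < r0" for x by (simp add: dist_norm norm_minus_commute)
 show ?thesis
 proof (rule that[of "?\<rho> / (32 * G)" r4])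
  show "0 < ?\<rho> / (32 * G)" "0 < r4" using \<rho> G r4 by auto
  fix y h assume y: "norm (y - z0) < r4" and h: "0 < h" "h < r4" and ly: "h * ?\<rho> / 16 \<le> l y" "l y \<le> h * ?\<rho> / 8"
  \<comment> \<open>With Lipschitz constant \<open>G\<close>, moving by \<open>\<delta>\<close>
    changes \<open>l\<close> by at most \<open>h * norm z0 / 32\<close>, and after dilation, whose
    factor is at most \<open>3\<close>, by at most three times that. Both stay below the available
    gaps \<open>h * norm z0 / 16\<close> and \<open>h * norm z0 / 8\<close>.\<close>
  define \<delta> where "\<delta> = h * ?\<rho> / (32 * G)"
  have G\<delta>: "G * \<delta> = h * ?\<rho> / 32" using G by (simp add: \<delta>_def)
  have h\<rho>: "4 * h * ?\<rho> \<le> r0 / 4"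
  proof -
   have "4 * h * ?\<rho> \<le> 4 * (r0 / (16 * ?\<rho>)) * ?\<rho>" using h r4 \<rho> by (intro mult_right_mono mult_left_mono) auto
   then show ?thesis using \<rho> by simp
  qed
  have hp: "0 < h * ?\<rho>" using h \<rho> by simp
  have \<delta>: "0 < \<delta>" "\<delta> \<le> r0 / 4" "\<delta> \<le> ?\<rho> / 4"
  proof -
   show "0 < \<delta>" using h \<rho> G by (simp add: \<delta>_def)
   have "\<delta> \<le> G * \<delta>" using G \<open>0 < \<delta>\<close> by simp
   then show "\<delta> \<le> r0 / 4" "\<delta> \<le> ?\<rho> / 4" unfolding G\<delta> using h\<rho> hp h r4 mult_right_mono[of h 1 ?\<rho>] \<rho> by linarith+
  qed
  have near: "norm (x - z0) < r0 / 2 \<and> norm x \<le> 2 * ?\<rho>" if "norm (y - x) < \<delta>" for x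
  proof -
   have "norm (x - z0) \<le> norm (y - x) + norm (y - z0)" using norm_triangle_ineq4[of "y - z0" "y - x"] by simp
   moreover have "norm x \<le> norm (x - z0) + ?\<rho>" using norm_triangle_ineq[of "x - z0" z0] by simp
   ultimately show ?thesis using that y r4 \<delta> by linarith
  qed
  have near': "exp h *\<^sub>R x \<in> ball z0 r0" if "norm (y - x) < \<delta>" for x
  proof -
   have "norm (exp h *\<^sub>R x - x) \<le> 4 * h * ?\<rho>" using near[OF that] h r4 by (intro dilate_dist) auto
   moreover have "norm (exp h *\<^sub>R x - z0) \<le> norm (exp h *\<^sub>R x - x) + norm (x - z0)" using norm_triangle_ineq[of "exp h *\<^sub>R x - x" "x - z0"] by simp
   ultimately show ?thesis unfolding in_ball using near[OF that] h\<rho> r0 by linarith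
  qed
  have yb: "y \<in> ball z0 r0" unfolding in_ball using y r4 r0 by linarith
  have "\<delta> \<le> infdist y (- \<Omega>)"
  proof (rule le_infdist)
   have "z0 \<notin> \<Omega>" using chart l_z0 r0 centre_in_ball[of z0 r0] by (metis (no_types, lifting) IntI less_irrefl mem_Collect_eq)
   then show "- \<Omega> \<noteq> {}" by auto
   fix x assume x: "x \<in> - \<Omega>"
   show "\<delta> \<le> dist y x"
   proof (rule ccontr)
    assume "\<not> \<delta> \<le> dist y x"
    then have d: "norm (y - x) < \<delta>" by (simp add: dist_norm)
    have xb: "x \<in> ball z0 r0" unfolding in_ball using near[OF d] r0 by linarith
    have "G * norm (y - x) \<le> G * \<delta>" using d G by (intro mult_left_mono) auto
    then have "l y - l x \<le> h * ?\<rho> / 32" using G(2)[OF xb yb] unfolding G\<delta> by linarith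
    then have "0 < l x" using ly hp by linarith
    then have "x \<in> \<Omega> \<inter> ball z0 r0" unfolding chart using xb by simp
    then show False using x by simp
   qed
  qed
  moreover have "\<delta> \<le> infdist y (shrunk h)"
  proof (rule le_infdist)
   show "shrunk h \<noteq> {}" using origin by (auto simp: shrunk_def intro: exI[of _ 0])
   fix x assume x: "x \<in> shrunk h"
   show "\<delta> \<le> dist y x"
   proof (rule ccontr)
    assume "\<not> \<delta> \<le> dist y x"
    then have d: "norm (y - x) < \<delta>" by (simp add: dist_norm)
    have "norm (exp h *\<^sub>R x - exp h *\<^sub>R y) = exp h * norm (y - x)"
     by (simp add: scaleR_diff_right[symmetric] norm_minus_commute)
    also have "... \<le> 3 * \<delta>" using d exp_le_twice[of h] h r4 by (intro mult_mono) auto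
    finally have "G * norm (exp h *\<^sub>R x - exp h *\<^sub>R y) \<le> G * (3 * \<delta>)" using G by (intro mult_left_mono) auto
    also have "... = 3 * (h * ?\<rho> / 32)" using G\<delta> by simp
    finally have "l (exp h *\<^sub>R x) - l (exp h *\<^sub>R y) \<le> 3 * (h * ?\<rho> / 32)"
     using G(2)[OF near'[of y] near'[OF d]] \<delta> by simp
    moreover have "l (exp h *\<^sub>R y) \<le> l y - h * ?\<rho> / 4" using y h r4 by (intro r3(2)) auto
    moreover have "0 < l (exp h *\<^sub>R x)"
    proof -
     have "exp h *\<^sub>R x \<in> \<Omega> \<inter> ball z0 r0" using x near'[OF d] by (simp add: shrunk_def)
     then show ?thesis unfolding chart by simp
    qed
    ultimately show False using ly hp by linarith
   qed
  qed
  ultimately have "(1 / h) * \<delta> \<le> shell_test h y" unfolding shell_test_def using h by (intro mult_left_mono) auto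
  then show "?\<rho> / (32 * G) \<le> shell_test h y" using h by (simp add: \<delta>_def)
 qed
qed

text \<open>Fubini along \<open>e\<close>: as \<open>l\<close> drops by exactly \<open>t\<close>
  under the shift by \<open>- t *\<^sub>R e\<close>, each base point in a small ball meets the layer
  for a set of \<open>t\<close> of length \<open>h * norm z0 / 16\<close>. Shifting a full ball of
  base points avoids coordinates on the hyperplane.\<close>

lemma shell_volume:
 assumes r3: "0 < r3" "r3 \<le> r0"
 obtains c h2 where "0 < c" "0 < h2" "\<And>h. 0 < h \<Longrightarrow> h < h2 \<Longrightarrow>
   ennreal (c * h) \<le> emeasure lborel {y \<in> ball z0 r3. h * norm z0 / 16 \<le> l y \<and> l y \<le> h * norm z0 / 8}"
proof -
 let ?\<rho> = "norm z0"
 have \<rho>: "0 < ?\<rho>" using z0 by simp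
 obtain G where G: "1 \<le> G" "\<And>x y. x \<in> ball z0 r0 \<Longrightarrow> y \<in> ball z0 r0 \<Longrightarrow> \<bar>l y - l x\<bar> \<le> G * norm (y - x)" using l_lipschitz by blast
 \<comment> \<open>Small enough that \<open>\<bar>l y\<bar> \<le> r3 / 4\<close> on the base ball,
   so the shifts that reach the layer are at most \<open>r3 / 2\<close> and stay in
   \<open>ball z0 r3\<close>.\<close>
 define r4 where "r4 = r3 / (4 * G)"
 have r4: "0 < r4" "r4 \<le> r3 / 4" "G * r4 = r3 / 4" using r3 G by (auto simp: r4_def field_simps)
 define v where "v = measure lborel (ball z0 r4)"
 have v: "0 < v" unfolding v_def using content_ball_gt_0_iff[of z0 r4] r4 by simp
 have ve: "emeasure lborel (ball z0 r4) = ennreal v"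
  unfolding v_def using emeasure_lborel_ball_finite[of z0 r4] by (simp add: emeasure_eq_ennreal_measure)
 show ?thesis
 proof (rule that[of "v * ?\<rho> / (32 * r3)" "2 * r3 / ?\<rho>"])
  show "0 < v * ?\<rho> / (32 * r3)" "0 < 2 * r3 / ?\<rho>" using v \<rho> r3 by auto
  fix h assume h: "0 < h" "h < 2 * r3 / ?\<rho>"
  have h\<rho>: "h * ?\<rho> / 8 < r3 / 4" using h \<rho> by (simp add: field_simps)
  define Y where "Y = {y \<in> ball z0 r3. h * ?\<rho> / 16 \<le> l y \<and> l y \<le> h * ?\<rho> / 8}"
  have [measurable]: "Y \<in> sets borel" unfolding Y_def by measurable
  let ?I = "\<lambda>y. {l y - h * ?\<rho> / 8 .. l y - h * ?\<rho> / 16}"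
  have tI: "indicator (ball z0 r4) y * indicator (?I y) t \<le> (indicator {- r3..r3} t * indicator Y (- t *\<^sub>R e + y) :: ennreal)" for y :: 'a and t :: real
  proof (cases "y \<in> ball z0 r4 \<and> t \<in> ?I y")
   case True
   then have y: "norm (y - z0) < r4" by (simp add: dist_norm norm_minus_commute)
   have "\<bar>l y - l z0\<bar> \<le> G * norm (y - z0)" using y r4 r3 r0 by (intro G(2)) (auto simp: dist_norm norm_minus_commute)
   also have "... \<le> G * r4" using y G by (intro mult_left_mono) auto
   finally have "\<bar>l y\<bar> \<le> r3 / 4" using l_z0 r4 by simp
   moreover have "0 < h * ?\<rho>" using h \<rho> by simp
   ultimately have t: "\<bar>t\<bar> \<le> r3 / 2" using True h\<rho> by auto
   have ls: "l (- t *\<^sub>R e + y) = l y - t" using shift[of y "- t"] by (simp add: add.commute)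
   have "norm (- t *\<^sub>R e + y - z0) \<le> norm (t *\<^sub>R e) + norm (y - z0)" using norm_triangle_ineq4[of "y - z0" "t *\<^sub>R e"] by (simp add: algebra_simps)
   then have "norm (- t *\<^sub>R e + y - z0) < r3" using t y r4 e r3 by simp
   then have "- t *\<^sub>R e + y \<in> Y" using True unfolding Y_def mem_Collect_eq ls by (auto simp: dist_norm norm_minus_commute)
   then show ?thesis using True t r3 abs_le_iff[of t r3] by (simp add: indicator_def)
  qed (auto simp: indicator_def)
  have "ennreal (v * (h * ?\<rho> / 16)) = (\<integral>\<^sup>+y. ennreal (h * ?\<rho> / 16) * indicator (ball z0 r4) y)"
   using v h \<rho> by (subst nn_integral_cmult_indicator) (auto simp: ve ennreal_mult[symmetric] mult.commute)
  also have "... = (\<integral>\<^sup>+y. (\<integral>\<^sup>+t. indicator (ball z0 r4) y * indicator (?I y) t))"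
   using h \<rho> by (intro nn_integral_cong) (simp add: nn_integral_cmult mult.commute)
  also have "... \<le> (\<integral>\<^sup>+y. (\<integral>\<^sup>+t. indicator {- r3..r3} t * indicator Y (- t *\<^sub>R e + y)))"
   by (intro nn_integral_mono tI)
  also have "... = (\<integral>\<^sup>+t. (\<integral>\<^sup>+y. indicator {- r3..r3} t * indicator Y (- t *\<^sub>R e + y)))"
   by (rule lborel_pair.Fubini') (unfold lborel_prod[symmetric] split_beta', measurable)
  also have "... = (\<integral>\<^sup>+t. emeasure lborel Y * indicator {- r3..r3} t)"
  proof (rule nn_integral_cong, goal_cases)
   case (1 t)
   have "(\<integral>\<^sup>+y. indicator Y (- t *\<^sub>R e + y)) = emeasure lborel Y"
    using nn_integral_lborel_shift[of "indicator Y" "- t *\<^sub>R e"] by simp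
   moreover have [measurable]: "(\<lambda>y. indicator Y (- t *\<^sub>R e + y) :: ennreal) \<in> borel_measurable borel" by measurable
   ultimately show ?case
    by (subst nn_integral_cmult) (auto simp: mult.commute)
  qed
  also have "... = emeasure lborel Y * ennreal (2 * r3)" using r3 by (simp add: nn_integral_cmult_indicator)
  finally have "ennreal (v * (h * ?\<rho> / 16)) * ennreal (1 / (2 * r3)) \<le> (emeasure lborel Y * ennreal (2 * r3)) * ennreal (1 / (2 * r3))" by (intro mult_right_mono) auto
  also have "... = emeasure lborel Y" using r3 by (simp add: mult.assoc ennreal_mult[symmetric])
  also have "ennreal (v * (h * ?\<rho> / 16)) * ennreal (1 / (2 * r3)) = ennreal (v * ?\<rho> / (32 * r3) * h)"
   using v h \<rho> r3 by (simp add: ennreal_mult[symmetric] mult_ac)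
  finally show "ennreal (v * ?\<rho> / (32 * r3) * h) \<le> emeasure lborel {y \<in> ball z0 r3. h * ?\<rho> / 16 \<le> l y \<and> l y \<le> h * ?\<rho> / 8}"
   unfolding Y_def .
 qed
qed

end

lemma one_le_powr_nonpos: "0 < x \<Longrightarrow> x \<le> 1 \<Longrightarrow> a \<le> 0 \<Longrightarrow> 1 \<le> x powr a" for x a :: real
 using powr_mono'[of a 0 x] by simp

context positive_solution
begin

text \<open>One scale \<open>t\<close>: the ball about \<open>y + t *\<^sub>R e\<close> lies at
  height comparable to \<open>t\<close>, where the dilate is at least of order \<open>t\<close> by
  \<open>linear_lower\<close>. Volume \<open>t ^ n\<close>, kernel
  \<open>t powr - (n + 2 * s)\<close> and value \<open>t\<close> multiply to
  \<open>t powr (1 - 2 * s)\<close>.\<close>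

lemma potential_lower:
 obtains c r5 K G where "0 < c" "0 < r5" "1 \<le> G" "0 < K"
  "\<And>y h t. norm (y - z0) < r5 \<Longrightarrow> 0 \<le> l y \<Longrightarrow> 0 < h \<Longrightarrow> h < r5 \<Longrightarrow> K * h \<le> t \<Longrightarrow> t < r5 \<Longrightarrow>
    ennreal (c * t powr (1 - 2 * s)) \<le> (\<integral>\<^sup>+x. ennreal (dil s h u x * kr (2 * s) (x - y)) * indicator (ball (y + t *\<^sub>R e) (t / (4 * G))) x)"
proof -
 let ?n = "real DIM('a)" let ?\<rho> = "norm z0"
 have \<rho>: "0 < ?\<rho>" using z0 by simp
 obtain G where G: "1 \<le> G" "\<And>x y. x \<in> ball z0 r0 \<Longrightarrow> y \<in> ball z0 r0 \<Longrightarrow> \<bar>l y - l x\<bar> \<le> G * norm (y - x)" using l_lipschitz by blast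
 obtain c0 r2 where c0: "0 < c0" "0 < r2" "\<And>x. norm (x - z0) < r2 \<Longrightarrow> 0 < l x \<Longrightarrow> l x < r2 \<Longrightarrow> c0 * l x \<le> u x" using linear_lower by blast
 define m where "m = Min {r0, r2 / G, ?\<rho>}"
 have m: "0 < m" "m \<le> r0" "m \<le> r2 / G" "m \<le> ?\<rho>" using r0 c0 G \<rho> by (auto simp: m_def)
 have mG: "G * m \<le> r2" "m \<le> r2"
 proof -
  have "G * m \<le> G * (r2 / G)" using m G by (intro mult_left_mono) auto
  then show "G * m \<le> r2" using G by simp
  moreover have "m \<le> G * m" using G m by simp
  ultimately show "m \<le> r2" by linarith
 qed
 define r5 where "r5 = Min {m / 8, m / (16 * ?\<rho>), 1}"
 have r5: "0 < r5" "r5 \<le> m / 8" "r5 \<le> m / (16 * ?\<rho>)" "r5 \<le> 1"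
  using m \<rho> by (simp add: r5_def) (auto simp only: r5_def intro!: Min_le)
 define c1 where "c1 = exp (- \<bar>b\<bar>) * c0 / 2"
 define \<kappa> where "\<kappa> = 1 / (4 * G)"
 have \<kappa>: "0 < \<kappa>" "\<kappa> \<le> 1/4" "G * \<kappa> = 1/4" using G by (auto simp: \<kappa>_def field_simps)
 define c where "c = c1 * 2 powr - (?n + 2 * s) * \<kappa> ^ DIM('a) * unit_ball_vol ?n"
 have c1: "0 < c1" using c0 by (simp add: c1_def)
 show ?thesis
 \<comment> \<open>With \<open>t \<ge> 16 * G * norm z0 * h\<close> the dilation, which moves points
   by at most \<open>4 * h * norm z0\<close>, lowers \<open>l\<close> by at most
   \<open>t / 4\<close>.\<close>
 proof (rule that[of c r5 G "16 * G * ?\<rho>"])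
  show "0 < c" unfolding c_def using c1 \<kappa> by (intro mult_pos_pos) auto
  show "0 < r5" "1 \<le> G" "0 < 16 * G * ?\<rho>" using r5 G \<rho> by auto
  fix y h t
  assume y: "norm (y - z0) < r5" "0 \<le> l y" and h: "0 < h" "h < r5" and t: "16 * G * ?\<rho> * h \<le> t" "t < r5"
  have t0: "0 < t" using t h G \<rho> by (intro less_le_trans[OF _ t(1)]) simp
  have h\<rho>: "4 * h * ?\<rho> < m / 4"
  proof -
   have "4 * h * ?\<rho> < 4 * (m / (16 * ?\<rho>)) * ?\<rho>" using h r5 \<rho> by (intro mult_strict_right_mono mult_strict_left_mono) auto
   then show ?thesis using \<rho> by simp
  qed
  define a where "a = c1 * t * (1 / (2 * t) powr (?n + 2 * s))"
  have a: "0 \<le> a" using c1 t0 by (simp add: a_def)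
  have pt: "a \<le> dil s h u x * kr (2 * s) (x - y)" if "x \<in> ball (y + t *\<^sub>R e) (\<kappa> * t)" for x
  proof -
   have x: "norm (x - (y + t *\<^sub>R e)) < \<kappa> * t" using that by (simp add: dist_norm norm_minus_commute)
   have \<kappa>t: "\<kappa> * t \<le> t / 4" using \<kappa> t0 mult_right_mono[of \<kappa> "1/4" t] by simp
   have te: "norm (t *\<^sub>R e) = t" using e t0 by simp
   have "norm (x - y) \<le> norm (x - (y + t *\<^sub>R e)) + t" using norm_triangle_ineq[of "x - (y + t *\<^sub>R e)" "t *\<^sub>R e"] te by simp
   moreover have "t \<le> norm (x - y) + norm (x - (y + t *\<^sub>R e))" using norm_triangle_ineq4[of "x - y" "x - (y + t *\<^sub>R e)"] te by simp
   ultimately have x1: "norm (x - y) \<le> 2 * t" "0 < norm (x - y)" using x \<kappa>t t0 by linarith+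
   have y1: "norm (y + t *\<^sub>R e - z0) < m / 4" using norm_triangle_ineq[of "y - z0" "t *\<^sub>R e"] y t te r5 by (simp add: algebra_simps)
   have "norm (x - z0) \<le> norm (x - (y + t *\<^sub>R e)) + norm (y + t *\<^sub>R e - z0)" using norm_triangle_ineq[of "x - (y + t *\<^sub>R e)" "y + t *\<^sub>R e - z0"] by simp
   then have x2: "norm (x - z0) < m / 2" using y1 x \<kappa>t t r5 m by linarith
   have nx: "norm x \<le> 2 * ?\<rho>" using norm_triangle_ineq[of "x - z0" z0] x2 m by simp
   have ex: "norm (exp h *\<^sub>R x - x) \<le> 4 * h * ?\<rho>" using h r5 nx by (intro dilate_dist) auto
   have x3: "norm (exp h *\<^sub>R x - z0) < m" using norm_triangle_ineq[of "exp h *\<^sub>R x - x" "x - z0"] x2 ex h\<rho> m by simp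
   have inb: "w \<in> ball z0 r0" if "norm (w - z0) < m" for w using that m by (simp add: dist_norm norm_minus_commute)
   have b1: "y + t *\<^sub>R e \<in> ball z0 r0" "x \<in> ball z0 r0" "exp h *\<^sub>R x \<in> ball z0 r0" "z0 \<in> ball z0 r0"
    by ((rule inb, use y1 x2 x3 m in linarith)+, use r0 in simp)
   have "l (y + t *\<^sub>R e) - l x \<le> G * (\<kappa> * t)"
    using G(2)[OF b1(1,2)] mult_left_mono[OF less_imp_le[OF x], of G] G(1) by linarith
   also have "... = t / 4" using \<kappa>(3) by (simp add: mult.assoc[symmetric])
   finally have l1: "3 / 4 * t \<le> l x" using shift[of y t] y by simp
   have "l x - l (exp h *\<^sub>R x) \<le> G * (4 * h * ?\<rho>)"
    using G(2)[OF b1(2,3)] mult_left_mono[OF ex, of G] G(1) by linarith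
   also have "... \<le> t / 4" using t by (simp add: mult_ac)
   finally have l2: "t / 2 \<le> l (exp h *\<^sub>R x)" using l1 by simp
   have "l (exp h *\<^sub>R x) \<le> G * norm (exp h *\<^sub>R x - z0)" using G(2)[OF b1(4,3)] l_z0 by simp
   also have "... < G * m" using x3 G by (intro mult_strict_left_mono) auto
   finally have l3: "l (exp h *\<^sub>R x) < r2" using mG by simp
   have "c0 * (t / 2) \<le> c0 * l (exp h *\<^sub>R x)" using l2 c0 by (intro mult_left_mono) auto
   also have "... \<le> u (exp h *\<^sub>R x)" using x3 mG l2 l3 t0 by (intro c0(3)) auto
   finally have u1: "c0 * (t / 2) \<le> u (exp h *\<^sub>R x)" .
   have "- \<bar>b\<bar> \<le> b * h"
   proof -
    have "\<bar>b * h\<bar> \<le> \<bar>b\<bar> * 1" unfolding abs_mult using h r5 by (intro mult_left_mono) auto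
    then show ?thesis by (simp add: abs_le_iff)
   qed
   then have "exp (- \<bar>b\<bar>) * (c0 * (t / 2)) \<le> exp (b * h) * u (exp h *\<^sub>R x)" using u1 c0 t0 by (intro mult_mono) auto
   then have V: "c1 * t \<le> dil s h u x" by (simp add: c1_def dil_b)
   have "1 / (2 * t) powr (?n + 2 * s) \<le> kr (2 * s) (x - y)"
    unfolding kr_def using x1 t0 s by (intro divide_left_mono powr_mono2 mult_pos_pos) auto
   then show ?thesis unfolding a_def using V c1 t0 by (intro mult_mono) (auto simp: order_trans[OF _ V])
  qed
  have "c * t powr (1 - 2 * s) = a * (unit_ball_vol ?n * (\<kappa> * t) ^ DIM('a))"
  proof -
   have "t powr (1 - 2 * s) = t * t ^ DIM('a) * t powr - (?n + 2 * s)"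
    using t0 by (simp add: powr_realpow[symmetric] powr_mult_base powr_add[symmetric] del: powr_realpow)
   moreover have "1 / (2 * t) powr (?n + 2 * s) = 2 powr - (?n + 2 * s) * t powr - (?n + 2 * s)"
    
   proof -
    have pw: "p powr - k * q powr - k = 1 / (p * q) powr k" if "0 < p" "0 < q" for p q k :: real
     using that by (simp add: powr_mult powr_minus divide_inverse)
    show ?thesis by (rule pw[symmetric]) (use t0 in auto)
   qed
   ultimately show ?thesis by (simp add: a_def c_def power_mult_distrib mult_ac)
  qed
  then have "ennreal (c * t powr (1 - 2 * s)) = ennreal a * ennreal (unit_ball_vol ?n * (\<kappa> * t) ^ DIM('a))"
   using a \<kappa> t0 by (simp add: ennreal_mult[symmetric])
  also have "... = ennreal a * emeasure lborel (ball (y + t *\<^sub>R e) (\<kappa> * t))" using \<kappa> t0 by (simp add: emeasure_ball)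
  also have "... = (\<integral>\<^sup>+x. ennreal a * indicator (ball (y + t *\<^sub>R e) (\<kappa> * t)) x)" by (simp add: nn_integral_cmult_indicator)
  also have "... \<le> (\<integral>\<^sup>+x. ennreal (dil s h u x * kr (2 * s) (x - y)) * indicator (ball (y + t *\<^sub>R e) (\<kappa> * t)) x)"
  proof (rule nn_integral_mono)
   fix x show "ennreal a * indicator (ball (y + t *\<^sub>R e) (\<kappa> * t)) x \<le> ennreal (dil s h u x * kr (2 * s) (x - y)) * indicator (ball (y + t *\<^sub>R e) (\<kappa> * t)) x"
    using pt[of x] by (cases "x \<in> ball (y + t *\<^sub>R e) (\<kappa> * t)") (auto intro: ennreal_leI)
  qed
  also have "\<kappa> * t = t / (4 * G)" by (simp add: \<kappa>_def)
  finally show "ennreal (c * t powr (1 - 2 * s)) \<le> (\<integral>\<^sup>+x. ennreal (dil s h u x * kr (2 * s) (x - y)) * indicator (ball (y + t *\<^sub>R e) (t / (4 * G))) x)" .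
 qed
qed

lemma scales_disjoint:
 assumes t: "0 < t" "4 * t \<le> t'" and G: "1 \<le> G"
 shows "ball (y + t *\<^sub>R e) (t / (4 * G)) \<inter> ball (y + t' *\<^sub>R e) (t' / (4 * G)) = {}"
proof (rule disjoint_ballI)
 have "t / (4 * G) \<le> t / (4 * 1)" "t' / (4 * G) \<le> t' / (4 * 1)" by (rule divide_left_mono; use t G in simp)+
 moreover have "dist (y + t *\<^sub>R e) (y + t' *\<^sub>R e) = t' - t"
  using e t by (simp add: dist_norm scaleR_diff_left[symmetric])
 ultimately show "t / (4 * G) + t' / (4 * G) \<le> dist (y + t *\<^sub>R e) (y + t' *\<^sub>R e)" using t by simp
qed

text \<open>At \<open>t = sqrt h\<close> the potential is of order \<open>h powr (1/2 - s)\<close>,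
  which together with a layer of measure of order \<open>h\<close> matches the upper bound exactly.
  \<open>J\<close> disjoint scales on the favourable side of \<open>sqrt h\<close> multiply this by
  \<open>J\<close>; their number is free because \<open>sqrt h\<close> lies far from both
  \<open>K * h\<close> and \<open>r5\<close> for small \<open>h\<close>.\<close>

lemma interaction_lower:
 obtains c where "0 < c" "\<And>J::nat. \<exists>h0>0. \<forall>h. 0 < h \<longrightarrow> h < h0 \<longrightarrow> ennreal (c * real J * h powr (3/2 - s)) \<le> interaction h"
proof -
 let ?d = "\<lambda>h x y. dil s h u x * kr (2 * s) (x - y)"
 let ?\<rho> = "norm z0"
 have \<rho>: "0 < ?\<rho>" using z0 by simp
 obtain c1 r3 where c1: "0 < c1" "0 < r3" "\<And>y h. norm (y - z0) < r3 \<Longrightarrow> 0 < h \<Longrightarrow> h < r3 \<Longrightarrow> h * ?\<rho> / 16 \<le> l y \<Longrightarrow> l y \<le> h * ?\<rho> / 8 \<Longrightarrow> c1 \<le> shell_test h y"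
  using shell_test_lower by blast
 obtain c2 r5 K G where c2: "0 < c2" "0 < r5" "1 \<le> G" "0 < K"
  and pot: "\<And>y h t. norm (y - z0) < r5 \<Longrightarrow> 0 \<le> l y \<Longrightarrow> 0 < h \<Longrightarrow> h < r5 \<Longrightarrow> K * h \<le> t \<Longrightarrow> t < r5 \<Longrightarrow>
    ennreal (c2 * t powr (1 - 2 * s)) \<le> (\<integral>\<^sup>+x. ennreal (?d h x y) * indicator (ball (y + t *\<^sub>R e) (t / (4 * G))) x)"
  using that by (rule potential_lower)
 define r where "r = Min {r3, r5, r0}"
 have r: "0 < r" "r \<le> r3" "r \<le> r5" "r \<le> r0" using c1 c2 r0 by (auto simp: r_def)
 obtain c3 h2 where c3: "0 < c3" "0 < h2" "\<And>h. 0 < h \<Longrightarrow> h < h2 \<Longrightarrow>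
   ennreal (c3 * h) \<le> emeasure lborel {y \<in> ball z0 r. h * ?\<rho> / 16 \<le> l y \<and> l y \<le> h * ?\<rho> / 8}"
  using shell_volume[OF r(1) r(4)] by blast
 \<comment> \<open>The direction in which \<open>t powr (1 - 2 * s)\<close> does not decrease:
   larger scales for \<open>s \<le> 1/2\<close>, smaller ones otherwise. The ratio \<open>4\<close>
   makes the balls disjoint.\<close>
 define q where "q = (if s \<le> 1/2 then 4 else 1/4 :: real)"
 have q: "0 < q" by (simp add: q_def)
 show ?thesis
 proof (rule that[of "c1 * c2 * c3"])
  show "0 < c1 * c2 * c3" using c1 c2 c3 by simp
  fix J :: nat
  \<comment> \<open>Bound for \<open>sqrt h\<close>: the first entry keeps the largest scale below
    \<open>r5\<close>, the second keeps the smallest at least \<open>K * h\<close>.\<close>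
  define \<eta> where "\<eta> = Min {r5 / 4 ^ J, 1 / (K * 4 ^ J), 1}"
  have \<eta>: "0 < \<eta>" "\<eta> \<le> r5 / 4 ^ J" "\<eta> \<le> 1 / (K * 4 ^ J)" "\<eta> \<le> 1" using c2 by (auto simp: \<eta>_def)
  define h0 where "h0 = Min {r, h2, \<eta>\<^sup>2}"
  have h0: "0 < h0" "h0 \<le> r" "h0 \<le> h2" "h0 \<le> \<eta>\<^sup>2" using r c3 \<eta> by (auto simp: h0_def)
  have "ennreal (c1 * c2 * c3 * real J * h powr (3/2 - s)) \<le> interaction h" if h: "0 < h" "h < h0" for h
  proof -
   let ?g = "sqrt h"
   have g: "0 < ?g" "?g * ?g = h" using h by auto
   have g\<eta>: "?g < \<eta>"
   proof -
    have "h < \<eta>\<^sup>2" using h h0 by linarith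
    then have "?g < sqrt (\<eta>\<^sup>2)" by (rule real_sqrt_less_mono)
    then show ?thesis using \<eta> by simp
   qed
   define t where "t j = ?g * q ^ j" for j :: nat
   have t0: "0 < t j" for j using g q by (simp add: t_def)
   have qj: "1 / 4 ^ J \<le> q ^ j \<and> q ^ j \<le> 4 ^ J" if "j < J" for j
   proof -
    have p: "1 \<le> (4::real) ^ j" "(4::real) ^ j \<le> 4 ^ J" using that by (auto intro!: power_increasing)
    have "1 / 4 ^ J \<le> 1 / (4::real) ^ j" using p by (intro divide_left_mono) auto
    moreover have "1 / (4::real) ^ j \<le> 1" "1 / (4::real) ^ J \<le> 1" using p by auto
    ultimately have "1 / 4 ^ J \<le> (4::real) ^ j" "1 / (4::real) ^ j \<le> 4 ^ J" using p by linarith+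
    then show ?thesis using p \<open>1 / 4 ^ J \<le> 1 / (4::real) ^ j\<close> by (cases "s \<le> 1/2") (simp_all add: q_def power_divide)
   qed
   have tr: "K * h \<le> t j \<and> t j < r5" if "j < J" for j
   proof
    have "K * ?g \<le> 1 / 4 ^ J"
    proof -
     have "K * ?g \<le> K * (1 / (K * 4 ^ J))" using g\<eta> \<eta> c2 by (intro mult_left_mono) auto
     then show ?thesis using c2 by simp
    qed
    then have "K * ?g \<le> q ^ j" using qj[OF that] by linarith
    then have "?g * (K * ?g) \<le> ?g * q ^ j" using g by (intro mult_left_mono) auto
    then show "K * h \<le> t j" using g(2) by (simp add: t_def mult_ac)
    have "t j \<le> ?g * 4 ^ J" unfolding t_def using qj[OF that] g by (intro mult_left_mono) auto
    also have "... < (r5 / 4 ^ J) * 4 ^ J" using g\<eta> \<eta> by (intro mult_strict_right_mono) auto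
    finally show "t j < r5" by simp
   qed
   have tp: "h powr (1/2 - s) \<le> t j powr (1 - 2 * s)" for j
   proof -
    have "1 \<le> (q ^ j) powr (1 - 2 * s)"
    proof (cases "s \<le> 1/2")
     case True
     then show ?thesis by (intro ge_one_powr_ge_zero) (auto simp: q_def)
    next
     case False
     then show ?thesis by (intro one_le_powr_nonpos) (auto simp: q_def power_le_one)
    qed
    then have "?g powr (1 - 2 * s) * 1 \<le> ?g powr (1 - 2 * s) * (q ^ j) powr (1 - 2 * s)" by (intro mult_left_mono) auto
    also have "... = t j powr (1 - 2 * s)" using g q by (simp add: t_def powr_mult)
    also have "?g powr (1 - 2 * s) = h powr (1/2 - s)" using h by (simp add: powr_half_sqrt[symmetric] powr_powr algebra_simps)
    finally show ?thesis by simp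
   qed
   define Y where "Y = {y \<in> ball z0 r. h * ?\<rho> / 16 \<le> l y \<and> l y \<le> h * ?\<rho> / 8}"
   have [measurable]: "Y \<in> sets borel" unfolding Y_def by measurable
   note [measurable] = Hsb_measurable[OF Hsb_dil[OF u(1)]]
   have hh: "h < h2" "h < r3" "h < r5" using h h0 r by auto
   let ?A = "c2 * real J * h powr (1/2 - s)"
   have inner: "ennreal ?A \<le> (\<integral>\<^sup>+x. ennreal (?d h x y))" if y: "y \<in> Y" for y
   proof -
    have yn: "norm (y - z0) < r5" using y r by (auto simp: Y_def dist_norm norm_minus_commute)
    have "0 < h * ?\<rho>" using h \<rho> by simp
    then have ly: "0 \<le> l y" using y by (simp add: Y_def)
    let ?B = "\<lambda>j. ball (y + t j *\<^sub>R e) (t j / (4 * G))"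
    have dj: "?B i \<inter> ?B j = {}" if "i < j" for i j
    proof -
     have "4 * 1 \<le> (4::real) * 4 ^ (j - Suc i)" by (intro mult_left_mono) auto
     then have p: "4 \<le> (4::real) ^ (j - i)" using that by (simp add: power_Suc[symmetric] Suc_diff_Suc del: power_Suc)
     have tj: "t j = t i * q ^ (j - i)" using that by (simp add: t_def power_add[symmetric])
     show ?thesis
     proof (cases "s \<le> 1/2")
      case True
      then have "4 * t i \<le> t j" using tj p t0[of i] by (simp add: q_def mult.commute)
      then show ?thesis using t0 c2 by (intro scales_disjoint) auto
     next
      case False
      then have "t i = t j * 4 ^ (j - i)" using tj by (simp add: q_def power_divide)
      then have "4 * t j \<le> t i" using p t0[of j] by (simp add: mult.commute)
      then have "?B j \<inter> ?B i = {}" using t0 c2 by (intro scales_disjoint) auto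
      then show ?thesis by blast
     qed
    qed
    have dis: "disjoint_family_on ?B {..<J}"
     unfolding disjoint_family_on_def using dj by (metis Int_commute linorder_neqE_nat)
    have [measurable]: "?B j \<in> sets borel" for j by simp
    have "ennreal ?A = (\<Sum>j<J. ennreal (c2 * h powr (1/2 - s)))" using c2 by (simp add: ennreal_of_nat_eq_real_of_nat ennreal_mult[symmetric] mult_ac)
    also have "... \<le> (\<Sum>j<J. (\<integral>\<^sup>+x. ennreal (?d h x y) * indicator (?B j) x))"
    proof (rule sum_mono)
     fix j assume "j \<in> {..<J}"
     then have j: "j < J" by simp
     have "ennreal (c2 * h powr (1/2 - s)) \<le> ennreal (c2 * t j powr (1 - 2 * s))" using tp c2 by (intro ennreal_leI mult_left_mono) auto
     also have "... \<le> (\<integral>\<^sup>+x. ennreal (?d h x y) * indicator (?B j) x)"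
      using tr[OF j] hh h by (intro pot yn ly) auto
     finally show "ennreal (c2 * h powr (1/2 - s)) \<le> (\<integral>\<^sup>+x. ennreal (?d h x y) * indicator (?B j) x)" .
    qed
    also have "... = (\<integral>\<^sup>+x. (\<Sum>j<J. ennreal (?d h x y) * indicator (?B j) x))"
     by (rule nn_integral_sum[symmetric]) measurable
    also have "... \<le> (\<integral>\<^sup>+x. ennreal (?d h x y))"
    proof (rule nn_integral_mono, goal_cases)
     case (1 x)
     have "(\<Sum>j<J. indicator (?B j) x) = (indicator (\<Union>j<J. ?B j) x :: ennreal)" by (rule indicator_UN_disjoint[OF finite_lessThan dis, symmetric])
     also have "... \<le> 1" by (simp add: indicator_def)
     finally have "ennreal (?d h x y) * (\<Sum>j<J. indicator (?B j) x) \<le> ennreal (?d h x y) * 1" by (intro mult_left_mono) auto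
     then show ?case by (simp add: sum_distrib_left)
    qed
    finally show ?thesis .
   qed
   have "c1 * c2 * c3 * real J * h powr (3/2 - s) = c1 * ?A * (c3 * h)"
   proof -
    have "h powr (3/2 - s) = h * h powr (1/2 - s)" using h by (simp add: powr_mult_base)
    then show ?thesis by (simp add: mult_ac)
   qed
   then have "ennreal (c1 * c2 * c3 * real J * h powr (3/2 - s)) = ennreal (c1 * ?A) * ennreal (c3 * h)"
    using c1 c2 c3 h by (simp add: ennreal_mult[symmetric])
   also have "... \<le> ennreal (c1 * ?A) * emeasure lborel Y" unfolding Y_def using c3(3)[OF h(1) hh(1)] by (intro mult_left_mono) auto
   also have "... = (\<integral>\<^sup>+y. ennreal (c1 * ?A) * indicator Y y)" by (simp add: nn_integral_cmult_indicator)
   also have "... \<le> interaction h"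
    unfolding interaction_def
   proof (rule nn_integral_mono, goal_cases)
    case (1 y)
    show ?case
    proof (cases "y \<in> Y")
     case True
     have st: "c1 \<le> shell_test h y" using True h hh r by (intro c1(3)) (auto simp: Y_def dist_norm norm_minus_commute)
     have "ennreal (c1 * ?A) = ennreal c1 * ennreal ?A" using c1 c2 by (intro ennreal_mult) auto
     also have "... \<le> ennreal (shell_test h y) * (\<integral>\<^sup>+x. ennreal (?d h x y))"
      using st inner[OF True] by (intro mult_mono ennreal_leI) auto
     also have "... = (\<integral>\<^sup>+x. ennreal (shell_test h y) * ennreal (?d h x y))"
      by (rule nn_integral_cmult[symmetric]) measurable
     also have "... = (\<integral>\<^sup>+x. ennreal (dil s h u x * shell_test h y * kr (2 * s) (x - y)))"
      using shell_test_nonneg[OF h(1), of y] by (intro nn_integral_cong) (simp add: ennreal_mult'[symmetric] mult_ac)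
     finally show ?thesis using True by simp
    qed simp
   qed
   finally show ?thesis .
  qed
  then show "\<exists>h0>0. \<forall>h. 0 < h \<longrightarrow> h < h0 \<longrightarrow> ennreal (c1 * c2 * c3 * real J * h powr (3/2 - s)) \<le> interaction h" using h0(1) by blast
 qed
qed

theorem impossible: False
proof -
 obtain c where c: "0 < c" "\<And>J::nat. \<exists>h0>0. \<forall>h. 0 < h \<longrightarrow> h < h0 \<longrightarrow> ennreal (c * real J * h powr (3/2 - s)) \<le> interaction h"
  using interaction_lower by blast
 obtain C where C: "0 \<le> C" "\<And>k. interaction ((1/2)^k) \<le> ennreal (C * ((1/2)^k) powr (3/2 - s))" using interaction_upper by blast
 have "c * real J \<le> C" for J :: nat
 proof -
  obtain h0 where h0: "0 < h0" "\<And>h. 0 < h \<Longrightarrow> h < h0 \<Longrightarrow> ennreal (c * real J * h powr (3/2 - s)) \<le> interaction h" using c(2)[of J] by blast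
  obtain k :: nat where k: "(1/2::real)^k < h0" using real_arch_pow_inv[OF h0(1), of "1/2"] by auto
  define h where "h = (1/2::real)^k"
  have "ennreal (c * real J * h powr (3/2 - s)) \<le> ennreal (C * h powr (3/2 - s))"
   using h0(2)[of h] C(2)[of k] k by (auto simp: h_def)
  then have "c * real J * h powr (3/2 - s) \<le> C * h powr (3/2 - s)" using C(1) by (subst (asm) ennreal_le_iff) auto
  then show ?thesis by (simp add: h_def)
 qed
 moreover obtain J :: nat where "C / c < real J" using reals_Archimedean2 by blast
 ultimately show False using c(1) by (metis mult.commute not_less pos_divide_less_eq)
qed

end

subsection \<open>Nonexistence\<close>

context energy_solution
begin

lemma strict_zero:
 assumes strict: "\<And>t. t \<noteq> 0 \<Longrightarrow> 0 < dex TYPE('a) s * (t * f t) - real DIM('a) * F t"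
 shows "AE x in lborel. u x = 0"
proof -
 have "AE x in lborel. b * (u x * f (u x)) - real DIM('a) * F (u x) = 0"
 proof (rule integral_nonneg_eq_0_iff_AE[THEN iffD1, OF poh_integrable])
  show "AE x in lborel. 0 \<le> b * (u x * f (u x)) - real DIM('a) * F (u x)" using poh by (intro AE_I2) (simp add: b_def)
  show "(\<integral>x. b * (u x * f (u x)) - real DIM('a) * F (u x)) = 0" unfolding poh_integral by (rule P_zero_energy(1))
 qed
 then show ?thesis
 proof eventually_elim
  case (elim x)
  then show ?case using strict[of "u x"] by (cases "u x = 0") (auto simp: b_def)
 qed
qed

text \<open>Dividing \<open>poh\<close> by \<open>t\<close> and letting \<open>t\<close> tend to
  zero from either side gives both signs of \<open>(b - n) * f 0\<close>, and \<open>b < n\<close>.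
  Vanishing at zero is what allows \<open>f (u x) \<ge> - L * u x\<close> in the comparison
  argument.\<close>

lemma f_zero: "f 0 = 0"
proof -
 let ?n = "real DIM('a)"
 have bn: "b < ?n" using s DIM_positive[where 'a='a] by (simp add: b_def dex_def)
 have "((\<lambda>t. (F (0 + t) - F 0) / t) \<longlongrightarrow> f 0) (at 0)" using F(2)[of 0] unfolding DERIV_def .
 then have lim: "((\<lambda>t. b * f t - ?n * (F t / t)) \<longlongrightarrow> b * f 0 - ?n * f 0) (at 0)"
  using f(1) F(1) by (intro tendsto_intros) (auto simp: continuous_on_def)
 have r: "eventually (\<lambda>t::real. 0 \<le> b * f t - ?n * (F t / t)) (at_right 0)"
  unfolding eventually_at_right_field
 proof (intro exI[of _ 1] conjI allI impI)
  fix t :: real assume t: "0 < t"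
  then have "0 \<le> (b * (t * f t) - ?n * F t) / t" using poh[of t] by (simp add: b_def)
  then show "0 \<le> b * f t - ?n * (F t / t)" using t by (simp add: diff_divide_distrib)
 qed simp
 have l: "eventually (\<lambda>t::real. b * f t - ?n * (F t / t) \<le> 0) (at_left 0)"
  unfolding eventually_at_left_field
 proof (intro exI[of _ "-1"] conjI allI impI)
  fix t :: real assume t: "t < 0"
  then have "(b * (t * f t) - ?n * F t) / t \<le> 0" using poh[of t] by (simp add: b_def divide_nonneg_neg)
  then show "b * f t - ?n * (F t / t) \<le> 0" using t by (simp add: diff_divide_distrib)
 qed simp
 have "0 \<le> b * f 0 - ?n * f 0"
  by (rule tendsto_lowerbound[OF filterlim_mono[OF lim order_refl at_le] r trivial_limit_at_right_real]) simp
 moreover have "b * f 0 - ?n * f 0 \<le> 0"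
  by (rule tendsto_upperbound[OF filterlim_mono[OF lim order_refl at_le] l trivial_limit_at_left_real]) simp
 ultimately have "(b - ?n) * f 0 = 0" by (simp add: left_diff_distrib)
 then show ?thesis using bn by simp
qed

end

section \<open>Reduction of the theorem to the normal form\<close>

lemma locally_lipschitz_continuous:
 assumes "locally_lipschitz f" shows "continuous_on UNIV f"
proof (intro continuous_at_imp_continuous_on ballI)
 fix t :: real
 obtain r L where r: "r > 0" "L-lipschitz_on (ball t r) f" using assms unfolding locally_lipschitz_def by blast
 then show "isCont f t" using lipschitz_on_continuous_on[OF r(2)] continuous_on_interior[of "ball t r" f t] by simp
qed

lemma locally_lipschitz_bounded:
 assumes f: "locally_lipschitz f"
 shows "\<exists>L\<ge>0. \<forall>x y. \<bar>x\<bar> \<le> B \<longrightarrow> \<bar>y\<bar> \<le> B \<longrightarrow> \<bar>f x - f y\<bar> \<le> L * \<bar>x - y\<bar>"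
proof -
 \<comment> \<open>\<open>f\<close> is regarded as a family constant over the one-point time set
   \<open>{0}\<close>, so that compactness of \<open>{-B..B}\<close> yields a single Lipschitz
   constant.\<close>
 have ll: "local_lipschitz {0::real} {-B..B} (\<lambda>_. f)"
 proof (rule local_lipschitzI)
  fix t x :: real
  obtain r L where r: "r > 0" "L-lipschitz_on (ball x r) f" using f unfolding locally_lipschitz_def by blast
  have "L-lipschitz_on (cball x (r/2) \<inter> {-B..B}) f" using r by (intro lipschitz_on_subset[OF r(2)]) auto
  then show "\<exists>u>0. \<exists>L. \<forall>t\<in>cball t u \<inter> {0}. L-lipschitz_on (cball x u \<inter> {-B..B}) f" using r(1) by (intro exI[of _ "r/2"]) auto
 qed
 obtain L where L: "\<And>t. t \<in> {0::real} \<Longrightarrow> L-lipschitz_on {-B..B} f"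
  using local_lipschitz_compact_implies_lipschitz[OF ll] by auto
 then have L: "L-lipschitz_on {-B..B} f" by simp
 show ?thesis
  using lipschitz_onD[OF L] lipschitz_on_nonneg[OF L] by (intro exI[of _ L]) (auto simp: dist_real_def abs_le_iff)
qed

lemma antiderivative:
 assumes f: "continuous_on UNIV (f :: real \<Rightarrow> real)"
 shows "((\<lambda>t. LBINT \<tau>=ereal 0..ereal t. f \<tau>) has_real_derivative f x) (at x)"
proof -
 have "((\<lambda>t. LBINT \<tau>=ereal 0..ereal t. f \<tau>) has_vector_derivative f x) (at x within {- \<bar>x\<bar> - 1..\<bar>x\<bar> + 1})"
  by (rule interval_integral_FTC2) (use continuous_on_subset[OF f] in auto)
 then show ?thesis by (simp add: at_within_Icc_at has_real_derivative_iff_has_vector_derivative)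
qed

text \<open>Translation moves the star centre to the origin, and \<open>f\<close> is divided by the
  constant of the energy form; the hypothesis on \<open>f\<close> is linear in \<open>f\<close> and
  survives division by \<open>c > 0\<close>. Multiplied by \<open>n\<close>, its coefficient becomes
  \<open>dex\<close>.\<close>

proposition weak_solution_energy_solution:
 fixes s M :: real and \<Omega> :: "'a::euclidean_space set" and f :: "real \<Rightarrow> real" and x0 :: 'a
 assumes s: "0 < s" "s < 1" and \<Omega>: "bounded \<Omega>" "open \<Omega>" "\<And>x. x \<in> \<Omega> \<Longrightarrow> closed_segment x0 x \<subseteq> \<Omega>"
  and f: "locally_lipschitz f" and u: "weak_solution s \<Omega> f u"
  and w: "w \<in> borel_measurable borel" "AE x in lborel. u x = w x" "\<And>x. x \<notin> \<Omega> \<Longrightarrow> w x = 0" "\<And>x. \<bar>w x\<bar> \<le> M"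
  and poh: "\<And>t. (real DIM('a) - 2 * s) / (2 * real DIM('a)) * (t * f t) \<ge> (LBINT \<tau>=ereal 0..ereal t. f \<tau>)"
 obtains c R where "0 < c" "energy_solution s {x. x0 + x \<in> \<Omega>} (\<lambda>t. f t / c) (\<lambda>t. (LBINT \<tau>=ereal 0..ereal t. f \<tau>) / c) (\<lambda>x. w (x0 + x)) M R"
proof -
 note fc = locally_lipschitz_continuous[OF f]
 obtain c where c: "0 < c" "\<And>\<phi>. Hsb s \<phi> \<Longrightarrow> (\<And>x. x \<notin> \<Omega> \<Longrightarrow> \<phi> x = 0) \<Longrightarrow> c * Eb s w \<phi> = (\<integral>x. f (w x) * \<phi> x)"
 proof (rule weak_solution_energy[OF s, where 'a='a], goal_cases)
  case (1 c)
  show ?thesis by (rule that[OF 1(2)]) (rule 1(3)[OF u \<Omega>(2) fc w(1,2)])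
 qed
 have Hw: "Hsb s w" using u w(1,2) by (intro Hs_borel[of u]) (auto simp: weak_solution_def Hs0_def)
 obtain R0 where R0: "\<And>x. x \<in> \<Omega> \<Longrightarrow> norm x \<le> R0" using \<Omega>(1) bounded_iff by blast
 define R where "R = \<bar>R0\<bar> + norm x0 + 1"
 show ?thesis
 proof (rule that[OF c(1)], unfold_locales)
  show "0 < s" "s < 1" by (rule s)+
  have "{x. x0 + x \<in> \<Omega>} = (\<lambda>x. x0 + x) -` \<Omega>" by auto
  then show "open {x. x0 + x \<in> \<Omega>}" using \<Omega>(2) by (simp add: open_vimage continuous_intros)
  show "0 < R" by (simp add: R_def add_nonneg_pos)
  fix x assume x: "x \<in> {x. x0 + x \<in> \<Omega>}"
  show "norm x \<le> R" using R0[of "x0 + x"] x norm_triangle_ineq4[of "x0 + x" x0] by (simp add: R_def)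
  fix t :: real assume t: "0 \<le> t" "t \<le> 1"
  have "x0 + t *\<^sub>R x \<in> closed_segment x0 (x0 + x)" using t unfolding in_segment by (intro exI[of _ t]) (auto simp: algebra_simps)
  then show "t *\<^sub>R x \<in> {x. x0 + x \<in> \<Omega>}" using \<Omega>(3)[of "x0 + x"] x by blast
 next
  show Hw': "Hsb s (\<lambda>x. w (x0 + x))" using Hsb_affine(1)[OF Hw, of 1 x0] by simp
  show "w (x0 + x) = 0" if "x \<notin> {x. x0 + x \<in> \<Omega>}" for x using that w(3) by simp
  show "\<bar>w (x0 + x)\<bar> \<le> M" for x by (rule w(4))
  show "continuous_on UNIV (\<lambda>t. f t / c)" using fc c(1) by (intro continuous_intros) auto
  show "\<exists>L\<ge>0. \<forall>x y. \<bar>x\<bar> \<le> B \<longrightarrow> \<bar>y\<bar> \<le> B \<longrightarrow> \<bar>f x / c - f y / c\<bar> \<le> L * \<bar>x - y\<bar>" for B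
  proof -
   obtain L where L: "0 \<le> L" "\<forall>x y. \<bar>x\<bar> \<le> B \<longrightarrow> \<bar>y\<bar> \<le> B \<longrightarrow> \<bar>f x - f y\<bar> \<le> L * \<bar>x - y\<bar>" using locally_lipschitz_bounded[OF f] by blast
   have "\<bar>f x / c - f y / c\<bar> \<le> (L / c) * \<bar>x - y\<bar>" if "\<bar>x\<bar> \<le> B" "\<bar>y\<bar> \<le> B" for x y
    using L(2) that c(1) by (simp add: diff_divide_distrib[symmetric] divide_right_mono)
   then show ?thesis using L(1) c(1) by (intro exI[of _ "L / c"]) auto
  qed
  show "(LBINT \<tau>=ereal 0..ereal 0. f \<tau>) / c = 0" by simp
  show "((\<lambda>t. (LBINT \<tau>=ereal 0..ereal t. f \<tau>) / c) has_real_derivative f t / c) (at t)" for t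
   by (intro DERIV_cdivide antiderivative fc)
  show "0 \<le> dex TYPE('a) s * (t * (f t / c)) - real DIM('a) * ((LBINT \<tau>=ereal 0..ereal t. f \<tau>) / c)" for t
  proof -
   have "real DIM('a) * (LBINT \<tau>=ereal 0..ereal t. f \<tau>) \<le> real DIM('a) * ((real DIM('a) - 2 * s) / (2 * real DIM('a)) * (t * f t))"
    by (intro mult_left_mono poh) simp
   also have "... = dex TYPE('a) s * (t * f t)" by (simp add: dex_def)
   finally have "0 \<le> (dex TYPE('a) s * (t * f t) - real DIM('a) * (LBINT \<tau>=ereal 0..ereal t. f \<tau>)) / c" using c(1) by simp
   then show ?thesis by (simp add: diff_divide_distrib)
  qed
  fix \<phi> :: "'a \<Rightarrow> real" assume \<phi>: "Hsb s \<phi>" "\<And>x. x \<notin> {x. x0 + x \<in> \<Omega>} \<Longrightarrow> \<phi> x = 0"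
  define \<psi> where "\<psi> x = \<phi> (- x0 + x)" for x
  have H\<psi>: "Hsb s \<psi>" using Hsb_affine(1)[OF \<phi>(1), of 1 "- x0"] by (simp add: \<psi>_def[abs_def])
  note [measurable] = w(1) Hsb_measurable[OF H\<psi>] borel_measurable_continuous_onI[OF fc]
  have "Eb s (\<lambda>x. w (x0 + x)) \<phi> = Eb s w \<psi>"
   using Hsb_affine(2)[OF Hw, of 1 \<psi> x0] H\<psi> by (simp add: \<psi>_def)
  also have "... = (\<integral>x. f (w x) * \<psi> x) / c" using c(2)[OF H\<psi>] \<phi>(2) c(1) by (simp add: \<psi>_def field_simps)
  also have "(\<integral>x. f (w x) * \<psi> x) = (\<integral>x. f (w (x0 + x)) * \<psi> (x0 + x))"
   by (rule integral_lborel_shift[symmetric]) measurable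
  finally show "Eb s (\<lambda>x. w (x0 + x)) \<phi> = (\<integral>x. f (w (x0 + x)) / c * \<phi> x)" by (simp add: \<psi>_def)
 qed
qed

lemma farthest_frontier_point:
 fixes \<Omega> :: "'a::euclidean_space set"
 assumes \<Omega>: "bounded \<Omega>" "open \<Omega>" "x0 \<in> \<Omega>"
 obtains y0 where "y0 \<in> frontier \<Omega>" "\<And>x. x \<in> \<Omega> \<Longrightarrow> norm (x - x0) \<le> norm (y0 - x0)"
proof -
 have "compact (closure \<Omega>)" "closure \<Omega> \<noteq> {}" using \<Omega> by (auto simp: compact_closure)
 moreover have "continuous_on (closure \<Omega>) (\<lambda>x. norm (x - x0))" by (intro continuous_intros)
 ultimately obtain y0 where y0: "y0 \<in> closure \<Omega>" "\<And>x. x \<in> closure \<Omega> \<Longrightarrow> norm (x - x0) \<le> norm (y0 - x0)"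
  using continuous_attains_sup[of "closure \<Omega>" "\<lambda>x. norm (x - x0)"] by blast
 have "y0 \<notin> \<Omega>"
 proof
  assume "y0 \<in> \<Omega>"
  then obtain \<epsilon> where \<epsilon>: "0 < \<epsilon>" "ball y0 \<epsilon> \<subseteq> \<Omega>" using \<Omega>(2) openE by blast
  \<comment> \<open>Outward direction at \<open>y0\<close>; if \<open>y0 = x0\<close>, any unit
    vector increases the distance to \<open>x0\<close>.\<close>
  obtain d where d: "norm d = 1" "y0 - x0 = norm (y0 - x0) *\<^sub>R d"
  proof (cases "y0 = x0")
   case True
   then show ?thesis using that[of "SOME i. i \<in> Basis"] by (simp add: SOME_Basis)
  next
   case False
   then show ?thesis using that[of "(y0 - x0) /\<^sub>R norm (y0 - x0)"] by simp
  qed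
  have "y0 + (\<epsilon> / 2) *\<^sub>R d \<in> \<Omega>" using \<epsilon> d(1) by (intro subsetD[OF \<epsilon>(2)]) (simp add: dist_norm)
  then have "norm (y0 + (\<epsilon> / 2) *\<^sub>R d - x0) \<le> norm (y0 - x0)" using closure_subset by (intro y0(2)) auto
  moreover have "y0 + (\<epsilon> / 2) *\<^sub>R d - x0 = (norm (y0 - x0) + \<epsilon> / 2) *\<^sub>R d"
   unfolding scaleR_add_left using d(2) by (simp add: algebra_simps)
  ultimately show False using d(1) \<epsilon>(1) by simp
 qed
 then have "y0 \<in> frontier \<Omega>" using y0(1) \<Omega>(2) by (simp add: frontier_def interior_open)
 then show ?thesis using y0(2) closure_subset by (intro that) auto
qed

lemma boundary_chart_translate:
 assumes "boundary_chart \<Omega> (x0 + z0) e r0 \<Lambda> l N"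
 shows "boundary_chart {x. x0 + x \<in> \<Omega>} z0 e r0 \<Lambda> (\<lambda>x. l (x0 + x)) (\<lambda>x. N (x0 + x))"
proof -
 interpret boundary_chart \<Omega> "x0 + z0" e r0 \<Lambda> l N by fact
 show ?thesis
 proof
  show "l (x0 + (x + t *\<^sub>R e)) = l (x0 + x) + t" for x t using shift[of "x0 + x" t] by (simp add: add.assoc)
  show "norm (N (x0 + x) - N (x0 + y)) \<le> \<Lambda> * norm (x - y)" for x y using N_lip[of "x0 + x" "x0 + y"] by simp
  show "\<bar>l (x0 + y) - l (x0 + x) - N (x0 + x) \<bullet> (y - x)\<bar> \<le> \<Lambda> * (norm (y - x))\<^sup>2" for x y using taylor[of "x0 + y" "x0 + x"] by simp
  show "{x. x0 + x \<in> \<Omega>} \<inter> ball z0 r0 = {x \<in> ball z0 r0. 0 < l (x0 + x)}"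
  proof -
   have "(x \<in> ball z0 r0) = (x0 + x \<in> ball (x0 + z0) r0)" for x by (simp add: dist_norm)
   moreover have "x \<in> \<Omega> \<inter> ball (x0 + z0) r0 \<longleftrightarrow> x \<in> ball (x0 + z0) r0 \<and> 0 < l x" for x unfolding chart by simp
   ultimately show ?thesis by blast
  qed
  show "continuous_on UNIV (\<lambda>x. l (x0 + x))" by (rule continuous_on_compose2[OF l_cont]) (auto intro!: continuous_intros)
 qed (use r0 e \<Lambda> N_e l_z0 in auto)
qed

theorem corollary1p2:
 fixes s :: real and \<Omega> :: "'a::euclidean_space set" and f :: "real \<Rightarrow> real"
 assumes "0 < s" and "s < 1"
  and "bounded \<Omega>" and "C11_domain \<Omega>" and "starlike \<Omega>"
  and "locally_lipschitz f"
 shows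
  "((\<forall>t. (real DIM('a) - 2 * s) / (2 * real DIM('a)) * (t * f t)
       \<ge> (LBINT \<tau>=ereal 0..ereal t. f \<tau>)) \<longrightarrow>
    \<not> (\<exists>u v. bounded_solution s \<Omega> f u \<and> continuous_representative v u \<and> (\<forall>x\<in>\<Omega>. v x > 0)))
   \<and>
   ((\<forall>t. t \<noteq> 0 \<longrightarrow> (real DIM('a) - 2 * s) / (2 * real DIM('a)) * (t * f t)
       > (LBINT \<tau>=ereal 0..ereal t. f \<tau>)) \<longrightarrow>
    (\<forall>u. bounded_solution s \<Omega> f u \<longrightarrow> (AE x in lebesgue. u x = 0)))"
proof -
 have op: "open \<Omega>" using assms(4) by (simp add: C11_domain_def)
 then have \<Omega>m [measurable]: "\<Omega> \<in> sets borel" by simp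
 obtain x0 where x0: "x0 \<in> \<Omega>" "\<And>x. x \<in> \<Omega> \<Longrightarrow> closed_segment x0 x \<subseteq> \<Omega>" using assms(5) unfolding starlike_def by blast
 have sol: "weak_solution s \<Omega> f u" "u \<in> Hs s" "AE x in lborel. x \<notin> \<Omega> \<longrightarrow> u x = 0" "\<exists>M. AE x in lborel. \<bar>u x\<bar> \<le> M"
  if "bounded_solution s \<Omega> f u" for u
  using that by (auto simp: bounded_solution_def weak_solution_def Hs0_def ess_bounded_def AE_completion_iff)
 note es = weak_solution_energy_solution[OF assms(1,2,3) op x0(2) assms(6)]
 show ?thesis
 proof (intro conjI impI allI notI)
  assume poh: "\<forall>t. (real DIM('a) - 2 * s) / (2 * real DIM('a)) * (t * f t) \<ge> (LBINT \<tau>=ereal 0..ereal t. f \<tau>)"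
   and "\<exists>u v. bounded_solution s \<Omega> f u \<and> continuous_representative v u \<and> (\<forall>x\<in>\<Omega>. v x > 0)"
  then obtain u v where u: "bounded_solution s \<Omega> f u" and v: "continuous_on UNIV v" "AE x in lborel. v x = u x" "\<And>x. x \<in> \<Omega> \<Longrightarrow> 0 < v x"
   by (auto simp: continuous_representative_def AE_completion_iff)
  obtain M where M: "AE x in lborel. \<bar>u x\<bar> \<le> M" using sol(4)[OF u] by blast
  \<comment> \<open>Outside \<open>\<Omega>\<close> the vanishing is known only almost everywhere;
    the cut-off makes it exact and leaves \<open>v\<close> untouched on \<open>\<Omega>\<close>,
    where continuity and positivity are used.\<close>
  define w where "w x = (if x \<in> \<Omega> then v x else 0)" for x
  have [measurable]: "v \<in> borel_measurable borel" using v(1) by (rule borel_measurable_continuous_onI)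
  have wm: "w \<in> borel_measurable borel" unfolding w_def by measurable
  have uw: "AE x in lborel. u x = w x" using v(2) sol(3)[OF u] by eventually_elim (auto simp: w_def)
  \<comment> \<open>Continuity upgrades the essential bound to a bound at every point.\<close>
  have vM: "\<bar>v x\<bar> \<le> M" for x
  proof (rule AE_le_imp_le[OF open_UNIV, where g="\<lambda>x. \<bar>v x\<bar>" and h="\<lambda>_. M" and x=x])
   show "AE x in lborel. x \<in> UNIV \<longrightarrow> \<bar>v x\<bar> \<le> M" using M v(2) by eventually_elim simp
  qed (use v(1) in \<open>auto intro!: continuous_intros\<close>)
  have "0 \<le> M" using vM[of x0] by linarith
  then have wM: "\<bar>w x\<bar> \<le> M" for x using vM by (simp add: w_def)
  obtain c R where c: "0 < c" and en: "energy_solution s {x. x0 + x \<in> \<Omega>} (\<lambda>t. f t / c) (\<lambda>t. (LBINT \<tau>=ereal 0..ereal t. f \<tau>) / c) (\<lambda>x. w (x0 + x)) M R"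
   using es[OF _ sol(1)[OF u] wm uw _ wM poh[rule_format]] by (auto simp: w_def)
  obtain y0 where y0: "y0 \<in> frontier \<Omega>" "\<And>x. x \<in> \<Omega> \<Longrightarrow> norm (x - x0) \<le> norm (y0 - x0)"
   using farthest_frontier_point[OF assms(3) op x0(1)] by blast
  obtain e r0 \<Lambda> l N where ch: "boundary_chart \<Omega> y0 e r0 \<Lambda> l N" using C11_boundary_chart[OF assms(4) y0(1)] by blast
  define z0 where "z0 = y0 - x0"
  have ch': "boundary_chart {x. x0 + x \<in> \<Omega>} z0 e r0 \<Lambda> (\<lambda>x. l (x0 + x)) (\<lambda>x. N (x0 + x))"
   using ch by (intro boundary_chart_translate) (simp add: z0_def)
  interpret E: energy_solution s "{x. x0 + x \<in> \<Omega>}" "\<lambda>t. f t / c" "\<lambda>t. (LBINT \<tau>=ereal 0..ereal t. f \<tau>) / c" "\<lambda>x. w (x0 + x)" M R by (rule en)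
  have "positive_solution s {x. x0 + x \<in> \<Omega>} (\<lambda>t. f t / c) (\<lambda>t. (LBINT \<tau>=ereal 0..ereal t. f \<tau>) / c) (\<lambda>x. w (x0 + x)) M R z0 e r0 \<Lambda> (\<lambda>x. l (x0 + x)) (\<lambda>x. N (x0 + x))"
  proof (intro positive_solution.intro en ch', unfold_locales)
   show "0 < w (x0 + x)" if "x \<in> {x. x0 + x \<in> \<Omega>}" for x using that v(3) by (simp add: w_def)
   have "continuous_on {x. x0 + x \<in> \<Omega>} (\<lambda>x. v (x0 + x))" by (rule continuous_on_compose2[OF v(1)]) (auto intro!: continuous_intros)
   then show "continuous_on {x. x0 + x \<in> \<Omega>} (\<lambda>x. w (x0 + x))" by (rule continuous_on_eq) (simp add: w_def)
   show "f 0 / c = 0" by (rule E.f_zero)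
   show "norm x \<le> norm z0" if "x \<in> {x. x0 + x \<in> \<Omega>}" for x using y0(2)[of "x0 + x"] that by (simp add: z0_def)
   have "y0 \<notin> \<Omega>" using y0(1) op by (simp add: frontier_def interior_open)
   then show "z0 \<noteq> 0" using x0(1) by (auto simp: z0_def)
   show "0 \<in> {x. x0 + x \<in> \<Omega>}" using x0(1) by simp
  qed
  then show False by (rule positive_solution.impossible)
 next
  fix u
  assume strict: "\<forall>t. t \<noteq> 0 \<longrightarrow> (real DIM('a) - 2 * s) / (2 * real DIM('a)) * (t * f t) > (LBINT \<tau>=ereal 0..ereal t. f \<tau>)"
   and u: "bounded_solution s \<Omega> f u"
  obtain M where M: "AE x in lborel. \<bar>u x\<bar> \<le> M" using sol(4)[OF u] by blast
  have "u \<in> borel_measurable lebesgue" using sol(2)[OF u] by (simp add: Hs_def)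
  then obtain g where g [measurable]: "g \<in> borel_measurable lborel" and ug: "AE x in lborel. u x = g x" using completion_ex_borel_measurable_real by blast
  \<comment> \<open>Clamping to the essential bound and cutting off outside \<open>\<Omega>\<close>
    alters \<open>u\<close> only on a null set and gives the everywhere conditions of the normal
    form.\<close>
  define w where "w x = (if x \<in> \<Omega> then max (- \<bar>M\<bar>) (min \<bar>M\<bar> (g x)) else 0)" for x
  have wm: "w \<in> borel_measurable borel" unfolding w_def using g by measurable
  have uw: "AE x in lborel. u x = w x" using ug M sol(3)[OF u] by eventually_elim (auto simp: w_def max_def min_def)
  have wM: "\<bar>w x\<bar> \<le> \<bar>M\<bar>" for x by (auto simp: w_def max_def min_def)
  \<comment> \<open>At \<open>t = 0\<close> both sides vanish, so the strict hypothesis implies the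
    weak one.\<close>
  have poh: "(real DIM('a) - 2 * s) / (2 * real DIM('a)) * (t * f t) \<ge> (LBINT \<tau>=ereal 0..ereal t. f \<tau>)" for t
   using strict by (cases "t = 0") (auto intro: less_imp_le)
  obtain c R where c: "0 < c" and en: "energy_solution s {x. x0 + x \<in> \<Omega>} (\<lambda>t. f t / c) (\<lambda>t. (LBINT \<tau>=ereal 0..ereal t. f \<tau>) / c) (\<lambda>x. w (x0 + x)) \<bar>M\<bar> R"
   using es[OF _ sol(1)[OF u] wm uw _ wM poh] by (auto simp: w_def)
  have "AE x in lborel. w (x0 + x) = 0"
  proof (rule energy_solution.strict_zero[OF en])
   fix t :: real assume "t \<noteq> 0"
   then have "real DIM('a) * (LBINT \<tau>=ereal 0..ereal t. f \<tau>) < real DIM('a) * ((real DIM('a) - 2 * s) / (2 * real DIM('a)) * (t * f t))"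
    using strict by (intro mult_strict_left_mono) auto
   also have "... = dex TYPE('a) s * (t * f t)" by (simp add: dex_def)
   finally have "0 < (dex TYPE('a) s * (t * f t) - real DIM('a) * (LBINT \<tau>=ereal 0..ereal t. f \<tau>)) / c" using c by simp
   then show "0 < dex TYPE('a) s * (t * (f t / c)) - real DIM('a) * ((LBINT \<tau>=ereal 0..ereal t. f \<tau>) / c)" by (simp add: diff_divide_distrib)
  qed
  then have "(\<integral>\<^sup>+x. ennreal \<bar>w (x0 + x)\<bar>) = 0" using wm by (subst nn_integral_0_iff_AE) auto
  then have "(\<integral>\<^sup>+x. ennreal \<bar>w x\<bar>) = 0" using nn_integral_lborel_shift[of "\<lambda>x. ennreal \<bar>w x\<bar>" x0] wm by simp
  then have "AE x in lborel. w x = 0" using wm by (subst (asm) nn_integral_0_iff_AE) auto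
  then have "AE x in lborel. u x = 0" using uw by eventually_elim simp
  then show "AE x in lebesgue. u x = 0" by (rule AE_completion)
 qed
qed

end
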